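(* Let $I_{2m-|k|}(f_{2m-|k|,d,\epsilon})$ be the $(2m-|k|)$-th chaotic component of $\alpha_d^{(|k|)}(\epsilon)-E[\alpha_d^{(|k|)}(\epsilon)]$ (see the context), where $m$ is an integer with $m>|k|/2$. All convergences in law are as $\epsilon\downarrow0$. (i) If $d=1$ and $|k|=2$, then for every integer $m\ge2$ $$\Big(\log\frac1\epsilon\Big)^{-1/2}I_{2m-2}(f_{2m-2,1,\epsilon})\xrightarrow{\ \mathrm{Law}\ }\mathcal N\Big(0,\frac{(2m-4)!}{\pi2^{2m-7}((m-2)!)^2}\Big).$$ (ii) If $d=2$ and $|k|=1$ (with the convention $k=(1,0)$), then for $m=1$ $$\Big(\log\frac1\epsilon\Big)^{-1}I_{1}(f_{1,2,\epsilon})\xrightarrow{\ \mathrm{Law}\ }\mathcal N\Big(0,\frac1{4\pi^2}\Big),$$ and for every integer $m\ge2$ $$\Big(\log\frac1\epsilon\Big)^{-1/2}I_{2m-1}(f_{2m-1,2,\epsilon})\xrightarrow{\ \mathrm{Law}\ }\mathcal N\Big(0,\frac{2\beta_{2m-1,2}(2m-1)}{m^2(m-1)}\Big),$$ where $$\beta_{2m-1,2}=\sum_{\substack{m_1+m_2=m\\ m_1\ge1,\ m_2\ge0}}\frac{((2m_1)!(2m_2)!)^2}{(2\pi)^22^{2m}(2m_1-1)!(2m_2)!(m_1!)^2(m_2!)^2}.$$ (iii) If $d\ge1$, $|k|\ge1$ and $d+|k|\ge4$, then for every integer $m>|k|/2$ $$\epsilon^{\frac{d+|k|-3}2}I_{2m-|k|}(f_{2m-|k|,d,\epsilon})\xrightarrow{\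 \mathrm{Law}\ }\mathcal N\big(0,\widehat\sigma^2_{2m-|k|,d}\big),$$ where $$\widehat\sigma^2_{2m-|k|,d}=\begin{cases}\dfrac{(2m-1)!\,(|k|-3)!}{2^{2m-3}\pi((m-1)!)^2}\left(\dfrac1{m-\frac12}+\dfrac1{m-\frac32}\right),&d=1,\\[2mm] \sigma^2_{2m-|k|,d},&d\ge2,\end{cases}$$ with $\sigma^2_{2m-|k|,d}=\beta_{2m-|k|,d}\,\phi(m,d,|k|)$, $$\beta_{2m-|k|,d}=\sum_{\substack{m_1+\cdots+m_d=m\\ m_j\ge k_j/2,\ j=1,\dots,d}}\frac{((2m_1)!\cdots(2m_d)!)^2}{(2\pi)^d2^{2m}(2m_1-k_1)!\cdots(2m_d-k_d)!\,(m_1!)^2\cdots(m_d!)^2}$$ (the sum being over nonnegative integers $m_j$) and $$\phi(m,d,|k|)=\frac{2\Gamma(2m-|k|+1)\Gamma(d+|k|-3)}{\Gamma(2m+d-2)\,(m+\frac d2-1)}\left(\frac1{m+\frac d2-1}+\frac1{m+\frac d2-2}\right).$$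
   Context: Let $d\ge1$ and let $\{B_t=(B^1_t,\dots,B^d_t),t\ge0\}$ be a standard $d$-dimensional Brownian motion. For $\epsilon>0$ and $x\in\mathbb R^d$ put $p_{d,\epsilon}(x)=(2\pi\epsilon)^{-d/2}e^{-|x|^2/(2\epsilon)}$. For a multi-index $k=(k_1,\dots,k_d)$ of nonnegative integers put $|k|=k_1+\cdots+k_d$, $p^{(|k|)}_{d,\epsilon}=\partial_{x_1}^{k_1}\cdots\partial_{x_d}^{k_d}p_{d,\epsilon}$, and $$\alpha_d^{(|k|)}(\epsilon)=\int_0^1\int_0^s p^{(|k|)}_{d,\epsilon}(B_s-B_r)\,dr\,ds.$$ For $n\ge1$ and a square integrable $f(\mathbf i,r)=f(i_1,\dots,i_n,r_1,\dots,r_n)$, $\mathbf i\in\{1,\dots,d\}^n$, $r\in[0,1]^n$, symmetric under simultaneous permutations of the pairs $(i_l,r_l)$, $I_n(f)$ denotes the multiple Wiener–Itô integral $\sum_{\mathbf i}\int f(\mathbf i,r)\,dB^{i_1}_{r_1}\cdots dB^{i_n}_{r_n}$ (so $E[I_n(f)^2]=n!\|f\|^2$). The Wiener chaos expansion is $$\alpha^{(|k|)}_d(\epsilon)-E[\alpha^{(|k|)}_d(\epsilon)]=\sum_{m>|k|/2}I_{2m-|k|}(f_{2m-|k|,d,\epsilon}),$$ where, with $n=2m-|k|$, $$f_{n,d,\epsilon}(\mathbf i,r_1,\dots,r_n)=\frac{(-1)^mA(\mathbf i)}{(2\pi)^{d/2}\,n!}\int_0^1\int_0^t\frac{\prod_{j=1}^n1_{(s,t]}(r_j)}{(t-s+\epsilon)^{m+\frac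 d2}}\,ds\,dt,\qquad A(\mathbf i)=E[\xi_{i_1}\cdots\xi_{i_n}\xi_1^{k_1}\cdots\xi_d^{k_d}],$$ with $\xi_1,\dots,\xi_d$ independent $N(0,1)$ variables. That is, $I_{2m-|k|}(f_{2m-|k|,d,\epsilon})$ is the projection of $\alpha_d^{(|k|)}(\epsilon)$ on the $(2m-|k|)$-th Wiener chaos. $\mathcal N(0,\sigma^2)$ is the centered normal law with variance $\sigma^2$ and $\Gamma$ is the Gamma function. *)

theory Defs
  imports "HOL-Probability.Probability"
begin

section \<open>Brownian motion\<close>

text \<open>Coordinates are numbered \<open>0, \<dots>, d - 1\<close>; a point of \<open>d\<close>-dimensional space is a function
  \<open>nat \<Rightarrow> real\<close> of which only the values below \<open>d\<close> matter, and \<open>B j t\<close> is the \<open>j\<close>-th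
  coordinate of the process at time \<open>t\<close>.\<close>

locale brownian_motion = prob_space M
  for M :: "'w measure" and d :: nat and B :: "nat \<Rightarrow> real \<Rightarrow> 'w \<Rightarrow> real" +
  assumes BM_measurable: "\<And>j t. j < d \<Longrightarrow> 0 \<le> t \<Longrightarrow> B j t \<in> borel_measurable M"
    and BM_start: "\<And>j. j < d \<Longrightarrow> AE \<omega> in M. B j 0 \<omega> = 0"
    and BM_continuous: "\<And>j \<omega>. j < d \<Longrightarrow> \<omega> \<in> space M \<Longrightarrow> continuous_on {0..} (\<lambda>t. B j t \<omega>)"
    and BM_increment: "\<And>j s t. j < d \<Longrightarrow> 0 \<le> s \<Longrightarrow> s < t \<Longrightarrow>
          distributed M lborel (\<lambda>\<omega>. B j t \<omega> - B j s \<omega>) (normal_density 0 (sqrt (t - s)))"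
    \<comment> \<open>independence of the increments and of the coordinates at once\<close>
    and BM_indep: "\<And>(N::nat) t. 0 \<le> t 0 \<Longrightarrow> strict_mono_on {..N} t \<Longrightarrow>
          indep_vars (\<lambda>_. borel) (\<lambda>(j, l) \<omega>. B j (t (Suc l)) \<omega> - B j (t l) \<omega>) ({..<d} \<times> {..<N})"

section \<open>Derivatives of the self-intersection local time\<close>

definition mi_abs :: "nat \<Rightarrow> (nat \<Rightarrow> nat) \<Rightarrow> nat" where
  "mi_abs d k = (\<Sum>j<d. k j)"

definition heat_kernel :: "nat \<Rightarrow> real \<Rightarrow> (nat \<Rightarrow> real) \<Rightarrow> real" where
  "heat_kernel d \<epsilon> x = (2 * pi * \<epsilon>) powr (- (real d / 2)) * exp (- (\<Sum>j<d. (x j)\<^sup>2) / (2 * \<epsilon>))"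

definition partial_deriv :: "nat \<Rightarrow> ((nat \<Rightarrow> real) \<Rightarrow> real) \<Rightarrow> (nat \<Rightarrow> real) \<Rightarrow> real" where
  "partial_deriv j g = (\<lambda>x. deriv (\<lambda>y. g (x(j := y))) (x j))"

definition mi_deriv :: "nat \<Rightarrow> (nat \<Rightarrow> nat) \<Rightarrow> ((nat \<Rightarrow> real) \<Rightarrow> real) \<Rightarrow> (nat \<Rightarrow> real) \<Rightarrow> real" where
  "mi_deriv d k g = foldr (\<lambda>j. partial_deriv j ^^ k j) [0..<d] g"

definition alpha :: "nat \<Rightarrow> (nat \<Rightarrow> real \<Rightarrow> 'w \<Rightarrow> real) \<Rightarrow> (nat \<Rightarrow> nat) \<Rightarrow> real \<Rightarrow> 'w \<Rightarrow> real" where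
  "alpha d B k \<epsilon> \<omega> = (LINT s:{0..1}|lborel. LINT r:{0..s}|lborel.
      mi_deriv d k (heat_kernel d \<epsilon>) (\<lambda>j. B j s \<omega> - B j r \<omega>))"

section \<open>Multiple Wiener-Ito integrals\<close>

text \<open>A kernel of order \<open>n\<close> takes \<open>\<i> \<in> {0, \<dots>, d - 1}\<^sup>n\<close> and \<open>r \<in> [0, 1]\<^sup>n\<close>, both of which are
  extensional functions on \<open>{..<n}\<close>.\<close>

type_synonym kernel = "(nat \<Rightarrow> nat) \<Rightarrow> (nat \<Rightarrow> real) \<Rightarrow> real"

abbreviation index_tuples :: "nat \<Rightarrow> nat \<Rightarrow> (nat \<Rightarrow> nat) set" where
  "index_tuples n d \<equiv> {..<n} \<rightarrow>\<^sub>E {..<d}"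

abbreviation unit_cube :: "nat \<Rightarrow> (nat \<Rightarrow> real) measure" where
  "unit_cube n \<equiv> Pi\<^sub>M {..<n} (\<lambda>_. restrict_space lborel {0..1})"

definition kernel_dist_sq :: "nat \<Rightarrow> nat \<Rightarrow> kernel \<Rightarrow> kernel \<Rightarrow> ennreal" where
  "kernel_dist_sq d n f g =
    (\<Sum>i\<in>index_tuples n d. \<integral>\<^sup>+ r. ennreal ((f i r - g i r)\<^sup>2) \<partial>unit_cube n)"

definition sym_L2_kernel :: "nat \<Rightarrow> nat \<Rightarrow> kernel \<Rightarrow> bool" where
  "sym_L2_kernel d n f \<longleftrightarrow>
    (\<forall>i\<in>index_tuples n d. f i \<in> borel_measurable (unit_cube n)) \<and>
    kernel_dist_sq d n f (\<lambda>i r. 0) < \<infinity> \<and>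
    (\<forall>\<pi>. \<pi> permutes {..<n} \<longrightarrow>
      (\<forall>i\<in>index_tuples n d. \<forall>r\<in>space (unit_cube n). f (i \<circ> \<pi>) (r \<circ> \<pi>) = f i r))"

text \<open>The Brownian motion is an isonormal process over \<open>{0, \<dots>, d - 1} \<times> [0, 1]\<close>. Elementary
  kernels are constant on products of cells \<open>{j} \<times> (t\<^sub>l, t\<^bsub>l+1\<^esub>]\<close> and vanish whenever two of the
  cells coincide.\<close>

definition elementary_integral ::
  "nat \<Rightarrow> (nat \<Rightarrow> real \<Rightarrow> 'w \<Rightarrow> real) \<Rightarrow> nat \<Rightarrow> kernel \<Rightarrow> ('w \<Rightarrow> real) \<Rightarrow> bool" where
  "elementary_integral d B n g Y \<longleftrightarrow>
    (\<exists>(N::nat) (t :: nat \<Rightarrow> real) (c :: (nat \<Rightarrow> nat) \<Rightarrow> (nat \<Rightarrow> nat) \<Rightarrow> real).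
      strict_mono_on {..N} t \<and> t 0 = 0 \<and> t N = 1 \<and>
      (\<forall>i\<in>index_tuples n d. \<forall>l\<in>index_tuples n N.
        (\<exists>a<n. \<exists>b<n. a \<noteq> b \<and> i a = i b \<and> l a = l b) \<longrightarrow> c i l = 0) \<and>
      g = (\<lambda>i r. \<Sum>l\<in>index_tuples n N. c i l * (\<Prod>a<n. indicator {t (l a)<..t (Suc (l a))} (r a))) \<and>
      Y = (\<lambda>\<omega>. \<Sum>i\<in>index_tuples n d. \<Sum>l\<in>index_tuples n N.
             c i l * (\<Prod>a<n. B (i a) (t (Suc (l a))) \<omega> - B (i a) (t (l a)) \<omega>)))"

definition is_multiple_integral ::
  "'w measure \<Rightarrow> nat \<Rightarrow> (nat \<Rightarrow> real \<Rightarrow> 'w \<Rightarrow> real) \<Rightarrow> nat \<Rightarrow> kernel \<Rightarrow> ('w \<Rightarrow> real) \<Rightarrow> bool" where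
  "is_multiple_integral M d B n f X \<longleftrightarrow>
    X \<in> borel_measurable M \<and>
    (\<exists>g Y. (\<forall>q. elementary_integral d B n (g q) (Y q)) \<and>
      (\<lambda>q. kernel_dist_sq d n (g q) f) \<longlonglongrightarrow> 0 \<and>
      (\<lambda>q. \<integral>\<^sup>+ \<omega>. ennreal ((Y q \<omega> - X \<omega>)\<^sup>2) \<partial>M) \<longlonglongrightarrow> 0)"

text \<open>For a square integrable \<open>f\<close> the following is determined up to almost sure equality.\<close>

definition multiple_integral ::
  "'w measure \<Rightarrow> nat \<Rightarrow> (nat \<Rightarrow> real \<Rightarrow> 'w \<Rightarrow> real) \<Rightarrow> nat \<Rightarrow> kernel \<Rightarrow> 'w \<Rightarrow> real" where
  "multiple_integral M d B n f = (SOME X. is_multiple_integral M d B n f X)"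

definition wiener_chaos ::
  "'w measure \<Rightarrow> nat \<Rightarrow> (nat \<Rightarrow> real \<Rightarrow> 'w \<Rightarrow> real) \<Rightarrow> nat \<Rightarrow> ('w \<Rightarrow> real) set" where
  "wiener_chaos M d B n = {X. \<exists>f. sym_L2_kernel d n f \<and> is_multiple_integral M d B n f X}"

definition chaotic_component ::
  "'w measure \<Rightarrow> nat \<Rightarrow> (nat \<Rightarrow> real \<Rightarrow> 'w \<Rightarrow> real) \<Rightarrow> nat \<Rightarrow> ('w \<Rightarrow> real) \<Rightarrow> ('w \<Rightarrow> real) \<Rightarrow> bool" where
  "chaotic_component M d B n F X \<longleftrightarrow>
    F \<in> borel_measurable M \<and> integrable M (\<lambda>\<omega>. (F \<omega>)\<^sup>2) \<and>
    X \<in> wiener_chaos M d B n \<and>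
    (\<forall>Y\<in>wiener_chaos M d B n. (\<integral>\<omega>. (F \<omega> - X \<omega>) * Y \<omega> \<partial>M) = 0)"

section \<open>The chaos kernels\<close>

definition gauss_moment :: "nat \<Rightarrow> (nat \<Rightarrow> nat) \<Rightarrow> nat \<Rightarrow> (nat \<Rightarrow> nat) \<Rightarrow> real" where
  "gauss_moment d k n i =
    (\<integral>\<xi>. (\<Prod>a<n. \<xi> (i a)) * (\<Prod>j<d. \<xi> j ^ k j) \<partial>(Pi\<^sub>M {..<d} (\<lambda>_. std_normal_distribution)))"

text \<open>\<open>f\<^bsub>2m-|k|,d,\<epsilon>\<^esub>\<close>, to be used for \<open>2m > |k|\<close>\<close>

definition chaos_kernel :: "nat \<Rightarrow> (nat \<Rightarrow> nat) \<Rightarrow> nat \<Rightarrow> real \<Rightarrow> kernel" where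
  "chaos_kernel d k m \<epsilon> = (\<lambda>i r. let n = 2 * m - mi_abs d k in
      (-1) ^ m * gauss_moment d k n i / ((2 * pi) powr (real d / 2) * fact n) *
      (LINT t:{0..1}|lborel. LINT s:{0..t}|lborel.
        (\<Prod>a<n. indicator {s<..t} (r a)) / (t - s + \<epsilon>) powr (real m + real d / 2)))"

definition chaos_term ::
  "'w measure \<Rightarrow> nat \<Rightarrow> (nat \<Rightarrow> real \<Rightarrow> 'w \<Rightarrow> real) \<Rightarrow> (nat \<Rightarrow> nat) \<Rightarrow> nat \<Rightarrow> real \<Rightarrow> 'w \<Rightarrow> real" where
  "chaos_term M d B k m \<epsilon> =
    multiple_integral M d B (2 * m - mi_abs d k) (chaos_kernel d k m \<epsilon>)"

section \<open>Convergence in law and the limiting variances\<close>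

text \<open>The law of \<open>\<surd>v Z\<close> with \<open>Z\<close> standard normal; it is the Dirac measure at \<open>0\<close> for \<open>v = 0\<close>,
  a case which does occur (the sum in \<open>beta\<close> can be empty).\<close>

definition centered_normal :: "real \<Rightarrow> real measure" where
  "centered_normal v = distr std_normal_distribution borel (\<lambda>z. sqrt v * z)"

definition tends_in_law :: "'w measure \<Rightarrow> (real \<Rightarrow> 'w \<Rightarrow> real) \<Rightarrow> real measure \<Rightarrow> bool" where
  "tends_in_law M X \<nu> \<longleftrightarrow>
    (\<forall>e. filterlim e (at_right 0) sequentially \<longrightarrow> weak_conv_m (\<lambda>q. distr M borel (X (e q))) \<nu>)"

definition beta :: "nat \<Rightarrow> (nat \<Rightarrow> nat) \<Rightarrow> nat \<Rightarrow> real" where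
  "beta d k m = (\<Sum>\<mu> | \<mu> \<in> {..<d} \<rightarrow>\<^sub>E {..m} \<and> (\<Sum>j<d. \<mu> j) = m \<and> (\<forall>j<d. real (\<mu> j) \<ge> real (k j) / 2).
      (\<Prod>j<d. fact (2 * \<mu> j))\<^sup>2 /
      ((2 * pi) ^ d * 2 ^ (2 * m) * (\<Prod>j<d. fact (2 * \<mu> j - k j)) * (\<Prod>j<d. (fact (\<mu> j))\<^sup>2)))"

definition phi :: "nat \<Rightarrow> nat \<Rightarrow> nat \<Rightarrow> real" where
  "phi m d K = 2 * Gamma (2 * real m - real K + 1) * Gamma (real d + real K - 3) /
      (Gamma (2 * real m + real d - 2) * (real m + real d / 2 - 1)) *
      (1 / (real m + real d / 2 - 1) + 1 / (real m + real d / 2 - 2))"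

text \<open>Used for \<open>d + |k| \<ge> 4\<close> only, so that \<open>|k| - 3\<close> is not truncated when \<open>d = 1\<close>.\<close>

definition sigma_hat_sq :: "nat \<Rightarrow> (nat \<Rightarrow> nat) \<Rightarrow> nat \<Rightarrow> real" where
  "sigma_hat_sq d k m =
    (if d = 1
     then fact (2 * m - 1) * fact (mi_abs d k - 3) /
            (2 powi (2 * int m - 3) * pi * (fact (m - 1))\<^sup>2) *
            (1 / (real m - 1 / 2) + 1 / (real m - 3 / 2))
     else beta d k m * phi m d (mi_abs d k))"

end

theory Submission
  imports Defs
begin

text \<open>For all index tuples the kernels of one chaos are multiples of a single function of \<open>r\<close>, the
  integral of \<open>(t - s + \<epsilon>) powr - p\<close> with \<open>p = m + d / 2\<close> over all \<open>s < t\<close> such that \<open>(s, t]\<close> contains the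
  coordinates of \<open>r\<close>. It depends on the smallest and the largest coordinate only and becomes large when these are close.
  After normalisation its square therefore concentrates, as \<open>\<epsilon>\<close> decreases to \<open>0\<close>, on the diagonal
  \<open>r\<^sub>1 = \<dots> = r\<^sub>n\<close> of the cube, along which it spreads uniformly. This one fact makes the limit
  normal and determines the variance.

  Normality: cut \<open>[0, 1]\<close> into \<open>J\<close> blocks. Up to a remainder of small variance, the multiple integral
  is the sum of its restrictions to the \<open>J\<close> cubes over the blocks. These are independent, each
  has variance of order \<open>1 / J\<close>, and by hypercontractivity (\<open>mform_fourth_moment\<close>) the fourth
  moment of each is at most a constant times the square of its variance. Lyapunov's argument then
  bounds the distance of the characteristic functions (\<open>mform_char_approx\<close>). All this happens for
  multilinear forms in finitely many Gaussian increments; approximation on uniform grids carries the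
  estimate over to multiple integrals of continuous kernels (\<open>multiple_integral_clt\<close>).

  Variance: the smallest and the largest of \<open>n\<close> points have joint density
  \<open>n (n - 1) (y - x)\<^sup>n\<^sup>-\<^sup>2\<close>, and the kernel is a mixed difference of a second antiderivative \<open>g\<close> of
  \<open>x powr - p\<close> (\<open>simplex_kernel_eq\<close>) whose leading term is \<open>g (y - x + \<epsilon>)\<close>. So the squared norm is asymptotically
  \<open>n (n - 1)\<close> times the integral of \<open>z\<^sup>n\<^sup>-\<^sup>2 g (z + \<epsilon>)\<^sup>2\<close> over \<open>[0, 1]\<close> (\<open>concentrates_diagonal\<close>). This
  is a logarithm for \<open>d + |k| = 3\<close> and a Beta integral for \<open>d + |k| \<ge> 4\<close>; for \<open>n = 1\<close> the kernel
  is asymptotically constant. Summing the squared Gaussian moments over the index tuples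
  produces the constant \<open>beta\<close> (\<open>beta_eq\<close>).

  That the stated kernels give the chaotic components is checked against elementary integrals.
  Derivatives of the Gaussian density are stable under Gaussian convolution, and integration by parts
  turns each increment in a product into one more derivative
  (\<open>gauss_deriv_product_integral\<close>). The resulting derivatives at the origin are, up to powers of
  \<open>t - s + \<epsilon>\<close>, the Gaussian moments in the kernels, and orthogonality extends from
  elementary integrals to the whole chaos by density (\<open>chaos_term_chaotic_component\<close>).\<close>

section \<open>Square integrable functions\<close>

lemma abs_mult_le_sq: "\<bar>x * y\<bar> \<le> x^2 + (y::real)^2"
proof -
 have "0 \<le> (\<bar>x\<bar> - \<bar>y\<bar>)^2" by simp
 then have "2 * (\<bar>x\<bar> * \<bar>y\<bar>) \<le> x^2 + y^2" by (simp add: power2_diff)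
 moreover have "0 \<le> \<bar>x\<bar> * \<bar>y\<bar>" by simp
 ultimately show ?thesis unfolding abs_mult by linarith
qed

lemma integrable_mult_of_sq:
 fixes X Y :: "'a \<Rightarrow> real"
 assumes [measurable]: "X \<in> borel_measurable M" "Y \<in> borel_measurable M"
  and "integrable M (\<lambda>x. (X x)^2)" "integrable M (\<lambda>x. (Y x)^2)"
 shows "integrable M (\<lambda>x. X x * Y x)"
 using abs_mult_le_sq
 by (intro Bochner_Integration.integrable_bound[OF Bochner_Integration.integrable_add[OF assms(3,4)]]) auto

lemma integrable_sq_add:
 fixes X Y :: "'a \<Rightarrow> real"
 assumes [measurable]: "X \<in> borel_measurable M" "Y \<in> borel_measurable M"
  and i: "integrable M (\<lambda>x. (X x)^2)" "integrable M (\<lambda>x. (Y x)^2)"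
 shows "integrable M (\<lambda>x. (X x + Y x)^2)" "integrable M (\<lambda>x. (X x - Y x)^2)"
 using integrable_mult_of_sq[OF assms] i
 by (auto simp: power2_sum power2_diff mult.assoc)

lemma integral_Cauchy_Schwarz:
 fixes X Y :: "'a \<Rightarrow> real"
 assumes [measurable]: "X \<in> borel_measurable M" "Y \<in> borel_measurable M"
  and i: "integrable M (\<lambda>x. (X x)^2)" "integrable M (\<lambda>x. (Y x)^2)"
 shows "(\<integral>x. X x * Y x \<partial>M)^2 \<le> (\<integral>x. (X x)^2 \<partial>M) * (\<integral>x. (Y x)^2 \<partial>M)"
proof -
 define a b c where "a = (\<integral>x. (X x)^2 \<partial>M)" and "b = (\<integral>x. X x * Y x \<partial>M)" and "c = (\<integral>x. (Y x)^2 \<partial>M)"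
 have q: "0 \<le> a + 2 * l * b + l^2 * c" for l
 proof -
  have "0 \<le> (\<integral>x. (X x + l * Y x)^2 \<partial>M)" by simp
  also have "\<dots> = (\<integral>x. (X x)^2 + ((2 * l) * (X x * Y x) + l^2 * (Y x)^2) \<partial>M)"
   by (intro Bochner_Integration.integral_cong refl) (simp add: power2_eq_square algebra_simps)
  also have "\<dots> = a + (2 * l * b + l^2 * c)"
   using i integrable_mult_of_sq[OF assms]
   by (simp add: a_def b_def c_def)
  finally show ?thesis by simp
 qed
 have c0: "0 \<le> c" unfolding c_def by simp
 show ?thesis
 proof (cases "c = 0")
  case True
  have "b = 0"
  proof (rule ccontr)
   assume "b \<noteq> 0"
   then have "a + 2 * (- (a + 1) / (2 * b)) * b = - 1" by (simp add: field_simps)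
   then show False using q[of "- (a + 1) / (2 * b)"] True by simp
  qed
  then show ?thesis using True by (simp add: a_def b_def c_def)
 next
  case False
  then have "0 < c" using c0 by simp
  then have "b^2 / c \<le> a" using q[of "- b / c"] by (simp add: power2_eq_square field_simps)
  then show ?thesis using \<open>0 < c\<close> by (simp add: a_def b_def c_def field_simps)
 qed
qed

lemma integral_Cauchy_Schwarz_abs:
 fixes X Y :: "'a \<Rightarrow> real"
 assumes "X \<in> borel_measurable M" "Y \<in> borel_measurable M"
  and "integrable M (\<lambda>x. (X x)^2)" "integrable M (\<lambda>x. (Y x)^2)"
 shows "\<bar>\<integral>x. X x * Y x \<partial>M\<bar> \<le> sqrt (\<integral>x. (X x)^2 \<partial>M) * sqrt (\<integral>x. (Y x)^2 \<partial>M)"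
 using integral_Cauchy_Schwarz[OF assms] by (metis real_sqrt_le_iff real_sqrt_abs real_sqrt_mult)

lemma integral_mult_tendsto:
 fixes X Z :: "'a \<Rightarrow> real"
 assumes [measurable]: "\<And>q. Y q \<in> borel_measurable M" "X \<in> borel_measurable M" "Z \<in> borel_measurable M"
  and i: "\<And>q. integrable M (\<lambda>x. (Y q x)^2)" "integrable M (\<lambda>x. (X x)^2)" "integrable M (\<lambda>x. (Z x)^2)"
  and lim: "(\<lambda>q. \<integral>x. (Y q x - X x)^2 \<partial>M) \<longlonglongrightarrow> 0"
 shows "(\<lambda>q. \<integral>x. Y q x * Z x \<partial>M) \<longlonglongrightarrow> (\<integral>x. X x * Z x \<partial>M)"
proof (rule Lim_transform2)
 show "(\<lambda>q. \<integral>x. X x * Z x \<partial>M) \<longlonglongrightarrow> (\<integral>x. X x * Z x \<partial>M)" by simp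
 have "(\<lambda>q. (\<integral>x. X x * Z x \<partial>M) - (\<integral>x. Y q x * Z x \<partial>M)) \<longlonglongrightarrow> 0"
 proof (rule Lim_null_comparison)
  have "norm ((\<integral>x. X x * Z x \<partial>M) - (\<integral>x. Y q x * Z x \<partial>M)) \<le>
    sqrt (\<integral>x. (Y q x - X x)^2 \<partial>M) * sqrt (\<integral>x. (Z x)^2 \<partial>M)" for q
  proof -
   have "(\<integral>x. X x * Z x \<partial>M) - (\<integral>x. Y q x * Z x \<partial>M) = (\<integral>x. X x * Z x - Y q x * Z x \<partial>M)"
    using i by (intro Bochner_Integration.integral_diff[symmetric] integrable_mult_of_sq) auto
   also have "\<dots> = - (\<integral>x. (Y q x - X x) * Z x \<partial>M)"
    by (subst Bochner_Integration.integral_minus[symmetric]) (simp add: algebra_simps)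
   finally show ?thesis
    using integral_Cauchy_Schwarz_abs[OF _ _ integrable_sq_add(2)[OF _ _ i(1)[of q] i(2)] i(3)] by simp
  qed
  then show "\<forall>\<^sub>F q in sequentially. norm ((\<integral>x. X x * Z x \<partial>M) - (\<integral>x. Y q x * Z x \<partial>M)) \<le>
    sqrt (\<integral>x. (Y q x - X x)^2 \<partial>M) * sqrt (\<integral>x. (Z x)^2 \<partial>M)" by simp
  show "(\<lambda>q. sqrt (\<integral>x. (Y q x - X x)^2 \<partial>M) * sqrt (\<integral>x. (Z x)^2 \<partial>M)) \<longlonglongrightarrow> 0"
   using tendsto_mult_right[OF tendsto_real_sqrt[OF lim], of "sqrt (\<integral>x. (Z x)^2 \<partial>M)"] by simp
 qed
 then show "(\<lambda>q. (\<integral>x. X x * Z x \<partial>M) - (\<integral>x. Y q x * Z x \<partial>M)) \<longlonglongrightarrow> 0" .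
qed

lemma (in prob_space) expectation_abs_le_sqrt:
 assumes [measurable]: "X \<in> borel_measurable M" and i: "integrable M (\<lambda>x. (X x :: real)^2)"
 shows "integrable M X" "expectation (\<lambda>x. \<bar>X x\<bar>) \<le> sqrt (expectation (\<lambda>x. (X x)^2))"
proof -
 show "integrable M X" using integrable_mult_of_sq[of X M "\<lambda>_. 1"] i by simp
 show "expectation (\<lambda>x. \<bar>X x\<bar>) \<le> sqrt (expectation (\<lambda>x. (X x)^2))"
  using integral_Cauchy_Schwarz_abs[of "\<lambda>x. \<bar>X x\<bar>" M "\<lambda>_. 1"] i by (simp add: prob_space)
qed

text \<open>A subsequence converges almost everywhere, because it does so for Cauchy sequences in \<open>L\<^sup>1\<close>;
  Fatou's lemma shows that its limit is the limit in mean square of the whole sequence.\<close>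

lemma (in prob_space) L2_complete:
 fixes Y :: "nat \<Rightarrow> 'a \<Rightarrow> real"
 assumes [measurable]: "\<And>q. Y q \<in> borel_measurable M"
  and i: "\<And>q. integrable M (\<lambda>x. (Y q x)^2)"
  and cauchy: "\<And>e. e > 0 \<Longrightarrow> \<exists>N. \<forall>p\<ge>N. \<forall>q\<ge>N. expectation (\<lambda>x. (Y p x - Y q x)^2) < e"
 obtains X where "X \<in> borel_measurable M" "integrable M (\<lambda>x. (X x)^2)"
  "(\<lambda>q. expectation (\<lambda>x. (Y q x - X x)^2)) \<longlonglongrightarrow> 0"
  "(\<lambda>q. \<integral>\<^sup>+ x. ennreal ((Y q x - X x)^2) \<partial>M) \<longlonglongrightarrow> 0"
proof -
 have isq: "integrable M (\<lambda>x. (Y p x - Y q x)^2)" for p q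
  by (rule integrable_sq_add(2)) (use i in auto)
 obtain r where r: "strict_mono r" and C: "AE x in M. Cauchy (\<lambda>k. Y (r k) x)"
 proof (rule cauchy_L1_AE_cauchy_subseq[of M Y])
  show "integrable M (Y q)" for q by (rule expectation_abs_le_sqrt(1)[OF _ i]) measurable
  fix e :: real assume e: "0 < e"
  obtain N where N: "\<forall>p\<ge>N. \<forall>q\<ge>N. expectation (\<lambda>x. (Y p x - Y q x)^2) < e^2"
   using cauchy[of "e^2"] e by auto
  have "expectation (\<lambda>x. norm (Y p x - Y q x)) < e" if "N \<le> p" "N \<le> q" for p q
  proof -
   have "expectation (\<lambda>x. \<bar>Y p x - Y q x\<bar>) \<le> sqrt (expectation (\<lambda>x. (Y p x - Y q x)^2))"
    by (rule expectation_abs_le_sqrt(2)[OF _ isq]) measurable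
   also have "\<dots> < sqrt (e^2)" using N that by (intro real_sqrt_less_mono) auto
   finally show ?thesis using e by simp
  qed
  then show "\<exists>N. \<forall>p\<ge>N. \<forall>q\<ge>N. expectation (\<lambda>x. norm (Y p x - Y q x)) < e" by blast
 qed
 have rk: "k \<le> r k" for k using r by (rule seq_suble)
 have conv: "AE x in M. convergent (\<lambda>k. Y (r k) x)" using C by eventually_elim (rule Cauchy_convergent)
 define X where "X x = lim (\<lambda>k. Y (r k) x)" for x
 have [measurable]: "X \<in> borel_measurable M" unfolding X_def by (rule borel_measurable_lim_metric) auto
 have lim: "AE x in M. (\<lambda>k. Y (r k) x) \<longlonglongrightarrow> X x"
  using conv by eventually_elim (simp add: X_def convergent_LIMSEQ_iff)
 have fat: "(\<integral>\<^sup>+ x. ennreal ((Y q x - X x)^2) \<partial>M) \<le> ennreal e"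
  if "0 < e" "\<And>p. p \<ge> q0 \<Longrightarrow> expectation (\<lambda>x. (Y q x - Y p x)^2) \<le> e" for q q0 e
 proof -
  have "(\<integral>\<^sup>+ x. ennreal ((Y q x - X x)^2) \<partial>M) = (\<integral>\<^sup>+ x. liminf (\<lambda>k. ennreal ((Y q x - Y (r k) x)^2)) \<partial>M)"
  proof (rule nn_integral_cong_AE, use lim in eventually_elim)
   case (elim x)
   have "(\<lambda>k. ennreal ((Y q x - Y (r k) x)^2)) \<longlonglongrightarrow> ennreal ((Y q x - X x)^2)"
    by (intro tendsto_intros elim)
   then show ?case by (intro lim_imp_Liminf[symmetric]) auto
  qed
  also have "\<dots> \<le> liminf (\<lambda>k. \<integral>\<^sup>+ x. ennreal ((Y q x - Y (r k) x)^2) \<partial>M)"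
   by (rule nn_integral_liminf) auto
  also have "\<dots> \<le> ennreal e"
  proof (rule Liminf_le)
   have "(\<integral>\<^sup>+ x. ennreal ((Y q x - Y (r k) x)^2) \<partial>M) \<le> ennreal e" if "k \<ge> q0" for k
    using \<open>\<And>p. p \<ge> q0 \<Longrightarrow> _ p\<close>[of "r k"] order_trans[OF that rk]
    by (subst nn_integral_eq_integral) (auto intro!: ennreal_leI isq)
   then show "\<forall>\<^sub>F k in sequentially. (\<integral>\<^sup>+ x. ennreal ((Y q x - Y (r k) x)^2) \<partial>M) \<le> ennreal e"
    by (auto simp: eventually_sequentially)
  qed simp
  finally show ?thesis .
 qed
 have nn: "(\<lambda>q. \<integral>\<^sup>+ x. ennreal ((Y q x - X x)^2) \<partial>M) \<longlonglongrightarrow> 0"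
 proof (rule order_tendstoI)
  fix a :: ennreal assume "0 < a"
  then obtain b where b: "0 < b" "b < a" using dense by blast
  define e where "e = enn2real b"
  have "b < \<top>" using b(2) by (simp add: order_less_le_trans)
  then have e: "0 < e" "ennreal e < a"
   using b by (simp_all add: e_def enn2real_positive_iff)
  obtain N' where "\<forall>p\<ge>N'. \<forall>q\<ge>N'. expectation (\<lambda>x. (Y p x - Y q x)^2) < e" using cauchy[OF e(1)] by blast
  then have "(\<integral>\<^sup>+ x. ennreal ((Y q x - X x)^2) \<partial>M) < a" if "q \<ge> N'" for q
   using le_less_trans[OF fat[OF e(1), of N' q] e(2)] that by (auto intro: less_imp_le)
  then show "\<forall>\<^sub>F q in sequentially. (\<integral>\<^sup>+ x. ennreal ((Y q x - X x)^2) \<partial>M) < a"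
   by (auto simp: eventually_sequentially)
 qed auto
 have "\<forall>\<^sub>F q in sequentially. (\<integral>\<^sup>+ x. ennreal ((Y q x - X x)^2) \<partial>M) < 1"
  using nn by (rule order_tendstoD) simp
 then obtain q where q: "(\<integral>\<^sup>+ x. ennreal ((Y q x - X x)^2) \<partial>M) < 1" by (auto simp: eventually_sequentially)
 have "integrable M (\<lambda>x. (Y q x - X x)^2)"
  using q order_less_trans[OF q, of \<top>] by (intro integrableI_bounded) auto
 then have Xi: "integrable M (\<lambda>x. (X x)^2)"
  using integrable_sq_add(2)[OF _ _ i[of q], of "\<lambda>x. Y q x - X x"] by simp
 moreover have "(\<lambda>q. expectation (\<lambda>x. (Y q x - X x)^2)) \<longlonglongrightarrow> 0"
 proof -
  have "(\<integral>\<^sup>+ x. ennreal ((Y q x - X x)^2) \<partial>M) = ennreal (expectation (\<lambda>x. (Y q x - X x)^2))" for q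
   by (intro nn_integral_eq_integral integrable_sq_add i Xi) auto
  then have "(\<lambda>q. ennreal (expectation (\<lambda>x. (Y q x - X x)^2))) \<longlonglongrightarrow> ennreal 0" using nn by simp
  then show ?thesis by (subst (asm) tendsto_ennreal_iff) auto
 qed
 ultimately show thesis using nn by (intro that[of X]) auto
qed

section \<open>Multilinear forms in independent Gaussian variables\<close>

text \<open>Multilinear polynomials have one coefficient for each set of variables, which makes orthogonality
  of the monomials a statement about sets.\<close>

definition mform :: "'u set \<Rightarrow> ('u set \<Rightarrow> real) \<Rightarrow> ('u \<Rightarrow> real) \<Rightarrow> real" where
 "mform A c x = (\<Sum>S\<in>Pow A. c S * (\<Prod>u\<in>S. x u))"

lemma mform_insert:
 assumes "finite A" "u \<notin> A"
 shows "mform (insert u A) c x = x u * mform A (\<lambda>S. c (insert u S)) x + mform A c x"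
proof -
 have "mform (insert u A) c x = mform A c x + (\<Sum>S\<in>insert u ` Pow A. c S * (\<Prod>u\<in>S. x u))"
  unfolding mform_def Pow_insert using assms by (subst sum.union_disjoint) auto
 also have "(\<Sum>S\<in>insert u ` Pow A. c S * (\<Prod>u\<in>S. x u)) =
   (\<Sum>S\<in>Pow A. c (insert u S) * (\<Prod>u\<in>insert u S. x u))"
  using assms(2) by (subst sum.reindex) (auto simp: inj_on_def o_def)
 also have "\<dots> = (\<Sum>S\<in>Pow A. x u * (c (insert u S) * (\<Prod>u\<in>S. x u)))"
 proof (rule sum.cong[OF refl])
  fix S assume "S \<in> Pow A"
  then have "finite S" "u \<notin> S" using assms finite_subset by auto
  then show "c (insert u S) * (\<Prod>u\<in>insert u S. x u) = x u * (c (insert u S) * (\<Prod>u\<in>S. x u))" by simp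
 qed
 finally show ?thesis by (simp add: mform_def sum_distrib_left)
qed

lemma mform_restrict: "mform A c (restrict x A) = mform A c x"
 unfolding mform_def by (intro sum.cong arg_cong2[where f="(*)"] prod.cong) auto

lemma mform_measurable [measurable]: "mform A c \<in> borel_measurable (PiM A (\<lambda>_. borel))"
 unfolding mform_def
 by (intro borel_measurable_sum borel_measurable_times borel_measurable_prod borel_measurable_const
   measurable_component_singleton) auto

lemma cubic_le_quadratic_quartic:
 fixes a b :: real
 shows "\<bar>a ^ 3 * b\<bar> \<le> a ^ 4 + b ^ 4" "a^2 * b^2 \<le> a ^ 4 + b ^ 4" "\<bar>a * b ^ 3\<bar> \<le> a ^ 4 + b ^ 4"
proof -
 define m where "m = max \<bar>a\<bar> \<bar>b\<bar>"
 have m: "\<bar>a\<bar> \<le> m" "\<bar>b\<bar> \<le> m" "0 \<le> m" by (auto simp: m_def)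
 have "m = \<bar>a\<bar> \<or> m = \<bar>b\<bar>" by (auto simp: m_def)
 then have m4: "m ^ 4 \<le> a ^ 4 + b ^ 4" by (auto simp: power_even_abs)
 have "\<bar>a\<bar> ^ 3 * \<bar>b\<bar> \<le> m ^ 3 * m" using m by (intro mult_mono power_mono) auto
 then show "\<bar>a ^ 3 * b\<bar> \<le> a ^ 4 + b ^ 4" using m4 by (simp add: abs_mult power_abs eval_nat_numeral ac_simps)
 have "\<bar>a\<bar>\<^sup>2 * \<bar>b\<bar>\<^sup>2 \<le> m^2 * m^2" using m by (intro mult_mono power_mono) auto
 then show "a^2 * b^2 \<le> a ^ 4 + b ^ 4" using m4 by (simp add: eval_nat_numeral ac_simps)
 have "\<bar>a\<bar> * \<bar>b\<bar> ^ 3 \<le> m * m ^ 3" using m by (intro mult_mono power_mono) auto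
 then show "\<bar>a * b ^ 3\<bar> \<le> a ^ 4 + b ^ 4" using m4 by (simp add: abs_mult power_abs eval_nat_numeral ac_simps)
qed

text \<open>The moments of order one and three of a centered Gaussian variable vanish, so that only the
  even powers of \<open>X\<close> survive in the expansion of \<open>(X P + Q)\<^sup>4\<close>; the mixed term is controlled by
  the Cauchy-Schwarz inequality. The factor \<open>9\<close> is the smallest that absorbs it.\<close>

lemma (in prob_space) fourth_moment_step:
 fixes X P Q :: "'a \<Rightarrow> real"
 assumes [measurable]: "X \<in> borel_measurable M" "P \<in> borel_measurable M" "Q \<in> borel_measurable M"
  and ind: "\<And>k i j. indep_var borel (\<lambda>w. X w ^ k) borel (\<lambda>w. P w ^ i * Q w ^ j)"
  and iX: "\<And>k. integrable M (\<lambda>w. X w ^ k)"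
  and iP: "integrable M (\<lambda>w. P w ^ 4)" and iQ: "integrable M (\<lambda>w. Q w ^ 4)"
  and X1: "expectation X = 0" and X2: "expectation (\<lambda>w. X w ^ 2) = v"
  and X3: "expectation (\<lambda>w. X w ^ 3) = 0" and X4: "expectation (\<lambda>w. X w ^ 4) = 3 * v^2"
  and K: "0 \<le> K" and v: "0 \<le> v"
  and P4: "expectation (\<lambda>w. P w ^ 4) \<le> K * (expectation (\<lambda>w. P w ^ 2))^2"
  and Q4: "expectation (\<lambda>w. Q w ^ 4) \<le> 9 * K * (expectation (\<lambda>w. Q w ^ 2))^2"
 shows "integrable M (\<lambda>w. (X w * P w + Q w) ^ 4)"
  and "expectation (\<lambda>w. (X w * P w + Q w) ^ 4) \<le> 9 * K * (expectation (\<lambda>w. (X w * P w + Q w) ^ 2))^2"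
proof -
 have PQi: "integrable M (\<lambda>w. P w ^ 4 + Q w ^ 4)" using iP iQ by simp
 have m4: "integrable M (\<lambda>w. P w ^ 4 * Q w ^ 0)" using iP by simp
 have m3: "integrable M (\<lambda>w. P w ^ 3 * Q w ^ 1)"
  using cubic_le_quadratic_quartic by (intro Bochner_Integration.integrable_bound[OF PQi]) auto
 have m2: "integrable M (\<lambda>w. P w ^ 2 * Q w ^ 2)"
  using cubic_le_quadratic_quartic by (intro Bochner_Integration.integrable_bound[OF PQi]) auto
 have m1: "integrable M (\<lambda>w. P w ^ 1 * Q w ^ 3)"
  using cubic_le_quadratic_quartic by (intro Bochner_Integration.integrable_bound[OF PQi]) auto
 have m0: "integrable M (\<lambda>w. P w ^ 0 * Q w ^ 4)" using iQ by simp
 have sq: "integrable M (\<lambda>w. (Z w)^2)" if [measurable]: "Z \<in> borel_measurable M" and "integrable M (\<lambda>w. Z w ^ 4)" for Z :: "'a \<Rightarrow> real"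
  using expectation_abs_le_sqrt(1)[of "\<lambda>w. (Z w)^2"] that by (simp flip: power_mult)
 have n2: "integrable M (\<lambda>w. P w ^ 2 * Q w ^ 0)" "integrable M (\<lambda>w. P w ^ 0 * Q w ^ 2)"
  using sq[of P] sq[of Q] iP iQ by simp_all
 have n1: "integrable M (\<lambda>w. P w ^ 1 * Q w ^ 1)"
  using integrable_mult_of_sq[of P M Q] n2 by simp
 note I = indep_var_integrable[OF ind iX] indep_var_lebesgue_integral[OF ind iX]
 define a b where "a = expectation (\<lambda>w. P w ^ 2)" and "b = expectation (\<lambda>w. Q w ^ 2)"
 have ab: "0 \<le> a" "0 \<le> b" by (auto simp: a_def b_def)
 have e4: "(\<lambda>w. (X w * P w + Q w) ^ 4) = (\<lambda>w. X w ^ 4 * (P w ^ 4 * Q w ^ 0) + 4 * (X w ^ 3 * (P w ^ 3 * Q w ^ 1))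
   + 6 * (X w ^ 2 * (P w ^ 2 * Q w ^ 2)) + 4 * (X w ^ 1 * (P w ^ 1 * Q w ^ 3)) + X w ^ 0 * (P w ^ 0 * Q w ^ 4))"
  by (rule ext) (simp add: eval_nat_numeral algebra_simps)
 have e2: "(\<lambda>w. (X w * P w + Q w) ^ 2) = (\<lambda>w. X w ^ 2 * (P w ^ 2 * Q w ^ 0) + 2 * (X w ^ 1 * (P w ^ 1 * Q w ^ 1))
   + X w ^ 0 * (P w ^ 0 * Q w ^ 2))"
  by (rule ext) (simp add: eval_nat_numeral algebra_simps)
 show "integrable M (\<lambda>w. (X w * P w + Q w) ^ 4)"
  unfolding e4 by (intro Bochner_Integration.integrable_add integrable_mult_right I(1) m0 m1 m2 m3 m4)
 have E4: "expectation (\<lambda>w. (X w * P w + Q w) ^ 4) =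
   3 * v^2 * expectation (\<lambda>w. P w ^ 4) + 6 * v * expectation (\<lambda>w. P w ^ 2 * Q w ^ 2) + expectation (\<lambda>w. Q w ^ 4)"
 proof -
  have "expectation (\<lambda>w. (X w * P w + Q w) ^ 4) =
    expectation (\<lambda>w. X w ^ 4) * expectation (\<lambda>w. P w ^ 4 * Q w ^ 0)
    + 4 * (expectation (\<lambda>w. X w ^ 3) * expectation (\<lambda>w. P w ^ 3 * Q w ^ 1))
    + 6 * (expectation (\<lambda>w. X w ^ 2) * expectation (\<lambda>w. P w ^ 2 * Q w ^ 2))
    + 4 * (expectation (\<lambda>w. X w ^ 1) * expectation (\<lambda>w. P w ^ 1 * Q w ^ 3))
    + expectation (\<lambda>w. X w ^ 0) * expectation (\<lambda>w. P w ^ 0 * Q w ^ 4)"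
   unfolding e4
   by (simp only: Bochner_Integration.integral_add Bochner_Integration.integrable_add integrable_mult_right
    integral_mult_right_zero I[OF m0] I[OF m1] I[OF m2] I[OF m3] I[OF m4])
  then show ?thesis by (simp add: X1 X2 X3 X4 prob_space)
 qed
 have E2: "expectation (\<lambda>w. (X w * P w + Q w) ^ 2) = v * a + b"
 proof -
  have "expectation (\<lambda>w. (X w * P w + Q w) ^ 2) =
    expectation (\<lambda>w. X w ^ 2) * expectation (\<lambda>w. P w ^ 2 * Q w ^ 0)
    + 2 * (expectation (\<lambda>w. X w ^ 1) * expectation (\<lambda>w. P w ^ 1 * Q w ^ 1))
    + expectation (\<lambda>w. X w ^ 0) * expectation (\<lambda>w. P w ^ 0 * Q w ^ 2)"
   unfolding e2
   by (simp only: Bochner_Integration.integral_add Bochner_Integration.integrable_add integrable_mult_right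
    integral_mult_right_zero I[OF n1] I[OF n2(1)] I[OF n2(2)])
  then show ?thesis by (simp add: X1 X2 prob_space a_def b_def)
 qed
 have "(expectation (\<lambda>w. P w ^ 2 * Q w ^ 2))^2 \<le> expectation (\<lambda>w. P w ^ 4) * expectation (\<lambda>w. Q w ^ 4)"
  using integral_Cauchy_Schwarz[of "\<lambda>w. P w ^ 2" M "\<lambda>w. Q w ^ 2"] iP iQ by (simp flip: power_mult)
 also have "\<dots> \<le> (K * a^2) * (9 * K * b^2)"
  using P4 Q4 K by (intro mult_mono) (auto simp: a_def b_def)
 also have "\<dots> = (3 * K * a * b)^2" by (simp add: power2_eq_square)
 finally have PQ: "expectation (\<lambda>w. P w ^ 2 * Q w ^ 2) \<le> 3 * K * a * b"
  by (rule power2_le_imp_le) (use ab K in auto)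
 have "expectation (\<lambda>w. (X w * P w + Q w) ^ 4) \<le> 3 * v^2 * (K * a^2) + 6 * v * (3 * K * a * b) + 9 * K * b^2"
  unfolding E4 using P4 Q4 PQ v by (intro add_mono mult_left_mono) (auto simp: a_def b_def)
 also have "\<dots> \<le> 9 * K * (v * a + b)^2"
 proof -
  have "0 \<le> K * v^2 * a^2" using K by simp
  then show ?thesis by (simp add: power2_eq_square algebra_simps)
 qed
 finally show "expectation (\<lambda>w. (X w * P w + Q w) ^ 4) \<le> 9 * K * (expectation (\<lambda>w. (X w * P w + Q w) ^ 2))^2"
  by (simp add: E2)
qed

locale gauss_family = prob_space M for M :: "'w measure" +
 fixes U :: "'u set" and v :: "'u \<Rightarrow> real" and W :: "'u \<Rightarrow> 'w \<Rightarrow> real"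
 assumes finite_U: "finite U"
  and indep_W: "indep_vars (\<lambda>_. borel) W U"
  and v_pos: "\<And>u. u \<in> U \<Longrightarrow> 0 < v u"
  and W_distributed: "\<And>u. u \<in> U \<Longrightarrow> distributed M lborel (W u) (normal_density 0 (sqrt (v u)))"
begin

lemma W_measurable: "u \<in> U \<Longrightarrow> W u \<in> borel_measurable M"
 using distributed_measurable[OF W_distributed] by simp

lemma W_power_integrable: "u \<in> U \<Longrightarrow> integrable M (\<lambda>w. W u w ^ k)"
 using distributed_integrable[OF W_distributed, of u "\<lambda>x. x ^ k"]
  integrable_normal_moment[of "sqrt (v u)" 0 k] v_pos[of u]
 by (simp add: normal_density_nonneg)

lemma W_moment: "u \<in> U \<Longrightarrow> expectation (\<lambda>w. W u w ^ k) = (\<integral>x. normal_density 0 (sqrt (v u)) x * x ^ k \<partial>lborel)"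
 using distributed_integral[OF W_distributed, of u "\<lambda>x. x ^ k"] by (simp add: normal_density_nonneg)

lemma W_moments:
 assumes "u \<in> U"
 shows "expectation (W u) = 0" "expectation (\<lambda>w. W u w ^ 2) = v u"
  "expectation (\<lambda>w. W u w ^ 3) = 0" "expectation (\<lambda>w. W u w ^ 4) = 3 * (v u)^2"
 using W_moment[OF assms, of 1] W_moment[OF assms, of 2] W_moment[OF assms, of 3] W_moment[OF assms, of 4]
  integral_normal_moment_odd[of "sqrt (v u)" 0 0] integral_normal_moment_odd[of "sqrt (v u)" 0 1]
  integral_normal_moment_even[of "sqrt (v u)" 0 1] integral_normal_moment_even[of "sqrt (v u)" 0 2]
  v_pos[OF assms]
 by (simp_all add: eval_nat_numeral field_simps)

lemma monomial_expectation:
 assumes "A \<subseteq> U"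
 shows "integrable M (\<lambda>w. \<Prod>u\<in>A. W u w ^ e u)"
  and "expectation (\<lambda>w. \<Prod>u\<in>A. W u w ^ e u) = (\<Prod>u\<in>A. expectation (\<lambda>w. W u w ^ e u))"
proof -
 have fin: "finite A" using assms finite_U finite_subset by auto
 have ind: "indep_vars (\<lambda>_. borel) (\<lambda>u w. W u w ^ e u) A"
  by (rule indep_vars_compose2[OF indep_vars_subset[OF indep_W assms]]) auto
 show "integrable M (\<lambda>w. \<Prod>u\<in>A. W u w ^ e u)"
  by (rule indep_vars_integrable[OF fin ind]) (use assms W_power_integrable in auto)
 show "expectation (\<lambda>w. \<Prod>u\<in>A. W u w ^ e u) = (\<Prod>u\<in>A. expectation (\<lambda>w. W u w ^ e u))"
  by (rule indep_vars_lebesgue_integral[OF fin ind]) (use assms W_power_integrable in auto)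
qed

lemma prod_prod_expectation:
 assumes "S \<subseteq> U" "T \<subseteq> U"
 shows "integrable M (\<lambda>w. (\<Prod>u\<in>S. W u w) * (\<Prod>u\<in>T. W u w))"
  and "expectation (\<lambda>w. (\<Prod>u\<in>S. W u w) * (\<Prod>u\<in>T. W u w)) = (if S = T then \<Prod>u\<in>S. v u else 0)"
proof -
 define e :: "'u \<Rightarrow> nat" where "e u = of_bool (u \<in> S) + of_bool (u \<in> T)" for u
 have p: "(\<Prod>u\<in>S. W u w) = (\<Prod>u\<in>U. W u w ^ of_bool (u \<in> S))" if "S \<subseteq> U" for S w
  using that finite_U by (intro prod.mono_neutral_cong_left) auto
 have eq: "(\<Prod>u\<in>S. W u w) * (\<Prod>u\<in>T. W u w) = (\<Prod>u\<in>U. W u w ^ e u)" for w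
  by (simp add: p[OF assms(1)] p[OF assms(2)] e_def power_add prod.distrib)
 show "integrable M (\<lambda>w. (\<Prod>u\<in>S. W u w) * (\<Prod>u\<in>T. W u w))"
  unfolding eq by (rule monomial_expectation) simp
 have E: "expectation (\<lambda>w. (\<Prod>u\<in>S. W u w) * (\<Prod>u\<in>T. W u w)) = (\<Prod>u\<in>U. expectation (\<lambda>w. W u w ^ e u))"
  unfolding eq by (rule monomial_expectation) simp
 show "expectation (\<lambda>w. (\<Prod>u\<in>S. W u w) * (\<Prod>u\<in>T. W u w)) = (if S = T then \<Prod>u\<in>S. v u else 0)"
 proof (cases "S = T")
  case True
  have "(\<Prod>u\<in>U. expectation (\<lambda>w. W u w ^ e u)) = (\<Prod>u\<in>U. if u \<in> S then v u else 1)"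
   using W_moments True by (intro prod.cong) (auto simp: e_def prob_space numeral_2_eq_2)
  also have "\<dots> = (\<Prod>u\<in>S. v u)" using assms(1) finite_U by (intro prod.mono_neutral_cong_right) auto
  finally show ?thesis using True E by simp
 next
  case False
  then obtain u where u: "u \<in> U" "e u = 1" using assms unfolding e_def by fastforce
  then have "\<exists>u\<in>U. expectation (\<lambda>w. W u w ^ e u) = 0" using W_moments(1)[OF u(1)] by (intro bexI[of _ u]) auto
  then show ?thesis using False E finite_U by (simp add: prod_zero_iff)
 qed
qed

lemma mform_W_measurable: "A \<subseteq> U \<Longrightarrow> (\<lambda>w. mform A c (\<lambda>u. W u w)) \<in> borel_measurable M"
 unfolding mform_def using W_measurable
 by (intro borel_measurable_sum borel_measurable_times borel_measurable_prod borel_measurable_const) auto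

lemma mform_mult_expectation:
 assumes "A \<subseteq> U"
 shows "integrable M (\<lambda>w. mform A c (\<lambda>u. W u w) * mform A c' (\<lambda>u. W u w))"
  and "expectation (\<lambda>w. mform A c (\<lambda>u. W u w) * mform A c' (\<lambda>u. W u w)) =
   (\<Sum>S\<in>Pow A. c S * c' S * (\<Prod>u\<in>S. v u))"
proof -
 have fin: "finite A" using assms finite_U finite_subset by auto
 have eq: "mform A c (\<lambda>u. W u w) * mform A c' (\<lambda>u. W u w) =
   (\<Sum>S\<in>Pow A. \<Sum>T\<in>Pow A. c S * c' T * ((\<Prod>u\<in>S. W u w) * (\<Prod>u\<in>T. W u w)))" for w
  unfolding mform_def by (simp add: sum_product algebra_simps)
 have i: "integrable M (\<lambda>w. (\<Prod>u\<in>S. W u w) * (\<Prod>u\<in>T. W u w))" if "S \<in> Pow A" "T \<in> Pow A" for S T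
  using that assms by (intro prod_prod_expectation) auto
 show "integrable M (\<lambda>w. mform A c (\<lambda>u. W u w) * mform A c' (\<lambda>u. W u w))"
  unfolding eq by (intro Bochner_Integration.integrable_sum integrable_mult_right i)
 have "expectation (\<lambda>w. mform A c (\<lambda>u. W u w) * mform A c' (\<lambda>u. W u w)) =
   (\<Sum>S\<in>Pow A. \<Sum>T\<in>Pow A. c S * c' T * (if S = T then \<Prod>u\<in>S. v u else 0))"
  unfolding eq using i assms
  by (subst Bochner_Integration.integral_sum | intro sum.cong Bochner_Integration.integrable_sum integrable_mult_right refl)+
    (auto simp: prod_prod_expectation)
 also have "\<dots> = (\<Sum>S\<in>Pow A. c S * c' S * (\<Prod>u\<in>S. v u))"
  using fin by (intro sum.cong) (auto simp: if_distrib sum.delta' cong: if_cong)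
 finally show "expectation (\<lambda>w. mform A c (\<lambda>u. W u w) * mform A c' (\<lambda>u. W u w)) =
   (\<Sum>S\<in>Pow A. c S * c' S * (\<Prod>u\<in>S. v u))" .
qed

lemma mform_expectation:
 assumes "A \<subseteq> U"
 shows "expectation (\<lambda>w. mform A c (\<lambda>u. W u w)) = c {}"
proof -
 have fin: "finite A" using assms finite_U finite_subset by auto
 have one: "mform A (\<lambda>S. if S = {} then 1 else 0) x = 1" for x :: "'u \<Rightarrow> real"
  unfolding mform_def using fin by (simp add: if_distrib[of "\<lambda>c. c * _"] sum.delta cong: if_cong)
 show ?thesis
  using mform_mult_expectation(2)[OF assms, of c "\<lambda>S. if S = {} then 1 else 0"] fin
  by (simp add: one if_distrib[of "\<lambda>c. _ * c"] if_distrib[of "\<lambda>c. c * _"] sum.delta cong: if_cong)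
qed

text \<open>Bonami's hypercontractive inequality, by induction on the number of variables. Splitting off a
  variable \<open>u\<close> gives \<open>x\<^sub>u P + Q\<close> where \<open>P\<close> has lower degree, which pays for the factor \<open>9\<close>.\<close>

lemma mform_fourth_moment:
 assumes "A \<subseteq> U" and "\<And>S. S \<subseteq> A \<Longrightarrow> n < card S \<Longrightarrow> c S = 0"
 shows "integrable M (\<lambda>w. mform A c (\<lambda>u. W u w) ^ 4) \<and>
  expectation (\<lambda>w. mform A c (\<lambda>u. W u w) ^ 4) \<le> 9 ^ n * (expectation (\<lambda>w. mform A c (\<lambda>u. W u w) ^ 2))^2"
proof -
 have "finite A" using assms(1) finite_U finite_subset by auto
 then show ?thesis using assms
 proof (induction A arbitrary: c n rule: finite_induct)
  case empty
  have "(c {}) ^ 4 \<le> 9 ^ n * ((c {})^2)^2"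
   using mult_right_mono[of 1 "9 ^ n" "c {} ^ 4"] by (simp flip: power_mult)
  then show ?case by (simp add: mform_def prob_space)
 next
  case (insert u A)
  have uU: "u \<in> U" and AU: "A \<subseteq> U" using insert.prems(1) by auto
  define P where "P = (\<lambda>w. mform A (\<lambda>S. c (insert u S)) (\<lambda>u. W u w))"
  define Q where "Q = (\<lambda>w. mform A c (\<lambda>u. W u w))"
  have eq: "mform (insert u A) c (\<lambda>u. W u w) = W u w * P w + Q w" for w
   unfolding P_def Q_def by (rule mform_insert) fact+
  have Q: "integrable M (\<lambda>w. Q w ^ 4)" "expectation (\<lambda>w. Q w ^ 4) \<le> 9 ^ n * (expectation (\<lambda>w. Q w ^ 2))^2"
   using insert.IH[OF AU, of n c] insert.prems(2) by (auto simp: Q_def)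
  have P: "integrable M (\<lambda>w. P w ^ 4) \<and> expectation (\<lambda>w. P w ^ 4) \<le> (9 ^ n / 9) * (expectation (\<lambda>w. P w ^ 2))^2"
  proof (cases n)
   case 0
   have "c (insert u S) = 0" if "S \<subseteq> A" for S
    using that insert.prems(2)[of "insert u S"] insert.hyps finite_subset[OF that] 0 card_gt_0_iff[of "insert u S"] by auto
   then have "P w = 0" for w unfolding P_def mform_def by (intro sum.neutral) auto
   then show ?thesis by simp
  next
   case (Suc n')
   have "c (insert u S) = 0" if "S \<subseteq> A" "n' < card S" for S
   proof -
    have "finite S" "u \<notin> S" using that(1) insert.hyps finite_subset by auto
    then show ?thesis using that insert.prems(2)[of "insert u S"] Suc by auto
   qed
   then show ?thesis using insert.IH[OF AU, of n' "\<lambda>S. c (insert u S)"] Suc by (simp add: P_def)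
  qed
  have ind: "indep_var borel (\<lambda>w. W u w ^ k) borel (\<lambda>w. P w ^ i * Q w ^ j)" for k i j
  proof -
   have "indep_var borel ((\<lambda>f. f u ^ k) \<circ> (\<lambda>w. restrict (\<lambda>i. W i w) {u}))
    borel ((\<lambda>f. mform A (\<lambda>S. c (insert u S)) f ^ i * mform A c f ^ j) \<circ> (\<lambda>w. restrict (\<lambda>i. W i w) A))"
    by (intro indep_var_compose[OF indep_var_restrict[OF indep_W]])
      (use insert.hyps uU AU in \<open>auto intro!: measurable_component_singleton borel_measurable_power\<close>)
   then show ?thesis by (simp add: o_def mform_restrict P_def Q_def)
  qed
  have "integrable M (\<lambda>w. (W u w * P w + Q w) ^ 4) \<and>
   expectation (\<lambda>w. (W u w * P w + Q w) ^ 4) \<le> 9 * (9 ^ n / 9) * (expectation (\<lambda>w. (W u w * P w + Q w) ^ 2))^2"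
   using P Q W_moments[OF uU] v_pos[OF uU] W_power_integrable[OF uU]
   by (intro conjI fourth_moment_step[where v = "v u" and K = "9 ^ n / 9" and X = "W u" and P = P and Q = Q]
     ind W_measurable[OF uU])
     (auto simp: P_def Q_def intro: mform_W_measurable[OF AU])
  then show ?case by (simp add: eq)
 qed
qed

end

section \<open>Characteristic functions of sums over independent blocks\<close>

lemma (in prob_space) char_distr_eq:
 assumes "X \<in> borel_measurable M"
 shows "char (distr M borel X) t = (CLINT w|M. iexp (t * X w))"
 unfolding char_def using assms by (subst integral_distr) auto

lemma norm_iexp_diff_le: "norm (iexp a - iexp b) \<le> \<bar>a - b\<bar>"
proof -
 have "iexp a - iexp b = iexp b * (iexp (a - b) - 1)"
  by (simp add: algebra_simps flip: exp_add)
 then have "norm (iexp a - iexp b) = norm (iexp (a - b) - 1)" by (simp add: norm_mult)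
 also have "\<dots> \<le> \<bar>a - b\<bar>" using iexp_approx1[of "a - b" 0] by simp
 finally show ?thesis .
qed

lemma (in prob_space) char_diff_le:
 fixes X Y :: "'a \<Rightarrow> real"
 assumes [measurable]: "X \<in> borel_measurable M" "Y \<in> borel_measurable M"
  and i: "integrable M (\<lambda>w. (X w - Y w)^2)"
 shows "norm (char (distr M borel X) t - char (distr M borel Y) t) \<le> \<bar>t\<bar> * sqrt (expectation (\<lambda>w. (X w - Y w)^2))"
proof -
 have ie: "integrable M (\<lambda>w. iexp (t * Z w))" if [measurable]: "Z \<in> borel_measurable M" for Z
  by (intro integrable_const_bound[of _ 1]) auto
 have [measurable]: "(\<lambda>w. X w - Y w) \<in> borel_measurable M" by measurable
 have i1: "integrable M (\<lambda>w. X w - Y w)"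
  and i2: "expectation (\<lambda>w. \<bar>X w - Y w\<bar>) \<le> sqrt (expectation (\<lambda>w. (X w - Y w)^2))"
  by (rule expectation_abs_le_sqrt[OF _ i], measurable)+
 have "norm (char (distr M borel X) t - char (distr M borel Y) t) = norm (CLINT w|M. iexp (t * X w) - iexp (t * Y w))"
  by (subst (1 2) char_distr_eq) (auto simp: ie simp del: of_real_mult)
 also have "\<dots> \<le> expectation (\<lambda>w. norm (iexp (t * X w) - iexp (t * Y w)))"
  by (rule integral_norm_bound)
 also have "\<dots> \<le> expectation (\<lambda>w. \<bar>t\<bar> * \<bar>X w - Y w\<bar>)"
 proof (rule integral_mono)
  show "integrable M (\<lambda>w. norm (iexp (t * X w) - iexp (t * Y w)))"
   by (intro integrable_norm Bochner_Integration.integrable_diff ie) auto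
  show "integrable M (\<lambda>w. \<bar>t\<bar> * \<bar>X w - Y w\<bar>)"
   by (intro integrable_mult_right integrable_abs i1)
  show "norm (iexp (t * X w) - iexp (t * Y w)) \<le> \<bar>t\<bar> * \<bar>X w - Y w\<bar>" for w
   using norm_iexp_diff_le[of "t * X w" "t * Y w"] by (simp add: abs_mult flip: right_diff_distrib)
 qed
 also have "\<dots> = \<bar>t\<bar> * expectation (\<lambda>w. \<bar>X w - Y w\<bar>)" by simp
 also have "\<dots> \<le> \<bar>t\<bar> * sqrt (expectation (\<lambda>w. (X w - Y w)^2))"
  by (intro mult_left_mono i2) auto
 finally show ?thesis .
qed

text \<open>The remainder of the quadratic Taylor polynomial is a third absolute moment. It is reduced to
  even moments by \<open>2 |X|\<^sup>3 \<le> \<surd>\<eta> X\<^sup>2 + X\<^sup>4 / \<surd>\<eta>\<close>.\<close>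

lemma (in prob_space) char_quadratic_approx:
 fixes X :: "'a \<Rightarrow> real"
 assumes [measurable]: "X \<in> borel_measurable M" and i4: "integrable M (\<lambda>w. X w ^ 4)"
  and X1: "expectation X = 0" and X2: "expectation (\<lambda>w. (X w)^2) = V"
  and X4: "expectation (\<lambda>w. X w ^ 4) \<le> C * V^2" and V: "V \<le> \<eta>" and \<eta>: "0 < \<eta>" and C: "0 \<le> C"
 shows "norm (char (distr M borel X) t - (1 - t\<^sup>2 * V / 2)) \<le> \<bar>t\<bar> ^ 3 * (V * sqrt \<eta> * (1 + C) / 12)"
proof -
 have i2: "integrable M (\<lambda>w. (X w)^2)"
  using expectation_abs_le_sqrt(1)[of "\<lambda>w. (X w)^2"] i4 by (simp flip: power_mult)
 have i1: "integrable M X" using expectation_abs_le_sqrt(1)[of X] i2 by simp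
 have V0: "0 \<le> V" using X2[symmetric] by simp
 define s where "s = sqrt \<eta>"
 have s: "0 < s" "s^2 = \<eta>" using \<eta> by (auto simp: s_def)
 have cube: "\<bar>x\<bar> ^ 3 \<le> (s * x^2 + x ^ 4 / s) / 2" for x :: real
 proof -
  define y where "y = \<bar>x\<bar>"
  have y: "x^2 = y^2" "x ^ 4 = y ^ 4" by (auto simp: y_def power_even_abs)
  have "0 \<le> y^2 * (s - y)^2 / s" using s by simp
  also have "y^2 * (s - y)^2 / s = s * y^2 + y ^ 4 / s - 2 * y ^ 3"
  proof -
   have "y^2 * (s - y)^2 = s^2 * y^2 + y ^ 4 - 2 * s * y ^ 3"
    by (simp add: power2_diff algebra_simps eval_nat_numeral)
   then show ?thesis using s(1) by (simp add: field_simps power2_eq_square)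
  qed
  finally have "y ^ 3 \<le> (s * y^2 + y ^ 4 / s) / 2" by simp
  then show ?thesis unfolding y by (simp add: y_def)
 qed
 have i3: "integrable M (\<lambda>w. \<bar>X w\<bar> ^ 3)"
 proof (rule Bochner_Integration.integrable_bound)
  show "integrable M (\<lambda>w. (s * (X w)^2 + X w ^ 4 / s) / 2)" using i2 i4 by simp
  show "AE w in M. norm (\<bar>X w\<bar> ^ 3) \<le> norm ((s * (X w)^2 + X w ^ 4 / s) / 2)"
  proof (rule AE_I2)
   fix w
   have "norm (\<bar>X w\<bar> ^ 3) = \<bar>X w\<bar> ^ 3" by simp
   also note cube
   also note abs_ge_self
   finally show "norm (\<bar>X w\<bar> ^ 3) \<le> norm ((s * (X w)^2 + X w ^ 4 / s) / 2)" by simp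
  qed
 qed simp
 have "expectation (\<lambda>w. \<bar>X w\<bar> ^ 3) \<le> expectation (\<lambda>w. (s * (X w)^2 + X w ^ 4 / s) / 2)"
  by (rule integral_mono[OF i3 _ cube]) (use i2 i4 in simp)
 also have "\<dots> = (s * V + expectation (\<lambda>w. X w ^ 4) / s) / 2" using i2 i4 by (simp add: X2)
 also have "\<dots> \<le> (s * V + (C * V * s^2) / s) / 2"
 proof -
  have "C * V^2 \<le> C * V * s^2" using V V0 C s(2) by (simp add: power2_eq_square mult_left_mono mult.assoc)
  then show ?thesis using X4 s(1) by (intro divide_right_mono add_left_mono) auto
 qed
 also have "\<dots> = V * s * (1 + C) / 2" using s(1) by (simp add: power2_eq_square field_simps)
 finally have E3: "expectation (\<lambda>w. \<bar>X w\<bar> ^ 3) \<le> V * s * (1 + C) / 2" .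
 have ie: "integrable M (\<lambda>w. iexp (t * X w))" by (intro integrable_const_bound[of _ 1]) auto
 define r where "r x = 1 + \<i> * of_real (t * x) - of_real (t^2 * x^2 / 2)" for x
 have r: "norm (iexp (t * x) - r x) \<le> \<bar>t\<bar> ^ 3 / 6 * \<bar>x\<bar> ^ 3" for x
  using iexp_approx1[of "t * x" 2]
  by (simp add: r_def eval_nat_numeral power_mult_distrib abs_mult field_simps)
 have ir: "integrable M (\<lambda>w. r (X w))"
  unfolding r_def using i1 i2
  by (intro Bochner_Integration.integrable_add Bochner_Integration.integrable_diff integrable_mult_right integrable_of_real) auto
 have Er: "(CLINT w|M. r (X w)) = 1 - t\<^sup>2 * V / 2"
 proof -
  have "(CLINT w|M. r (X w)) = (CLINT w|M. 1) + (CLINT w|M. \<i> * of_real (t * X w)) - (CLINT w|M. of_real (t^2 * (X w)^2 / 2))"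
   unfolding r_def using i1 i2
   by (subst Bochner_Integration.integral_diff Bochner_Integration.integral_add;
     (intro Bochner_Integration.integrable_add integrable_mult_right integrable_of_real)?; simp)+
  also have "\<dots> = 1 + \<i> * of_real (t * expectation X) - of_real (t^2 * expectation (\<lambda>w. (X w)^2) / 2)"
   by (simp add: prob_space del: of_real_mult of_real_divide of_real_power)
  finally show ?thesis by (simp add: X1 X2)
 qed
 have "norm (char (distr M borel X) t - (1 - t\<^sup>2 * V / 2)) = norm (CLINT w|M. iexp (t * X w) - r (X w))"
  using ie ir Er by (subst char_distr_eq) (auto simp del: of_real_mult)
 also have "\<dots> \<le> expectation (\<lambda>w. norm (iexp (t * X w) - r (X w)))"
  by (rule integral_norm_bound)
 also have "\<dots> \<le> expectation (\<lambda>w. \<bar>t\<bar> ^ 3 / 6 * \<bar>X w\<bar> ^ 3)"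
  using r ie ir i3 by (intro integral_mono integrable_norm Bochner_Integration.integrable_diff) auto
 also have "\<dots> \<le> \<bar>t\<bar> ^ 3 / 6 * (V * s * (1 + C) / 2)"
  unfolding integral_mult_right_zero by (intro mult_left_mono E3) simp
 finally show ?thesis by (simp add: s_def)
qed

lemma exp_minus_quadratic_approx:
 fixes x :: real
 assumes "0 \<le> x"
 shows "\<bar>exp (- x) - (1 - x)\<bar> \<le> x^2"
proof -
 have "1 - x \<le> exp (- x)" using exp_ge_add_one_self[of "- x"] by simp
 moreover have "exp (- x) \<le> 1 / (1 + x)"
  using exp_ge_add_one_self[of x] assms by (simp add: exp_minus field_simps)
 moreover have "1 / (1 + x) \<le> 1 - x + x^2"
 proof -
  have "1 \<le> (1 - x + x^2) * (1 + x)" using assms by (simp add: algebra_simps power2_eq_square)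
  then show ?thesis using assms by (simp add: field_simps)
 qed
 ultimately show ?thesis by simp
qed

lemma abs_exp_minus_diff_le:
 fixes x y :: real
 assumes "0 \<le> x" "x \<le> y"
 shows "\<bar>exp (- x) - exp (- y)\<bar> \<le> y - x"
proof -
 have "exp (- x) - exp (- y) = exp (- x) * (1 - exp (- (y - x)))" by (simp add: algebra_simps flip: exp_add)
 also have "\<dots> \<le> 1 * (y - x)"
 proof (rule mult_mono)
  show "1 - exp (- (y - x)) \<le> y - x" using exp_ge_add_one_self[of "x - y"] by (simp del: exp_ge_add_one_self)
 qed (use assms in auto)
 finally show ?thesis using assms by simp
qed

abbreviation lyapunov_error :: "nat \<Rightarrow> real \<Rightarrow> real \<Rightarrow> real" where
 "lyapunov_error n t \<eta> \<equiv> \<bar>t\<bar> ^ 3 * sqrt \<eta> * (1 + 9 ^ n) / 12 + t ^ 4 * \<eta> / 4"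

text \<open>Lyapunov's central limit theorem for a form whose coefficients live mostly inside blocks:
  the parts inside the blocks are independent, and by hypercontractivity their third moments are
  dominated by their variances.\<close>

lemma (in gauss_family) mform_char_approx:
 fixes J :: nat
 assumes A: "\<And>j. j < J \<Longrightarrow> A j \<subseteq> U" and disj: "disjoint_family_on A {..<J}"
  and c0: "c {} = 0" and cn: "\<And>S. S \<subseteq> U \<Longrightarrow> n < card S \<Longrightarrow> c S = 0"
  and V: "V = (\<Sum>S\<in>Pow U. (c S)^2 * (\<Prod>u\<in>S. v u))"
  and Voff: "Voff = (\<Sum>S | S \<subseteq> U \<and> (\<forall>j<J. \<not> S \<subseteq> A j). (c S)^2 * (\<Prod>u\<in>S. v u))"
  and \<eta>: "0 < \<eta>" "\<And>j. j < J \<Longrightarrow> (\<Sum>S\<in>Pow (A j). (c S)^2 * (\<Prod>u\<in>S. v u)) \<le> \<eta>"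
 shows "norm (char (distr M borel (\<lambda>w. mform U c (\<lambda>u. W u w))) t - exp (- (t^2 * V / 2))) \<le>
  \<bar>t\<bar> * sqrt Voff + t^2 * Voff / 2 + V * lyapunov_error n t \<eta>"
proof -
 define X where "X = (\<lambda>w. mform U c (\<lambda>u. W u w))"
 define Y where "Y j = (\<lambda>w. mform (A j) c (\<lambda>u. W u w))" for j
 define Vb where "Vb j = (\<Sum>S\<in>Pow (A j). (c S)^2 * (\<Prod>u\<in>S. v u))" for j
 (* The part of the form that belongs to no block; it is estimated by its variance alone. *)
 define c' where "c' S = (if \<exists>j<J. S \<subseteq> A j then 0 else c S)" for S
 have [measurable]: "X \<in> borel_measurable M" unfolding X_def by (rule mform_W_measurable) simp
 have Ym [measurable]: "Y j \<in> borel_measurable M" if "j < J" for j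
  unfolding Y_def by (rule mform_W_measurable) (use A that in auto)
 have finA: "finite (A j)" if "j < J" for j using A[OF that] finite_U finite_subset by auto
 have vS: "0 \<le> (\<Prod>u\<in>S. v u)" if "S \<subseteq> U" for S using that v_pos by (intro prod_nonneg) (auto intro: less_imp_le)
 have split: "(\<Sum>S\<in>Pow U. g S) = (\<Sum>j<J. \<Sum>S\<in>Pow (A j). g S) + (\<Sum>S | S \<subseteq> U \<and> (\<forall>j<J. \<not> S \<subseteq> A j). g S)"
  if g: "g {} = 0" for g :: "'u set \<Rightarrow> real"
 proof -
  have "(\<Sum>S\<in>Pow U. g S) = (\<Sum>S\<in>(\<Union>j<J. Pow (A j) - {{}}) \<union> ({S. S \<subseteq> U \<and> (\<forall>j<J. \<not> S \<subseteq> A j)}). g S)"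
   using finite_U A g by (intro sum.mono_neutral_right) (auto dest: A)
  also have "\<dots> = (\<Sum>S\<in>(\<Union>j<J. Pow (A j) - {{}}). g S) + (\<Sum>S | S \<subseteq> U \<and> (\<forall>j<J. \<not> S \<subseteq> A j). g S)"
   using finite_U by (intro sum.union_disjoint finite_UN_I finite_lessThan) (auto dest: finA)
  also have "(\<Sum>S\<in>(\<Union>j<J. Pow (A j) - {{}}). g S) = (\<Sum>j<J. \<Sum>S\<in>Pow (A j) - {{}}. g S)"
  proof (rule sum.UNION_disjoint)
   show "\<forall>j\<in>{..<J}. finite (Pow (A j) - {{}})" using finA by auto
   show "\<forall>i\<in>{..<J}. \<forall>j\<in>{..<J}. i \<noteq> j \<longrightarrow> (Pow (A i) - {{}}) \<inter> (Pow (A j) - {{}}) = {}"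
    using disj by (fastforce simp: disjoint_family_on_def)
  qed simp
  also have "\<dots> = (\<Sum>j<J. \<Sum>S\<in>Pow (A j). g S)"
   using finA g by (intro sum.cong refl sum.mono_neutral_left) auto
  finally show ?thesis .
 qed
 have VV: "V = (\<Sum>j<J. Vb j) + Voff" unfolding V Voff Vb_def using c0 by (intro split) simp
 have Vb0: "0 \<le> Vb j" if "j < J" for j
  unfolding Vb_def using A[OF that] by (intro sum_nonneg mult_nonneg_nonneg vS) auto
 have Voff0: "0 \<le> Voff" unfolding Voff by (intro sum_nonneg mult_nonneg_nonneg vS) auto
 have diff: "X w - (\<Sum>j<J. Y j w) = mform U c' (\<lambda>u. W u w)" for w
 proof -
  have "X w = (\<Sum>j<J. Y j w) + (\<Sum>S | S \<subseteq> U \<and> (\<forall>j<J. \<not> S \<subseteq> A j). c S * (\<Prod>u\<in>S. W u w))"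
   unfolding X_def Y_def mform_def using c0 by (intro split) simp
  also have "(\<Sum>S | S \<subseteq> U \<and> (\<forall>j<J. \<not> S \<subseteq> A j). c S * (\<Prod>u\<in>S. W u w)) = mform U c' (\<lambda>u. W u w)"
   unfolding mform_def c'_def using finite_U by (intro sum.mono_neutral_cong_left) auto
  finally show ?thesis by simp
 qed
 have Ediff: "integrable M (\<lambda>w. (X w - (\<Sum>j<J. Y j w))^2)" "expectation (\<lambda>w. (X w - (\<Sum>j<J. Y j w))^2) = Voff"
 proof -
  show "integrable M (\<lambda>w. (X w - (\<Sum>j<J. Y j w))^2)"
   unfolding diff using mform_mult_expectation(1)[of U c' c'] by (simp add: power2_eq_square)
  have "expectation (\<lambda>w. (X w - (\<Sum>j<J. Y j w))^2) = (\<Sum>S\<in>Pow U. c' S * c' S * (\<Prod>u\<in>S. v u))"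
   unfolding diff using mform_mult_expectation(2)[of U c' c'] by (simp add: power2_eq_square)
  also have "\<dots> = Voff" unfolding Voff c'_def
   using finite_U by (intro sum.mono_neutral_cong_right) (auto simp: power2_eq_square)
  finally show "expectation (\<lambda>w. (X w - (\<Sum>j<J. Y j w))^2) = Voff" .
 qed
 have step1: "norm (char (distr M borel X) t - char (distr M borel (\<lambda>w. \<Sum>j<J. Y j w)) t) \<le> \<bar>t\<bar> * sqrt Voff"
  using char_diff_le[of X "\<lambda>w. \<Sum>j<J. Y j w" t] Ediff by simp
 have "indep_vars (\<lambda>_. borel) (\<lambda>j w. mform (A j) c (restrict (\<lambda>u. W u w) (A j))) {..<J}"
  by (rule indep_vars_compose2[OF indep_vars_restrict[OF indep_W _ disj]]) (use A in auto)
 then have "indep_vars (\<lambda>_. borel) Y {..<J}" by (simp add: mform_restrict Y_def[abs_def])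
 then have step2: "char (distr M borel (\<lambda>w. \<Sum>j<J. Y j w)) t = (\<Prod>j<J. char (distr M borel (Y j)) t)"
  by (rule char_distr_sum)
 have Y: "norm (char (distr M borel (Y j)) t - exp (- (t^2 * Vb j / 2))) \<le>
   Vb j * lyapunov_error n t \<eta>" if j: "j < J" for j
 proof -
  have EY2: "expectation (\<lambda>w. (Y j w)^2) = Vb j"
   unfolding Y_def Vb_def using mform_mult_expectation(2)[OF A[OF j], of c c] by (simp add: power2_eq_square)
  have EY1: "expectation (Y j) = 0" unfolding Y_def using mform_expectation[OF A[OF j], of c] c0 by simp
  have "integrable M (\<lambda>w. Y j w ^ 4)" "expectation (\<lambda>w. Y j w ^ 4) \<le> 9 ^ n * (Vb j)^2"
   using mform_fourth_moment[OF A[OF j], of n c] cn A[OF j] EY2 unfolding Y_def by auto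
  then have 1: "norm (char (distr M borel (Y j)) t - (1 - t\<^sup>2 * Vb j / 2)) \<le> \<bar>t\<bar> ^ 3 * (Vb j * sqrt \<eta> * (1 + 9 ^ n) / 12)"
   using EY1 EY2 \<eta> j by (intro char_quadratic_approx) (auto simp: Vb_def)
  have "\<bar>exp (- (t^2 * Vb j / 2)) - (1 - t\<^sup>2 * Vb j / 2)\<bar> \<le> (t^2 * Vb j / 2)^2"
   using Vb0[OF j] by (intro exp_minus_quadratic_approx) auto
  also have "\<dots> = t ^ 4 * Vb j * Vb j / 4" by (simp add: power2_eq_square eval_nat_numeral)
  also have "\<dots> \<le> t ^ 4 * Vb j * \<eta> / 4"
   using \<eta>(2)[OF j] Vb0[OF j] by (intro divide_right_mono mult_left_mono) (auto simp: Vb_def)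
  finally have 2: "norm (complex_of_real (exp (- (t^2 * Vb j / 2))) - (1 - t\<^sup>2 * Vb j / 2)) \<le> t ^ 4 * Vb j * \<eta> / 4"
   by (metis norm_of_real of_real_diff of_real_1)
  have "norm (char (distr M borel (Y j)) t - exp (- (t^2 * Vb j / 2))) \<le>
   \<bar>t\<bar> ^ 3 * (Vb j * sqrt \<eta> * (1 + 9 ^ n) / 12) + t ^ 4 * Vb j * \<eta> / 4"
   using norm_triangle_le_diff[OF add_mono[OF 1 2]] by (simp add: algebra_simps)
  then show ?thesis by (simp add: algebra_simps)
 qed
 have "norm ((\<Prod>j<J. char (distr M borel (Y j)) t) - (\<Prod>j<J. complex_of_real (exp (- (t^2 * Vb j / 2))))) \<le>
   (\<Sum>j<J. norm (char (distr M borel (Y j)) t - exp (- (t^2 * Vb j / 2))))"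
 proof (rule norm_prod_diff)
  fix j assume j: "j \<in> {..<J}"
  interpret D: real_distribution "distr M borel (Y j)" using j by (intro real_distribution_distr) auto
  show "norm (char (distr M borel (Y j)) t) \<le> 1" by (rule D.cmod_char_le_1)
  show "norm (complex_of_real (exp (- (t^2 * Vb j / 2)))) \<le> 1" using j Vb0 by (simp del: of_real_exp)
 qed
 also have "\<dots> \<le> (\<Sum>j<J. Vb j * lyapunov_error n t \<eta>)"
  by (intro sum_mono Y) auto
 also have "\<dots> \<le> V * lyapunov_error n t \<eta>"
  unfolding sum_distrib_right[symmetric] using VV Voff0 \<eta>(1)
  by (intro mult_right_mono add_nonneg_nonneg) auto
 finally have step3: "norm ((\<Prod>j<J. char (distr M borel (Y j)) t) - (\<Prod>j<J. complex_of_real (exp (- (t^2 * Vb j / 2))))) \<le>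
  V * lyapunov_error n t \<eta>" .
 have e: "(\<Prod>j<J. complex_of_real (exp (- (t^2 * Vb j / 2)))) = exp (- (t^2 * (\<Sum>j<J. Vb j) / 2))"
  by (simp add: sum_distrib_left sum_divide_distrib exp_sum flip: sum_negf of_real_prod del: of_real_exp)
 have "\<bar>exp (- (t^2 * (\<Sum>j<J. Vb j) / 2)) - exp (- (t^2 * V / 2))\<bar> \<le> t^2 * V / 2 - t\<^sup>2 * (\<Sum>j<J. Vb j) / 2"
  using Vb0 Voff0 VV
  by (intro abs_exp_minus_diff_le) (auto intro!: divide_right_mono mult_left_mono sum_nonneg mult_nonneg_nonneg)
 also have "\<dots> = t^2 * Voff / 2" by (simp add: VV algebra_simps)
 finally have step4: "norm (complex_of_real (exp (- (t^2 * (\<Sum>j<J. Vb j) / 2))) - exp (- (t^2 * V / 2))) \<le> t^2 * Voff / 2"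
  by (metis norm_of_real of_real_diff)
 show ?thesis
  using norm_triangle_le[OF add_mono[OF norm_triangle_le[OF add_mono[OF step1 step3]] step4]]
  unfolding step2 e X_def by simp
qed

section \<open>Elementary integrals\<close>

type_synonym coefficients = "(nat \<Rightarrow> nat) \<Rightarrow> (nat \<Rightarrow> nat) \<Rightarrow> real"

definition is_partition :: "nat \<Rightarrow> (nat \<Rightarrow> real) \<Rightarrow> bool" where
 "is_partition N t \<longleftrightarrow> strict_mono_on {..N} t \<and> t 0 = 0 \<and> t N = 1"

definition offdiagonal :: "nat \<Rightarrow> nat \<Rightarrow> nat \<Rightarrow> coefficients \<Rightarrow> bool" where
 "offdiagonal d n N c \<longleftrightarrow> (\<forall>i\<in>index_tuples n d. \<forall>l\<in>index_tuples n N.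
    (\<exists>a<n. \<exists>b<n. a \<noteq> b \<and> i a = i b \<and> l a = l b) \<longrightarrow> c i l = 0)"

lemma offdiagonalD:
 assumes "offdiagonal d n N c" "i \<in> index_tuples n d" "l \<in> index_tuples n N"
  "a < n" "b < n" "a \<noteq> b" "i a = i b" "l a = l b"
 shows "c i l = 0"
 using assms(1)[unfolded offdiagonal_def, rule_format, OF assms(2,3)] assms(4-8) by metis

definition step_kernel :: "nat \<Rightarrow> nat \<Rightarrow> (nat \<Rightarrow> real) \<Rightarrow> coefficients \<Rightarrow> kernel" where
 "step_kernel n N t c = (\<lambda>i r. \<Sum>l\<in>index_tuples n N. c i l * (\<Prod>a<n. indicator {t (l a)<..t (Suc (l a))} (r a)))"

definition step_form :: "nat \<Rightarrow> (nat \<Rightarrow> real \<Rightarrow> 'w \<Rightarrow> real) \<Rightarrow> nat \<Rightarrow> nat \<Rightarrow> (nat \<Rightarrow> real) \<Rightarrow>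
  coefficients \<Rightarrow> 'w \<Rightarrow> real" where
 "step_form d B n N t c = (\<lambda>w. \<Sum>i\<in>index_tuples n d. \<Sum>l\<in>index_tuples n N.
   c i l * (\<Prod>a<n. B (i a) (t (Suc (l a))) w - B (i a) (t (l a)) w))"

lemma elementary_integral_iff:
 "elementary_integral d B n g Y \<longleftrightarrow>
  (\<exists>N t c. is_partition N t \<and> offdiagonal d n N c \<and> g = step_kernel n N t c \<and> Y = step_form d B n N t c)"
 unfolding elementary_integral_def is_partition_def offdiagonal_def step_kernel_def step_form_def
 by (simp only: conj_assoc)

lemma is_partition_less: "is_partition N t \<Longrightarrow> k < l \<Longrightarrow> l \<le> N \<Longrightarrow> t k < t l"
 unfolding is_partition_def strict_mono_on_def by auto

lemma is_partition_le: "is_partition N t \<Longrightarrow> k \<le> l \<Longrightarrow> l \<le> N \<Longrightarrow> t k \<le> t l"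
 using is_partition_less[of N t k l] by (cases "k = l") auto

lemma is_partition_bounds:
 assumes "is_partition N t" "k \<le> N"
 shows "0 \<le> t k" "t k \<le> 1"
 using is_partition_le[OF assms(1), of 0 k] is_partition_le[OF assms(1), of k N] assms
 by (auto simp: is_partition_def)

subsection \<open>Refinement of partitions\<close>

text \<open>Step kernels and step forms are both values of one multilinear expression in the increments
  of functions: those of \<open>s \<mapsto> 1 (r \<le> s)\<close> and those of the Brownian paths. Refining the partition
  therefore has the same effect on both.\<close>

definition step_sum :: "nat \<Rightarrow> nat \<Rightarrow> (nat \<Rightarrow> real) \<Rightarrow> ((nat \<Rightarrow> nat) \<Rightarrow> real) \<Rightarrow> (nat \<Rightarrow> real \<Rightarrow> real) \<Rightarrow> real" where
 "step_sum n N t c X = (\<Sum>l\<in>index_tuples n N. c l * (\<Prod>a<n. X a (t (Suc (l a))) - X a (t (l a))))"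

lemma step_kernel_eq_step_sum:
 assumes "is_partition N t"
 shows "step_kernel n N t c i r = step_sum n N t (c i) (\<lambda>a s. of_bool (r a \<le> s))"
 unfolding step_kernel_def step_sum_def
proof (intro sum.cong refl arg_cong2[where f="(*)"] prod.cong)
 fix l a assume "l \<in> index_tuples n N" "a \<in> {..<n}"
 then have "l a < N" by auto
 then have "t (l a) \<le> t (Suc (l a))" using assms by (intro is_partition_le) auto
 then show "indicator {t (l a)<..t (Suc (l a))} (r a) = of_bool (r a \<le> t (Suc (l a))) - (of_bool (r a \<le> t (l a)) :: real)"
  by (auto simp: indicator_def)
qed

lemma step_form_eq_step_sum:
 "step_form d B n N t c w = (\<Sum>i\<in>index_tuples n d. step_sum n N t (c i) (\<lambda>a s. B (i a) s w))"
 unfolding step_form_def step_sum_def ..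

text \<open>An increment over a coarse cell is the sum of the increments over the fine cells inside it.\<close>

lemma step_sum_refine:
 assumes t: "is_partition N t" and t': "is_partition N' t'" and sub: "t ` {..N} \<subseteq> t' ` {..N'}"
  and c: "offdiagonal d n N c"
 obtains c' where "offdiagonal d n N' c'" "\<And>i X. step_sum n N' t' (c' i) X = step_sum n N t (c i) X"
proof -
 have "\<forall>l\<in>{..N}. \<exists>k\<in>{..N'}. t' k = t l" using sub by (fastforce simp: image_subset_iff)
 then obtain idx where idx: "\<And>l. l \<le> N \<Longrightarrow> idx l \<le> N'" "\<And>l. l \<le> N \<Longrightarrow> t' (idx l) = t l" by (metis atMost_iff)
 have mono: "idx k \<le> idx l" if "k \<le> l" "l \<le> N" for k l
 proof (rule ccontr)
  assume "\<not> idx k \<le> idx l"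
  then have "t' (idx l) < t' (idx k)" using idx that by (intro is_partition_less[OF t']) auto
  then show False using is_partition_le[OF t that] idx that by simp
 qed
 define w :: "nat \<Rightarrow> nat \<Rightarrow> real" where "w l l' = of_bool (idx l \<le> l' \<and> l' < idx (Suc l))" for l l'
 have w_unique: "l = k" if "w l l' \<noteq> 0" "w k l' \<noteq> 0" "l < N" "k < N" for l k l'
 proof (rule ccontr)
  assume "l \<noteq> k"
  then have "idx (Suc l) \<le> idx k \<or> idx (Suc k) \<le> idx l"
   using that mono[of "Suc l" k] mono[of "Suc k" l] by linarith
  then show False using that by (auto simp: w_def split: if_splits)
 qed
 have tele: "(\<Sum>l'<N'. w l l' * (X (t' (Suc l')) - X (t' l'))) = X (t (Suc l)) - X (t l)" if "l < N" for l and X :: "real \<Rightarrow> real"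
 proof -
  have le: "idx l \<le> idx (Suc l)" "idx (Suc l) \<le> N'" using mono[of l "Suc l"] idx(1)[of "Suc l"] that by auto
  have "(\<Sum>l'<N'. w l l' * (X (t' (Suc l')) - X (t' l'))) = (\<Sum>l'\<in>{idx l..<idx (Suc l)}. X (t' (Suc l')) - X (t' l'))"
   using le by (intro sum.mono_neutral_cong_right) (auto simp: w_def)
  also have "\<dots> = X (t' (idx (Suc l))) - X (t' (idx l))" using le(1) by (intro sum_Suc_diff') auto
  finally show ?thesis using idx(2) that by simp
 qed
 define c' where "c' i l' = (\<Sum>l\<in>index_tuples n N. c i l * (\<Prod>a<n. w (l a) (l' a)))" for i l'
 show thesis
 proof (rule that[of c'])
  show "offdiagonal d n N' c'" unfolding offdiagonal_def
  proof (intro ballI impI)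
   fix i l' assume i: "i \<in> index_tuples n d" and l': "l' \<in> index_tuples n N'"
    and "\<exists>a<n. \<exists>b<n. a \<noteq> b \<and> i a = i b \<and> l' a = l' b"
   then obtain a b where ab: "a < n" "b < n" "a \<noteq> b" "i a = i b" "l' a = l' b" by blast
   show "c' i l' = 0" unfolding c'_def
   proof (rule sum.neutral, rule ballI)
    fix l assume l: "l \<in> index_tuples n N"
    show "c i l * (\<Prod>a<n. w (l a) (l' a)) = 0"
    proof (cases "w (l a) (l' a) \<noteq> 0 \<and> w (l b) (l' b) \<noteq> 0")
     case True
     then have "l a = l b" using l ab w_unique[of "l a" "l' a" "l b"] by (auto simp: PiE_iff)
     then have "c i l = 0" using offdiagonalD[OF c i l ab(1-4)] by simp
     then show ?thesis by simp
    next
     case False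
     then have "\<exists>x\<in>{..<n}. w (l x) (l' x) = 0" using ab(1,2) by blast
     then have "(\<Prod>a<n. w (l a) (l' a)) = 0" by (intro prod_zero finite_lessThan)
     then show ?thesis by simp
    qed
   qed
  qed
  show "step_sum n N' t' (c' i) X = step_sum n N t (c i) X" for i X
  proof -
   have "step_sum n N' t' (c' i) X =
    (\<Sum>l'\<in>index_tuples n N'. \<Sum>l\<in>index_tuples n N. c i l * (\<Prod>a<n. w (l a) (l' a) * (X a (t' (Suc (l' a))) - X a (t' (l' a)))))"
    unfolding step_sum_def c'_def by (simp add: sum_distrib_right prod.distrib mult.assoc)
   also have "\<dots> = (\<Sum>l\<in>index_tuples n N. c i l * (\<Sum>l'\<in>index_tuples n N'. \<Prod>a<n. w (l a) (l' a) * (X a (t' (Suc (l' a))) - X a (t' (l' a)))))"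
    by (subst sum.swap) (simp add: sum_distrib_left)
   also have "\<dots> = (\<Sum>l\<in>index_tuples n N. c i l * (\<Prod>a<n. \<Sum>l'<N'. w (l a) l' * (X a (t' (Suc l')) - X a (t' l'))))"
    by (subst prod_sum_PiE) auto
   also have "\<dots> = step_sum n N t (c i) X"
    unfolding step_sum_def by (intro sum.cong refl arg_cong2[where f="(*)"] prod.cong tele) auto
   finally show ?thesis .
  qed
 qed
qed

lemma partition_of_finite_set:
 assumes "finite F" "F \<subseteq> {0..1}" "0 \<in> F" "(1::real) \<in> F"
 obtains N t where "is_partition N t" "t ` {..N} = F"
proof -
 define xs where "xs = sorted_list_of_set F"
 have xs: "set xs = F" "sorted_wrt (<) xs" using assms(1) by (auto simp: xs_def)
 have ne: "xs \<noteq> []" using xs(1) assms(3) by auto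
 define N where "N = length xs - 1"
 have len: "length xs = Suc N" using ne by (simp add: N_def)
 have sm: "strict_mono_on {..N} (\<lambda>k. xs ! k)"
  using xs(2) len by (auto simp: strict_mono_on_def sorted_wrt_iff_nth_less)
 have im: "(\<lambda>k. xs ! k) ` {..N} = F"
  using xs(1) len by (auto simp: set_conv_nth less_Suc_eq_le)
 have le: "xs ! k \<le> xs ! l" if "k \<le> l" "l \<le> N" for k l
  using strict_mono_onD[OF sm, of k l] that by (cases "k = l") auto
 obtain k0 k1 where k: "k0 \<le> N" "xs ! k0 = 0" "k1 \<le> N" "xs ! k1 = 1" using im assms(3,4) by (metis atMost_iff imageE)
 have "xs ! 0 \<in> {0..1}" "xs ! N \<in> {0..1}" using im assms(2) by auto
 then have "xs ! 0 = 0" "xs ! N = 1" using le[of 0 k0] le[of k1 N] k by auto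
 then have "is_partition N (\<lambda>k. xs ! k)" using sm by (simp add: is_partition_def)
 then show thesis using im that by blast
qed

lemma common_refinement:
 assumes "is_partition N t" "is_partition N' t'" "finite F" "F \<subseteq> {0..1}"
 obtains N'' t'' where "is_partition N'' t''" "t ` {..N} \<subseteq> t'' ` {..N''}" "t' ` {..N'} \<subseteq> t'' ` {..N''}" "F \<subseteq> t'' ` {..N''}"
proof (rule partition_of_finite_set[of "t ` {..N} \<union> t' ` {..N'} \<union> F"])
 show "t ` {..N} \<union> t' ` {..N'} \<union> F \<subseteq> {0..1}"
  using is_partition_bounds[OF assms(1)] is_partition_bounds[OF assms(2)] assms(4) by auto
 show "0 \<in> t ` {..N} \<union> t' ` {..N'} \<union> F" using assms(1) by (force simp: is_partition_def)
 show "1 \<in> t ` {..N} \<union> t' ` {..N'} \<union> F" using assms(1) by (force simp: is_partition_def)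
 fix N'' t'' assume "is_partition N'' t''" "t'' ` {..N''} = t ` {..N} \<union> t' ` {..N'} \<union> F"
 then show thesis by (intro that) auto
qed (use assms in auto)

lemma step_refine:
 assumes t: "is_partition N t" and t': "is_partition N' t'" and sub: "t ` {..N} \<subseteq> t' ` {..N'}"
  and c: "offdiagonal d n N c"
 obtains c' where "offdiagonal d n N' c'" "step_kernel n N' t' c' = step_kernel n N t c"
  "step_form d B n N' t' c' = step_form d B n N t c"
proof -
 obtain c' where c': "offdiagonal d n N' c'" "\<And>i X. step_sum n N' t' (c' i) X = step_sum n N t (c i) X"
  by (rule step_sum_refine[OF t t' sub c]) blast
 show thesis
 proof (rule that[OF c'(1)])
  show "step_kernel n N' t' c' = step_kernel n N t c"
   by (intro ext) (simp only: step_kernel_eq_step_sum[OF t] step_kernel_eq_step_sum[OF t'] c'(2))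
  show "step_form d B n N' t' c' = step_form d B n N t c"
   by (intro ext) (simp only: step_form_eq_step_sum c'(2))
 qed
qed

lemma elementary_integral_refine:
 assumes "elementary_integral d B n g Y" "finite F" "F \<subseteq> {0..1}"
 obtains N t c where "is_partition N t" "F \<subseteq> t ` {..N}" "offdiagonal d n N c"
  "g = step_kernel n N t c" "Y = step_form d B n N t c"
proof -
 obtain N t c where 1: "is_partition N t" "offdiagonal d n N c" "g = step_kernel n N t c" "Y = step_form d B n N t c"
  using assms(1) unfolding elementary_integral_iff by blast
 obtain N' t' where 2: "is_partition N' t'" "t ` {..N} \<subseteq> t' ` {..N'}" "F \<subseteq> t' ` {..N'}"
  by (rule common_refinement[OF 1(1) 1(1) assms(2,3)])
 obtain c' where 3: "offdiagonal d n N' c'" "step_kernel n N' t' c' = step_kernel n N t c"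
  "step_form d B n N' t' c' = step_form d B n N t c" by (rule step_refine[OF 1(1) 2(1,2) 1(2)])
 show thesis by (rule that[OF 2(1) 2(3) 3(1)]) (simp_all add: 1 3)
qed

lemma elementary_integral_common:
 assumes "elementary_integral d B n g Y" "elementary_integral d B n' g' Y'"
 obtains N t c c' where "is_partition N t" "offdiagonal d n N c" "offdiagonal d n' N c'"
  "g = step_kernel n N t c" "Y = step_form d B n N t c" "g' = step_kernel n' N t c'" "Y' = step_form d B n' N t c'"
proof -
 obtain N t c where 1: "is_partition N t" "offdiagonal d n N c" "g = step_kernel n N t c" "Y = step_form d B n N t c"
  using assms(1) unfolding elementary_integral_iff by blast
 obtain N' t' c' where 2: "is_partition N' t'" "offdiagonal d n' N' c'" "g' = step_kernel n' N' t' c'" "Y' = step_form d B n' N' t' c'"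
  using assms(2) unfolding elementary_integral_iff by blast
 obtain M s where 3: "is_partition M s" "t ` {..N} \<subseteq> s ` {..M}" "t' ` {..N'} \<subseteq> s ` {..M}"
  by (rule common_refinement[OF 1(1) 2(1) finite.emptyI empty_subsetI])
 obtain b where 4: "offdiagonal d n M b" "step_kernel n M s b = step_kernel n N t c"
  "step_form d B n M s b = step_form d B n N t c" by (rule step_refine[OF 1(1) 3(1,2) 1(2)])
 obtain b' where 5: "offdiagonal d n' M b'" "step_kernel n' M s b' = step_kernel n' N' t' c'"
  "step_form d B n' M s b' = step_form d B n' N' t' c'" by (rule step_refine[OF 2(1) 3(1,3) 2(2)])
 show thesis by (rule that[OF 3(1) 4(1) 5(1)]) (simp_all add: 1 2 4 5)
qed

lemma elementary_integral_diff:
 assumes "elementary_integral d B n g Y" "elementary_integral d B n g' Y'"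
 shows "elementary_integral d B n (\<lambda>i r. g i r - g' i r) (\<lambda>w. Y w - Y' w)"
proof -
 obtain N t c c' where 1: "is_partition N t" "offdiagonal d n N c" "offdiagonal d n N c'"
  "g = step_kernel n N t c" "Y = step_form d B n N t c" "g' = step_kernel n N t c'" "Y' = step_form d B n N t c'"
  by (rule elementary_integral_common[OF assms])
 show ?thesis unfolding elementary_integral_iff
 proof (intro exI[of _ N] exI[of _ t] exI[of _ "\<lambda>i l. c i l - c' i l"] conjI)
  show "offdiagonal d n N (\<lambda>i l. c i l - c' i l)" unfolding offdiagonal_def
  proof (intro ballI impI)
   fix i l assume il: "i \<in> index_tuples n d" "l \<in> index_tuples n N"
    and "\<exists>a<n. \<exists>b<n. a \<noteq> b \<and> i a = i b \<and> l a = l b"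
   then obtain a b where ab: "a < n" "b < n" "a \<noteq> b" "i a = i b" "l a = l b" by blast
   show "c i l - c' i l = 0" using offdiagonalD[OF 1(2) il ab] offdiagonalD[OF 1(3) il ab] by simp
  qed
  show "(\<lambda>i r. g i r - g' i r) = step_kernel n N t (\<lambda>i l. c i l - c' i l)"
   unfolding 1 step_kernel_def by (simp add: left_diff_distrib sum_subtractf)
  show "(\<lambda>w. Y w - Y' w) = step_form d B n N t (\<lambda>i l. c i l - c' i l)"
   unfolding 1 step_form_def by (simp add: left_diff_distrib sum_subtractf)
 qed fact
qed

subsection \<open>Step kernels\<close>

abbreviation unit_interval :: "real measure" where
 "unit_interval \<equiv> restrict_space lborel {0..1}"

lemma space_unit_cube: "space (unit_cube n) = {..<n} \<rightarrow>\<^sub>E {0..1}"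
 by (simp add: space_PiM)

lemma prob_space_unit_interval: "prob_space unit_interval"
 by (rule prob_spaceI) (simp add: emeasure_restrict_space)

lemma prob_space_unit_cube: "prob_space (unit_cube n)"
 by (intro prob_space_PiM prob_space_unit_interval)

lemma product_sigma_finite_unit: "product_sigma_finite (\<lambda>_. unit_interval)"
 unfolding product_sigma_finite_def by (intro allI prob_space_imp_sigma_finite prob_space_unit_interval)

lemma integral_prod_indicator_unit_cube:
 assumes "\<And>a. a < n \<Longrightarrow> 0 \<le> p a" "\<And>a. a < n \<Longrightarrow> p a \<le> q a" "\<And>a. a < n \<Longrightarrow> q a \<le> 1"
 shows "(\<integral>r. (\<Prod>a<n. indicator {p a<..q a} (r a)) \<partial>unit_cube n) = (\<Prod>a<n. q a - p a)"
  and "integrable (unit_cube n) (\<lambda>r. \<Prod>a<n. indicator {p a<..q a} (r a) :: real)"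
proof -
 interpret product_sigma_finite "\<lambda>_. unit_interval" by (rule product_sigma_finite_unit)
 interpret P: prob_space "unit_interval" by (rule prob_space_unit_interval)
 have sub: "{p a<..q a} \<in> sets unit_interval" if "a < n" for a
 proof -
  have "{p a<..q a} \<subseteq> {0..1}" using assms(1)[OF that] assms(3)[OF that] by force
  then show ?thesis by (subst sets_restrict_space_iff) auto
 qed
 have 1: "integrable unit_interval (indicator {p a<..q a} :: real \<Rightarrow> real)" if "a < n" for a
  using sub[OF that] by (simp add: P.emeasure_eq_measure integrable_real_indicator)
 have "(\<integral>r. (\<Prod>a<n. indicator {p a<..q a} (r a) :: real) \<partial>unit_cube n) =
   (\<Prod>a<n. \<integral>x. indicator {p a<..q a} x \<partial>unit_interval)"
  by (rule product_integral_prod[of "{..<n}" "\<lambda>a. indicator {p a<..q a} :: real \<Rightarrow> real"]) (use 1 in auto)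
 also have "\<dots> = (\<Prod>a<n. q a - p a)"
 proof (rule prod.cong[OF refl])
  fix a assume "a \<in> {..<n}"
  then have a: "a < n" by simp
  have s: "{p a<..q a} \<subseteq> {0..1}" using assms(1)[OF a] assms(3)[OF a] by force
  have "(\<integral>x. indicator {p a<..q a} x \<partial>unit_interval) = measure unit_interval {p a<..q a}"
   using sub[OF a] s by (simp add: Int_absorb2)
  also have "\<dots> = q a - p a" using s assms(2)[OF a] by (subst measure_restrict_space) auto
  finally show "(\<integral>x. indicator {p a<..q a} x \<partial>unit_interval) = q a - p a" .
 qed
 finally show "(\<integral>r. (\<Prod>a<n. indicator {p a<..q a} (r a)) \<partial>unit_cube n) = (\<Prod>a<n. q a - p a)" .
 show "integrable (unit_cube n) (\<lambda>r. \<Prod>a<n. indicator {p a<..q a} (r a) :: real)"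
  by (rule product_integrable_prod[of "{..<n}" "\<lambda>a. indicator {p a<..q a} :: real \<Rightarrow> real"]) (use 1 in auto)
qed

definition kernel_ip :: "nat \<Rightarrow> nat \<Rightarrow> kernel \<Rightarrow> kernel \<Rightarrow> real" where
 "kernel_ip d n f g = (\<Sum>i\<in>index_tuples n d. \<integral>r. f i r * g i r \<partial>unit_cube n)"

lemma cell_unique:
 assumes "is_partition N t" "k < N" "l < N" "x \<in> {t k<..t (Suc k)}" "x \<in> {t l<..t (Suc l)}"
 shows "k = l"
proof (rule ccontr)
 assume "k \<noteq> l"
 then consider "Suc k \<le> l" | "Suc l \<le> k" by linarith
 then show False
 proof cases
  case 1
  then have "t (Suc k) \<le> t l" using is_partition_le[OF assms(1)] assms(3) by simp
  then show ?thesis using assms(4,5) by simp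
 next
  case 2
  then have "t (Suc l) \<le> t k" using is_partition_le[OF assms(1)] assms(2) by simp
  then show ?thesis using assms(4,5) by simp
 qed
qed

lemma step_kernel_value:
 assumes t: "is_partition N t" and l: "l \<in> index_tuples n N" and r: "\<And>a. a < n \<Longrightarrow> r a \<in> {t (l a)<..t (Suc (l a))}"
 shows "step_kernel n N t c i r = c i l"
proof -
 have "step_kernel n N t c i r = (\<Sum>l'\<in>index_tuples n N. if l' = l then c i l else 0)"
  unfolding step_kernel_def
 proof (rule sum.cong[OF refl])
  fix l' assume l': "l' \<in> index_tuples n N"
  show "c i l' * (\<Prod>a<n. indicator {t (l' a)<..t (Suc (l' a))} (r a)) = (if l' = l then c i l else 0)"
  proof (cases "l' = l")
   case True
   then show ?thesis using r by (simp add: indicator_def)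
  next
   case False
   then obtain a where a: "a < n" "l' a \<noteq> l a" using PiE_ext[OF l' l] by auto
   then have "r a \<notin> {t (l' a)<..t (Suc (l' a))}"
    using cell_unique[OF t, of "l' a" "l a" "r a"] r[of a] l l' by auto
   then have "(\<Prod>a<n. indicator {t (l' a)<..t (Suc (l' a))} (r a) :: real) = 0"
    using a(1) by (intro prod_zero bexI[of _ a]) auto
   then show ?thesis using False by simp
  qed
 qed
 also have "\<dots> = c i l" using l by (simp add: finite_PiE)
 finally show ?thesis .
qed

lemma step_kernel_zero:
 assumes r: "\<And>l. l \<in> index_tuples n N \<Longrightarrow> \<exists>a<n. r a \<notin> {t (l a)<..t (Suc (l a))}"
 shows "step_kernel n N t c i r = 0"
 unfolding step_kernel_def
proof (rule sum.neutral, rule ballI)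
 fix l assume "l \<in> index_tuples n N"
 then obtain a where "a < n" "r a \<notin> {t (l a)<..t (Suc (l a))}" using r by blast
 then have "(\<Prod>a<n. indicator {t (l a)<..t (Suc (l a))} (r a) :: real) = 0" by (intro prod_zero bexI[of _ a]) auto
 then show "c i l * (\<Prod>a<n. indicator {t (l a)<..t (Suc (l a))} (r a)) = 0" by simp
qed

lemma step_kernel_mult:
 assumes t: "is_partition N t"
 shows "step_kernel n N t c i r * step_kernel n N t c' i r = step_kernel n N t (\<lambda>i l. c i l * c' i l) i r"
proof (cases "\<exists>l\<in>index_tuples n N. \<forall>a<n. r a \<in> {t (l a)<..t (Suc (l a))}")
 case True
 then show ?thesis using step_kernel_value[OF t] by auto
next
 case False
 then show ?thesis by (subst (1 2 3) step_kernel_zero) auto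
qed

lemma step_kernel_integral:
 assumes t: "is_partition N t"
 shows "integrable (unit_cube n) (step_kernel n N t c i)"
  and "(\<integral>r. step_kernel n N t c i r \<partial>unit_cube n) = (\<Sum>l\<in>index_tuples n N. c i l * (\<Prod>a<n. t (Suc (l a)) - t (l a)))"
proof -
 have b: "0 \<le> t (l a)" "t (l a) \<le> t (Suc (l a))" "t (Suc (l a)) \<le> 1" if "l \<in> index_tuples n N" "a < n" for l a
  using that is_partition_bounds[OF t, of "l a"] is_partition_bounds[OF t, of "Suc (l a)"] is_partition_le[OF t, of "l a" "Suc (l a)"]
  by (auto simp: PiE_iff less_imp_le Suc_le_eq)
 show "integrable (unit_cube n) (step_kernel n N t c i)"
  unfolding step_kernel_def using b
  by (intro Bochner_Integration.integrable_sum integrable_mult_right integral_prod_indicator_unit_cube(2)) auto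
 show "(\<integral>r. step_kernel n N t c i r \<partial>unit_cube n) = (\<Sum>l\<in>index_tuples n N. c i l * (\<Prod>a<n. t (Suc (l a)) - t (l a)))"
  unfolding step_kernel_def using b
  by (subst Bochner_Integration.integral_sum)
    (auto intro!: integrable_mult_right integral_prod_indicator_unit_cube sum.cong simp: integral_prod_indicator_unit_cube)
qed

lemma step_kernel_ip:
 assumes "is_partition N t"
 shows "kernel_ip d n (step_kernel n N t c) (step_kernel n N t c') =
  (\<Sum>i\<in>index_tuples n d. \<Sum>l\<in>index_tuples n N. c i l * c' i l * (\<Prod>a<n. t (Suc (l a)) - t (l a)))"
 unfolding kernel_ip_def step_kernel_mult[OF assms] by (simp add: step_kernel_integral[OF assms])

definition symmetric_kernel :: "nat \<Rightarrow> nat \<Rightarrow> kernel \<Rightarrow> bool" where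
 "symmetric_kernel d n f \<longleftrightarrow> (\<forall>\<pi>. \<pi> permutes {..<n} \<longrightarrow>
   (\<forall>i\<in>index_tuples n d. \<forall>r\<in>space (unit_cube n). f (i \<circ> \<pi>) (r \<circ> \<pi>) = f i r))"

lemma PiE_permutes:
 assumes "\<pi> permutes {..<n}" "x \<in> {..<n} \<rightarrow>\<^sub>E (A :: 'a set)"
 shows "x \<circ> \<pi> \<in> {..<n} \<rightarrow>\<^sub>E A"
 using assms permutes_in_image[OF assms(1)] by (auto simp: PiE_iff extensional_def permutes_not_in)

text \<open>The coefficients of a step kernel are its values at the right endpoints of the cells.\<close>

lemma symmetric_step_kernel_coeff:
 assumes t: "is_partition N t" and s: "symmetric_kernel d n (step_kernel n N t c)"
  and p: "\<pi> permutes {..<n}" and i: "i \<in> index_tuples n d" and l: "l \<in> index_tuples n N"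
 shows "c (i \<circ> \<pi>) (l \<circ> \<pi>) = c i l"
proof -
 define r where "r = (\<lambda>a\<in>{..<n}. t (Suc (l a)))"
 have lN: "l a < N" if "a < n" for a using l that by auto
 have r: "r \<in> space (unit_cube n)"
  using is_partition_bounds[OF t, of "Suc (l a)" for a] lN by (auto simp: space_unit_cube r_def Suc_le_eq)
 have 1: "step_kernel n N t c i r = c i l"
  using lN is_partition_less[OF t, of "l a" "Suc (l a)" for a] by (intro step_kernel_value t l) (auto simp: r_def Suc_le_eq)
 have 2: "step_kernel n N t c (i \<circ> \<pi>) (r \<circ> \<pi>) = c (i \<circ> \<pi>) (l \<circ> \<pi>)"
  using lN is_partition_less[OF t, of "l a" "Suc (l a)" for a] permutes_in_image[OF p]
  by (intro step_kernel_value t PiE_permutes[OF p l]) (auto simp: r_def Suc_le_eq)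
 show ?thesis using s p i r 1 2 unfolding symmetric_kernel_def by metis
qed

subsection \<open>The isometry\<close>

definition pair_image :: "nat \<Rightarrow> (nat \<Rightarrow> nat) \<Rightarrow> (nat \<Rightarrow> nat) \<Rightarrow> (nat \<times> nat) set" where
 "pair_image n i l = (\<lambda>a. (i a, l a)) ` {..<n}"

abbreviation increment :: "(nat \<Rightarrow> real \<Rightarrow> 'w \<Rightarrow> real) \<Rightarrow> (nat \<Rightarrow> real) \<Rightarrow> nat \<times> nat \<Rightarrow> 'w \<Rightarrow> real" where
 "increment B t u w \<equiv> B (fst u) (t (Suc (snd u))) w - B (fst u) (t (snd u)) w"

abbreviation cell_volume :: "(nat \<Rightarrow> real) \<Rightarrow> (nat \<times> nat) set \<Rightarrow> real" where
 "cell_volume t S \<equiv> \<Prod>u\<in>S. t (Suc (snd u)) - t (snd u)"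

text \<open>A pair \<open>(i, l)\<close> lists \<open>n\<close> cells in some order. The increments over these cells enter a step form
  through their product only, so that the coefficient of a set \<open>S\<close> of cells in the multilinear form is
  the sum of \<open>c\<close> over all listings of \<open>S\<close>.\<close>

definition fibre :: "nat \<Rightarrow> nat \<Rightarrow> nat \<Rightarrow> (nat \<times> nat) set \<Rightarrow> ((nat \<Rightarrow> nat) \<times> (nat \<Rightarrow> nat)) set" where
 "fibre d n N S = {(i, l). i \<in> index_tuples n d \<and> l \<in> index_tuples n N \<and>
   inj_on (\<lambda>a. (i a, l a)) {..<n} \<and> pair_image n i l = S}"

text \<open>Two listings of the same set differ by a permutation of the positions.\<close>

lemma bij_betw_permutations_fibre:
 assumes "(i, l) \<in> fibre d n N S"
 shows "bij_betw (\<lambda>\<pi>. (i \<circ> \<pi>, l \<circ> \<pi>)) {\<pi>. \<pi> permutes {..<n}} (fibre d n N S)"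
proof -
 define z where "z a = (i a, l a)" for a
 have il: "i \<in> index_tuples n d" "l \<in> index_tuples n N" "inj_on z {..<n}" "z ` {..<n} = S"
  using assms by (auto simp: fibre_def z_def[abs_def] pair_image_def)
 show ?thesis unfolding bij_betw_def
 proof
  show "inj_on (\<lambda>\<pi>. (i \<circ> \<pi>, l \<circ> \<pi>)) {\<pi>. \<pi> permutes {..<n}}"
  proof (rule inj_onI, rule ext)
   fix \<pi> \<rho> a assume p: "\<pi> \<in> {\<pi>. \<pi> permutes {..<n}}" "\<rho> \<in> {\<pi>. \<pi> permutes {..<n}}"
    and eq: "(i \<circ> \<pi>, l \<circ> \<pi>) = (i \<circ> \<rho>, l \<circ> \<rho>)"
   show "\<pi> a = \<rho> a"
   proof (cases "a < n")
    case True
    have "z (\<pi> a) = z (\<rho> a)" using eq by (auto simp: z_def fun_eq_iff)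
    then show ?thesis using inj_onD[OF il(3)] True p permutes_in_image[of _ "{..<n}" a] by (metis lessThan_iff mem_Collect_eq)
   next
    case False
    then show ?thesis using p by (auto simp: permutes_not_in)
   qed
  qed
  show "(\<lambda>\<pi>. (i \<circ> \<pi>, l \<circ> \<pi>)) ` {\<pi>. \<pi> permutes {..<n}} = fibre d n N S"
  proof
   show "(\<lambda>\<pi>. (i \<circ> \<pi>, l \<circ> \<pi>)) ` {\<pi>. \<pi> permutes {..<n}} \<subseteq> fibre d n N S"
   proof clarify
    fix \<pi> assume p: "\<pi> permutes {..<n}"
    have e: "(\<lambda>a. ((i \<circ> \<pi>) a, (l \<circ> \<pi>) a)) = z \<circ> \<pi>" by (auto simp: z_def)
    have "inj_on (z \<circ> \<pi>) {..<n}"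
     using p il(3) by (intro comp_inj_on) (auto simp: permutes_image permutes_inj_on)
    moreover have "(z \<circ> \<pi>) ` {..<n} = S" using il(4) permutes_image[OF p] by (metis image_comp)
    ultimately show "(i \<circ> \<pi>, l \<circ> \<pi>) \<in> fibre d n N S"
     using PiE_permutes[OF p il(1)] PiE_permutes[OF p il(2)]
     unfolding fibre_def pair_image_def by (auto simp: o_def z_def)
   qed
   show "fibre d n N S \<subseteq> (\<lambda>\<pi>. (i \<circ> \<pi>, l \<circ> \<pi>)) ` {\<pi>. \<pi> permutes {..<n}}"
   proof clarify
    fix i' l' assume f: "(i', l') \<in> fibre d n N S"
    define z' where "z' a = (i' a, l' a)" for a
    have il': "i' \<in> index_tuples n d" "l' \<in> index_tuples n N" "inj_on z' {..<n}" "z' ` {..<n} = S"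
     using f by (auto simp: fibre_def z'_def[abs_def] pair_image_def)
    define \<pi> where "\<pi> a = (if a < n then inv_into {..<n} z (z' a) else a)" for a
    have z\<pi>: "z (\<pi> a) = z' a" if "a < n" for a
     using f_inv_into_f[of "z' a" z "{..<n}"] il(4) il'(4) that by (auto simp: \<pi>_def)
    have "bij_betw (inv_into {..<n} z \<circ> z') {..<n} {..<n}"
     using il il' by (intro bij_betw_trans[of z' _ S] bij_betw_inv_into) (auto simp: bij_betw_def)
    then have "bij_betw \<pi> {..<n} {..<n}"
     by (rule bij_betw_cong[THEN iffD1, rotated]) (auto simp: \<pi>_def)
    then have p: "\<pi> permutes {..<n}" by (rule bij_imp_permutes) (auto simp: \<pi>_def)
    have "i \<circ> \<pi> = i'" by (rule PiE_ext[OF PiE_permutes[OF p il(1)] il'(1)]) (use z\<pi> in \<open>auto simp: z_def z'_def\<close>)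
    moreover have "l \<circ> \<pi> = l'" by (rule PiE_ext[OF PiE_permutes[OF p il(2)] il'(2)]) (use z\<pi> in \<open>auto simp: z_def z'_def\<close>)
    ultimately show "(i', l') \<in> (\<lambda>\<pi>. (i \<circ> \<pi>, l \<circ> \<pi>)) ` {\<pi>. \<pi> permutes {..<n}}" using p by auto
   qed
  qed
 qed
qed

lemma card_fibre_le: "card (fibre d n N S) \<le> fact n"
proof (cases "fibre d n N S = {}")
 case False
 then obtain i l where "(i, l) \<in> fibre d n N S" by auto
 then have "card (fibre d n N S) = card {\<pi>. \<pi> permutes {..<n}}"
  using bij_betw_same_card[OF bij_betw_permutations_fibre] by metis
 then show ?thesis by (simp add: card_permutations)
qed simp

definition fibre_sum :: "nat \<Rightarrow> nat \<Rightarrow> nat \<Rightarrow> coefficients \<Rightarrow> (nat \<times> nat) set \<Rightarrow> real" where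
 "fibre_sum d n N c S = (\<Sum>(i, l)\<in>fibre d n N S. c i l)"

lemma fibre_sum_zero:
 assumes "card S \<noteq> n"
 shows "fibre_sum d n N c S = 0"
proof -
 have "card S = n" if "(i, l) \<in> fibre d n N S" for i l
  using that card_image[of "\<lambda>a. (i a, l a)" "{..<n}"] by (simp add: fibre_def pair_image_def)
 then have "fibre d n N S = {}" using assms by fastforce
 then show ?thesis by (simp add: fibre_sum_def)
qed

lemma fibre_sum_symmetric:
 assumes "\<And>\<pi> i l. \<pi> permutes {..<n} \<Longrightarrow> i \<in> index_tuples n d \<Longrightarrow> l \<in> index_tuples n N \<Longrightarrow> c (i \<circ> \<pi>) (l \<circ> \<pi>) = c i l"
  and f: "(i, l) \<in> fibre d n N S"
 shows "fibre_sum d n N c S = fact n * c i l"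
proof -
 have il: "i \<in> index_tuples n d" "l \<in> index_tuples n N" using f by (auto simp: fibre_def)
 have "fibre_sum d n N c S = (\<Sum>\<pi> | \<pi> permutes {..<n}. c (i \<circ> \<pi>) (l \<circ> \<pi>))"
  unfolding fibre_sum_def by (subst sum.reindex_bij_betw[OF bij_betw_permutations_fibre[OF f], symmetric]) simp
 also have "\<dots> = (\<Sum>\<pi> | \<pi> permutes {..<n}. c i l)" using assms(1) il by (intro sum.cong) auto
 also have "\<dots> = fact n * c i l" by (simp add: card_permutations)
 finally show ?thesis .
qed

lemma sum_over_fibres:
 fixes g :: "(nat \<Rightarrow> nat) \<Rightarrow> (nat \<Rightarrow> nat) \<Rightarrow> real"
 assumes "\<And>i l. i \<in> index_tuples n d \<Longrightarrow> l \<in> index_tuples n N \<Longrightarrow> \<not> inj_on (\<lambda>a. (i a, l a)) {..<n} \<Longrightarrow> g i l = 0"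
 shows "(\<Sum>i\<in>index_tuples n d. \<Sum>l\<in>index_tuples n N. g i l) = (\<Sum>S\<in>Pow ({..<d} \<times> {..<N}). \<Sum>(i, l)\<in>fibre d n N S. g i l)"
proof -
 let ?Z = "{(i, l). i \<in> index_tuples n d \<and> l \<in> index_tuples n N \<and> inj_on (\<lambda>a. (i a, l a)) {..<n}}"
 have fin: "finite ?Z" by (rule finite_subset[of _ "index_tuples n d \<times> index_tuples n N"]) (auto simp: finite_PiE)
 have "(\<Sum>i\<in>index_tuples n d. \<Sum>l\<in>index_tuples n N. g i l) = (\<Sum>(i, l)\<in>index_tuples n d \<times> index_tuples n N. g i l)"
  by (simp add: sum.cartesian_product)
 also have "\<dots> = (\<Sum>(i, l)\<in>?Z. g i l)"
  using assms by (intro sum.mono_neutral_right) (auto simp: finite_PiE)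
 also have "\<dots> = (\<Sum>S\<in>Pow ({..<d} \<times> {..<N}). \<Sum>z\<in>{z \<in> ?Z. pair_image n (fst z) (snd z) = S}. case z of (i, l) \<Rightarrow> g i l)"
  by (rule sum.group[symmetric]) (use fin in \<open>auto simp: pair_image_def PiE_iff\<close>)
 also have "\<dots> = (\<Sum>S\<in>Pow ({..<d} \<times> {..<N}). \<Sum>(i, l)\<in>fibre d n N S. g i l)"
  by (intro sum.cong) (auto simp: fibre_def)
 finally show ?thesis .
qed

lemma offdiagonal_not_inj:
 assumes "offdiagonal d n N c" "i \<in> index_tuples n d" "l \<in> index_tuples n N" "\<not> inj_on (\<lambda>a. (i a, l a)) {..<n}"
 shows "c i l = 0"
proof -
 obtain a b where "a < n" "b < n" "a \<noteq> b" "i a = i b" "l a = l b" using assms(4) by (auto simp: inj_on_def)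
 then show ?thesis by (rule offdiagonalD[OF assms(1-3)])
qed

lemma step_form_eq_mform:
 assumes "offdiagonal d n N c"
 shows "step_form d B n N t c w = mform ({..<d} \<times> {..<N}) (fibre_sum d n N c) (\<lambda>u. increment B t u w)"
proof -
 let ?W = "\<lambda>u. increment B t u w"
 have "step_form d B n N t c w = (\<Sum>S\<in>Pow ({..<d} \<times> {..<N}). \<Sum>(i, l)\<in>fibre d n N S. c i l * (\<Prod>a<n. ?W (i a, l a)))"
  unfolding step_form_def using offdiagonal_not_inj[OF assms] by (subst sum_over_fibres) auto
 also have "\<dots> = (\<Sum>S\<in>Pow ({..<d} \<times> {..<N}). \<Sum>(i, l)\<in>fibre d n N S. c i l * (\<Prod>u\<in>S. ?W u))"
 proof (intro sum.cong refl, clarify)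
  fix S i l assume "(i, l) \<in> fibre d n N S"
  then have "inj_on (\<lambda>a. (i a, l a)) {..<n}" "S = (\<lambda>a. (i a, l a)) ` {..<n}" by (auto simp: fibre_def pair_image_def)
  then show "c i l * (\<Prod>a<n. ?W (i a, l a)) = c i l * (\<Prod>u\<in>S. ?W u)" by (simp add: prod.reindex)
 qed
 also have "\<dots> = mform ({..<d} \<times> {..<N}) (fibre_sum d n N c) ?W"
  unfolding mform_def fibre_sum_def by (intro sum.cong refl) (simp add: sum_distrib_right case_prod_beta)
 finally show ?thesis .
qed

lemma fibre_sum_mult:
 assumes sym: "\<And>\<pi> i l. \<pi> permutes {..<n} \<Longrightarrow> i \<in> index_tuples n d \<Longrightarrow> l \<in> index_tuples n N \<Longrightarrow> c (i \<circ> \<pi>) (l \<circ> \<pi>) = c i l"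
  and off: "offdiagonal d n N c'"
 shows "(\<Sum>S\<in>Pow ({..<d} \<times> {..<N}). fibre_sum d n N c S * fibre_sum d n N c' S * cell_volume t S) =
  fact n * (\<Sum>i\<in>index_tuples n d. \<Sum>l\<in>index_tuples n N. c i l * c' i l * (\<Prod>a<n. t (Suc (l a)) - t (l a)))"
proof -
 have "(\<Sum>i\<in>index_tuples n d. \<Sum>l\<in>index_tuples n N. c i l * c' i l * (\<Prod>a<n. t (Suc (l a)) - t (l a))) =
  (\<Sum>S\<in>Pow ({..<d} \<times> {..<N}). \<Sum>(i, l)\<in>fibre d n N S. c i l * c' i l * (\<Prod>a<n. t (Suc (l a)) - t (l a)))"
  using offdiagonal_not_inj[OF off] by (subst sum_over_fibres) auto
 moreover have "fact n * (\<Sum>(i, l)\<in>fibre d n N S. c i l * c' i l * (\<Prod>a<n. t (Suc (l a)) - t (l a))) =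
   fibre_sum d n N c S * fibre_sum d n N c' S * cell_volume t S" for S
 proof -
  have "(fibre_sum d n N c S * cell_volume t S) * fibre_sum d n N c' S =
   (\<Sum>(i, l)\<in>fibre d n N S. (fibre_sum d n N c S * cell_volume t S) * c' i l)"
   unfolding fibre_sum_def[of d n N c'] by (simp add: sum_distrib_left case_prod_beta)
  also have "\<dots> = (\<Sum>(i, l)\<in>fibre d n N S. fact n * (c i l * c' i l * (\<Prod>a<n. t (Suc (l a)) - t (l a))))"
  proof (rule sum.cong[OF refl], clarify)
   fix i l assume f: "(i, l) \<in> fibre d n N S"
   then have "inj_on (\<lambda>a. (i a, l a)) {..<n}" "S = (\<lambda>a. (i a, l a)) ` {..<n}" by (auto simp: fibre_def pair_image_def)
   then have "cell_volume t S = (\<Prod>a<n. t (Suc (l a)) - t (l a))" by (simp add: prod.reindex)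
   then show "(fibre_sum d n N c S * cell_volume t S) * c' i l =
     fact n * (c i l * c' i l * (\<Prod>a<n. t (Suc (l a)) - t (l a)))"
    using fibre_sum_symmetric[of n d N c i l S, OF sym f] by simp
  qed
  finally show ?thesis by (simp add: sum_distrib_left case_prod_beta algebra_simps)
 qed
 ultimately show ?thesis by (simp add: sum_distrib_left)
qed

text \<open>Without symmetry of the coefficients there remains an inequality, by the Cauchy-Schwarz inequality on the fibres.\<close>

lemma fibre_sum_sq_le:
 assumes t: "is_partition N t" and off: "offdiagonal d n N c"
 shows "(\<Sum>S\<in>Pow ({..<d} \<times> {..<N}). (fibre_sum d n N c S)^2 * cell_volume t S) \<le>
  fact n * (\<Sum>i\<in>index_tuples n d. \<Sum>l\<in>index_tuples n N. (c i l)^2 * (\<Prod>a<n. t (Suc (l a)) - t (l a)))"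
proof -
 have eq: "(\<Sum>i\<in>index_tuples n d. \<Sum>l\<in>index_tuples n N. (c i l)^2 * (\<Prod>a<n. t (Suc (l a)) - t (l a))) =
  (\<Sum>S\<in>Pow ({..<d} \<times> {..<N}). \<Sum>(i, l)\<in>fibre d n N S. (c i l)^2 * (\<Prod>a<n. t (Suc (l a)) - t (l a)))"
  using offdiagonal_not_inj[OF off] by (subst sum_over_fibres) auto
 have le: "(fibre_sum d n N c S)^2 * cell_volume t S \<le>
   fact n * (\<Sum>(i, l)\<in>fibre d n N S. (c i l)^2 * (\<Prod>a<n. t (Suc (l a)) - t (l a)))" if "S \<in> Pow ({..<d} \<times> {..<N})" for S
 proof -
  have v0: "0 \<le> cell_volume t S"
   using that is_partition_le[OF t] by (intro prod_nonneg) (auto simp: Suc_le_eq)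
  have "(fibre_sum d n N c S)^2 \<le> (\<Sum>(i, l)\<in>fibre d n N S. (c i l)^2) * card (fibre d n N S)"
   unfolding fibre_sum_def using sum_squared_le_sum_of_squares[of "\<lambda>(i, l). c i l" "fibre d n N S"] by (simp add: case_prod_beta)
  also have "\<dots> \<le> (\<Sum>(i, l)\<in>fibre d n N S. (c i l)^2) * fact n"
  proof (rule mult_left_mono)
   have "real (card (fibre d n N S)) \<le> real (fact n)" using card_fibre_le[of d n N S] by (simp only: of_nat_le_iff)
   then show "real (card (fibre d n N S)) \<le> fact n" by (simp only: of_nat_fact)
   show "0 \<le> (\<Sum>(i, l)\<in>fibre d n N S. (c i l)^2)" by (intro sum_nonneg) (simp add: case_prod_beta)
  qed
  finally have "(fibre_sum d n N c S)^2 * cell_volume t S \<le>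
   (\<Sum>(i, l)\<in>fibre d n N S. (c i l)^2) * fact n * cell_volume t S"
   by (rule mult_right_mono[OF _ v0])
  also have "\<dots> = fact n * (\<Sum>(i, l)\<in>fibre d n N S. (c i l)^2 * cell_volume t S)"
  proof -
   have fac: "(\<Sum>(i, l)\<in>fibre d n N S. (c i l)^2 * p) = (\<Sum>(i, l)\<in>fibre d n N S. (c i l)^2) * p" for p
    unfolding sum_distrib_right by (simp add: case_prod_beta)
   have ac: "x * y * z = y * (x * z)" for x y z :: real by simp
   show ?thesis by (subst fac) (rule ac)
  qed
  also have "(\<Sum>(i, l)\<in>fibre d n N S. (c i l)^2 * cell_volume t S) =
    (\<Sum>(i, l)\<in>fibre d n N S. (c i l)^2 * (\<Prod>a<n. t (Suc (l a)) - t (l a)))"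
  proof (rule sum.cong[OF refl], clarify)
   fix i l assume "(i, l) \<in> fibre d n N S"
   then have "inj_on (\<lambda>a. (i a, l a)) {..<n}" "S = (\<lambda>a. (i a, l a)) ` {..<n}" by (auto simp: fibre_def pair_image_def)
   then show "(c i l)^2 * cell_volume t S = (c i l)^2 * (\<Prod>a<n. t (Suc (l a)) - t (l a))"
    by (simp add: prod.reindex)
  qed
  finally show ?thesis .
 qed
 show ?thesis unfolding eq sum_distrib_left[of "fact n" _ "Pow ({..<d} \<times> {..<N})"] by (rule sum_mono) (rule le)
qed

context brownian_motion
begin

lemma gauss_family_increments:
 assumes t: "is_partition N t"
 shows "gauss_family M ({..<d} \<times> {..<N}) (\<lambda>u. t (Suc (snd u)) - t (snd u))
  (\<lambda>u w. increment B t u w)"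
proof
 show "indep_vars (\<lambda>_. borel) (\<lambda>u w. increment B t u w) ({..<d} \<times> {..<N})"
 proof -
  have "(\<lambda>(j, l) w. B j (t (Suc l)) w - B j (t l) w) = (\<lambda>u w. increment B t u w)"
   by (simp add: fun_eq_iff)
  moreover have "0 \<le> t 0" "strict_mono_on {..N} t" using t by (simp_all add: is_partition_def)
  ultimately show ?thesis using BM_indep[of t N] by simp
 qed
 fix u assume "u \<in> {..<d} \<times> {..<N}"
 then have u: "fst u < d" "snd u < N" by auto
 show "0 < t (Suc (snd u)) - t (snd u)" using is_partition_less[OF t, of "snd u" "Suc (snd u)"] u by simp
 then show "distributed M lborel (\<lambda>w. increment B t u w)
   (normal_density 0 (sqrt (t (Suc (snd u)) - t (snd u))))"
  using is_partition_bounds[OF t, of "snd u"] u by (intro BM_increment) auto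
qed simp

lemma step_form_measurable:
 assumes "is_partition N t" "offdiagonal d n N c"
 shows "step_form d B n N t c \<in> borel_measurable M"
proof -
 interpret G: gauss_family M "{..<d} \<times> {..<N}" "\<lambda>u. t (Suc (snd u)) - t (snd u)"
  "\<lambda>u w. increment B t u w"
  by (rule gauss_family_increments[OF assms(1)])
 show ?thesis using G.mform_W_measurable[of "{..<d} \<times> {..<N}" "fibre_sum d n N c"]
  by (simp add: step_form_eq_mform[OF assms(2), abs_def] cong: measurable_cong)
qed

lemma step_form_mult:
 assumes "is_partition N t" "offdiagonal d n N c" "offdiagonal d n' N c'"
 shows "integrable M (\<lambda>w. step_form d B n N t c w * step_form d B n' N t c' w)"
  and "expectation (\<lambda>w. step_form d B n N t c w * step_form d B n' N t c' w) =
   (\<Sum>S\<in>Pow ({..<d} \<times> {..<N}). fibre_sum d n N c S * fibre_sum d n' N c' S * cell_volume t S)"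
proof -
 interpret G: gauss_family M "{..<d} \<times> {..<N}" "\<lambda>u. t (Suc (snd u)) - t (snd u)"
  "\<lambda>u w. increment B t u w"
  by (rule gauss_family_increments[OF assms(1)])
 show "integrable M (\<lambda>w. step_form d B n N t c w * step_form d B n' N t c' w)"
  unfolding step_form_eq_mform[OF assms(2)] step_form_eq_mform[OF assms(3)] by (rule G.mform_mult_expectation) simp
 show "expectation (\<lambda>w. step_form d B n N t c w * step_form d B n' N t c' w) =
   (\<Sum>S\<in>Pow ({..<d} \<times> {..<N}). fibre_sum d n N c S * fibre_sum d n' N c' S * cell_volume t S)"
  unfolding step_form_eq_mform[OF assms(2)] step_form_eq_mform[OF assms(3)] by (rule G.mform_mult_expectation) simp
qed

text \<open>For kernels without symmetry the integral is bounded by, not equal to, the norm of the kernel.\<close>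

lemma elementary_integral_sq:
 assumes "elementary_integral d B n g Y"
 shows "Y \<in> borel_measurable M" "integrable M (\<lambda>w. (Y w)^2)"
  "expectation (\<lambda>w. (Y w)^2) \<le> fact n * kernel_ip d n g g"
proof -
 obtain N t c where 1: "is_partition N t" "offdiagonal d n N c" "g = step_kernel n N t c" "Y = step_form d B n N t c"
  using assms unfolding elementary_integral_iff by blast
 show "Y \<in> borel_measurable M" "integrable M (\<lambda>w. (Y w)^2)"
  using step_form_measurable[OF 1(1,2)] step_form_mult(1)[OF 1(1,2,2)] unfolding 1 by (auto simp: power2_eq_square)
 show "expectation (\<lambda>w. (Y w)^2) \<le> fact n * kernel_ip d n g g"
  using step_form_mult(2)[OF 1(1,2,2)] fibre_sum_sq_le[OF 1(1,2)] unfolding 1 step_kernel_ip[OF 1(1)]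
  by (simp add: power2_eq_square)
qed

text \<open>Symmetry of one of the two kernels is enough: its coefficients are constant on fibres, and the sum
  over the fibre then falls on the other kernel.\<close>

lemma elementary_integral_isometry:
 assumes "elementary_integral d B n g Y" "elementary_integral d B n g' Y'" "symmetric_kernel d n g"
 shows "expectation (\<lambda>w. Y w * Y' w) = fact n * kernel_ip d n g g'"
proof -
 obtain N t c c' where 1: "is_partition N t" "offdiagonal d n N c" "offdiagonal d n N c'"
  "g = step_kernel n N t c" "Y = step_form d B n N t c" "g' = step_kernel n N t c'" "Y' = step_form d B n N t c'"
  by (rule elementary_integral_common[OF assms(1,2)])
 show ?thesis
  unfolding 1 step_form_mult(2)[OF 1(1,2,3)] step_kernel_ip[OF 1(1)]
  by (rule fibre_sum_mult[OF symmetric_step_kernel_coeff[OF 1(1)] 1(3)]) (use assms(3) 1 in auto)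
qed

end

section \<open>Multiple integrals\<close>

definition L2_kernel :: "nat \<Rightarrow> nat \<Rightarrow> kernel \<Rightarrow> bool" where
 "L2_kernel d n f \<longleftrightarrow> (\<forall>i\<in>index_tuples n d. f i \<in> borel_measurable (unit_cube n) \<and>
   integrable (unit_cube n) (\<lambda>r. (f i r)^2))"

abbreviation kernel_diff_sq :: "nat \<Rightarrow> nat \<Rightarrow> kernel \<Rightarrow> kernel \<Rightarrow> real" where
 "kernel_diff_sq d n f g \<equiv> kernel_ip d n (\<lambda>i r. f i r - g i r) (\<lambda>i r. f i r - g i r)"

lemma L2_kernel_diff:
 assumes "L2_kernel d n f" "L2_kernel d n g"
 shows "L2_kernel d n (\<lambda>i r. f i r - g i r)"
 unfolding L2_kernel_def
proof (intro ballI conjI)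
 fix i assume i: "i \<in> index_tuples n d"
 have [measurable]: "f i \<in> borel_measurable (unit_cube n)" "g i \<in> borel_measurable (unit_cube n)"
  using assms i by (auto simp: L2_kernel_def)
 show "(\<lambda>r. f i r - g i r) \<in> borel_measurable (unit_cube n)" by measurable
 show "integrable (unit_cube n) (\<lambda>r. (f i r - g i r)^2)"
  by (rule integrable_sq_add(2)) (use assms i in \<open>auto simp: L2_kernel_def\<close>)
qed

lemma kernel_dist_sq_eq:
 assumes "L2_kernel d n f" "L2_kernel d n g"
 shows "kernel_dist_sq d n f g = ennreal (kernel_diff_sq d n f g)"
proof -
 have "kernel_dist_sq d n f g = (\<Sum>i\<in>index_tuples n d. ennreal (\<integral>r. (f i r - g i r)^2 \<partial>unit_cube n))"
  unfolding kernel_dist_sq_def using L2_kernel_diff[OF assms]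
  by (intro sum.cong refl nn_integral_eq_integral) (auto simp: L2_kernel_def)
 also have "\<dots> = ennreal (kernel_diff_sq d n f g)"
  unfolding kernel_ip_def by (subst sum_ennreal) (auto simp: power2_eq_square)
 finally show ?thesis .
qed

lemma kernel_diff_sq_nonneg: "0 \<le> kernel_diff_sq d n f g"
 unfolding kernel_ip_def by (intro sum_nonneg) simp

lemma kernel_dist_sq_tendsto_0_iff:
 assumes "\<And>q. L2_kernel d n (g q)" "L2_kernel d n f"
 shows "((\<lambda>q. kernel_dist_sq d n (g q) f) \<longlonglongrightarrow> 0) \<longleftrightarrow> ((\<lambda>q. kernel_diff_sq d n (g q) f) \<longlonglongrightarrow> 0)"
proof -
 have "((\<lambda>q. ennreal (kernel_diff_sq d n (g q) f)) \<longlonglongrightarrow> ennreal 0) \<longleftrightarrow> ((\<lambda>q. kernel_diff_sq d n (g q) f) \<longlonglongrightarrow> 0)"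
  by (rule tendsto_ennreal_iff) (simp_all add: kernel_diff_sq_nonneg)
 then show ?thesis using kernel_dist_sq_eq[OF assms(1) assms(2)] by simp
qed

lemma square_diff_le: "(x - y)^2 \<le> 2 * (x - z)^2 + 2 * (y - (z::real))^2"
proof -
 have "0 \<le> ((x - z) + (y - z))^2" by simp
 then show ?thesis by (simp add: power2_eq_square algebra_simps)
qed

lemma kernel_diff_sq_triangle:
 assumes "L2_kernel d n f" "L2_kernel d n g" "L2_kernel d n h"
 shows "kernel_diff_sq d n f g \<le> 2 * kernel_diff_sq d n f h + 2 * kernel_diff_sq d n g h"
proof -
 have "kernel_diff_sq d n f g \<le> (\<Sum>i\<in>index_tuples n d. 2 * (\<integral>r. (f i r - h i r)^2 \<partial>unit_cube n) + 2 * (\<integral>r. (g i r - h i r)^2 \<partial>unit_cube n))"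
  unfolding kernel_ip_def power2_eq_square[symmetric]
 proof (rule sum_mono)
  fix i assume i: "i \<in> index_tuples n d"
  have j: "integrable (unit_cube n) (\<lambda>r. (f i r - g i r)^2)" "integrable (unit_cube n) (\<lambda>r. (f i r - h i r)^2)"
   "integrable (unit_cube n) (\<lambda>r. (g i r - h i r)^2)"
   using L2_kernel_diff[OF assms(1,2)] L2_kernel_diff[OF assms(1,3)] L2_kernel_diff[OF assms(2,3)] i
   unfolding L2_kernel_def by blast+
  have "(\<integral>r. (f i r - g i r)^2 \<partial>unit_cube n) \<le> (\<integral>r. 2 * (f i r - h i r)^2 + 2 * (g i r - h i r)^2 \<partial>unit_cube n)"
   by (rule integral_mono[OF j(1) _ square_diff_le]) (use j in simp)
  then show "(\<integral>r. (f i r - g i r)^2 \<partial>unit_cube n) \<le> 2 * (\<integral>r. (f i r - h i r)^2 \<partial>unit_cube n) + 2 * (\<integral>r. (g i r - h i r)^2 \<partial>unit_cube n)"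
   using j by simp
 qed
 then show ?thesis by (simp add: kernel_ip_def sum.distrib sum_distrib_left power2_eq_square)
qed

lemma kernel_component_tendsto_0:
 assumes "(\<lambda>q. kernel_diff_sq d n (g q) f) \<longlonglongrightarrow> 0" "i \<in> index_tuples n d"
 shows "(\<lambda>q. \<integral>r. (g q i r - f i r)^2 \<partial>unit_cube n) \<longlonglongrightarrow> 0"
proof (rule tendsto_sandwich[OF _ _ tendsto_const assms(1)])
 have "(\<integral>r. (g q i r - f i r)^2 \<partial>unit_cube n) \<le> kernel_diff_sq d n (g q) f" for q
  unfolding kernel_ip_def power2_eq_square[symmetric] by (rule member_le_sum) (use assms(2) in \<open>auto simp: finite_PiE\<close>)
 then show "\<forall>\<^sub>F q in sequentially. (\<integral>r. (g q i r - f i r)^2 \<partial>unit_cube n) \<le> kernel_diff_sq d n (g q) f" by simp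
qed simp

lemma kernel_ip_tendsto:
 assumes g: "\<And>q. L2_kernel d n (g q)" and f: "L2_kernel d n f" and h: "L2_kernel d n h"
  and lim: "(\<lambda>q. kernel_diff_sq d n (g q) f) \<longlonglongrightarrow> 0"
 shows "(\<lambda>q. kernel_ip d n (g q) h) \<longlonglongrightarrow> kernel_ip d n f h"
 unfolding kernel_ip_def
proof (rule tendsto_sum)
 fix i assume i: "i \<in> index_tuples n d"
 show "(\<lambda>q. \<integral>r. g q i r * h i r \<partial>unit_cube n) \<longlonglongrightarrow> (\<integral>r. f i r * h i r \<partial>unit_cube n)"
  by (rule integral_mult_tendsto[OF _ _ _ _ _ _ kernel_component_tendsto_0[OF lim i]])
    (use g f h i in \<open>auto simp: L2_kernel_def\<close>)
qed

lemma elementary_integral_L2_kernel: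
 assumes "elementary_integral d B n g Y"
 shows "L2_kernel d n g"
proof -
 obtain N t c where 1: "is_partition N t" "offdiagonal d n N c" "g = step_kernel n N t c" "Y = step_form d B n N t c"
  using assms unfolding elementary_integral_iff by blast
 show ?thesis
  unfolding L2_kernel_def 1(3) power2_eq_square step_kernel_mult[OF 1(1)]
  using step_kernel_integral(1)[OF 1(1)] by auto
qed

lemma sym_L2_kernel_imp_L2_kernel:
 assumes "sym_L2_kernel d n f"
 shows "L2_kernel d n f"
 unfolding L2_kernel_def
proof (intro ballI conjI)
 fix i assume i: "i \<in> index_tuples n d"
 show m: "f i \<in> borel_measurable (unit_cube n)" using assms i unfolding sym_L2_kernel_def by blast
 have "(\<integral>\<^sup>+ r. ennreal ((f i r)^2) \<partial>unit_cube n) \<le> kernel_dist_sq d n f (\<lambda>i r. 0)"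
  unfolding kernel_dist_sq_def using i
  by (simp add: member_le_sum[of i "index_tuples n d" "\<lambda>i. \<integral>\<^sup>+ r. ennreal ((f i r)^2) \<partial>unit_cube n"] finite_PiE)
 also have "\<dots> < \<infinity>" using assms unfolding sym_L2_kernel_def by blast
 finally show "integrable (unit_cube n) (\<lambda>r. (f i r)^2)" using m by (intro integrableI_bounded) auto
qed

text \<open>Symmetry of the kernels is kept apart from square integrability because the approximants in
  the definition of the multiple integral need not be symmetric.\<close>

definition sym_approximable :: "nat \<Rightarrow> (nat \<Rightarrow> real \<Rightarrow> 'w \<Rightarrow> real) \<Rightarrow> nat \<Rightarrow> kernel \<Rightarrow> bool" where
 "sym_approximable d B n f \<longleftrightarrow> (\<exists>g Y. (\<forall>q. elementary_integral d B n (g q) (Y q) \<and> symmetric_kernel d n (g q)) \<and>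
   (\<lambda>q. kernel_diff_sq d n (g q) f) \<longlonglongrightarrow> 0)"

context brownian_motion
begin

lemma is_multiple_integralE:
 assumes "is_multiple_integral M d B n f X" "L2_kernel d n f"
 obtains g Y where "\<And>q. elementary_integral d B n (g q) (Y q)" "(\<lambda>q. kernel_diff_sq d n (g q) f) \<longlonglongrightarrow> 0"
  "(\<lambda>q. expectation (\<lambda>w. (Y q w - X w)^2)) \<longlonglongrightarrow> 0" "X \<in> borel_measurable M" "integrable M (\<lambda>w. (X w)^2)"
proof -
 obtain g Y where gY: "\<And>q. elementary_integral d B n (g q) (Y q)"
  "(\<lambda>q. kernel_dist_sq d n (g q) f) \<longlonglongrightarrow> 0" "(\<lambda>q. \<integral>\<^sup>+ w. ennreal ((Y q w - X w)^2) \<partial>M) \<longlonglongrightarrow> 0"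
  using assms(1) unfolding is_multiple_integral_def by blast
 have Xm [measurable]: "X \<in> borel_measurable M" using assms(1) unfolding is_multiple_integral_def by blast
 note Y = elementary_integral_sq(1,2)[OF gY(1)]
 have [measurable]: "Y q \<in> borel_measurable M" for q by (rule Y)
 have "\<forall>\<^sub>F q in sequentially. (\<integral>\<^sup>+ w. ennreal ((Y q w - X w)^2) \<partial>M) < 1"
  by (rule order_tendstoD(2)[OF gY(3)]) simp
 then obtain q where q: "(\<integral>\<^sup>+ w. ennreal ((Y q w - X w)^2) \<partial>M) < 1" by (auto simp: eventually_sequentially)
 have "(\<integral>\<^sup>+ w. ennreal (norm ((Y q w - X w)^2)) \<partial>M) < \<infinity>"
  using order_less_trans[OF q, of \<top>] by simp
 then have iq: "integrable M (\<lambda>w. (Y q w - X w)^2)" by (intro integrableI_bounded) auto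
 have "integrable M (\<lambda>w. (Y q w - (Y q w - X w))^2)"
  by (rule integrable_sq_add(2)[OF _ _ Y(2) iq]) measurable
 then have Xi: "integrable M (\<lambda>w. (X w)^2)" by simp
 have "(\<integral>\<^sup>+ w. ennreal ((Y q w - X w)^2) \<partial>M) = ennreal (expectation (\<lambda>w. (Y q w - X w)^2))" for q
  by (intro nn_integral_eq_integral integrable_sq_add(2) Y Xi) auto
 then have "(\<lambda>q. ennreal (expectation (\<lambda>w. (Y q w - X w)^2))) \<longlonglongrightarrow> ennreal 0" using gY(3) by simp
 then have 3: "(\<lambda>q. expectation (\<lambda>w. (Y q w - X w)^2)) \<longlonglongrightarrow> 0"
  by (subst (asm) tendsto_ennreal_iff) auto
 have 2: "(\<lambda>q. kernel_diff_sq d n (g q) f) \<longlonglongrightarrow> 0"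
  using gY(2) kernel_dist_sq_tendsto_0_iff[of d n g f, OF elementary_integral_L2_kernel[OF gY(1)] assms(2)] by simp
 show thesis by (rule that[OF gY(1) 2 3 Xm Xi])
qed

lemma elementary_diff_sq_le:
 assumes "elementary_integral d B n g Y" "elementary_integral d B n g' Y'" "L2_kernel d n f"
 shows "expectation (\<lambda>w. (Y w - Y' w)^2) \<le> fact n * (2 * kernel_diff_sq d n g f + 2 * kernel_diff_sq d n g' f)"
 by (rule order_trans[OF elementary_integral_sq(3)[OF elementary_integral_diff[OF assms(1,2)]]],
   rule mult_left_mono[OF kernel_diff_sq_triangle])
   (use assms elementary_integral_L2_kernel in auto)

text \<open>By the isometry bound, the difference of two approximating sequences tends to zero in mean square, so
  that any approximation serves, not just the one given by the definition.\<close>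

lemma multiple_integral_limit:
 assumes X: "is_multiple_integral M d B n f X" and f: "L2_kernel d n f"
  and g: "\<And>q. elementary_integral d B n (g q) (Y q)" and lim: "(\<lambda>q. kernel_diff_sq d n (g q) f) \<longlonglongrightarrow> 0"
 shows "(\<lambda>q. expectation (\<lambda>w. (Y q w - X w)^2)) \<longlonglongrightarrow> 0"
proof -
 obtain g' Y' where g': "\<And>q. elementary_integral d B n (g' q) (Y' q)" "(\<lambda>q. kernel_diff_sq d n (g' q) f) \<longlonglongrightarrow> 0"
  "(\<lambda>q. expectation (\<lambda>w. (Y' q w - X w)^2)) \<longlonglongrightarrow> 0" and [measurable]: "X \<in> borel_measurable M" and Xi: "integrable M (\<lambda>w. (X w)^2)"
  by (rule is_multiple_integralE[OF X f]) blast
 have [measurable]: "Y q \<in> borel_measurable M" "Y' q \<in> borel_measurable M" for q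
  using elementary_integral_sq(1)[OF g] elementary_integral_sq(1)[OF g'(1)] by auto
 note Yi = elementary_integral_sq(2)[OF g] and Yi' = elementary_integral_sq(2)[OF g'(1)]
 have "expectation (\<lambda>w. (Y q w - X w)^2) \<le>
   2 * (fact n * (2 * kernel_diff_sq d n (g q) f + 2 * kernel_diff_sq d n (g' q) f)) + 2 * expectation (\<lambda>w. (Y' q w - X w)^2)" for q
 proof -
  have i1: "integrable M (\<lambda>w. (Y q w - Y' q w)^2)" by (rule integrable_sq_add(2)[OF _ _ Yi Yi']) auto
  have i2: "integrable M (\<lambda>w. (X w - Y' q w)^2)" by (rule integrable_sq_add(2)[OF _ _ Xi Yi']) auto
  have i3: "integrable M (\<lambda>w. (Y q w - X w)^2)" by (rule integrable_sq_add(2)[OF _ _ Yi Xi]) auto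
  have "expectation (\<lambda>w. (Y q w - X w)^2) \<le> expectation (\<lambda>w. 2 * (Y q w - Y' q w)^2 + 2 * (X w - Y' q w)^2)"
   by (rule integral_mono[OF i3 _ square_diff_le]) (use i1 i2 in simp)
  also have "\<dots> = 2 * expectation (\<lambda>w. (Y q w - Y' q w)^2) + 2 * expectation (\<lambda>w. (Y' q w - X w)^2)"
   using i1 i2 by (simp add: power2_commute)
  finally show ?thesis using elementary_diff_sq_le[OF g[of q] g'(1)[of q] f] by linarith
 qed
 moreover have "(\<lambda>q. 2 * (fact n * (2 * kernel_diff_sq d n (g q) f + 2 * kernel_diff_sq d n (g' q) f)) + 2 * expectation (\<lambda>w. (Y' q w - X w)^2)) \<longlonglongrightarrow>
   2 * (fact n * (2 * 0 + 2 * 0)) + 2 * 0"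
  by (intro tendsto_intros lim g')
 ultimately show ?thesis
  by - (rule Lim_null_comparison[OF always_eventually], simp_all)
qed

lemma multiple_integral_ip_elementary:
 assumes X: "is_multiple_integral M d B n f X" and f: "L2_kernel d n f" and a: "sym_approximable d B n f"
  and Z: "elementary_integral d B n h Z"
 shows "expectation (\<lambda>w. X w * Z w) = fact n * kernel_ip d n f h"
proof -
 obtain g Y where g: "\<And>q. elementary_integral d B n (g q) (Y q)" "\<And>q. symmetric_kernel d n (g q)"
  and lim: "(\<lambda>q. kernel_diff_sq d n (g q) f) \<longlonglongrightarrow> 0"
  using a unfolding sym_approximable_def by blast
 have Xm: "X \<in> borel_measurable M" and Xi: "integrable M (\<lambda>w. (X w)^2)"
  by (rule is_multiple_integralE[OF X f], assumption)+
 have "(\<lambda>q. expectation (\<lambda>w. Y q w * Z w)) \<longlonglongrightarrow> expectation (\<lambda>w. X w * Z w)"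
  by (rule integral_mult_tendsto[OF elementary_integral_sq(1)[OF g(1)] Xm elementary_integral_sq(1)[OF Z]
   elementary_integral_sq(2)[OF g(1)] Xi elementary_integral_sq(2)[OF Z] multiple_integral_limit[OF X f g(1) lim]])
 moreover have "(\<lambda>q. expectation (\<lambda>w. Y q w * Z w)) \<longlonglongrightarrow> fact n * kernel_ip d n f h"
  unfolding elementary_integral_isometry[OF g(1) Z g(2)]
  by (intro tendsto_intros kernel_ip_tendsto[OF elementary_integral_L2_kernel[OF g(1)] f elementary_integral_L2_kernel[OF Z] lim])
 ultimately show ?thesis by (rule LIMSEQ_unique)
qed

text \<open>Approximating integrals form a Cauchy sequence by the isometry bound.\<close>

lemma multiple_integral_exists:
 assumes f: "L2_kernel d n f" and g: "\<And>q. elementary_integral d B n (g q) (Y q)"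
  and lim: "(\<lambda>q. kernel_diff_sq d n (g q) f) \<longlonglongrightarrow> 0"
 shows "\<exists>X. is_multiple_integral M d B n f X"
proof -
 have cauchy: "\<exists>N. \<forall>p\<ge>N. \<forall>q\<ge>N. expectation (\<lambda>w. (Y p w - Y q w)^2) < e" if "0 < e" for e
 proof -
  define e' where "e' = e / (4 * fact n)"
  have "0 < e'" using that by (simp add: e'_def)
  then obtain N where N: "\<And>q. q \<ge> N \<Longrightarrow> kernel_diff_sq d n (g q) f < e'"
   using order_tendstoD(2)[OF lim] by (auto simp: eventually_sequentially)
  show ?thesis
  proof (intro exI allI impI)
   fix p q assume "N \<le> p" "N \<le> q"
   then have "2 * kernel_diff_sq d n (g p) f + 2 * kernel_diff_sq d n (g q) f < 4 * e'"
    using N[of p] N[of q] by linarith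
   then have "fact n * (2 * kernel_diff_sq d n (g p) f + 2 * kernel_diff_sq d n (g q) f) < fact n * (4 * e')"
    by (intro mult_strict_left_mono) auto
   also have "\<dots> = e" by (simp add: e'_def)
   finally show "expectation (\<lambda>w. (Y p w - Y q w)^2) < e"
    using elementary_diff_sq_le[OF g[of p] g[of q] f] by linarith
  qed
 qed
 obtain X where X: "X \<in> borel_measurable M" "(\<lambda>q. \<integral>\<^sup>+ w. ennreal ((Y q w - X w)^2) \<partial>M) \<longlonglongrightarrow> 0"
  by (rule L2_complete[OF elementary_integral_sq(1,2)[OF g] cauchy])
 have "is_multiple_integral M d B n f X"
  unfolding is_multiple_integral_def
 proof (intro conjI exI[of _ g] exI[of _ Y] allI)
  show "(\<lambda>q. kernel_dist_sq d n (g q) f) \<longlonglongrightarrow> 0"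
   using lim kernel_dist_sq_tendsto_0_iff[of d n g f, OF elementary_integral_L2_kernel[OF g] f] by simp
 qed (rule X g)+
 then show ?thesis by blast
qed

end

section \<open>Approximation on uniform grids\<close>

text \<open>Continuity along sequences, coordinate by coordinate, is what pointwise approximation on grids needs.\<close>

definition continuous_kernel :: "nat \<Rightarrow> nat \<Rightarrow> kernel \<Rightarrow> bool" where
 "continuous_kernel d n f \<longleftrightarrow> symmetric_kernel d n f \<and>
  (\<forall>i\<in>index_tuples n d. f i \<in> borel_measurable (unit_cube n)) \<and>
  (\<exists>C. \<forall>i\<in>index_tuples n d. \<forall>r\<in>space (unit_cube n). \<bar>f i r\<bar> \<le> C) \<and>
  (\<forall>i\<in>index_tuples n d. \<forall>r\<in>space (unit_cube n). \<forall>\<rho>. (\<forall>q. \<rho> q \<in> space (unit_cube n)) \<longrightarrow>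
   (\<forall>a<n. (\<lambda>q. \<rho> q a) \<longlonglongrightarrow> r a) \<longrightarrow> (\<lambda>q. f i (\<rho> q)) \<longlonglongrightarrow> f i r)"

lemma continuous_kernel_tendsto:
 assumes f: "continuous_kernel d n f" and "i \<in> index_tuples n d" "r \<in> space (unit_cube n)"
  and "\<And>q. \<rho> q \<in> space (unit_cube n)" "\<And>a. a < n \<Longrightarrow> (\<lambda>q. \<rho> q a) \<longlonglongrightarrow> r a"
 shows "(\<lambda>q. f i (\<rho> q)) \<longlonglongrightarrow> f i r"
proof -
 have "\<forall>i\<in>index_tuples n d. \<forall>r\<in>space (unit_cube n). \<forall>\<rho>. (\<forall>q. \<rho> q \<in> space (unit_cube n)) \<longrightarrow>
   (\<forall>a<n. (\<lambda>q. \<rho> q a) \<longlonglongrightarrow> r a) \<longrightarrow> (\<lambda>q. f i (\<rho> q)) \<longlonglongrightarrow> f i r"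
  using f unfolding continuous_kernel_def by (elim conjE)
 from this[rule_format, OF assms(2,3), of \<rho>] show ?thesis using assms(4,5) by simp
qed

lemma continuous_kernel_bounded:
 assumes "continuous_kernel d n f"
 shows "\<exists>C. 0 \<le> C \<and> (\<forall>i\<in>index_tuples n d. \<forall>r\<in>space (unit_cube n). \<bar>f i r\<bar> \<le> C)"
proof -
 have "\<exists>C. \<forall>i\<in>index_tuples n d. \<forall>r\<in>space (unit_cube n). \<bar>f i r\<bar> \<le> C"
  using assms unfolding continuous_kernel_def by (elim conjE)
 then obtain C where C: "\<forall>i\<in>index_tuples n d. \<forall>r\<in>space (unit_cube n). \<bar>f i r\<bar> \<le> C" ..
 show ?thesis
 proof (intro exI[of _ "max 0 C"] conjI ballI)
  fix i r assume "i \<in> index_tuples n d" "r \<in> space (unit_cube n)"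
  then have "\<bar>f i r\<bar> \<le> C" using C by simp
  then show "\<bar>f i r\<bar> \<le> max 0 C" by simp
 qed simp
qed

lemma continuous_kernel_measurable:
 "continuous_kernel d n f \<Longrightarrow> i \<in> index_tuples n d \<Longrightarrow> f i \<in> borel_measurable (unit_cube n)"
 unfolding continuous_kernel_def by (elim conjE) simp

definition grid :: "nat \<Rightarrow> nat \<Rightarrow> real" where
 "grid N l = real l / real N"

text \<open>The values at the upper corners of the grid cells, with the coefficients on the diagonal set to \<open>0\<close> as
  elementary kernels require. The exceptional set shrinks to a null set when the grid is refined.\<close>

definition grid_coeff :: "nat \<Rightarrow> kernel \<Rightarrow> nat \<Rightarrow> (nat \<Rightarrow> nat) \<Rightarrow> (nat \<Rightarrow> nat) \<Rightarrow> real" where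
 "grid_coeff n f N i l = (if inj_on (\<lambda>a. (i a, l a)) {..<n} then f i (\<lambda>a\<in>{..<n}. grid N (l a)) else 0)"

abbreviation grid_kernel :: "nat \<Rightarrow> kernel \<Rightarrow> nat \<Rightarrow> kernel" where
 "grid_kernel n f N \<equiv> step_kernel n N (grid N) (grid_coeff n f N)"

lemma is_partition_grid: "0 < N \<Longrightarrow> is_partition N (grid N)"
 by (auto simp: is_partition_def grid_def strict_mono_on_def divide_strict_right_mono)

lemma offdiagonal_grid_coeff: "offdiagonal d n N (grid_coeff n f N)"
 unfolding offdiagonal_def grid_coeff_def inj_on_def by auto

lemma grid_point_in_cube:
 assumes "0 < N" "l \<in> index_tuples n N"
 shows "(\<lambda>a\<in>{..<n}. grid N (l a)) \<in> space (unit_cube n)"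
proof -
 have "l a < N" if "a < n" for a using assms(2) that by auto
 then show ?thesis using assms(1) by (auto simp: space_unit_cube grid_def divide_le_eq less_imp_le)
qed

lemma symmetric_step_kernel:
 assumes t: "is_partition N t"
  and c: "\<And>\<pi> i l. \<pi> permutes {..<n} \<Longrightarrow> i \<in> index_tuples n d \<Longrightarrow> l \<in> index_tuples n N \<Longrightarrow> c (i \<circ> \<pi>) (l \<circ> \<pi>) = c i l"
 shows "symmetric_kernel d n (step_kernel n N t c)"
 unfolding symmetric_kernel_def
proof (intro allI impI ballI)
 fix \<pi> i r assume p: "\<pi> permutes {..<n}" and i: "i \<in> index_tuples n d" and r: "r \<in> space (unit_cube n)"
 have pn: "\<pi> a < n" if "a < n" for a using permutes_in_image[OF p, of a] that by simp
 show "step_kernel n N t c (i \<circ> \<pi>) (r \<circ> \<pi>) = step_kernel n N t c i r"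
 proof (cases "\<exists>l\<in>index_tuples n N. \<forall>a<n. r a \<in> {t (l a)<..t (Suc (l a))}")
  case True
  then obtain l where l: "l \<in> index_tuples n N" "\<And>a. a < n \<Longrightarrow> r a \<in> {t (l a)<..t (Suc (l a))}" by blast
  have "step_kernel n N t c i r = c i l" by (rule step_kernel_value[OF t l])
  moreover have "step_kernel n N t c (i \<circ> \<pi>) (r \<circ> \<pi>) = c (i \<circ> \<pi>) (l \<circ> \<pi>)"
   by (rule step_kernel_value[OF t PiE_permutes[OF p l(1)]]) (use l(2) pn in simp)
  ultimately show ?thesis using c[OF p i l(1)] by simp
 next
  case False
  have p': "inv \<pi> permutes {..<n}" by (rule permutes_inv[OF p])
  have "step_kernel n N t c i r = 0" by (rule step_kernel_zero) (use False in blast)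
  moreover have "step_kernel n N t c (i \<circ> \<pi>) (r \<circ> \<pi>) = 0"
  proof (rule step_kernel_zero, rule ccontr)
   fix l assume l: "l \<in> index_tuples n N" and n: "\<not> (\<exists>a<n. (r \<circ> \<pi>) a \<notin> {t (l a)<..t (Suc (l a))})"
   have "r a \<in> {t ((l \<circ> inv \<pi>) a)<..t (Suc ((l \<circ> inv \<pi>) a))}" if "a < n" for a
   proof -
    have "inv \<pi> a < n" using permutes_in_image[OF p', of a] that by simp
    then have "(r \<circ> \<pi>) (inv \<pi> a) \<in> {t (l (inv \<pi> a))<..t (Suc (l (inv \<pi> a)))}" using n by blast
    then show ?thesis using permutes_inverses(1)[OF p] by simp
   qed
   then show False using False PiE_permutes[OF p' l] by blast
  qed
  ultimately show ?thesis by simp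
 qed
qed

lemma grid_coeff_symmetric:
 assumes "symmetric_kernel d n f" "0 < N"
  and p: "\<pi> permutes {..<n}" and i: "i \<in> index_tuples n d" and l: "l \<in> index_tuples n N"
 shows "grid_coeff n f N (i \<circ> \<pi>) (l \<circ> \<pi>) = grid_coeff n f N i l"
proof -
 have "(\<lambda>a. ((i \<circ> \<pi>) a, (l \<circ> \<pi>) a)) = (\<lambda>a. (i a, l a)) \<circ> \<pi>" by auto
 then have 1: "inj_on (\<lambda>a. ((i \<circ> \<pi>) a, (l \<circ> \<pi>) a)) {..<n} \<longleftrightarrow> inj_on (\<lambda>a. (i a, l a)) {..<n}"
  using comp_inj_on_iff[OF permutes_inj_on[OF p, of "{..<n}"], of "\<lambda>a. (i a, l a)"] permutes_image[OF p] by simp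
 have 2: "(\<lambda>a\<in>{..<n}. grid N ((l \<circ> \<pi>) a)) = (\<lambda>a\<in>{..<n}. grid N (l a)) \<circ> \<pi>"
  using permutes_in_image[OF p] by (auto simp: fun_eq_iff permutes_not_in[OF p] restrict_def)
 show ?thesis
  unfolding grid_coeff_def 1 2
  using assms(1) p i grid_point_in_cube[OF assms(2) l] by (simp add: symmetric_kernel_def)
qed

lemma elementary_integral_grid:
 assumes "0 < N"
 shows "elementary_integral d B n (grid_kernel n f N) (step_form d B n N (grid N) (grid_coeff n f N))"
 unfolding elementary_integral_iff
 using is_partition_grid[OF assms] offdiagonal_grid_coeff[of d n N f] by blast

lemma grid_cell:
 assumes "0 < N" "0 < x" "x \<le> 1"
 defines "l \<equiv> nat (\<lceil>real N * x\<rceil> - 1)"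
 shows "l < N" "x \<in> {grid N l<..grid N (Suc l)}"
proof -
 have p: "0 < real N * x" "real N * x \<le> real N" using assms by (auto simp: mult_le_cancel_left1)
 have c: "1 \<le> \<lceil>real N * x\<rceil>" "\<lceil>real N * x\<rceil> \<le> int N" using p by (simp_all add: ceiling_le_iff one_le_ceiling)
 then have l: "real l = of_int \<lceil>real N * x\<rceil> - 1" "real (Suc l) = of_int \<lceil>real N * x\<rceil>" by (auto simp: l_def)
 show "l < N" using c unfolding l_def by linarith
 have "real l < real N * x" "real N * x \<le> real (Suc l)" using l le_of_int_ceiling[of "real N * x"] ceiling_correct[of "real N * x"] by auto
 then show "x \<in> {grid N l<..grid N (Suc l)}" using assms(1) by (simp add: grid_def divide_less_eq le_divide_eq mult.commute)
qed

lemma grid_kernel_bound: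
 assumes f: "\<And>r. r \<in> space (unit_cube n) \<Longrightarrow> \<bar>f i r\<bar> \<le> C" and C: "0 \<le> C" and N: "0 < N"
 shows "\<bar>grid_kernel n f N i r\<bar> \<le> C"
proof (cases "\<exists>l\<in>index_tuples n N. \<forall>a<n. r a \<in> {grid N (l a)<..grid N (Suc (l a))}")
 case True
 then obtain l where l: "l \<in> index_tuples n N" "\<And>a. a < n \<Longrightarrow> r a \<in> {grid N (l a)<..grid N (Suc (l a))}" by blast
 have "grid_kernel n f N i r = grid_coeff n f N i l" by (rule step_kernel_value[OF is_partition_grid[OF N] l])
 then show ?thesis using f[OF grid_point_in_cube[OF N l(1)]] C by (simp add: grid_coeff_def)
next
 case False
 have "grid_kernel n f N i r = 0" by (rule step_kernel_zero) (use False in blast)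
 then show ?thesis using C by simp
qed

lemma grid_kernel_tendsto:
 assumes f: "continuous_kernel d n f" and i: "i \<in> index_tuples n d" and r: "r \<in> space (unit_cube n)"
  and pos: "\<And>a. a < n \<Longrightarrow> 0 < r a" and dist: "\<And>a b. a < n \<Longrightarrow> b < n \<Longrightarrow> a \<noteq> b \<Longrightarrow> r a \<noteq> r b"
  and N: "\<And>q. 0 < N q" "filterlim N at_top sequentially"
 shows "(\<lambda>q. grid_kernel n f (N q) i r) \<longlonglongrightarrow> f i r"
proof -
 define l where "l q = (\<lambda>a\<in>{..<n}. nat (\<lceil>real (N q) * r a\<rceil> - 1))" for q
 have r1: "r a \<le> 1" if "a < n" for a
  using PiE_mem[OF r[unfolded space_unit_cube], of a] that by simp
 have l: "l q \<in> index_tuples n (N q)" for q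
  unfolding l_def restrict_PiE_iff using grid_cell(1)[OF N(1) pos r1] by simp
 have cell: "r a \<in> {grid (N q) (l q a)<..grid (N q) (Suc (l q a))}" if "a < n" for a q
  using grid_cell(2)[OF N(1) pos[OF that] r1[OF that]] that by (simp add: l_def)
 have val: "grid_kernel n f (N q) i r = grid_coeff n f (N q) i (l q)" for q
  by (rule step_kernel_value[OF is_partition_grid[OF N(1)] l cell])
 have inv: "(\<lambda>q. 1 / real (N q)) \<longlonglongrightarrow> 0"
  using filterlim_compose[OF lim_1_over_n N(2)] by simp
 have close: "\<bar>grid (N q) (l q a) - r a\<bar> \<le> 1 / real (N q)" if "a < n" for q a
  using cell[OF that, of q] by (auto simp: grid_def add_divide_distrib)
 have "\<forall>\<^sub>F q in sequentially. \<forall>a\<in>{..<n}. \<forall>b\<in>{..<n} - {a}. 1 / real (N q) < \<bar>r a - r b\<bar>"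
 proof (intro eventually_ball_finite ballI)
  fix a b assume "a \<in> {..<n}" "b \<in> {..<n} - {a}"
  then show "\<forall>\<^sub>F q in sequentially. 1 / real (N q) < \<bar>r a - r b\<bar>"
   using dist[of a b] by (intro order_tendstoD(2)[OF inv]) auto
 qed auto
 then have ev: "\<forall>\<^sub>F q in sequentially. grid_kernel n f (N q) i r = f i (\<lambda>a\<in>{..<n}. grid (N q) (l q a))"
 proof eventually_elim
  case (elim q)
  have "inj_on (\<lambda>a. (i a, l q a)) {..<n}"
  proof (rule inj_onI, rule ccontr)
   fix a b assume ab: "a \<in> {..<n}" "b \<in> {..<n}" "(i a, l q a) = (i b, l q b)" "a \<noteq> b"
   have "r a \<in> {grid (N q) (l q a)<..grid (N q) (Suc (l q a))}" "r b \<in> {grid (N q) (l q a)<..grid (N q) (Suc (l q a))}"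
    using cell[of a q] cell[of b q] ab by auto
   then have "\<bar>r a - r b\<bar> \<le> 1 / real (N q)" by (auto simp: grid_def add_divide_distrib abs_le_iff)
   then show False using elim ab by force
  qed
  then show ?case by (simp add: val grid_coeff_def)
 qed
 have lim: "(\<lambda>q. f i (\<lambda>a\<in>{..<n}. grid (N q) (l q a))) \<longlonglongrightarrow> f i r"
 proof -
  have 1: "(\<lambda>q. (\<lambda>a\<in>{..<n}. grid (N q) (l q a)) a) \<longlonglongrightarrow> r a" if "a < n" for a
  proof -
   have "(\<lambda>q. grid (N q) (l q a) - r a) \<longlonglongrightarrow> 0"
    by (rule Lim_null_comparison[OF _ inv]) (use close[OF that] in simp)
   then show ?thesis using that by (simp add: LIM_zero_iff)
  qed
  show ?thesis by (rule continuous_kernel_tendsto[OF f i r grid_point_in_cube[OF N(1) l] 1])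
 qed
 show ?thesis using lim ev by (rule Lim_transform_eventually[OF _ eventually_mono]) auto
qed

lemma unit_cube_coordinate_measurable:
 assumes "a < n"
 shows "(\<lambda>r. r a) \<in> borel_measurable (unit_cube n)"
proof (rule measurable_compose[of "\<lambda>r. r a" _ "unit_interval" "\<lambda>x. x"])
 show "(\<lambda>r. r a) \<in> measurable (unit_cube n) unit_interval"
  by (rule measurable_component_singleton) (use assms in simp)
 show "(\<lambda>x. x) \<in> borel_measurable unit_interval"
  by (rule measurable_restrict_space1) simp
qed

lemma AE_unit_cube_positive: "AE r in unit_cube n. \<forall>a<n. 0 < r a"
proof -
 have "AE r in unit_cube n. 0 < r a" if a: "a < n" for a
 proof (rule AE_PiM_component[where P = "\<lambda>x. 0 < x"])
  have "AE x in lborel. x \<noteq> (0::real)" by (rule AE_lborel_singleton)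
  then show "AE x in unit_interval. 0 < x"
   by (subst AE_restrict_space_iff) auto
 qed (use a prob_space_unit_interval in auto)
 then have "AE r in unit_cube n. \<forall>a\<in>{..<n}. 0 < r a" by (intro AE_finite_allI) auto
 then show ?thesis by (simp add: Ball_def)
qed

lemma AE_unit_cube_distinct: "AE r in unit_cube n. \<forall>a<n. \<forall>b<n. a \<noteq> b \<longrightarrow> r a \<noteq> r b"
proof -
 have "AE r in unit_cube n. r a \<noteq> r b" if ab: "a < n" "b < n" "a \<noteq> b" for a b
 proof -
  interpret product_sigma_finite "\<lambda>_. unit_interval" by (rule product_sigma_finite_unit)
  have [measurable]: "(\<lambda>r. r a) \<in> borel_measurable (unit_cube n)" "(\<lambda>r. r b) \<in> borel_measurable (unit_cube n)"
   using unit_cube_coordinate_measurable ab by auto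
  have ins: "{..<n} = insert a ({..<n} - {a})" using ab by auto
  have "(\<integral>\<^sup>+ r. indicator {0} (r a - r b) \<partial>unit_cube n) =
   (\<integral>\<^sup>+ r. (\<integral>\<^sup>+ y. indicator {0} ((r(a := y)) a - (r(a := y)) b) \<partial>unit_interval)
    \<partial>(Pi\<^sub>M ({..<n} - {a}) (\<lambda>_. unit_interval)))"
  proof (subst ins, rule product_nn_integral_insert)
   show "(\<lambda>r. indicator {0} (r a - r b)) \<in> borel_measurable (Pi\<^sub>M (insert a ({..<n} - {a})) (\<lambda>_. unit_interval))"
    unfolding ins[symmetric] by measurable
  qed auto
  also have "\<dots> = (\<integral>\<^sup>+ r. 0 \<partial>(Pi\<^sub>M ({..<n} - {a}) (\<lambda>_. unit_interval)))"
  proof (rule nn_integral_cong)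
   fix r :: "nat \<Rightarrow> real"
   have "(\<integral>\<^sup>+ y. indicator {0} ((r(a := y)) a - (r(a := y)) b) \<partial>unit_interval) =
     (\<integral>\<^sup>+ y. indicator {0} (y - r b) * indicator {0..1} y \<partial>lborel)"
    using ab by (subst nn_integral_restrict_space) auto
   also have "\<dots> \<le> (\<integral>\<^sup>+ y. indicator {r b} y \<partial>lborel)"
    by (intro nn_integral_mono) (auto simp: indicator_def)
   also have "\<dots> = 0" by (subst nn_integral_indicator) auto
   finally show "(\<integral>\<^sup>+ y. indicator {0} ((r(a := y)) a - (r(a := y)) b) \<partial>unit_interval) = 0" by simp
  qed
  finally have "(\<integral>\<^sup>+ r. indicator {0} (r a - r b) \<partial>unit_cube n) = 0" by simp
  then have "AE r in unit_cube n. indicator {0} (r a - r b) = (0::ennreal)"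
   using ab by (subst (asm) nn_integral_0_iff_AE) auto
  then show ?thesis by eventually_elim (auto simp: indicator_def split: if_splits)
 qed
 then have "AE r in unit_cube n. \<forall>a\<in>{..<n}. \<forall>b\<in>{..<n}. a \<noteq> b \<longrightarrow> r a \<noteq> r b"
  by (intro AE_finite_allI) auto
 then show ?thesis by (simp add: Ball_def)
qed

lemma grid_kernel_AE_tendsto:
 assumes "continuous_kernel d n f" "i \<in> index_tuples n d" "\<And>q. 0 < N q" "filterlim N at_top sequentially"
 shows "AE r in unit_cube n. (\<lambda>q. grid_kernel n f (N q) i r) \<longlonglongrightarrow> f i r"
 using AE_unit_cube_positive AE_unit_cube_distinct AE_space
proof eventually_elim
 case (elim r)
 show ?case by (rule grid_kernel_tendsto[OF assms(1,2) elim(3)]) (use elim assms in auto)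
qed

lemma continuous_kernel_L2:
 assumes "continuous_kernel d n f"
 shows "L2_kernel d n f"
 unfolding L2_kernel_def
proof (intro ballI conjI)
 fix i assume i: "i \<in> index_tuples n d"
 show m: "f i \<in> borel_measurable (unit_cube n)" by (rule continuous_kernel_measurable[OF assms i])
 obtain C where "0 \<le> C \<and> (\<forall>i\<in>index_tuples n d. \<forall>r\<in>space (unit_cube n). \<bar>f i r\<bar> \<le> C)"
  using continuous_kernel_bounded[OF assms] ..
 note C = bspec[OF bspec[OF conjunct2[OF this] i]]
 interpret prob_space "unit_cube n" by (rule prob_space_unit_cube)
 show "integrable (unit_cube n) (\<lambda>r. (f i r)^2)"
 proof (rule integrable_const_bound[of _ "C^2"])
  show "AE r in unit_cube n. norm ((f i r)^2) \<le> C^2"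
  proof (rule AE_I2)
   fix r assume "r \<in> space (unit_cube n)"
   then have "\<bar>f i r\<bar> \<le> C" by (rule C)
   from power_mono[OF this, of 2] show "norm ((f i r)^2) \<le> C^2" by simp
  qed
  show "(\<lambda>r. (f i r)^2) \<in> borel_measurable (unit_cube n)" using m by measurable
 qed
qed

lemma continuous_kernel_sym_L2:
 assumes "continuous_kernel d n f"
 shows "sym_L2_kernel d n f"
proof -
 have L: "L2_kernel d n f" by (rule continuous_kernel_L2[OF assms])
 have "L2_kernel d n (\<lambda>i r. 0)" by (simp add: L2_kernel_def)
 then have "kernel_dist_sq d n f (\<lambda>i r. 0) < \<infinity>" using kernel_dist_sq_eq[OF L] by simp
 then show ?thesis using assms unfolding sym_L2_kernel_def continuous_kernel_def symmetric_kernel_def by blast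
qed

lemma grid_kernel_measurable: "0 < N \<Longrightarrow> grid_kernel n f N i \<in> borel_measurable (unit_cube n)"
 using step_kernel_integral(1)[OF is_partition_grid] by blast

lemma grid_kernel_weighted_sq_tendsto:
 assumes f: "continuous_kernel d n f" and N: "\<And>q. 0 < N q" "filterlim N at_top sequentially"
  and E: "Measurable.pred (unit_cube n) E"
 shows "(\<lambda>q. \<Sum>i\<in>index_tuples n d. \<integral>r. (grid_kernel n f (N q) i r)^2 * of_bool (E r) \<partial>unit_cube n) \<longlonglongrightarrow>
   (\<Sum>i\<in>index_tuples n d. \<integral>r. (f i r)^2 * of_bool (E r) \<partial>unit_cube n)"
  and "(\<lambda>q. kernel_diff_sq d n (grid_kernel n f (N q)) f) \<longlonglongrightarrow> 0"
proof -
 interpret P: prob_space "unit_cube n" by (rule prob_space_unit_cube)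
 obtain C where CC: "0 \<le> C \<and> (\<forall>i\<in>index_tuples n d. \<forall>r\<in>space (unit_cube n). \<bar>f i r\<bar> \<le> C)"
  using continuous_kernel_bounded[OF f] ..
 note C = conjunct1[OF CC] bspec[OF bspec[OF conjunct2[OF CC]]]
 note [measurable] = grid_kernel_measurable[OF N(1)] E
 have b: "\<bar>grid_kernel n f (N q) i r\<bar> \<le> C" if "i \<in> index_tuples n d" for q i r
  using C(2)[OF that] C(1) N(1) by (rule grid_kernel_bound)
 show "(\<lambda>q. \<Sum>i\<in>index_tuples n d. \<integral>r. (grid_kernel n f (N q) i r)^2 * of_bool (E r) \<partial>unit_cube n) \<longlonglongrightarrow>
   (\<Sum>i\<in>index_tuples n d. \<integral>r. (f i r)^2 * of_bool (E r) \<partial>unit_cube n)"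
 proof (rule tendsto_sum)
  fix i assume i: "i \<in> index_tuples n d"
  have [measurable]: "f i \<in> borel_measurable (unit_cube n)" by (rule continuous_kernel_measurable[OF f i])
  show "(\<lambda>q. \<integral>r. (grid_kernel n f (N q) i r)^2 * of_bool (E r) \<partial>unit_cube n) \<longlonglongrightarrow> (\<integral>r. (f i r)^2 * of_bool (E r) \<partial>unit_cube n)"
  proof (rule integral_dominated_convergence[where w = "\<lambda>_. C\<^sup>2"])
   show "AE r in unit_cube n. (\<lambda>q. (grid_kernel n f (N q) i r)^2 * of_bool (E r)) \<longlonglongrightarrow> (f i r)^2 * of_bool (E r)"
    using grid_kernel_AE_tendsto[OF f i N] by eventually_elim (intro tendsto_intros)
   show "AE r in unit_cube n. norm ((grid_kernel n f (N q) i r)^2 * of_bool (E r)) \<le> C^2" for q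
   proof (rule AE_I2)
    fix r
    have "(grid_kernel n f (N q) i r)^2 \<le> C^2" using power_mono[OF b[OF i, of q r], of 2] by simp
    then show "norm ((grid_kernel n f (N q) i r)^2 * of_bool (E r)) \<le> C^2" by simp
   qed
  qed auto
 qed
 have "(\<lambda>q. \<Sum>i\<in>index_tuples n d. \<integral>r. (grid_kernel n f (N q) i r - f i r)^2 \<partial>unit_cube n) \<longlonglongrightarrow> (\<Sum>i\<in>index_tuples n d. \<integral>r. 0 \<partial>unit_cube n)"
 proof (rule tendsto_sum)
  fix i assume i: "i \<in> index_tuples n d"
  have [measurable]: "f i \<in> borel_measurable (unit_cube n)" by (rule continuous_kernel_measurable[OF f i])
  show "(\<lambda>q. \<integral>r. (grid_kernel n f (N q) i r - f i r)^2 \<partial>unit_cube n) \<longlonglongrightarrow> (\<integral>r. 0 \<partial>unit_cube n)"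
  proof (rule integral_dominated_convergence[where w = "\<lambda>_. (2 * C)^2"])
   show "AE r in unit_cube n. (\<lambda>q. (grid_kernel n f (N q) i r - f i r)^2) \<longlonglongrightarrow> 0"
    using grid_kernel_AE_tendsto[OF f i N]
   proof eventually_elim
    case (elim r)
    have "(\<lambda>q. (grid_kernel n f (N q) i r - f i r)^2) \<longlonglongrightarrow> (f i r - f i r)^2" by (intro tendsto_intros elim)
    then show ?case by simp
   qed
   show "AE r in unit_cube n. norm ((grid_kernel n f (N q) i r - f i r)^2) \<le> (2 * C)^2" for q
   proof (rule AE_I2)
    fix r assume "r \<in> space (unit_cube n)"
    then have "\<bar>grid_kernel n f (N q) i r - f i r\<bar> \<le> 2 * C" using b[OF i, of q r] C(2)[OF i, of r] by linarith
    then show "norm ((grid_kernel n f (N q) i r - f i r)^2) \<le> (2 * C)^2"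
     using power_mono[of "\<bar>grid_kernel n f (N q) i r - f i r\<bar>" "2 * C" 2] by simp
   qed
  qed auto
 qed
 then show "(\<lambda>q. kernel_diff_sq d n (grid_kernel n f (N q)) f) \<longlonglongrightarrow> 0"
  unfolding kernel_ip_def power2_eq_square by simp
qed

lemma filterlim_mult_Suc: "0 < (J::nat) \<Longrightarrow> filterlim (\<lambda>q. J * Suc q) at_top sequentially"
 by (rule filterlim_at_top_mono[OF filterlim_Suc], rule always_eventually, rule allI)
   (metis Suc_leI One_nat_def mult_le_mono1 mult_1)

lemma continuous_kernel_sym_approximable:
 assumes "continuous_kernel d n f"
 shows "sym_approximable d B n f"
 unfolding sym_approximable_def
proof (intro exI conjI allI)
 fix q :: nat
 show "elementary_integral d B n (grid_kernel n f (1 * Suc q)) (step_form d B n (1 * Suc q) (grid (1 * Suc q)) (grid_coeff n f (1 * Suc q)))"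
  by (rule elementary_integral_grid) simp
 show "symmetric_kernel d n (grid_kernel n f (1 * Suc q))"
  by (rule symmetric_step_kernel[OF is_partition_grid], simp, rule grid_coeff_symmetric[of d])
    (use assms in \<open>simp_all add: continuous_kernel_def\<close>)
next
 show "(\<lambda>q. kernel_diff_sq d n (grid_kernel n f (1 * Suc q)) f) \<longlonglongrightarrow> 0"
  by (rule grid_kernel_weighted_sq_tendsto(2)[OF assms _ filterlim_mult_Suc, where E = "\<lambda>_. True"]) auto
qed

lemma (in brownian_motion) continuous_kernel_multiple_integral:
 assumes "continuous_kernel d n f"
 shows "is_multiple_integral M d B n f (multiple_integral M d B n f)"
proof -
 have "\<exists>X. is_multiple_integral M d B n f X"
  using continuous_kernel_sym_approximable[OF assms, of B] multiple_integral_exists[OF continuous_kernel_L2[OF assms]]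
  unfolding sym_approximable_def by blast
 then show ?thesis unfolding multiple_integral_def by (rule someI_ex)
qed

section \<open>Blocks of time and the central limit theorem\<close>

definition in_block :: "nat \<Rightarrow> nat \<Rightarrow> nat \<Rightarrow> (nat \<Rightarrow> real) \<Rightarrow> bool" where
 "in_block n J j r \<longleftrightarrow> (\<forall>a<n. r a \<in> {real j / real J<..real (Suc j) / real J})"

text \<open>For symmetric \<open>f\<close> and \<open>E\<close> this is the second moment of the multiple integral of \<open>f\<close> restricted to \<open>E\<close>.\<close>

definition kernel_mass :: "nat \<Rightarrow> nat \<Rightarrow> kernel \<Rightarrow> ((nat \<Rightarrow> real) \<Rightarrow> bool) \<Rightarrow> real" where
 "kernel_mass d n f E = fact n * (\<Sum>i\<in>index_tuples n d. \<integral>r. (f i r)^2 * of_bool (E r) \<partial>unit_cube n)"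

abbreviation off_blocks :: "nat \<Rightarrow> nat \<Rightarrow> (nat \<Rightarrow> real) \<Rightarrow> bool" where
 "off_blocks n J \<equiv> \<lambda>r. \<forall>j<J. \<not> in_block n J j r"

lemma pred_in_block: "Measurable.pred (unit_cube n) (in_block n J j)"
proof -
 have "Measurable.pred (unit_cube n) (\<lambda>r. \<forall>a\<in>{..<n}. r a \<in> {real j / real J<..real (Suc j) / real J})"
 proof (rule pred_intros_finite(3))
  fix a assume "a \<in> {..<n}"
  then have [measurable]: "(\<lambda>r. r a) \<in> borel_measurable (unit_cube n)" using unit_cube_coordinate_measurable by simp
  show "Measurable.pred (unit_cube n) (\<lambda>r. r a \<in> {real j / real J<..real (Suc j) / real J})" by measurable
 qed simp
 moreover have "in_block n J j = (\<lambda>r. \<forall>a\<in>{..<n}. r a \<in> {real j / real J<..real (Suc j) / real J})"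
  by (simp add: in_block_def fun_eq_iff Ball_def)
 ultimately show ?thesis by simp
qed

lemma pred_off_block: "Measurable.pred (unit_cube n) (off_blocks n J)"
proof -
 have "Measurable.pred (unit_cube n) (\<lambda>r. \<forall>j\<in>{..<J}. \<not> in_block n J j r)"
 proof (rule pred_intros_finite(3))
  note [measurable] = pred_in_block
  show "Measurable.pred (unit_cube n) (\<lambda>r. \<not> in_block n J j r)" for j by measurable
 qed simp
 then show ?thesis by (simp only: Ball_def lessThan_iff)
qed

text \<open>A property of the set of cells that a multi-index visits corresponds to an event in the cube;
  both restrict the sums in the isometry in the same way.\<close>

lemma fibre_sum_sq_weighted:
 assumes t: "is_partition N t" and off: "offdiagonal d n N c"
  and sym: "\<And>\<pi> i l. \<pi> permutes {..<n} \<Longrightarrow> i \<in> index_tuples n d \<Longrightarrow> l \<in> index_tuples n N \<Longrightarrow> c (i \<circ> \<pi>) (l \<circ> \<pi>) = c i l"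
  and PR: "\<And>i l r. i \<in> index_tuples n d \<Longrightarrow> l \<in> index_tuples n N \<Longrightarrow> (\<And>a. a < n \<Longrightarrow> r a \<in> {t (l a)<..t (Suc (l a))}) \<Longrightarrow>
    R r \<longleftrightarrow> P (pair_image n i l)"
 shows "(\<Sum>S\<in>Pow ({..<d} \<times> {..<N}). of_bool (P S) * ((fibre_sum d n N c S)^2 * cell_volume t S)) =
  kernel_mass d n (step_kernel n N t c) R"
proof -
 define c' where "c' i l = c i l * of_bool (P (pair_image n i l))" for i l
 have off': "offdiagonal d n N c'" unfolding offdiagonal_def
 proof (intro ballI impI)
  fix i l assume il: "i \<in> index_tuples n d" "l \<in> index_tuples n N"
   and "\<exists>a<n. \<exists>b<n. a \<noteq> b \<and> i a = i b \<and> l a = l b"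
  then have "c i l = 0" using off[unfolded offdiagonal_def, rule_format, OF il] by simp
  then show "c' i l = 0" by (simp add: c'_def)
 qed
 have fs: "fibre_sum d n N c' S = of_bool (P S) * fibre_sum d n N c S" for S
 proof -
  have "fibre_sum d n N c' S = (\<Sum>(i, l)\<in>fibre d n N S. of_bool (P S) * c i l)"
   unfolding fibre_sum_def
  proof (rule sum.cong[OF refl], clarify)
   fix i l assume "(i, l) \<in> fibre d n N S"
   then have "pair_image n i l = S" by (simp add: fibre_def)
   then show "c' i l = of_bool (P S) * c i l" by (simp add: c'_def)
  qed
  also have "\<dots> = of_bool (P S) * fibre_sum d n N c S"
   unfolding fibre_sum_def sum_distrib_left by (simp add: case_prod_beta)
  finally show ?thesis .
 qed
 have sk: "step_kernel n N t c i r * step_kernel n N t c' i r = (step_kernel n N t c i r)^2 * of_bool (R r)" if i: "i \<in> index_tuples n d" for i r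
 proof (cases "\<exists>l\<in>index_tuples n N. \<forall>a<n. r a \<in> {t (l a)<..t (Suc (l a))}")
  case True
  then obtain l where l: "l \<in> index_tuples n N" "\<And>a. a < n \<Longrightarrow> r a \<in> {t (l a)<..t (Suc (l a))}" by blast
  have v: "step_kernel n N t b i r = b i l" for b by (rule step_kernel_value[OF t l])
  show ?thesis using PR[OF i l] by (simp add: v c'_def power2_eq_square)
 next
  case False
  have "step_kernel n N t c i r = 0" by (rule step_kernel_zero) (use False in blast)
  then show ?thesis by simp
 qed
 have "(\<Sum>S\<in>Pow ({..<d} \<times> {..<N}). of_bool (P S) * ((fibre_sum d n N c S)^2 * cell_volume t S)) =
   (\<Sum>S\<in>Pow ({..<d} \<times> {..<N}). fibre_sum d n N c S * fibre_sum d n N c' S * cell_volume t S)"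
  unfolding fs by (intro sum.cong refl) (simp add: power2_eq_square)
 also have "\<dots> = fact n * kernel_ip d n (step_kernel n N t c) (step_kernel n N t c')"
  unfolding step_kernel_ip[OF t] using sym off' by (rule fibre_sum_mult)
 also have "\<dots> = kernel_mass d n (step_kernel n N t c) R"
  unfolding kernel_ip_def kernel_mass_def using sk by simp
 finally show ?thesis .
qed

lemma pair_image_subset_iff: "pair_image n i l \<subseteq> A \<longleftrightarrow> (\<forall>a<n. (i a, l a) \<in> A)"
 by (auto simp: pair_image_def)

lemma grid_cell_block_iff:
 assumes J: "0 < J" and q: "0 < q" and x: "x \<in> {grid (J * q) l<..grid (J * q) (Suc l)}"
 shows "x \<in> {real j / real J<..real (Suc j) / real J} \<longleftrightarrow> j * q \<le> l \<and> l < Suc j * q"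
proof -
 have p: "0 < real (J * q)" using J q by simp
 have 1: "real j / real J = real (j * q) / real (J * q)" "real (Suc j) / real J = real (Suc j * q) / real (J * q)"
 proof -
  have c: "x / y = (x * real q) / (y * real q)" for x y :: real using q by simp
  show "real j / real J = real (j * q) / real (J * q)" "real (Suc j) / real J = real (Suc j * q) / real (J * q)"
   unfolding of_nat_mult by (rule c)+
 qed
 have x': "real l < x * real (J * q)" "x * real (J * q) \<le> real (Suc l)"
  using x p by (simp_all add: grid_def divide_less_eq le_divide_eq)
 have "x \<in> {real j / real J<..real (Suc j) / real J} \<longleftrightarrow> real (j * q) < x * real (J * q) \<and> x * real (J * q) \<le> real (Suc j * q)"
  unfolding 1 using p by (simp add: divide_less_eq le_divide_eq del: of_nat_mult)
 also have "\<dots> \<longleftrightarrow> j * q \<le> l \<and> l < Suc j * q"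
 proof
  assume *: "real (j * q) < x * real (J * q) \<and> x * real (J * q) \<le> real (Suc j * q)"
  then have "real (j * q) < real (Suc l)" "real l < real (Suc j * q)" using x' by linarith+
  then show "j * q \<le> l \<and> l < Suc j * q" unfolding of_nat_less_iff by linarith
 next
  assume "j * q \<le> l \<and> l < Suc j * q"
  then have "real (j * q) \<le> real l" "real (Suc l) \<le> real (Suc j * q)" unfolding of_nat_le_iff by linarith+
  then show "real (j * q) < x * real (J * q) \<and> x * real (J * q) \<le> real (Suc j * q)" using x' by linarith
 qed
 finally show ?thesis .
qed

context brownian_motion
begin

text \<open>When the grid refines the blocks, every cell lies in exactly one block, and the sets of cells over
  different blocks carry independent increments.\<close>

lemma grid_form_char_approx:
 assumes f: "symmetric_kernel d n f" and n: "0 < n" and J: "0 < J" and q: "0 < q" and \<eta>: "0 < \<eta>"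
  and V: "V = kernel_mass d n (grid_kernel n f (J * q)) (\<lambda>_. True)"
  and Voff: "Voff = kernel_mass d n (grid_kernel n f (J * q)) (off_blocks n J)"
  and Vb: "\<And>j. j < J \<Longrightarrow> kernel_mass d n (grid_kernel n f (J * q)) (in_block n J j) \<le> \<eta>"
 shows "norm (char (distr M borel (step_form d B n (J * q) (grid (J * q)) (grid_coeff n f (J * q)))) u - exp (- (u^2 * V / 2))) \<le>
  \<bar>u\<bar> * sqrt Voff + u^2 * Voff / 2 + V * lyapunov_error n u \<eta>"
proof -
 let ?N = "J * q" let ?t = "grid ?N" let ?c = "grid_coeff n f ?N"
 have N: "0 < ?N" using J q by simp
 have t: "is_partition ?N ?t" by (rule is_partition_grid[OF N])
 have off: "offdiagonal d n ?N ?c" by (rule offdiagonal_grid_coeff)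
 have sym: "?c (i \<circ> \<pi>) (l \<circ> \<pi>) = ?c i l" if "\<pi> permutes {..<n}" "i \<in> index_tuples n d" "l \<in> index_tuples n ?N" for \<pi> i l
  by (rule grid_coeff_symmetric[OF f N that])
 interpret G: gauss_family M "{..<d} \<times> {..<?N}" "\<lambda>u. ?t (Suc (snd u)) - ?t (snd u)"
  "\<lambda>u w. B (fst u) (?t (Suc (snd u))) w - B (fst u) (?t (snd u)) w"
  by (rule gauss_family_increments[OF t])
 let ?v = "\<lambda>S. (fibre_sum d n ?N ?c S)^2 * (\<Prod>u\<in>S. ?t (Suc (snd u)) - ?t (snd u))"
 define A where "A j = {..<d} \<times> {j * q..<Suc j * q}" for j :: nat
 have Ablock: "in_block n J j r \<longleftrightarrow> pair_image n i l \<subseteq> A j"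
  if "i \<in> index_tuples n d" "l \<in> index_tuples n ?N" "\<And>a. a < n \<Longrightarrow> r a \<in> {?t (l a)<..?t (Suc (l a))}" for i l r j
 proof -
  have "i a < d" if "a < n" for a using PiE_mem[OF \<open>i \<in> index_tuples n d\<close>, of a] that by simp
  then show ?thesis
   unfolding in_block_def pair_image_subset_iff A_def
   using grid_cell_block_iff[OF J q that(3), of _ j] by simp
 qed
 have AU: "A j \<subseteq> {..<d} \<times> {..<?N}" if "j < J" for j
 proof -
  have "Suc j * q \<le> J * q" using that by (intro mult_le_mono1) simp
  then show ?thesis by (auto simp: A_def)
 qed
 have disj: "disjoint_family_on A {..<J}"
  unfolding disjoint_family_on_def
 proof (intro ballI impI)
  fix j k :: nat assume "j \<noteq> k"
  then have "Suc j * q \<le> k * q \<or> Suc k * q \<le> j * q" by (metis Suc_leI linorder_neqE_nat mult_le_mono1)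
  then show "A j \<inter> A k = {}" by (auto simp: A_def)
 qed
 have FS: "(\<Sum>S\<in>Pow ({..<d} \<times> {..<?N}). of_bool (P S) * ?v S) = kernel_mass d n (grid_kernel n f ?N) R"
  if "\<And>i l r. i \<in> index_tuples n d \<Longrightarrow> l \<in> index_tuples n ?N \<Longrightarrow> (\<And>a. a < n \<Longrightarrow> r a \<in> {?t (l a)<..?t (Suc (l a))}) \<Longrightarrow>
    R r \<longleftrightarrow> P (pair_image n i l)" for P R
  using t off sym that by (rule fibre_sum_sq_weighted)
 have V': "V = (\<Sum>S\<in>Pow ({..<d} \<times> {..<?N}). ?v S)"
  unfolding V using FS[of "\<lambda>_. True" "\<lambda>_. True"] by simp
 have Voff': "Voff = (\<Sum>S | S \<subseteq> {..<d} \<times> {..<?N} \<and> (\<forall>j<J. \<not> S \<subseteq> A j). ?v S)"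
 proof -
  have "Voff = (\<Sum>S\<in>Pow ({..<d} \<times> {..<?N}). of_bool (\<forall>j<J. \<not> S \<subseteq> A j) * ?v S)"
   unfolding Voff by (rule FS[symmetric]) (use Ablock in simp)
  also have "\<dots> = (\<Sum>S | S \<subseteq> {..<d} \<times> {..<?N} \<and> (\<forall>j<J. \<not> S \<subseteq> A j). ?v S)"
   by (rule sum.mono_neutral_cong_right) auto
  finally show ?thesis .
 qed
 have Vb': "(\<Sum>S\<in>Pow (A j). ?v S) \<le> \<eta>" if j: "j < J" for j
 proof -
  have "(\<Sum>S\<in>Pow (A j). ?v S) = (\<Sum>S\<in>Pow ({..<d} \<times> {..<?N}). of_bool (S \<subseteq> A j) * ?v S)"
   using AU[OF j] by (intro sum.mono_neutral_cong_left) auto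
  also have "\<dots> = kernel_mass d n (grid_kernel n f ?N) (in_block n J j)"
   by (rule FS) (use Ablock in simp)
  finally show ?thesis using Vb[OF j] by simp
 qed
 show ?thesis
  unfolding step_form_eq_mform[OF off, abs_def]
 proof (rule G.mform_char_approx[OF AU disj _ _ V' Voff' \<eta> Vb'])
  show "fibre_sum d n ?N ?c {} = 0" by (rule fibre_sum_zero) (use n in simp)
  show "fibre_sum d n ?N ?c S = 0" if "n < card S" for S by (rule fibre_sum_zero) (use that in simp)
 qed
qed

text \<open>Passing to the limit along grids that refine the blocks.\<close>

lemma multiple_integral_char_approx:
 assumes f: "continuous_kernel d n f" and X: "is_multiple_integral M d B n f X" and n: "0 < n" and J: "0 < J" and \<eta>: "0 < \<eta>"
  and Vb: "\<And>j. j < J \<Longrightarrow> kernel_mass d n f (in_block n J j) < \<eta>"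
 shows "norm (char (distr M borel X) u - exp (- (u^2 * kernel_mass d n f (\<lambda>_. True) / 2))) \<le>
  \<bar>u\<bar> * sqrt (kernel_mass d n f (off_blocks n J)) + u^2 * kernel_mass d n f (off_blocks n J) / 2 +
  kernel_mass d n f (\<lambda>_. True) * lyapunov_error n u \<eta>"
proof -
 let ?g = "\<lambda>q. grid_kernel n f (J * Suc q)"
 let ?Y = "\<lambda>q. step_form d B n (J * Suc q) (grid (J * Suc q)) (grid_coeff n f (J * Suc q))"
 have N: "0 < J * Suc q" for q using J by simp
 have el: "elementary_integral d B n (?g q) (?Y q)" for q by (rule elementary_integral_grid[OF N])
 have lim: "(\<lambda>q. kernel_diff_sq d n (?g q) f) \<longlonglongrightarrow> 0"
  by (rule grid_kernel_weighted_sq_tendsto(2)[OF f N filterlim_mult_Suc[OF J], where E = "\<lambda>_. True"]) simp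
 have mass: "(\<lambda>q. kernel_mass d n (?g q) E) \<longlonglongrightarrow> kernel_mass d n f E" if "Measurable.pred (unit_cube n) E" for E
  unfolding kernel_mass_def
  by (intro tendsto_mult tendsto_const grid_kernel_weighted_sq_tendsto(1)[OF f N filterlim_mult_Suc[OF J] that])
 note L2 = continuous_kernel_L2[OF f]
 have XM: "X \<in> borel_measurable M" and Xi: "integrable M (\<lambda>w. (X w)^2)"
  by (rule is_multiple_integralE[OF X L2], assumption)+
 have dY: "(\<lambda>q. expectation (\<lambda>w. (?Y q w - X w)^2)) \<longlonglongrightarrow> 0" by (rule multiple_integral_limit[OF X L2 el lim])
 have char: "(\<lambda>q. char (distr M borel (?Y q)) u) \<longlonglongrightarrow> char (distr M borel X) u"
 proof (rule Lim_transform2[OF tendsto_const], rule Lim_null_comparison)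
  have "norm (char (distr M borel X) u - char (distr M borel (?Y q)) u) \<le> \<bar>u\<bar> * sqrt (expectation (\<lambda>w. (?Y q w - X w)^2))" for q
   using char_diff_le[OF elementary_integral_sq(1)[OF el] XM integrable_sq_add(2)[OF elementary_integral_sq(1)[OF el] XM elementary_integral_sq(2)[OF el] Xi], of q u]
   by (simp add: norm_minus_commute)
  then show "\<forall>\<^sub>F q in sequentially. norm (char (distr M borel X) u - char (distr M borel (?Y q)) u) \<le> \<bar>u\<bar> * sqrt (expectation (\<lambda>w. (?Y q w - X w)^2))"
   by (rule always_eventually[OF allI])
  show "(\<lambda>q. \<bar>u\<bar> * sqrt (expectation (\<lambda>w. (?Y q w - X w)^2))) \<longlonglongrightarrow> 0"
   using tendsto_mult_left[OF tendsto_real_sqrt[OF dY], of "\<bar>u\<bar>"] by simp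
 qed
 have "\<forall>\<^sub>F q in sequentially. \<forall>j\<in>{..<J}. kernel_mass d n (?g q) (in_block n J j) < \<eta>"
  using order_tendstoD(2)[OF mass[OF pred_in_block] Vb] by (intro eventually_ball_finite) auto
 then have ev: "\<forall>\<^sub>F q in sequentially. norm (char (distr M borel (?Y q)) u - exp (- (u^2 * kernel_mass d n (?g q) (\<lambda>_. True) / 2))) \<le>
  \<bar>u\<bar> * sqrt (kernel_mass d n (?g q) (off_blocks n J)) + u^2 * kernel_mass d n (?g q) (off_blocks n J) / 2 +
  kernel_mass d n (?g q) (\<lambda>_. True) * lyapunov_error n u \<eta>"
 proof eventually_elim
  case (elim q)
  show ?case
  proof (rule grid_form_char_approx[OF _ n J _ \<eta> refl refl])
   show "symmetric_kernel d n f" using f unfolding continuous_kernel_def by (elim conjE)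
  qed (use elim in \<open>simp_all add: less_imp_le\<close>)
 qed
 show ?thesis
 proof (rule tendsto_le[OF trivial_limit_sequentially _ _ ev])
  show "(\<lambda>q. \<bar>u\<bar> * sqrt (kernel_mass d n (?g q) (off_blocks n J)) + u^2 * kernel_mass d n (?g q) (off_blocks n J) / 2 +
   kernel_mass d n (?g q) (\<lambda>_. True) * lyapunov_error n u \<eta>) \<longlonglongrightarrow>
   \<bar>u\<bar> * sqrt (kernel_mass d n f (off_blocks n J)) + u^2 * kernel_mass d n f (off_blocks n J) / 2 +
   kernel_mass d n f (\<lambda>_. True) * lyapunov_error n u \<eta>"
   by (intro tendsto_add tendsto_mult tendsto_divide tendsto_real_sqrt tendsto_const mass pred_off_block) simp_all
  show "(\<lambda>q. norm (char (distr M borel (?Y q)) u - exp (- (u^2 * kernel_mass d n (?g q) (\<lambda>_. True) / 2)))) \<longlonglongrightarrow>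
   norm (char (distr M borel X) u - exp (- (u^2 * kernel_mass d n f (\<lambda>_. True) / 2)))"
   by (intro tendsto_norm tendsto_diff char tendsto_of_real tendsto_exp tendsto_minus tendsto_divide tendsto_mult tendsto_const mass) simp_all
 qed
qed

end

lemma char_centered_normal:
 assumes "0 \<le> s"
 shows "char (centered_normal s) u = exp (- (u^2 * s / 2))"
proof -
 interpret S: prob_space std_normal_distribution using prob_space_normal_density[of 1 0] by simp
 have "char (centered_normal s) u = (CLINT z|std_normal_distribution. iexp (u * (sqrt s * z)))"
  unfolding centered_normal_def by (rule S.char_distr_eq) simp
 also have "\<dots> = char std_normal_distribution (u * sqrt s)"
  unfolding char_def by (simp add: mult.assoc)
 also have "\<dots> = exp (- (u^2 * s / 2))"
  using assms by (simp add: char_std_normal_distribution power_mult_distrib)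
 finally show ?thesis .
qed

lemma real_distribution_centered_normal: "real_distribution (centered_normal s)"
proof -
 interpret S: prob_space std_normal_distribution using prob_space_normal_density[of 1 0] by simp
 show ?thesis unfolding centered_normal_def by (rule S.real_distribution_distr) simp
qed

text \<open>Asymptotic normality inside a fixed chaos: it is enough that the variances converge, that the
  kernels leave no mass outside the diagonal blocks, however fine, and that no block is dominant.\<close>

theorem (in brownian_motion) multiple_integral_clt:
 assumes f: "\<And>q. continuous_kernel d n (f q)" and X: "\<And>q. is_multiple_integral M d B n (f q) (X q)" and n: "0 < n"
  and V: "(\<lambda>q. kernel_mass d n (f q) (\<lambda>_. True)) \<longlonglongrightarrow> s"
  and Voff: "\<And>J. 0 < J \<Longrightarrow> (\<lambda>q. kernel_mass d n (f q) (off_blocks n J)) \<longlonglongrightarrow> 0"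
  and C: "0 \<le> C" and Vb: "\<And>J. 0 < J \<Longrightarrow> \<forall>\<^sub>F q in sequentially. \<forall>j<J. kernel_mass d n (f q) (in_block n J j) \<le> C / real J"
 shows "weak_conv_m (\<lambda>q. distr M borel (X q)) (centered_normal s)"
proof (rule levy_continuity)
 let ?m = "\<lambda>q. kernel_mass d n (f q)"
 show "real_distribution (distr M borel (X q))" for q
  using X[of q] by (intro real_distribution_distr) (simp add: is_multiple_integral_def)
 show "real_distribution (centered_normal s)" by (rule real_distribution_centered_normal)
 have s0: "0 \<le> s"
 proof (rule tendsto_lowerbound[OF V])
  show "\<forall>\<^sub>F q in sequentially. 0 \<le> ?m q (\<lambda>_. True)"
   unfolding kernel_mass_def by (intro always_eventually allI mult_nonneg_nonneg sum_nonneg) auto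
 qed simp
 fix u :: real
 (* The error for J blocks, with slack for the convergence of the masses. *)
 define K where "K J = (s + 1) * lyapunov_error n u ((C + 1) / real J)" for J
 have inv: "(\<lambda>J. (C + 1) / real J) \<longlonglongrightarrow> 0" by (rule tendsto_divide_0[OF tendsto_const filterlim_at_top_imp_at_infinity[OF filterlim_real_sequentially]])
 have K: "K \<longlonglongrightarrow> 0"
 proof -
  have "K \<longlonglongrightarrow> (s + 1) * (\<bar>u\<bar> ^ 3 * sqrt 0 * (1 + 9 ^ n) / 12 + u ^ 4 * 0 / 4)"
   unfolding K_def by (intro tendsto_add tendsto_mult tendsto_divide tendsto_real_sqrt tendsto_const inv) simp_all
  then show ?thesis by simp
 qed
 have "(\<lambda>q. char (distr M borel (X q)) u - exp (- (u^2 * ?m q (\<lambda>_. True) / 2))) \<longlonglongrightarrow> 0"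
 proof (rule tendstoI)
  fix e :: real assume e: "0 < e"
  have "\<forall>\<^sub>F J in sequentially. K J < e / 2" using order_tendstoD(2)[OF K, of "e / 2"] e by simp
  then have "\<forall>\<^sub>F J in sequentially. K J < e / 2 \<and> 0 < J" using eventually_gt_at_top[of 0] by eventually_elim simp
  then obtain J where J: "K J < e / 2" "0 < J" unfolding eventually_sequentially by blast
  have "(\<lambda>q. \<bar>u\<bar> * sqrt (?m q (off_blocks n J)) + u^2 * ?m q (off_blocks n J) / 2) \<longlonglongrightarrow>
    \<bar>u\<bar> * sqrt 0 + u^2 * 0 / 2"
   by (intro tendsto_add tendsto_mult tendsto_divide tendsto_real_sqrt tendsto_const Voff J) simp_all
  then have "\<forall>\<^sub>F q in sequentially. \<bar>u\<bar> * sqrt (?m q (off_blocks n J)) + u^2 * ?m q (off_blocks n J) / 2 < e / 2"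
   by (rule order_tendstoD(2)) (use e in simp)
  moreover have "\<forall>\<^sub>F q in sequentially. ?m q (\<lambda>_. True) < s + 1"
   by (rule order_tendstoD(2)[OF V]) simp
  ultimately show "\<forall>\<^sub>F q in sequentially. dist (char (distr M borel (X q)) u - exp (- (u^2 * ?m q (\<lambda>_. True) / 2))) 0 < e"
   using Vb[OF J(2)]
  proof eventually_elim
   case (elim q)
   have lt: "C / real J < (C + 1) / real J" using J(2) by (intro divide_strict_right_mono) auto
   have "norm (char (distr M borel (X q)) u - exp (- (u^2 * ?m q (\<lambda>_. True) / 2))) \<le>
    \<bar>u\<bar> * sqrt (?m q (off_blocks n J)) + u^2 * ?m q (off_blocks n J) / 2 +
    ?m q (\<lambda>_. True) * lyapunov_error n u ((C + 1) / real J)"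
    by (rule multiple_integral_char_approx[OF f X n J(2)]) (use C J(2) elim(3) lt in \<open>auto intro: le_less_trans\<close>)
   also have "?m q (\<lambda>_. True) * lyapunov_error n u ((C + 1) / real J) \<le> K J"
    unfolding K_def using elim(2) C by (intro mult_right_mono add_nonneg_nonneg) auto
   finally show ?case using elim(1) J(1) by (simp add: dist_norm)
  qed
 qed
 moreover have "(\<lambda>q. complex_of_real (exp (- (u^2 * ?m q (\<lambda>_. True) / 2)))) \<longlonglongrightarrow> complex_of_real (exp (- (u^2 * s / 2)))"
  by (intro tendsto_of_real tendsto_exp tendsto_minus tendsto_divide tendsto_mult tendsto_const V) simp_all
 ultimately have "(\<lambda>q. (char (distr M borel (X q)) u - exp (- (u^2 * ?m q (\<lambda>_. True) / 2))) +
   complex_of_real (exp (- (u^2 * ?m q (\<lambda>_. True) / 2)))) \<longlonglongrightarrow> 0 + complex_of_real (exp (- (u^2 * s / 2)))"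
  by (rule tendsto_add)
 then show "(\<lambda>q. char (distr M borel (X q)) u) \<longlonglongrightarrow> char (centered_normal s) u"
  by (simp add: char_centered_normal[OF s0])
qed

section \<open>Derivatives of the Gaussian density\<close>

text \<open>The \<open>k\<close>-th derivative of the centered Gaussian density of variance \<open>s\<close>, given by the three-term
  recurrence of the Hermite polynomials.\<close>

fun gauss_deriv :: "nat \<Rightarrow> real \<Rightarrow> real \<Rightarrow> real" where
 "gauss_deriv 0 s x = (2 * pi * s) powr (- (1 / 2)) * exp (- x\<^sup>2 / (2 * s))"
| "gauss_deriv (Suc k) s x = - (x * gauss_deriv k s x + real k * gauss_deriv (k - 1) s x) / s"

declare gauss_deriv.simps [simp del]

lemma gauss_deriv_has_derivative:
 assumes s: "0 < s"
 shows "(gauss_deriv k s has_real_derivative gauss_deriv (Suc k) s x) (at x)"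
proof (induction k arbitrary: x rule: less_induct)
 case (less k)
 show ?case
 proof (cases k)
  case 0
  have "((\<lambda>x. (2 * pi * s) powr (- (1 / 2)) * exp (- x\<^sup>2 / (2 * s))) has_real_derivative
    (2 * pi * s) powr (- (1 / 2)) * (exp (- x\<^sup>2 / (2 * s)) * (- (2 * x) / (2 * s)))) (at x)"
   using s by (auto intro!: derivative_eq_intros)
  then show ?thesis using s 0 by (simp add: gauss_deriv.simps[abs_def] mult_ac)
 next
  case (Suc j)
  have 1: "(gauss_deriv j s has_real_derivative gauss_deriv (Suc j) s x) (at x)" using less Suc by simp
  have 2: "((\<lambda>x. real j * gauss_deriv (j - 1) s x) has_real_derivative real j * gauss_deriv j s x) (at x)"
  proof (cases j)
   case (Suc i)
   then show ?thesis using less[of i x] \<open>k = Suc j\<close> by (intro DERIV_cmult) simp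
  qed simp
  have "((\<lambda>x. - (x * gauss_deriv j s x + real j * gauss_deriv (j - 1) s x) / s) has_real_derivative
    - ((1 * gauss_deriv j s x + gauss_deriv (Suc j) s x * x) + real j * gauss_deriv j s x) / s) (at x)"
   by (intro DERIV_cdivide DERIV_minus DERIV_add DERIV_mult DERIV_ident 1 2)
  moreover have "- ((1 * gauss_deriv j s x + gauss_deriv (Suc j) s x * x) + real j * gauss_deriv j s x) / s =
    gauss_deriv (Suc (Suc j)) s x"
   by (simp add: gauss_deriv.simps(2)[of "Suc j"] algebra_simps)
  moreover have "gauss_deriv k s = (\<lambda>x. - (x * gauss_deriv j s x + real j * gauss_deriv (j - 1) s x) / s)"
   by (simp add: Suc gauss_deriv.simps(2) fun_eq_iff)
  ultimately show ?thesis using Suc by simp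
 qed
qed

lemma power_mult_exp_minus_le:
 fixes y :: real
 assumes "0 \<le> y"
 shows "y ^ j * exp (- y) \<le> real j ^ j"
proof (cases "j = 0")
 case True
 then show ?thesis using assms by simp
next
 case False
 have "(y / real j) ^ j \<le> (1 + y / real j) ^ j" using assms by (intro power_mono) auto
 also have "\<dots> \<le> exp y" using assms False by (intro exp_ge_one_plus_x_over_n_power_n) auto
 finally have "y ^ j \<le> exp y * real j ^ j" using False by (simp add: power_divide divide_le_eq)
 then show ?thesis by (simp add: exp_minus divide_simps mult.commute)
qed

lemma gauss_deriv_weighted_bounded:
 assumes s: "0 < s"
 shows "\<exists>C. \<forall>x. \<bar>x\<bar> ^ j * \<bar>gauss_deriv k s x\<bar> \<le> C"
proof (induction k arbitrary: j rule: less_induct)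
 case (less k)
 show ?case
 proof (cases k)
  case 0
  define D where "D = (2 * pi * s) powr (- (1 / 2))"
  have "\<bar>x\<bar> ^ j * \<bar>gauss_deriv k s x\<bar> \<le> D * (1 + (2 * s) ^ j * real j ^ j)" for x
  proof -
   define y where "y = x^2 / (2 * s)"
   have y: "0 \<le> y" "x^2 = 2 * s * y" using s by (auto simp: y_def)
   have "0 \<le> (\<bar>x\<bar> ^ j - 1)^2" "0 \<le> \<bar>x\<bar> ^ j" by simp_all
   then have "\<bar>x\<bar> ^ j \<le> 1 + (\<bar>x\<bar> ^ j)^2" unfolding power2_diff one_power2 mult_1_right by linarith
   also have "(\<bar>x\<bar> ^ j)^2 = (\<bar>x\<bar>\<^sup>2) ^ j" by (simp only: power_mult[symmetric] mult.commute)
   also have "\<dots> = (2 * s) ^ j * y ^ j" by (simp only: power2_abs y(2) power_mult_distrib)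
   finally have "\<bar>x\<bar> ^ j * exp (- y) \<le> (1 + (2 * s) ^ j * y ^ j) * exp (- y)" by (intro mult_right_mono) auto
   also have "\<dots> = exp (- y) + (2 * s) ^ j * (y ^ j * exp (- y))" by (simp add: algebra_simps)
   also have "\<dots> \<le> 1 + (2 * s) ^ j * real j ^ j"
    using y(1) s by (intro add_mono mult_left_mono power_mult_exp_minus_le) auto
   finally have "D * (\<bar>x\<bar> ^ j * exp (- y)) \<le> D * (1 + (2 * s) ^ j * real j ^ j)"
    by (intro mult_left_mono) (auto simp: D_def)
   then show ?thesis by (simp add: 0 gauss_deriv.simps abs_mult D_def y_def mult_ac)
  qed
  then show ?thesis by blast
 next
  case (Suc i)
  obtain C1 where C1: "\<forall>x. \<bar>x\<bar> ^ Suc j * \<bar>gauss_deriv i s x\<bar> \<le> C1" using less[of i "Suc j"] Suc by auto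
  have "i - 1 < k" using Suc by simp
  from less[OF this, of j] obtain C2 where C2: "\<forall>x. \<bar>x\<bar> ^ j * \<bar>gauss_deriv (i - 1) s x\<bar> \<le> C2" ..
  have "\<bar>x\<bar> ^ j * \<bar>gauss_deriv k s x\<bar> \<le> (C1 + real i * C2) / s" for x
  proof -
   have "\<bar>gauss_deriv k s x\<bar> = \<bar>x * gauss_deriv i s x + real i * gauss_deriv (i - 1) s x\<bar> / s"
    using s by (simp add: Suc gauss_deriv.simps(2))
   also have "\<dots> \<le> (\<bar>x\<bar> * \<bar>gauss_deriv i s x\<bar> + real i * \<bar>gauss_deriv (i - 1) s x\<bar>) / s"
    using s abs_triangle_ineq[of "x * gauss_deriv i s x" "real i * gauss_deriv (i - 1) s x"]
    by (intro divide_right_mono) (auto simp: abs_mult)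
   finally have "\<bar>x\<bar> ^ j * \<bar>gauss_deriv k s x\<bar> \<le> \<bar>x\<bar> ^ j * ((\<bar>x\<bar> * \<bar>gauss_deriv i s x\<bar> + real i * \<bar>gauss_deriv (i - 1) s x\<bar>) / s)"
    by (intro mult_left_mono) auto
   also have "\<dots> = (\<bar>x\<bar> ^ Suc j * \<bar>gauss_deriv i s x\<bar> + real i * (\<bar>x\<bar> ^ j * \<bar>gauss_deriv (i - 1) s x\<bar>)) / s"
    by (simp add: algebra_simps)
   also have "\<dots> \<le> (C1 + real i * C2) / s"
    using C1 C2 s by (intro divide_right_mono add_mono mult_left_mono) auto
   finally show ?thesis .
  qed
  then show ?thesis by blast
 qed
qed

lemma gauss_deriv_bounded: "0 < s \<Longrightarrow> \<exists>C. \<forall>x. \<bar>gauss_deriv k s x\<bar> \<le> C"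
 using gauss_deriv_weighted_bounded[of s 0 k] by simp

lemma gauss_deriv_measurable [measurable]: "0 < s \<Longrightarrow> gauss_deriv k s \<in> borel_measurable borel"
 by (intro borel_measurable_continuous_onI continuous_at_imp_continuous_on ballI DERIV_isCont[OF gauss_deriv_has_derivative])

lemma gauss_deriv_0_eq_normal_density: "0 < s \<Longrightarrow> gauss_deriv 0 s x = normal_density 0 (sqrt s) x"
 by (simp add: gauss_deriv.simps normal_density_def powr_minus_divide powr_half_sqrt mult.commute)

abbreviation gauss_measure :: "real \<Rightarrow> real measure" where
 "gauss_measure v \<equiv> density lborel (\<lambda>x. ennreal (normal_density 0 (sqrt v) x))"

abbreviation gauss_product :: "'a set \<Rightarrow> ('a \<Rightarrow> real) \<Rightarrow> ('a \<Rightarrow> real) measure" where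
 "gauss_product A v \<equiv> Pi\<^sub>M A (\<lambda>u. gauss_measure (v u))"

lemma prob_space_gauss_measure: "0 < v \<Longrightarrow> prob_space (gauss_measure v)"
 by (rule prob_space_normal_density) simp

lemma gauss_measure_moments:
 assumes "0 < v"
 shows "integrable (gauss_measure v) (\<lambda>y. y)" "(\<integral>y. y \<partial>gauss_measure v) = 0"
  "integrable (gauss_measure v) (\<lambda>y. \<bar>y\<bar>)"
proof -
 show 1: "integrable (gauss_measure v) (\<lambda>y. y)"
  using integrable_normal_moment_nz_1[of "sqrt v" 0] assms by (subst integrable_real_density) (auto simp: normal_density_nonneg)
 show "(\<integral>y. y \<partial>gauss_measure v) = 0"
  using integral_normal_moment_nz_1[of "sqrt v" 0] assms by (subst integral_real_density) (auto simp: normal_density_nonneg)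
 show "integrable (gauss_measure v) (\<lambda>y. \<bar>y\<bar>)" by (rule integrable_abs[OF 1])
qed

text \<open>The heat semigroup acts on derivatives of the Gaussian density by increasing the variance.\<close>

lemma gauss_deriv_convolution:
 assumes s: "0 < s" and v: "0 < v"
 shows "(\<integral>y. gauss_deriv k s (x + y) \<partial>gauss_measure v) = gauss_deriv k (s + v) x"
proof (induction k arbitrary: x)
 case 0
 have "ennreal (normal_density 0 (sqrt (s + v)) (- x)) =
   (\<integral>\<^sup>+ y. ennreal (normal_density 0 (sqrt s) (- x - y) * normal_density 0 (sqrt v) y) \<partial>lborel)"
  using fun_cong[OF conv_normal_density_zero_mean[of "sqrt s" "sqrt v"], of "- x"] s v by simp
 moreover have "normal_density 0 (sqrt s) (- x - y) = gauss_deriv 0 s (x + y)" for y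
 proof -
  have "(- x - y - 0)^2 = (x + y - 0)^2" by (simp add: power2_eq_square algebra_simps)
  then show ?thesis unfolding gauss_deriv_0_eq_normal_density[OF s] normal_density_def by (simp only:)
 qed
 moreover have "normal_density 0 (sqrt (s + v)) (- x) = gauss_deriv 0 (s + v) x"
  using s v by (simp add: gauss_deriv_0_eq_normal_density normal_density_def)
 ultimately have e: "(\<integral>\<^sup>+ y. ennreal (gauss_deriv 0 s (x + y) * normal_density 0 (sqrt v) y) \<partial>lborel) = ennreal (gauss_deriv 0 (s + v) x)"
  by simp
 have "(\<integral>y. gauss_deriv 0 s (x + y) \<partial>gauss_measure v) = (\<integral>y. normal_density 0 (sqrt v) y * gauss_deriv 0 s (x + y) \<partial>lborel)"
  using s v by (subst integral_real_density) (auto simp: normal_density_nonneg)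
 also have "\<dots> = gauss_deriv 0 (s + v) x"
  using s v e by (subst integral_eq_nn_integral)
   (auto simp: normal_density_nonneg gauss_deriv_0_eq_normal_density mult.commute)
 finally show ?case .
next
 case (Suc k)
 interpret G: prob_space "gauss_measure v" by (rule prob_space_gauss_measure[OF v])
 obtain C0 where "\<forall>x. \<bar>gauss_deriv k s x\<bar> \<le> C0" using gauss_deriv_bounded[OF s] ..
 note C0 = spec[OF this]
 obtain C1 where "\<forall>x. \<bar>gauss_deriv (Suc k) s x\<bar> \<le> C1" using gauss_deriv_bounded[OF s] ..
 note C1 = spec[OF this]
 obtain C2 where "\<forall>x. \<bar>gauss_deriv (Suc (Suc k)) s x\<bar> \<le> C2" using gauss_deriv_bounded[OF s] ..
 note C2 = spec[OF this]
 have C20: "0 \<le> C2" using C2[of 0] by linarith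
 have [measurable]: "gauss_deriv j s \<in> borel_measurable borel" for j by (rule gauss_deriv_measurable[OF s])
 have i0: "integrable (gauss_measure v) (\<lambda>y. gauss_deriv k s (x + y))" for x
  using C0 by (intro G.integrable_const_bound[of _ C0]) auto
 have i1: "integrable (gauss_measure v) (\<lambda>y. gauss_deriv (Suc k) s (x + y))" for x
  using C1 by (intro G.integrable_const_bound[of _ C1]) auto
 have taylor: "\<bar>gauss_deriv k s (z + h) - gauss_deriv k s z - h * gauss_deriv (Suc k) s z\<bar> \<le> C2 * h^2" for z h
 proof -
  have lip: "\<bar>gauss_deriv (Suc k) s a - gauss_deriv (Suc k) s z\<bar> \<le> C2 * \<bar>a - z\<bar>" for a
   using field_differentiable_bound[of UNIV "gauss_deriv (Suc k) s" "gauss_deriv (Suc (Suc k)) s" C2 a z]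
    gauss_deriv_has_derivative[OF s] C2 by simp
  have "((\<lambda>x. gauss_deriv k s x - x * gauss_deriv (Suc k) s z) has_real_derivative (gauss_deriv (Suc k) s a - 1 * gauss_deriv (Suc k) s z)) (at a)" for a
   by (intro DERIV_diff gauss_deriv_has_derivative[OF s] DERIV_cmult_right DERIV_ident)
  then have "\<bar>(gauss_deriv k s (z + h) - (z + h) * gauss_deriv (Suc k) s z) - (gauss_deriv k s z - z * gauss_deriv (Suc k) s z)\<bar> \<le> (C2 * \<bar>h\<bar>) * \<bar>(z + h) - z\<bar>"
   using field_differentiable_bound[of "cball z \<bar>h\<bar>" "\<lambda>x. gauss_deriv k s x - x * gauss_deriv (Suc k) s z" "\<lambda>a. gauss_deriv (Suc k) s a - 1 * gauss_deriv (Suc k) s z" "C2 * \<bar>h\<bar>" "z + h" z]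
    order_trans[OF lip mult_left_mono[OF _ C20]]
   by (simp add: dist_real_def abs_minus_commute has_field_derivative_at_within)
  then show ?thesis by (simp add: algebra_simps power2_eq_square abs_mult_self_eq)
 qed
 have "(gauss_deriv k (s + v) has_real_derivative (\<integral>y. gauss_deriv (Suc k) s (x + y) \<partial>gauss_measure v)) (at x)"
 proof (unfold DERIV_def, rule LIM_zero_cancel, rule Lim_null_comparison)
  have "norm ((gauss_deriv k (s + v) (x + h) - gauss_deriv k (s + v) x) / h - (\<integral>y. gauss_deriv (Suc k) s (x + y) \<partial>gauss_measure v)) \<le> C2 * \<bar>h\<bar>"
   if h: "h \<noteq> 0" for h
  proof -
   have eq: "gauss_deriv k (s + v) (x + h) - gauss_deriv k (s + v) x - h * (\<integral>y. gauss_deriv (Suc k) s (x + y) \<partial>gauss_measure v) =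
     (\<integral>y. gauss_deriv k s ((x + y) + h) - gauss_deriv k s (x + y) - h * gauss_deriv (Suc k) s (x + y) \<partial>gauss_measure v)"
    using i0[of x] i0[of "x + h"] i1[of x] Suc.IH[of x] Suc.IH[of "x + h"] by (simp add: ac_simps)
   have "\<bar>gauss_deriv k (s + v) (x + h) - gauss_deriv k (s + v) x - h * (\<integral>y. gauss_deriv (Suc k) s (x + y) \<partial>gauss_measure v)\<bar> \<le>
     (\<integral>y. \<bar>gauss_deriv k s ((x + y) + h) - gauss_deriv k s (x + y) - h * gauss_deriv (Suc k) s (x + y)\<bar> \<partial>gauss_measure v)"
    unfolding eq by (rule integral_abs_bound)
   also have "\<dots> \<le> (\<integral>y. C2 * h^2 \<partial>gauss_measure v)"
   proof (rule integral_mono)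
    have "integrable (gauss_measure v) (\<lambda>y. gauss_deriv k s ((x + y) + h))" 
    proof -
     have e: "x + h + y = (x + y) + h" for y by simp
     show ?thesis using i0[of "x + h"] unfolding e .
    qed
    then show "integrable (gauss_measure v) (\<lambda>y. \<bar>gauss_deriv k s ((x + y) + h) - gauss_deriv k s (x + y) - h * gauss_deriv (Suc k) s (x + y)\<bar>)"
     by (intro integrable_abs Bochner_Integration.integrable_diff integrable_mult_right i0 i1)
    show "\<bar>gauss_deriv k s ((x + y) + h) - gauss_deriv k s (x + y) - h * gauss_deriv (Suc k) s (x + y)\<bar> \<le> C2 * h^2" for y
     by (rule taylor)
   qed simp
   also have "\<dots> = C2 * h^2" using G.prob_space by simp
   finally have le: "\<bar>gauss_deriv k (s + v) (x + h) - gauss_deriv k (s + v) x - h * (\<integral>y. gauss_deriv (Suc k) s (x + y) \<partial>gauss_measure v)\<bar> \<le> C2 * h^2" .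
   have "\<bar>(gauss_deriv k (s + v) (x + h) - gauss_deriv k (s + v) x - h * (\<integral>y. gauss_deriv (Suc k) s (x + y) \<partial>gauss_measure v)) / h\<bar> \<le> (C2 * h^2) / \<bar>h\<bar>"
    unfolding abs_divide by (rule divide_right_mono[OF le]) simp
   also have "h^2 = \<bar>h\<bar> * \<bar>h\<bar>" by (simp add: power2_eq_square)
   also have "C2 * (\<bar>h\<bar> * \<bar>h\<bar>) / \<bar>h\<bar> = C2 * \<bar>h\<bar>"
   proof -
    have "c * (a * a) / a = c * a" if "a \<noteq> 0" for a c :: real using that by simp
    then show ?thesis using h by (simp only: abs_eq_0 not_False_eq_True)
   qed
   finally show ?thesis using h by (simp add: diff_divide_distrib)
  qed
  then show "\<forall>\<^sub>F h in at 0. norm ((gauss_deriv k (s + v) (x + h) - gauss_deriv k (s + v) x) / h - (\<integral>y. gauss_deriv (Suc k) s (x + y) \<partial>gauss_measure v)) \<le> C2 * \<bar>h\<bar>"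
   by (auto simp: eventually_at_filter)
  show "((\<lambda>h. C2 * \<bar>h\<bar>) \<longlongrightarrow> 0) (at 0)" by (auto intro!: tendsto_eq_intros)
 qed
 then show ?case using DERIV_unique[OF _ gauss_deriv_has_derivative[of "s + v" k x]] s v by simp
qed

text \<open>Gaussian integration by parts, read off from the recurrence.\<close>

lemma gauss_deriv_convolution_times:
 assumes s: "0 < s" and v: "0 < v"
 shows "(\<integral>y. gauss_deriv k s (x + y) * y \<partial>gauss_measure v) = v * gauss_deriv (Suc k) (s + v) x"
proof -
 interpret G: prob_space "gauss_measure v" by (rule prob_space_gauss_measure[OF v])
 have [measurable]: "gauss_deriv j s \<in> borel_measurable borel" for j by (rule gauss_deriv_measurable[OF s])
 have i: "integrable (gauss_measure v) (\<lambda>y. gauss_deriv j s (x + y))" for j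
 proof -
  obtain C where "\<forall>x. \<bar>gauss_deriv j s x\<bar> \<le> C" using gauss_deriv_bounded[OF s] ..
  then show ?thesis by (intro G.integrable_const_bound[of _ C]) auto
 qed
 have iy: "integrable (gauss_measure v) (\<lambda>y. gauss_deriv k s (x + y) * y)"
 proof -
  obtain C where C: "\<forall>x. \<bar>gauss_deriv k s x\<bar> \<le> C" using gauss_deriv_bounded[OF s] ..
  show ?thesis
  proof (rule Bochner_Integration.integrable_bound)
   show "integrable (gauss_measure v) (\<lambda>y. C * \<bar>y\<bar>)" using gauss_measure_moments(3)[OF v] by simp
   show "AE y in gauss_measure v. norm (gauss_deriv k s (x + y) * y) \<le> norm (C * \<bar>y\<bar>)"
   proof (rule AE_I2)
    fix y :: real
    have "\<bar>gauss_deriv k s (x + y)\<bar> * \<bar>y\<bar> \<le> C * \<bar>y\<bar>" using C by (intro mult_right_mono) auto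
    moreover have "0 \<le> C" by (rule order_trans[OF abs_ge_zero spec[OF C]])
    ultimately show "norm (gauss_deriv k s (x + y) * y) \<le> norm (C * \<bar>y\<bar>)" by (simp add: abs_mult)
   qed
  qed measurable
 qed
 have r: "s * gauss_deriv (Suc k) s z = - z * gauss_deriv k s z - real k * gauss_deriv (k - 1) s z" for z
  using s by (simp add: gauss_deriv.simps(2))
 have r': "(s + v) * gauss_deriv (Suc k) (s + v) x = - x * gauss_deriv k (s + v) x - real k * gauss_deriv (k - 1) (s + v) x"
  using s v by (simp add: gauss_deriv.simps(2))
 have "s * gauss_deriv (Suc k) (s + v) x = (\<integral>y. s * gauss_deriv (Suc k) s (x + y) \<partial>gauss_measure v)"
  by (simp add: gauss_deriv_convolution[OF s v])
 also have "\<dots> = (\<integral>y. - x * gauss_deriv k s (x + y) - gauss_deriv k s (x + y) * y - real k * gauss_deriv (k - 1) s (x + y) \<partial>gauss_measure v)"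
  unfolding r by (intro Bochner_Integration.integral_cong refl) (simp add: algebra_simps)
 also have "\<dots> = - x * gauss_deriv k (s + v) x - (\<integral>y. gauss_deriv k s (x + y) * y \<partial>gauss_measure v) - real k * gauss_deriv (k - 1) (s + v) x"
  using i iy by (simp add: gauss_deriv_convolution[OF s v])
 finally show ?thesis using r' by (simp add: algebra_simps)
qed

lemma gauss_deriv_convolution_power:
 assumes "0 < s" "0 < v" "e \<le> 1"
 shows "(\<integral>y. gauss_deriv k s (x + y) * y ^ e \<partial>gauss_measure v) = v ^ e * gauss_deriv (k + e) (s + v) x"
proof (cases e)
 case 0
 then show ?thesis using gauss_deriv_convolution[OF assms(1,2), of k x] by simp
next
 case (Suc e')
 then have "e = 1" using assms(3) by simp
 then show ?thesis using gauss_deriv_convolution_times[OF assms(1,2), of k x] by simp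
qed

text \<open>Integrating out one variable after the other. The map \<open>\<pi>\<close> tells to which of the \<open>d\<close> sums a variable
  contributes; variables with \<open>d \<le> \<pi> u\<close> contribute to none.\<close>

lemma gauss_deriv_product_integral:
 fixes A :: "'a set" and v :: "'a \<Rightarrow> real" and \<pi> :: "'a \<Rightarrow> nat"
 assumes "finite A" "S \<subseteq> A" and v: "\<And>u. 0 < v u" and "\<And>j. j < d \<Longrightarrow> 0 < \<sigma> j"
 shows "integrable (gauss_product A v) (\<lambda>y. (\<Prod>j<d. gauss_deriv (k j) (\<sigma> j) (x j + (\<Sum>u | u \<in> A \<and> \<pi> u = j. y u))) * (\<Prod>u\<in>S. y u)) \<and>
  (\<integral>y. (\<Prod>j<d. gauss_deriv (k j) (\<sigma> j) (x j + (\<Sum>u | u \<in> A \<and> \<pi> u = j. y u))) * (\<Prod>u\<in>S. y u) \<partial>gauss_product A v) =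
  (if \<forall>u\<in>S. \<pi> u < d then (\<Prod>u\<in>S. v u) * (\<Prod>j<d. gauss_deriv (k j + card {u \<in> S. \<pi> u = j}) (\<sigma> j + (\<Sum>u | u \<in> A \<and> \<pi> u = j. v u)) (x j)) else 0)"
 using assms(1,2,4)
proof (induction A arbitrary: S k \<sigma> x rule: finite_induct)
 case empty
 interpret E: prob_space "gauss_product {} v" by (intro prob_space_PiM prob_space_gauss_measure v)
 have "S = {}" using empty by simp
 then have c: "(\<lambda>y. (\<Prod>j<d. gauss_deriv (k j) (\<sigma> j) (x j + (\<Sum>u | u \<in> {} \<and> \<pi> u = j. y u))) * (\<Prod>u\<in>S. y u)) =
   (\<lambda>y. \<Prod>j<d. gauss_deriv (k j) (\<sigma> j) (x j))"
  by (simp add: fun_eq_iff)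
 have intC: "(\<integral>y. C \<partial>gauss_product {} v) = C" for C :: real
  by (simp only: lebesgue_integral_const E.prob_space scaleR_one)
 show ?case unfolding c intC
  by (intro conjI E.integrable_const) (simp add: \<open>S = {}\<close>)
next
 case (insert u A)
 interpret P: product_sigma_finite "\<lambda>u. gauss_measure (v u)"
  unfolding product_sigma_finite_def by (intro allI prob_space_imp_sigma_finite prob_space_gauss_measure v)
 interpret PA: prob_space "gauss_product A v" by (intro prob_space_PiM prob_space_gauss_measure v)
 define f where "f = (\<lambda>y. (\<Prod>j<d. gauss_deriv (k j) (\<sigma> j) (x j + (\<Sum>w | w \<in> insert u A \<and> \<pi> w = j. y w))) * (\<Prod>w\<in>S. y w))"
 have finS: "finite S" using insert finite_subset by blast
 have [measurable]: "gauss_deriv i (\<sigma> j) \<in> borel_measurable borel" if "j < d" for i j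
  by (rule gauss_deriv_measurable[OF insert.prems(2)[OF that]])
 have comp: "(\<lambda>y. y w) \<in> borel_measurable (gauss_product (insert u A) v)" if "w \<in> insert u A" for w
 proof -
  have "(\<lambda>y. y w) \<in> measurable (gauss_product (insert u A) v) (gauss_measure (v w))"
   by (rule measurable_component_singleton[OF that])
  then show ?thesis by simp
 qed
 have fm: "f \<in> borel_measurable (gauss_product (insert u A) v)"
  unfolding f_def
 proof (intro borel_measurable_times borel_measurable_prod)
  fix j assume "j \<in> {..<d}"
  then have [measurable]: "gauss_deriv (k j) (\<sigma> j) \<in> borel_measurable borel"
   using gauss_deriv_measurable[OF insert.prems(2)] by simp
  have "(\<lambda>y. x j + (\<Sum>w | w \<in> insert u A \<and> \<pi> w = j. y w)) \<in> borel_measurable (gauss_product (insert u A) v)"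
   by (intro borel_measurable_add borel_measurable_const borel_measurable_sum comp) auto
  then show "(\<lambda>y. gauss_deriv (k j) (\<sigma> j) (x j + (\<Sum>w | w \<in> insert u A \<and> \<pi> w = j. y w))) \<in> borel_measurable (gauss_product (insert u A) v)"
   by measurable
 qed (use insert.prems(1) comp in auto)
 have "\<forall>j. \<exists>C. j < d \<longrightarrow> (\<forall>x. \<bar>gauss_deriv (k j) (\<sigma> j) x\<bar> \<le> C)" using gauss_deriv_bounded insert.prems(2) by meson
 then obtain C where C: "\<And>j x. j < d \<Longrightarrow> \<bar>gauss_deriv (k j) (\<sigma> j) x\<bar> \<le> C j" by metis
 have fi: "integrable (gauss_product (insert u A) v) f"
 proof (rule Bochner_Integration.integrable_bound[OF _ fm])
  have "integrable (gauss_product (insert u A) v) (\<lambda>y. \<Prod>w\<in>insert u A. (if w \<in> S then \<bar>y w\<bar> else 1))"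
  proof (rule P.product_integrable_prod[where f = "\<lambda>w y. if w \<in> S then \<bar>y\<bar> else 1"])
   show "integrable (gauss_measure (v w)) (\<lambda>y. if w \<in> S then \<bar>y\<bar> else 1)" for w
    using gauss_measure_moments(3)[OF v[of w]] prob_space.finite_measure[OF prob_space_gauss_measure[OF v[of w]]]
    by (cases "w \<in> S") (simp_all add: finite_measure.integrable_const)
  qed (use insert in auto)
  then show "integrable (gauss_product (insert u A) v) (\<lambda>y. (\<Prod>j<d. C j) * (\<Prod>w\<in>insert u A. (if w \<in> S then \<bar>y w\<bar> else 1)))"
   by simp
  show "AE y in gauss_product (insert u A) v. norm (f y) \<le> norm ((\<Prod>j<d. C j) * (\<Prod>w\<in>insert u A. (if w \<in> S then \<bar>y w\<bar> else 1)))"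
  proof (rule AE_I2)
   fix y :: "'a \<Rightarrow> real"
   have "(\<Prod>w\<in>insert u A. (if w \<in> S then \<bar>y w\<bar> else 1)) = (\<Prod>w\<in>S. \<bar>y w\<bar>)"
    using insert by (intro prod.mono_neutral_cong_right) auto
   moreover have "\<bar>\<Prod>j<d. gauss_deriv (k j) (\<sigma> j) (x j + (\<Sum>w | w \<in> insert u A \<and> \<pi> w = j. y w))\<bar> \<le> (\<Prod>j<d. C j)"
    unfolding abs_prod using C by (intro prod_mono) auto
   ultimately have "\<bar>f y\<bar> \<le> (\<Prod>j<d. C j) * (\<Prod>w\<in>insert u A. (if w \<in> S then \<bar>y w\<bar> else 1))"
    unfolding f_def abs_mult by (simp add: abs_prod mult_right_mono prod_nonneg)
   then show "norm (f y) \<le> norm ((\<Prod>j<d. C j) * (\<Prod>w\<in>insert u A. (if w \<in> S then \<bar>y w\<bar> else 1)))" by simp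
  qed
 qed
 define e :: nat where "e = of_bool (u \<in> S)"
 define S' where "S' = S - {u}"
 have S': "S' \<subseteq> A" "finite S'" using insert.prems(1) finS by (auto simp: S'_def)
 have prodS: "(\<Prod>w\<in>S. g w) = g u ^ e * (\<Prod>w\<in>S'. g w)" for g :: "'a \<Rightarrow> real"
  using finS by (cases "u \<in> S") (auto simp: e_def S'_def prod.remove)
 (* Integrating out y u changes order and variance in the sum that u belongs to; z is the factor it
  leaves, which is 0 when u occurs in the product but in none of the sums. *)
 define k' where "k' = (\<lambda>j. if j = \<pi> u then k j + e else k j)"
 define \<sigma>' where "\<sigma>' = (\<lambda>j. if j = \<pi> u then \<sigma> j + v u else \<sigma> j)"
 define z :: real where "z = (if \<pi> u < d then v u ^ e else 0 ^ e)"
 have sum_upd: "(\<Sum>w | w \<in> insert u A \<and> \<pi> w = j. (y(u := t)) w) = (if j = \<pi> u then t else 0) + (\<Sum>w | w \<in> A \<and> \<pi> w = j. y w)" for j t and y :: "'a \<Rightarrow> real"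
 proof -
  have "{w. w \<in> insert u A \<and> \<pi> w = j} = (if j = \<pi> u then insert u {w. w \<in> A \<and> \<pi> w = j} else {w. w \<in> A \<and> \<pi> w = j})" by auto
  moreover have "(\<Sum>w | w \<in> A \<and> \<pi> w = j. (y(u := t)) w) = (\<Sum>w | w \<in> A \<and> \<pi> w = j. y w)"
   using insert.hyps by (intro sum.cong) auto
  ultimately show ?thesis using insert.hyps by (cases "j = \<pi> u") simp_all
 qed
 have sum_ins: "(\<Sum>w | w \<in> insert u A \<and> \<pi> w = j. v w) = (if j = \<pi> u then v u else 0) + (\<Sum>w | w \<in> A \<and> \<pi> w = j. v w)" for j
  using sum_upd[of v "v u" j] by simp
 have inner: "(\<integral>t. f (y(u := t)) \<partial>gauss_measure (v u)) =
   z * ((\<Prod>j<d. gauss_deriv (k' j) (\<sigma>' j) (x j + (\<Sum>w | w \<in> A \<and> \<pi> w = j. y w))) * (\<Prod>w\<in>S'. y w))" for y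
 proof -
  define X where "X j = x j + (\<Sum>w | w \<in> A \<and> \<pi> w = j. y w)" for j
  have pS: "(\<Prod>w\<in>S. (y(u := t)) w) = t ^ e * (\<Prod>w\<in>S'. y w)" for t
  proof -
   have "(\<Prod>w\<in>S'. (y(u := t)) w) = (\<Prod>w\<in>S'. y w)" by (intro prod.cong) (auto simp: S'_def)
   then show ?thesis using prodS[of "y(u := t)"] by simp
  qed
  have fe: "f (y(u := t)) = (\<Prod>j<d. gauss_deriv (k j) (\<sigma> j) (X j + (if j = \<pi> u then t else 0))) * (t ^ e * (\<Prod>w\<in>S'. y w))" for t
   unfolding f_def sum_upd pS X_def by (simp add: ac_simps)
  show ?thesis
  proof (cases "\<pi> u < d")
   case True
   have split: "(\<Prod>j<d. g j) = g (\<pi> u) * (\<Prod>j\<in>{..<d} - {\<pi> u}. g j)" for g :: "nat \<Rightarrow> real"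
    using True by (subst prod.remove[of _ "\<pi> u"]) auto
   define R where "R = (\<Prod>j\<in>{..<d} - {\<pi> u}. gauss_deriv (k j) (\<sigma> j) (X j))"
   have "(\<integral>t. f (y(u := t)) \<partial>gauss_measure (v u)) =
    (\<integral>t. (R * (\<Prod>w\<in>S'. y w)) * (gauss_deriv (k (\<pi> u)) (\<sigma> (\<pi> u)) (X (\<pi> u) + t) * t ^ e) \<partial>gauss_measure (v u))"
    unfolding fe split by (simp add: R_def mult_ac)
   also have "\<dots> = (R * (\<Prod>w\<in>S'. y w)) * (v u ^ e * gauss_deriv (k (\<pi> u) + e) (\<sigma> (\<pi> u) + v u) (X (\<pi> u)))"
    using gauss_deriv_convolution_power[OF insert.prems(2)[OF True] v[of u], of e] by (simp add: e_def)
   also have "\<dots> = z * ((\<Prod>j<d. gauss_deriv (k' j) (\<sigma>' j) (X j)) * (\<Prod>w\<in>S'. y w))"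
    unfolding split using True by (simp add: z_def k'_def \<sigma>'_def R_def mult_ac)
   finally show ?thesis unfolding X_def .
  next
   case False
   have "(\<integral>t. f (y(u := t)) \<partial>gauss_measure (v u)) =
    (\<integral>t. ((\<Prod>j<d. gauss_deriv (k j) (\<sigma> j) (X j)) * (\<Prod>w\<in>S'. y w)) * t ^ e \<partial>gauss_measure (v u))"
    unfolding fe using False by (simp add: mult_ac)
   also have "\<dots> = ((\<Prod>j<d. gauss_deriv (k j) (\<sigma> j) (X j)) * (\<Prod>w\<in>S'. y w)) * 0 ^ e"
    using gauss_measure_moments(2)[OF v[of u]] prob_space.prob_space[OF prob_space_gauss_measure[OF v[of u]]]
    by (cases "u \<in> S") (simp_all add: e_def)
   also have "\<dots> = z * ((\<Prod>j<d. gauss_deriv (k' j) (\<sigma>' j) (X j)) * (\<Prod>w\<in>S'. y w))"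
    using False by (simp add: z_def k'_def \<sigma>'_def mult_ac cong: prod.cong_simp) 
   finally show ?thesis unfolding X_def .
  qed
 qed
 have \<sigma>'pos: "0 < \<sigma>' j" if "j < d" for j using insert.prems(2)[OF that] v[of u] by (cases "j = \<pi> u") (simp_all add: \<sigma>'_def)
 note IH = insert.IH[where k = k' and x = x, OF S'(1) \<sigma>'pos, THEN conjunct2]
 have "(\<integral>y. f y \<partial>gauss_product (insert u A) v) = (\<integral>y. (\<integral>t. f (y(u := t)) \<partial>gauss_measure (v u)) \<partial>gauss_product A v)"
  by (rule P.product_integral_insert[OF insert.hyps fi])
 also have "\<dots> = z * (if \<forall>u\<in>S'. \<pi> u < d then (\<Prod>u\<in>S'. v u) * (\<Prod>j<d. gauss_deriv (k' j + card {u \<in> S'. \<pi> u = j}) (\<sigma>' j + (\<Sum>u | u \<in> A \<and> \<pi> u = j. v u)) (x j)) else 0)"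
  unfolding inner using IH by simp
 also have "\<dots> = (if \<forall>u\<in>S. \<pi> u < d then (\<Prod>u\<in>S. v u) * (\<Prod>j<d. gauss_deriv (k j + card {u \<in> S. \<pi> u = j}) (\<sigma> j + (\<Sum>w | w \<in> insert u A \<and> \<pi> w = j. v w)) (x j)) else 0)"
 proof -
  have card: "k' j + card {w \<in> S'. \<pi> w = j} = k j + card {w \<in> S. \<pi> w = j}" for j
  proof (cases "u \<in> S \<and> \<pi> u = j")
   case True
   then have "{w \<in> S. \<pi> w = j} = insert u {w \<in> S'. \<pi> w = j}" by (auto simp: S'_def)
   moreover have "u \<notin> {w \<in> S'. \<pi> w = j}" by (simp add: S'_def)
   ultimately show ?thesis using True S'(2) by (simp add: k'_def e_def)
  next
   case False
   then have "{w \<in> S. \<pi> w = j} = {w \<in> S'. \<pi> w = j}" by (auto simp: S'_def)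
   then show ?thesis using False by (auto simp: k'_def e_def)
  qed
  have sig: "\<sigma>' j + (\<Sum>w | w \<in> A \<and> \<pi> w = j. v w) = \<sigma> j + (\<Sum>w | w \<in> insert u A \<and> \<pi> w = j. v w)" for j
   unfolding sum_ins by (simp add: \<sigma>'_def)
  have all: "(\<forall>w\<in>S. \<pi> w < d) \<longleftrightarrow> (u \<in> S \<longrightarrow> \<pi> u < d) \<and> (\<forall>w\<in>S'. \<pi> w < d)" by (auto simp: S'_def)
  show ?thesis unfolding card sig prodS[of v] all
   by (cases "u \<in> S"; cases "\<pi> u < d") (simp_all add: z_def e_def)
 qed
 finally show ?case using fi unfolding f_def by blast
qed

lemma heat_kernel_eq_prod:
 assumes "0 < eps"
 shows "heat_kernel d eps x = (\<Prod>j<d. gauss_deriv 0 eps (x j))"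
proof -
 have "(2 * pi * eps) powr (- (real d / 2)) = ((2 * pi * eps) powr (- (1 / 2))) ^ d"
  using assms by (simp add: powr_power mult.commute)
 moreover have "exp (- (\<Sum>j<d. (x j)^2) / (2 * eps)) = (\<Prod>j<d. exp (- (x j)\<^sup>2 / (2 * eps)))"
  by (simp add: exp_sum[symmetric] sum_divide_distrib sum_negf)
 ultimately show ?thesis by (simp add: heat_kernel_def gauss_deriv.simps(1) prod.distrib)
qed

definition gauss_deriv_prod :: "nat \<Rightarrow> real \<Rightarrow> (nat \<Rightarrow> nat) \<Rightarrow> (nat \<Rightarrow> real) \<Rightarrow> real" where
 "gauss_deriv_prod d eps m x = (\<Prod>j<d. gauss_deriv (m j) eps (x j))"

lemma partial_deriv_gauss_deriv_prod:
 assumes "0 < eps" "j < d"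
 shows "partial_deriv j (gauss_deriv_prod d eps m) = gauss_deriv_prod d eps (m(j := Suc (m j)))"
proof
 fix x
 have split: "(\<Prod>i<d. g i) = g j * (\<Prod>i\<in>{..<d} - {j}. g i)" for g :: "nat \<Rightarrow> real"
  using assms(2) by (subst prod.remove[of _ j]) auto
 define R where "R = (\<Prod>i\<in>{..<d} - {j}. gauss_deriv (m i) eps (x i))"
 have "gauss_deriv_prod d eps m (x(j := y)) = gauss_deriv (m j) eps y * R" for y
  unfolding gauss_deriv_prod_def split R_def by simp
 moreover have "((\<lambda>y. gauss_deriv (m j) eps y * R) has_real_derivative gauss_deriv (Suc (m j)) eps (x j) * R) (at (x j))"
  by (intro DERIV_cmult_right gauss_deriv_has_derivative assms)
 ultimately have "partial_deriv j (gauss_deriv_prod d eps m) x = gauss_deriv (Suc (m j)) eps (x j) * R"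
  unfolding partial_deriv_def by (simp add: DERIV_imp_deriv)
 also have "\<dots> = gauss_deriv_prod d eps (m(j := Suc (m j))) x"
  unfolding gauss_deriv_prod_def split R_def by simp
 finally show "partial_deriv j (gauss_deriv_prod d eps m) x = gauss_deriv_prod d eps (m(j := Suc (m j))) x" .
qed

lemma partial_deriv_power_gauss_deriv_prod:
 assumes "0 < eps" "j < d"
 shows "(partial_deriv j ^^ n) (gauss_deriv_prod d eps m) = gauss_deriv_prod d eps (m(j := m j + n))"
proof (induction n)
 case (Suc n)
 have "(partial_deriv j ^^ Suc n) (gauss_deriv_prod d eps m) = partial_deriv j (gauss_deriv_prod d eps (m(j := m j + n)))"
  by (simp only: funpow.simps o_apply Suc.IH)
 also have "\<dots> = gauss_deriv_prod d eps ((m(j := m j + n))(j := Suc ((m(j := m j + n)) j)))"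
  by (rule partial_deriv_gauss_deriv_prod[OF assms])
 also have "(m(j := m j + n))(j := Suc ((m(j := m j + n)) j)) = m(j := m j + Suc n)" by (simp only: fun_upd_upd fun_upd_same add_Suc_right)
 finally show ?case .
qed simp

lemma mi_deriv_heat_kernel:
 assumes "0 < eps"
 shows "mi_deriv d k (heat_kernel d eps) x = (\<Prod>j<d. gauss_deriv (k j) eps (x j))"
proof -
 have "foldr (\<lambda>j. partial_deriv j ^^ k j) js (gauss_deriv_prod d eps m) =
   gauss_deriv_prod d eps (\<lambda>i. if i \<in> set js then m i + k i else m i)" if "distinct js" "set js \<subseteq> {..<d}" for js m
  using that
 proof (induction js)
  case (Cons j js)
  have "(\<lambda>i. if i \<in> set js then m i + k i else m i)(j := (if j \<in> set js then m j + k j else m j) + k j) =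
    (\<lambda>i. if i \<in> set (j # js) then m i + k i else m i)"
   using Cons.prems by auto
  then show ?case using Cons by (simp add: partial_deriv_power_gauss_deriv_prod[OF assms])
 qed simp
 from this[of "[0..<d]" "\<lambda>_. 0"] have "mi_deriv d k (gauss_deriv_prod d eps (\<lambda>_. 0)) = gauss_deriv_prod d eps (\<lambda>i. if i < d then k i else 0)"
  unfolding mi_deriv_def by (simp add: atLeast0LessThan cong: if_cong)
 moreover have "heat_kernel d eps = gauss_deriv_prod d eps (\<lambda>_. 0)"
  by (simp add: fun_eq_iff gauss_deriv_prod_def heat_kernel_eq_prod[OF assms])
 ultimately show ?thesis by (simp add: gauss_deriv_prod_def)
qed

definition normal_moment :: "nat \<Rightarrow> real" where
 "normal_moment K = (if even K then fact K / (2 ^ (K div 2) * fact (K div 2)) else 0)"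

lemma integral_normal_moment: "(\<integral>x. x ^ K \<partial>std_normal_distribution) = normal_moment K"
 "integrable std_normal_distribution (\<lambda>x. x ^ K)"
proof -
 have "(\<integral>x. x ^ K \<partial>std_normal_distribution) = (\<integral>x. std_normal_density x * x ^ K \<partial>lborel)"
  by (subst integral_real_density) (auto simp: normal_density_nonneg)
 also have "\<dots> = normal_moment K"
 proof (cases "even K")
  case True
  then obtain m where "K = 2 * m" by (elim evenE)
  then show ?thesis using integral_std_normal_moment_even[of m] by (simp add: normal_moment_def)
 next
  case False
  then obtain m where "K = 2 * m + 1" by (elim oddE)
  then show ?thesis using integral_std_normal_moment_odd[of m] by (simp add: normal_moment_def)
 qed
 finally show "(\<integral>x. x ^ K \<partial>std_normal_distribution) = normal_moment K" .
 show "integrable std_normal_distribution (\<lambda>x. x ^ K)"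
  using integrable_std_normal_moment[of K] by (subst integrable_real_density) (auto simp: normal_density_nonneg)
qed

lemma normal_moment_Suc_Suc: "normal_moment (Suc (Suc k)) = real (Suc k) * normal_moment k"
proof (cases "even k")
 case True
 then obtain m where k: "k = 2 * m" by (elim evenE)
 have "fact (Suc (Suc k)) = (2 * real (Suc m)) * (real (Suc k) * fact k)"
  unfolding fact_Suc of_nat_mult by (simp add: k)
 moreover have "2 ^ Suc m * fact (Suc m) = (2 * real (Suc m)) * (2 ^ m * fact m)"
  by (simp only: power_Suc fact_Suc of_nat_mult of_nat_Suc mult_ac)
 moreover have "Suc (Suc k) div 2 = Suc m" "k div 2 = m" by (simp_all add: k)
 moreover have "(x * y) / (x * z) = y / z" if "x \<noteq> 0" for x y z :: real using that by simp
 ultimately have "normal_moment (Suc (Suc k)) = real (Suc k) * fact k / (2 ^ m * fact m)"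
  using True by (simp only: normal_moment_def even_Suc if_True not_not) simp
 then show ?thesis using True \<open>k div 2 = m\<close> by (simp add: normal_moment_def)
qed (simp add: normal_moment_def)

lemma gauss_deriv_at_0:
 assumes "0 < s"
 shows "gauss_deriv K s 0 = (-1) ^ (K div 2) * normal_moment K * (2 * pi) powr (- (1 / 2)) * s powr (- ((real K + 1) / 2))"
proof (induction K rule: induct_nat_012)
 case 0
 then show ?case using assms by (simp add: gauss_deriv.simps(1) normal_moment_def powr_mult)
next
 case 1
 then show ?case by (simp add: gauss_deriv.simps(2) normal_moment_def)
next
 case (ge2 k)
 have "s powr (- ((real (Suc (Suc k)) + 1) / 2)) = s powr (- ((real k + 1) / 2) - 1)"
  by (rule arg_cong[of _ _ "\<lambda>e. s powr e"]) (simp add: field_simps)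
 also have "\<dots> = s powr (- ((real k + 1) / 2)) / s" using assms by (simp add: powr_diff)
 finally have p: "s powr (- ((real (Suc (Suc k)) + 1) / 2)) = s powr (- ((real k + 1) / 2)) / s" .
 have "gauss_deriv (Suc (Suc k)) s 0 = - (real (Suc k) * gauss_deriv k s 0) / s"
  by (simp add: gauss_deriv.simps(2)[of "Suc k"])
 then show ?case unfolding ge2(1) p normal_moment_Suc_Suc by simp
qed

lemma gauss_deriv_prod_at_0:
 assumes s: "0 < s" and K: "(\<Sum>j<d. K j) = 2 * m"
 shows "(\<Prod>j<d. gauss_deriv (K j) s 0) =
  (-1) ^ m * (2 * pi) powr (- (real d / 2)) * s powr (- (real m + real d / 2)) * (\<Prod>j<d. normal_moment (K j))"
proof (cases "\<forall>j<d. even (K j)")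
 case True
 have "2 * (\<Sum>j<d. K j div 2) = (\<Sum>j<d. K j)" unfolding sum_distrib_left using True by (intro sum.cong) auto
 then have m: "(\<Sum>j<d. K j div 2) = m" using K by simp
 have "(\<Prod>j<d. s powr (- ((real (K j) + 1) / 2))) = s powr (\<Sum>j<d. - ((real (K j) + 1) / 2))"
  using s by (intro powr_sum[symmetric]) auto
 also have "(\<Sum>j<d. - ((real (K j) + 1) / 2)) = - ((real (\<Sum>j<d. K j) + real d) / 2)"
  by (simp add: sum_negf sum.distrib flip: sum_divide_distrib)
 also have "\<dots> = - (real m + real d / 2)" unfolding K by (simp add: field_simps)
 finally have p: "(\<Prod>j<d. s powr (- ((real (K j) + 1) / 2))) = s powr (- (real m + real d / 2))" .
 have q: "((2 * pi) powr (- (1 / 2))) ^ d = (2 * pi) powr (- (real d / 2))" by (simp add: powr_power mult.commute)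
 have r: "(\<Prod>j<d. (-1) ^ (K j div 2)) = ((-1) ^ m :: real)" by (simp add: m flip: power_sum)
 show ?thesis unfolding gauss_deriv_at_0[OF s] prod.distrib p r by (simp add: q)
next
 case False
 then obtain j where "j < d" "odd (K j)" by blast
 then have "normal_moment (K j) = 0" "gauss_deriv (K j) s 0 = 0" "j \<in> {..<d}" by (simp_all add: normal_moment_def gauss_deriv_at_0[OF s])
 note j = this
 have 1: "(\<Prod>j<d. normal_moment (K j)) = 0" by (rule prod_zero[OF finite_lessThan bexI[of _ j]]) (rule j)+
 have 2: "(\<Prod>j<d. gauss_deriv (K j) s 0) = 0" by (rule prod_zero[OF finite_lessThan bexI[of _ j]]) (rule j)+
 show ?thesis by (simp only: 1 2 mult_zero_right)
qed

definition multiplicity_of :: "nat \<Rightarrow> (nat \<Rightarrow> nat) \<Rightarrow> nat \<Rightarrow> nat" where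
 "multiplicity_of n i j = card {a. a < n \<and> i a = j}"

lemma sum_multiplicity_of:
 assumes "i \<in> index_tuples n d"
 shows "(\<Sum>j<d. multiplicity_of n i j) = n"
proof -
 have "(\<Sum>j<d. multiplicity_of n i j) = (\<Sum>j<d. \<Sum>a\<in>{a \<in> {..<n}. i a = j}. 1)"
  unfolding multiplicity_of_def by simp
 also have "\<dots> = (\<Sum>a<n. 1)" by (rule sum.group) (use assms in auto)
 finally show ?thesis by simp
qed

lemma prod_by_multiplicity:
 assumes "i \<in> index_tuples n d"
 shows "(\<Prod>a<n. \<xi> (i a)) = (\<Prod>j<d. \<xi> j ^ multiplicity_of n i j :: real)"
proof -
 have "(\<Prod>a<n. \<xi> (i a)) = (\<Prod>j<d. \<Prod>a\<in>{a \<in> {..<n}. i a = j}. \<xi> (i a))"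
  by (rule prod.group[symmetric]) (use assms in auto)
 also have "\<dots> = (\<Prod>j<d. \<xi> j ^ multiplicity_of n i j)"
  unfolding multiplicity_of_def by (intro prod.cong refl) simp
 finally show ?thesis .
qed

lemma gauss_moment_eq:
 assumes "i \<in> index_tuples n d"
 shows "gauss_moment d k n i = (\<Prod>j<d. normal_moment (k j + multiplicity_of n i j))"
proof -
 interpret product_sigma_finite "\<lambda>_::nat. std_normal_distribution"
  unfolding product_sigma_finite_def using prob_space_normal_density[of 1 0] by (simp add: prob_space_imp_sigma_finite)
 have "gauss_moment d k n i = (\<integral>\<xi>. (\<Prod>j<d. \<xi> j ^ (k j + multiplicity_of n i j)) \<partial>(Pi\<^sub>M {..<d} (\<lambda>_. std_normal_distribution)))"
  unfolding gauss_moment_def prod_by_multiplicity[OF assms] by (simp add: power_add prod.distrib mult.commute)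
 also have "\<dots> = (\<Prod>j<d. \<integral>x. x ^ (k j + multiplicity_of n i j) \<partial>std_normal_distribution)"
  by (rule product_integral_prod[where f = "\<lambda>j x. x ^ (k j + multiplicity_of n i j)"]) (simp_all add: integral_normal_moment)
 finally show ?thesis by (simp add: integral_normal_moment)
qed

section \<open>Correlations with elementary integrals\<close>

context brownian_motion
begin

text \<open>The increment between two partition points is the sum of the increments over the cells in between.
  Cells outside this window contribute to none of the \<open>d\<close> sums.\<close>

lemma gauss_deriv_increment_expectation:
 assumes d: "0 < d" and eps: "0 < eps" and t: "is_partition N t" and l: "lr \<le> ls" "ls \<le> N" and S: "S \<subseteq> {..<d} \<times> {..<N}"
 defines "W \<equiv> \<lambda>u w. increment B t u w"
 shows "integrable M (\<lambda>w. (\<Prod>j<d. gauss_deriv (k j) eps (B j (t ls) w - B j (t lr) w)) * (\<Prod>u\<in>S. W u w))" (is ?int)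
  and "expectation (\<lambda>w. (\<Prod>j<d. gauss_deriv (k j) eps (B j (t ls) w - B j (t lr) w)) * (\<Prod>u\<in>S. W u w)) =
   (if \<forall>u\<in>S. lr \<le> snd u \<and> snd u < ls
    then cell_volume t S * (\<Prod>j<d. gauss_deriv (k j + card {u \<in> S. fst u = j}) (eps + (t ls - t lr)) 0)
    else 0)" (is ?exp)
proof -
 let ?U = "{..<d} \<times> {..<N}"
 interpret G: gauss_family M ?U "\<lambda>u. t (Suc (snd u)) - t (snd u)" W
  unfolding W_def by (rule gauss_family_increments[OF t])
 have N: "0 < N" using t by (cases N) (auto simp: is_partition_def)
 define v where "v u = (if u \<in> ?U then t (Suc (snd u)) - t (snd u) else 1)" for u
 have v: "0 < v u" for u using G.v_pos[of u] unfolding v_def by auto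
 define \<pi> where "\<pi> u = (if lr \<le> snd u \<and> snd u < ls then fst u else d)" for u :: "nat \<times> nat"
 have inside: "{u. u \<in> ?U \<and> \<pi> u = j} = {j} \<times> {lr..<ls}" if "j < d" for j
  using that l(2) by (auto simp: \<pi>_def split: if_splits)
 have sumW: "B j (t ls) w - B j (t lr) w = (\<Sum>u | u \<in> ?U \<and> \<pi> u = j. W u w)" if "j < d" for j w
 proof -
  have "(\<Sum>u | u \<in> ?U \<and> \<pi> u = j. W u w) = (\<Sum>l\<in>{lr..<ls}. B j (t (Suc l)) w - B j (t l) w)"
   unfolding inside[OF that] W_def by (simp add: sum.cartesian_product')
  also have "\<dots> = B j (t ls) w - B j (t lr) w" by (rule sum_Suc_diff'[OF l(1)])
  finally show ?thesis by simp
 qed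
 have sumv: "(\<Sum>u | u \<in> ?U \<and> \<pi> u = j. v u) = t ls - t lr" if "j < d" for j
 proof -
  have "(\<Sum>u | u \<in> ?U \<and> \<pi> u = j. v u) = (\<Sum>l\<in>{lr..<ls}. t (Suc l) - t l)"
   unfolding inside[OF that] using that l(2) by (simp add: sum.cartesian_product' v_def)
  also have "\<dots> = t ls - t lr" by (rule sum_Suc_diff'[OF l(1)])
  finally show ?thesis .
 qed
 define F where "F = (\<lambda>y :: nat \<times> nat \<Rightarrow> real. (\<Prod>j<d. gauss_deriv (k j) eps (0 + (\<Sum>u | u \<in> ?U \<and> \<pi> u = j. y u))) * (\<Prod>u\<in>S. y u))"
 have FW: "(\<Prod>j<d. gauss_deriv (k j) eps (B j (t ls) w - B j (t lr) w)) * (\<Prod>u\<in>S. W u w) = F (\<lambda>u\<in>?U. W u w)" for w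
 proof -
  have "(\<Sum>u | u \<in> ?U \<and> \<pi> u = j. (\<lambda>u\<in>?U. W u w) u) = B j (t ls) w - B j (t lr) w" if "j < d" for j
   unfolding sumW[OF that] by (rule sum.cong) auto
  moreover have "(\<Prod>u\<in>S. (\<lambda>u\<in>?U. W u w) u) = (\<Prod>u\<in>S. W u w)" using S by (intro prod.cong) auto
  ultimately show ?thesis unfolding F_def by simp
 qed
 have law: "distr M (PiM ?U (\<lambda>_. borel)) (\<lambda>w. \<lambda>u\<in>?U. W u w) = PiM ?U (\<lambda>u. gauss_measure (v u))"
 proof -
  have "distr M (PiM ?U (\<lambda>_. borel)) (\<lambda>w. \<lambda>u\<in>?U. W u w) = PiM ?U (\<lambda>u. distr M borel (W u))"
   using indep_vars_iff_distr_eq_PiM'[of ?U W "\<lambda>_. borel"] G.indep_W G.W_measurable d N by auto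
  also have "\<dots> = PiM ?U (\<lambda>u. gauss_measure (v u))"
  proof (rule PiM_cong[OF refl])
   fix u assume u: "u \<in> ?U"
   have "distr M borel (W u) = distr M lborel (W u)" by (rule distr_cong) simp_all
   also have "\<dots> = gauss_measure (t (Suc (snd u)) - t (snd u))"
    using distributed_distr_eq_density[OF G.W_distributed[OF u]] by simp
   finally show "distr M borel (W u) = gauss_measure (v u)" using u by (simp add: v_def)
  qed
  finally show ?thesis .
 qed
 have Wm: "(\<lambda>w. \<lambda>u\<in>?U. W u w) \<in> measurable M (PiM ?U (\<lambda>_. borel))"
  using G.W_measurable by (intro measurable_restrict) auto
 have Fint: "integrable (PiM ?U (\<lambda>u. gauss_measure (v u))) F \<and> (\<integral>y. F y \<partial>PiM ?U (\<lambda>u. gauss_measure (v u))) =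
   (if \<forall>u\<in>S. \<pi> u < d then (\<Prod>u\<in>S. v u) * (\<Prod>j<d. gauss_deriv (k j + card {u \<in> S. \<pi> u = j}) (eps + (\<Sum>u | u \<in> ?U \<and> \<pi> u = j. v u)) 0) else 0)"
  unfolding F_def by (rule gauss_deriv_product_integral[where \<sigma> = "\<lambda>_. eps" and x = "\<lambda>_. 0"]) (use S v eps in auto)
 then have Fi: "integrable (distr M (PiM ?U (\<lambda>_. borel)) (\<lambda>w. \<lambda>u\<in>?U. W u w)) F" unfolding law by blast
 then have Fm: "F \<in> borel_measurable (PiM ?U (\<lambda>_. borel))" by (simp cong: measurable_cong_sets)
 show ?int unfolding FW using Fi by (subst (asm) integrable_distr_eq[OF Wm Fm])
 have "expectation (\<lambda>w. F (\<lambda>u\<in>?U. W u w)) = (\<integral>y. F y \<partial>PiM ?U (\<lambda>u. gauss_measure (v u)))"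
  unfolding law[symmetric] by (rule integral_distr[OF Wm Fm, symmetric])
 also have "\<dots> = (if \<forall>u\<in>S. lr \<le> snd u \<and> snd u < ls
    then cell_volume t S * (\<Prod>j<d. gauss_deriv (k j + card {u \<in> S. fst u = j}) (eps + (t ls - t lr)) 0)
    else 0)"
 proof (cases "\<forall>u\<in>S. lr \<le> snd u \<and> snd u < ls")
  case True
  then have 1: "\<pi> u = fst u" if "u \<in> S" for u using that by (simp add: \<pi>_def)
  have 2: "\<forall>u\<in>S. \<pi> u < d" using 1 S by auto
  have 3: "{u \<in> S. \<pi> u = j} = {u \<in> S. fst u = j}" for j using 1 by auto
  have 4: "(\<Prod>u\<in>S. v u) = cell_volume t S" using S by (intro prod.cong) (auto simp: v_def)
  have "(\<integral>y. F y \<partial>PiM ?U (\<lambda>u. gauss_measure (v u))) =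
    (\<Prod>u\<in>S. v u) * (\<Prod>j<d. gauss_deriv (k j + card {u \<in> S. \<pi> u = j}) (eps + (\<Sum>u | u \<in> ?U \<and> \<pi> u = j. v u)) 0)"
   using Fint 2 by simp
  also have "(\<Prod>j<d. gauss_deriv (k j + card {u \<in> S. \<pi> u = j}) (eps + (\<Sum>u | u \<in> ?U \<and> \<pi> u = j. v u)) 0) =
    (\<Prod>j<d. gauss_deriv (k j + card {u \<in> S. fst u = j}) (eps + (t ls - t lr)) 0)"
   unfolding 3 by (rule prod.cong[OF refl]) (simp add: sumv)
  finally show ?thesis using True 4 by simp
 next
  case False
  then have n: "\<not> (\<forall>u\<in>S. \<pi> u < d)" by (auto simp: \<pi>_def)
  show ?thesis unfolding if_not_P[OF False] using conjunct2[OF Fint] unfolding if_not_P[OF n] .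
 qed
 finally show ?exp unfolding FW .
qed

text \<open>In terms of kernels, the coefficients \<open>c\<close> of the elementary integral only enter through the
  restriction of its kernel to \<open>(r, s]\<^sup>n\<close>.\<close>

lemma gauss_deriv_step_form_expectation:
 assumes d: "0 < d" and eps: "0 < eps" and t: "is_partition N t" and l: "lr \<le> ls" "ls \<le> N" and off: "offdiagonal d n N c"
 shows "expectation (\<lambda>w. (\<Prod>j<d. gauss_deriv (k j) eps (B j (t ls) w - B j (t lr) w)) * step_form d B n N t c w) =
  (\<Sum>i\<in>index_tuples n d. (\<Prod>j<d. gauss_deriv (k j + multiplicity_of n i j) (eps + (t ls - t lr)) 0) *
   (\<integral>\<rho>. step_kernel n N t c i \<rho> * (\<Prod>a<n. indicator {t lr<..t ls} (\<rho> a)) \<partial>unit_cube n))"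
proof -
 let ?H = "\<lambda>w. \<Prod>j<d. gauss_deriv (k j) eps (B j (t ls) w - B j (t lr) w)"
 let ?W = "\<lambda>u w. increment B t u w"
 let ?\<Phi> = "\<lambda>i. \<Prod>j<d. gauss_deriv (k j + multiplicity_of n i j) (eps + (t ls - t lr)) 0"
 let ?in = "\<lambda>l. of_bool (\<forall>a<n. lr \<le> l a \<and> l a < ls) :: real"
 have trm: "c i l * expectation (\<lambda>w. ?H w * (\<Prod>a<n. ?W (i a, l a) w)) = ?\<Phi> i * (c i l * ?in l * (\<Prod>a<n. t (Suc (l a)) - t (l a)))"
  and trm_int: "integrable M (\<lambda>w. c i l * (?H w * (\<Prod>a<n. ?W (i a, l a) w)))"
  if il: "i \<in> index_tuples n d" "l \<in> index_tuples n N" for i l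
 proof -
  have "c i l * expectation (\<lambda>w. ?H w * (\<Prod>a<n. ?W (i a, l a) w)) = ?\<Phi> i * (c i l * ?in l * (\<Prod>a<n. t (Suc (l a)) - t (l a))) \<and>
   integrable M (\<lambda>w. c i l * (?H w * (\<Prod>a<n. ?W (i a, l a) w)))"
  proof (cases "inj_on (\<lambda>a. (i a, l a)) {..<n}")
   case False
   then have "c i l = 0" by (rule offdiagonal_not_inj[OF off il])
   then show ?thesis by simp
  next
   case True
   define S where "S = pair_image n i l"
   have S: "S \<subseteq> {..<d} \<times> {..<N}" using il by (auto simp: S_def pair_image_def)
   have pr: "(\<Prod>u\<in>S. g u) = (\<Prod>a<n. g (i a, l a))" for g :: "nat \<times> nat \<Rightarrow> real"
    unfolding S_def pair_image_def using True by (simp add: prod.reindex)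
   have crd: "card {u \<in> S. fst u = j} = multiplicity_of n i j" for j
   proof -
    have "{u \<in> S. fst u = j} = (\<lambda>a. (i a, l a)) ` {a. a < n \<and> i a = j}" by (auto simp: S_def pair_image_def)
    moreover have "inj_on (\<lambda>a. (i a, l a)) {a. a < n \<and> i a = j}" by (rule inj_on_subset[OF True]) auto
    ultimately show ?thesis unfolding multiplicity_of_def by (simp only: card_image)
   qed
   have inS: "(\<forall>u\<in>S. lr \<le> snd u \<and> snd u < ls) \<longleftrightarrow> (\<forall>a<n. lr \<le> l a \<and> l a < ls)" by (auto simp: S_def pair_image_def)
   note G = gauss_deriv_increment_expectation[OF d eps t l S, of k, unfolded pr crd inS]
   show ?thesis using G by simp
  qed
  then show "c i l * expectation (\<lambda>w. ?H w * (\<Prod>a<n. ?W (i a, l a) w)) = ?\<Phi> i * (c i l * ?in l * (\<Prod>a<n. t (Suc (l a)) - t (l a)))"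
   "integrable M (\<lambda>w. c i l * (?H w * (\<Prod>a<n. ?W (i a, l a) w)))" by blast+
 qed
 have "expectation (\<lambda>w. ?H w * step_form d B n N t c w) =
   expectation (\<lambda>w. \<Sum>i\<in>index_tuples n d. \<Sum>l\<in>index_tuples n N. c i l * (?H w * (\<Prod>a<n. ?W (i a, l a) w)))"
  unfolding step_form_def by (simp add: sum_distrib_left mult.left_commute)
 also have "\<dots> = (\<Sum>i\<in>index_tuples n d. \<Sum>l\<in>index_tuples n N. expectation (\<lambda>w. c i l * (?H w * (\<Prod>a<n. ?W (i a, l a) w))))"
  using trm_int by (subst Bochner_Integration.integral_sum | intro sum.cong refl Bochner_Integration.integrable_sum)+ auto
 also have "\<dots> = (\<Sum>i\<in>index_tuples n d. \<Sum>l\<in>index_tuples n N. ?\<Phi> i * (c i l * ?in l * (\<Prod>a<n. t (Suc (l a)) - t (l a))))"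
  using trm by (intro sum.cong refl) simp
 also have "\<dots> = (\<Sum>i\<in>index_tuples n d. ?\<Phi> i * (\<integral>\<rho>. step_kernel n N t (\<lambda>i l. c i l * ?in l) i \<rho> \<partial>unit_cube n))"
  unfolding step_kernel_integral(2)[OF t] by (simp add: sum_distrib_left)
 also have "\<dots> = (\<Sum>i\<in>index_tuples n d. ?\<Phi> i * (\<integral>\<rho>. step_kernel n N t c i \<rho> * (\<Prod>a<n. indicator {t lr<..t ls} (\<rho> a)) \<partial>unit_cube n))"
 proof -
  have "step_kernel n N t (\<lambda>i l. c i l * ?in l) i \<rho> = step_kernel n N t c i \<rho> * (\<Prod>a<n. indicator {t lr<..t ls} (\<rho> a))" for i \<rho>
  proof (cases "\<exists>l\<in>index_tuples n N. \<forall>a<n. \<rho> a \<in> {t (l a)<..t (Suc (l a))}")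
   case True
   then obtain p where p: "p \<in> index_tuples n N" "\<And>a. a < n \<Longrightarrow> \<rho> a \<in> {t (p a)<..t (Suc (p a))}" by blast
   have v: "step_kernel n N t b i \<rho> = b i p" for b by (rule step_kernel_value[OF t p])
   have "indicator {t lr<..t ls} (\<rho> a) = (of_bool (lr \<le> p a \<and> p a < ls) :: real)" if a: "a < n" for a
   proof -
    have pN: "p a < N" using PiE_mem[OF p(1), of a] a by simp
    have "lr \<le> p a \<Longrightarrow> t lr \<le> t (p a)" using is_partition_le[OF t, of lr "p a"] pN by simp
    moreover have "p a < lr \<Longrightarrow> t (Suc (p a)) \<le> t lr" using is_partition_le[OF t, of "Suc (p a)" lr] l by simp
    moreover have "p a < ls \<Longrightarrow> t (Suc (p a)) \<le> t ls" using is_partition_le[OF t, of "Suc (p a)" ls] l by simp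
    moreover have "ls \<le> p a \<Longrightarrow> t ls \<le> t (p a)" using is_partition_le[OF t, of ls "p a"] pN by simp
    ultimately show ?thesis using p(2)[OF a] by (cases "lr \<le> p a"; cases "p a < ls") (auto simp: indicator_def)
   qed
   then have "(\<Prod>a<n. indicator {t lr<..t ls} (\<rho> a)) = (\<Prod>a<n. of_bool (lr \<le> p a \<and> p a < ls) :: real)" by simp
   also have "\<dots> = ?in p"
   proof (cases "\<forall>a<n. lr \<le> p a \<and> p a < ls")
    case False
    then obtain a where "a < n" "\<not> (lr \<le> p a \<and> p a < ls)" by blast
    then have "(\<Prod>a<n. of_bool (lr \<le> p a \<and> p a < ls) :: real) = 0" by (intro prod_zero bexI[of _ a]) auto
    then show ?thesis using False by simp
   qed simp
   finally show ?thesis by (simp add: v)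
  next
   case False
   have "step_kernel n N t b i \<rho> = 0" for b by (rule step_kernel_zero) (use False in blast)
   then show ?thesis by simp
  qed
  then show ?thesis by simp
 qed
 finally show ?thesis .
qed

text \<open>The two times become partition points after a refinement, which leaves the elementary integral
  unchanged.\<close>

lemma gauss_deriv_elementary_expectation:
 assumes d: "0 < d" and eps: "0 < eps" and r: "0 \<le> r" "r \<le> s" "s \<le> 1" and Y: "elementary_integral d B n g Y"
  and m: "2 * m = mi_abs d k + n"
 shows "expectation (\<lambda>w. mi_deriv d k (heat_kernel d eps) (\<lambda>j. B j s w - B j r w) * Y w) =
  (\<Sum>i\<in>index_tuples n d. (-1) ^ m * (2 * pi) powr (- (real d / 2)) * gauss_moment d k n i * (s - r + eps) powr (- (real m + real d / 2)) *
   (\<integral>\<rho>. g i \<rho> * (\<Prod>a<n. indicator {r<..s} (\<rho> a)) \<partial>unit_cube n))"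
proof -
 obtain N t c where 1: "is_partition N t" "{r, s} \<subseteq> t ` {..N}" "offdiagonal d n N c"
  "g = step_kernel n N t c" "Y = step_form d B n N t c"
  by (rule elementary_integral_refine[OF Y, of "{r, s}"]) (use r in auto)
 obtain lr ls where l: "lr \<le> N" "t lr = r" "ls \<le> N" "t ls = s" using 1(2) by auto
 have "min lr ls \<le> ls" "t (min lr ls) = r"
  using l r(2) is_partition_le[OF 1(1), of ls lr] by (auto simp: min_def)
 note l' = this
 have K: "(\<Sum>j<d. k j + multiplicity_of n i j) = 2 * m" if "i \<in> index_tuples n d" for i
  using sum_multiplicity_of[OF that] m by (simp add: sum.distrib mi_abs_def)
 have pos: "0 < eps + (s - r)" using eps r by simp
 show ?thesis
  unfolding mi_deriv_heat_kernel[OF eps] 1(4,5)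
  using gauss_deriv_step_form_expectation[OF d eps 1(1) l'(1) l(3) 1(3), of k] unfolding l l'
  by (simp add: gauss_deriv_prod_at_0[OF pos K] gauss_moment_eq ac_simps cong: sum.cong_simp)
qed

lemma elementary_integral_expectation_0:
 assumes Y: "elementary_integral d B n g Y" and n: "0 < n"
 shows "expectation Y = 0"
proof -
 obtain N t c where 1: "is_partition N t" "offdiagonal d n N c" "g = step_kernel n N t c" "Y = step_form d B n N t c"
  using Y unfolding elementary_integral_iff by blast
 interpret G: gauss_family M "{..<d} \<times> {..<N}" "\<lambda>u. t (Suc (snd u)) - t (snd u)"
  "\<lambda>u w. increment B t u w"
  by (rule gauss_family_increments[OF 1(1)])
 show ?thesis
  unfolding 1(4) step_form_eq_mform[OF 1(2), abs_def] using n
  by (subst G.mform_expectation) (simp_all add: fibre_sum_zero)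
qed

end

section \<open>The time simplex\<close>

text \<open>Pairs of times are taken from the unit square and restricted to \<open>s \<le> t\<close> by a factor in the
  integrand, so that Fubini's theorem applies on products of probability spaces. In a pair \<open>q\<close> the
  larger time comes first.\<close>

abbreviation unit_square :: "(real \<times> real) measure" where
 "unit_square \<equiv> unit_interval \<Otimes>\<^sub>M unit_interval"

lemma prob_space_unit_square: "prob_space unit_square"
 by (intro prob_space_pair prob_space_unit_interval)

lemma unit_square_measurable [measurable]:
 "fst \<in> borel_measurable unit_square" "snd \<in> borel_measurable unit_square"
proof -
 have id: "(\<lambda>x. x) \<in> borel_measurable unit_interval"
  by (rule measurable_restrict_space1) simp
 show "fst \<in> borel_measurable unit_square" by (rule measurable_compose[OF measurable_fst id])
 show "snd \<in> borel_measurable unit_square" by (rule measurable_compose[OF measurable_snd id])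
qed

lemma pair_sigma_finite_prob: "prob_space M \<Longrightarrow> prob_space N \<Longrightarrow> pair_sigma_finite M N"
 by (simp add: pair_sigma_finite_def prob_space_imp_sigma_finite)

lemma simplex_integral_eq:
 fixes F :: "real \<Rightarrow> real \<Rightarrow> real"
 assumes i: "integrable unit_square (\<lambda>q. of_bool (snd q \<le> fst q) * F (fst q) (snd q))"
 shows "(LINT t:{0..1}|lborel. LINT s:{0..t}|lborel. F t s) =
  (\<integral>q. of_bool (snd q \<le> fst q) * F (fst q) (snd q) \<partial>unit_square)"
proof -
 interpret P: pair_sigma_finite "unit_interval" "unit_interval"
  by (rule pair_sigma_finite_prob[OF prob_space_unit_interval prob_space_unit_interval])
 have "(LINT t:{0..1}|lborel. LINT s:{0..t}|lborel. F t s) =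
   (\<integral>t. (LINT s:{0..t}|lborel. F t s) \<partial>unit_interval)"
  by (subst integral_restrict_space) (simp_all add: set_lebesgue_integral_def)
 also have "\<dots> = (\<integral>t. (\<integral>s. of_bool (s \<le> t) * F t s \<partial>unit_interval) \<partial>unit_interval)"
 proof (rule Bochner_Integration.integral_cong[OF refl])
  fix t :: real assume "t \<in> space unit_interval"
  then have t: "0 \<le> t" "t \<le> 1" by auto
  have "(\<integral>s. of_bool (s \<le> t) * F t s \<partial>unit_interval) = (\<integral>s. indicator {0..1} s *\<^sub>R (of_bool (s \<le> t) * F t s) \<partial>lborel)"
   by (rule integral_restrict_space) simp
  also have "\<dots> = (LINT s:{0..t}|lborel. F t s)"
   unfolding set_lebesgue_integral_def
   by (intro Bochner_Integration.integral_cong refl) (use t in \<open>auto simp: indicator_def\<close>)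
  finally show "(LINT s:{0..t}|lborel. F t s) = (\<integral>s. of_bool (s \<le> t) * F t s \<partial>unit_interval)" by simp
 qed
 also have "\<dots> = (\<integral>q. of_bool (snd q \<le> fst q) * F (fst q) (snd q) \<partial>unit_square)"
  using P.integral_fst'[OF i] by simp
 finally show ?thesis .
qed

lemma integrable_pair_dominated:
 fixes F :: "'a \<times> 'b \<Rightarrow> real"
 assumes N: "prob_space N1" "prob_space N2" and \<phi>: "integrable N1 \<phi>" and F: "F \<in> borel_measurable (N1 \<Otimes>\<^sub>M N2)"
  and b: "\<And>z. z \<in> space (N1 \<Otimes>\<^sub>M N2) \<Longrightarrow> \<bar>F z\<bar> \<le> C * \<bar>\<phi> (fst z)\<bar>"
 shows "integrable (N1 \<Otimes>\<^sub>M N2) F"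
proof (rule Bochner_Integration.integrable_bound[OF _ F])
 have "distr (N1 \<Otimes>\<^sub>M N2) N1 fst = N1" by (rule prob_space.distr_pair_fst[OF N(2)])
 then have "integrable (distr (N1 \<Otimes>\<^sub>M N2) N1 fst) \<phi>" using \<phi> by simp
 then have "integrable (N1 \<Otimes>\<^sub>M N2) (\<lambda>z. \<phi> (fst z))" by (rule integrable_distr[OF measurable_fst])
 then show "integrable (N1 \<Otimes>\<^sub>M N2) (\<lambda>z. C * \<bar>\<phi> (fst z)\<bar>)" by (intro integrable_mult_right integrable_abs)
 show "AE z in N1 \<Otimes>\<^sub>M N2. norm (F z) \<le> norm (C * \<bar>\<phi> (fst z)\<bar>)"
 proof (rule AE_I2)
  fix z assume "z \<in> space (N1 \<Otimes>\<^sub>M N2)"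
  then have "\<bar>F z\<bar> \<le> C * \<bar>\<phi> (fst z)\<bar>" by (rule b)
  then show "norm (F z) \<le> norm (C * \<bar>\<phi> (fst z)\<bar>)" by simp
 qed
qed

section \<open>The chaos kernels are continuous\<close>

definition simplex_integrand :: "nat \<Rightarrow> real \<Rightarrow> real \<Rightarrow> (nat \<Rightarrow> real) \<Rightarrow> real \<times> real \<Rightarrow> real" where
 "simplex_integrand n p eps \<rho> q = of_bool (snd q \<le> fst q) * ((\<Prod>a<n. indicator {snd q<..fst q} (\<rho> a)) / (fst q - snd q + eps) powr p)"

definition simplex_kernel :: "nat \<Rightarrow> real \<Rightarrow> real \<Rightarrow> (nat \<Rightarrow> real) \<Rightarrow> real" where
 "simplex_kernel n p eps \<rho> = (\<integral>q. simplex_integrand n p eps \<rho> q \<partial>unit_square)"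

definition chaos_coeff :: "nat \<Rightarrow> (nat \<Rightarrow> nat) \<Rightarrow> nat \<Rightarrow> (nat \<Rightarrow> nat) \<Rightarrow> real" where
 "chaos_coeff d k m i = (let n = 2 * m - mi_abs d k in
   (-1) ^ m * gauss_moment d k n i / ((2 * pi) powr (real d / 2) * fact n))"

lemma simplex_integrand_bounded:
 assumes "0 < eps" "0 \<le> p"
 shows "\<bar>simplex_integrand n p eps \<rho> q\<bar> \<le> 1 / eps powr p"
proof (cases "snd q \<le> fst q")
 case True
 have i01: "0 \<le> (\<Prod>a<n. indicator {snd q<..fst q} (\<rho> a) :: real)" "(\<Prod>a<n. indicator {snd q<..fst q} (\<rho> a) :: real) \<le> 1"
  by (intro prod_nonneg, simp) (intro prod_le_1, simp add: indicator_def)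
 have "eps powr p \<le> (fst q - snd q + eps) powr p" using True assms by (intro powr_mono2) auto
 then have "(\<Prod>a<n. indicator {snd q<..fst q} (\<rho> a)) / (fst q - snd q + eps) powr p \<le> 1 / eps powr p"
  using i01 assms by (intro frac_le) auto
 then show ?thesis using True i01(1) by (simp add: simplex_integrand_def)
next
 case False
 then show ?thesis by (simp add: simplex_integrand_def)
qed

lemma prod_indicator_eq_of_bool:
 fixes n :: nat and \<rho> :: "nat \<Rightarrow> real"
 shows "(\<Prod>a<n. indicator {s<..t} (\<rho> a) :: real) = of_bool (\<forall>a\<in>{..<n}. s < \<rho> a \<and> \<rho> a \<le> (t :: real))"
proof (cases "\<forall>a\<in>{..<n}. s < \<rho> a \<and> \<rho> a \<le> t")
 case False
 then obtain a where "a < n" "\<not> (s < \<rho> a \<and> \<rho> a \<le> t)" by auto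
 then have "(\<Prod>a<n. indicator {s<..t} (\<rho> a) :: real) = 0" by (intro prod_zero bexI[of _ a]) auto
 then show ?thesis using False by simp
qed simp

lemma simplex_integrand_measurable:
 "(\<lambda>(\<rho>, q). simplex_integrand n p eps \<rho> q) \<in> borel_measurable (unit_cube n \<Otimes>\<^sub>M unit_square)"
proof -
 have [measurable]: "(\<lambda>z. fst (snd z)) \<in> borel_measurable (unit_cube n \<Otimes>\<^sub>M unit_square)"
  "(\<lambda>z. snd (snd z)) \<in> borel_measurable (unit_cube n \<Otimes>\<^sub>M unit_square)"
  by (rule measurable_compose[OF measurable_snd unit_square_measurable(1)], rule measurable_compose[OF measurable_snd unit_square_measurable(2)])
 have P: "Measurable.pred (unit_cube n \<Otimes>\<^sub>M unit_square) (\<lambda>z. \<forall>a\<in>{..<n}. snd (snd z) < fst z a \<and> fst z a \<le> fst (snd z))"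
 proof (rule pred_intros_finite(3))
  fix a assume "a \<in> {..<n}"
  then have [measurable]: "(\<lambda>z. fst z a) \<in> borel_measurable (unit_cube n \<Otimes>\<^sub>M unit_square)"
   by (intro measurable_compose[OF measurable_fst unit_cube_coordinate_measurable]) simp
  show "Measurable.pred (unit_cube n \<Otimes>\<^sub>M unit_square) (\<lambda>z. snd (snd z) < fst z a \<and> fst z a \<le> fst (snd z))" by measurable
 qed simp
 note [measurable] = P
 show ?thesis unfolding simplex_integrand_def prod_indicator_eq_of_bool case_prod_beta by measurable
qed

lemma simplex_integrand_measurable_section:
 "simplex_integrand n p eps \<rho> \<in> borel_measurable unit_square"
proof -
 have P: "Measurable.pred unit_square (\<lambda>q. \<forall>a\<in>{..<n}. snd q < \<rho> a \<and> \<rho> a \<le> fst q)"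
  by (rule pred_intros_finite(3)) measurable
 note [measurable] = P
 show ?thesis unfolding simplex_integrand_def[abs_def] prod_indicator_eq_of_bool by measurable
qed

lemma simplex_integrand_integrable:
 assumes "0 < eps" "0 \<le> p"
 shows "integrable unit_square (simplex_integrand n p eps \<rho>)"
proof -
 interpret prob_space unit_square by (rule prob_space_unit_square)
 show ?thesis
  by (rule integrable_const_bound[of _ "1 / eps powr p"])
    (use simplex_integrand_bounded[OF assms] simplex_integrand_measurable_section in simp_all)
qed

lemma simplex_kernel_bounded:
 assumes "0 < eps" "0 \<le> p"
 shows "\<bar>simplex_kernel n p eps \<rho>\<bar> \<le> 1 / eps powr p"
proof -
 interpret prob_space unit_square by (rule prob_space_unit_square)
 have "\<bar>simplex_kernel n p eps \<rho>\<bar> \<le> (\<integral>q. \<bar>simplex_integrand n p eps \<rho> q\<bar> \<partial>unit_square)"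
  unfolding simplex_kernel_def by (rule integral_abs_bound)
 also have "\<dots> \<le> (\<integral>q. 1 / eps powr p \<partial>unit_square)"
  by (rule integral_mono[OF integrable_abs[OF simplex_integrand_integrable[OF assms]] integrable_const simplex_integrand_bounded[OF assms]])
 also have "\<dots> = 1 / eps powr p" by (simp only: lebesgue_integral_const prob_space scaleR_one)
 finally show ?thesis .
qed

lemma chaos_kernel_eq:
 assumes "0 < eps"
 shows "chaos_kernel d k m eps i \<rho> = chaos_coeff d k m i * simplex_kernel (2 * m - mi_abs d k) (real m + real d / 2) eps \<rho>"
proof -
 have "(LINT t:{0..1}|lborel. LINT s:{0..t}|lborel.
    (\<Prod>a<n. indicator {s<..t} (\<rho> a)) / (t - s + eps) powr (real m + real d / 2)) = simplex_kernel n (real m + real d / 2) eps \<rho>" for n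
  unfolding simplex_kernel_def simplex_integrand_def
  by (rule simplex_integral_eq) (use simplex_integrand_integrable[OF assms, of "real m + real d / 2" n \<rho>] in \<open>simp add: simplex_integrand_def[abs_def]\<close>)
 then show ?thesis by (simp add: chaos_kernel_def chaos_coeff_def Let_def)
qed

lemma AE_unit_square_neq: "AE q in unit_square. fst q \<noteq> c \<and> snd q \<noteq> c"
proof -
 interpret I: prob_space "unit_interval" by (rule prob_space_unit_interval)
 have 1: "AE x in unit_interval. x \<noteq> c"
  using AE_lborel_singleton[of c] by (subst AE_restrict_space_iff) auto
 have p: "Measurable.pred unit_interval (\<lambda>x. x \<noteq> c)"
  by (rule measurable_restrict_space1) simp
 have "AE q in unit_square. fst q \<noteq> c"
 proof -
  have D: "distr unit_square unit_interval fst = unit_interval"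
   by (rule prob_space.distr_pair_fst[OF prob_space_unit_interval])
  have "AE x in distr unit_square unit_interval fst. x \<noteq> c" unfolding D by (rule 1)
  then show ?thesis by (subst (asm) AE_distr_iff[OF measurable_fst]) (use p in \<open>simp_all add: pred_def\<close>)
 qed
 moreover have "AE q in unit_square. snd q \<noteq> c"
 proof -
  interpret P: pair_sigma_finite "unit_interval" "unit_interval"
   by (rule pair_sigma_finite_prob[OF prob_space_unit_interval prob_space_unit_interval])
  have "AE x in unit_interval. AE y in unit_interval. snd (x, y) \<noteq> c" using 1 by simp
  moreover have "{q \<in> space unit_square. snd q \<noteq> c} \<in> sets unit_square" by measurable
  ultimately show ?thesis by (intro P.AE_pair_measure)
 qed
 ultimately show ?thesis by eventually_elim simp
qed

lemma simplex_kernel_tendsto: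
 assumes eps: "0 < eps" and p: "0 \<le> p" and lim: "\<And>a. a < n \<Longrightarrow> (\<lambda>q. \<rho> q a) \<longlonglongrightarrow> r a"
 shows "(\<lambda>q. simplex_kernel n p eps (\<rho> q)) \<longlonglongrightarrow> simplex_kernel n p eps r"
 unfolding simplex_kernel_def
proof (rule integral_dominated_convergence[where w = "\<lambda>_. 1 / eps powr p"])
 interpret prob_space unit_square by (rule prob_space_unit_square)
 show "integrable unit_square (\<lambda>_. 1 / eps powr p)" by (rule integrable_const)
 have "AE z in unit_square. \<forall>a\<in>{..<n}. fst z \<noteq> r a \<and> snd z \<noteq> r a"
  by (intro AE_finite_allI AE_unit_square_neq) simp
 then show "AE z in unit_square. (\<lambda>q. simplex_integrand n p eps (\<rho> q) z) \<longlonglongrightarrow> simplex_integrand n p eps r z"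
 proof eventually_elim
  case (elim z)
  have "(\<lambda>q. indicator {snd z<..fst z} (\<rho> q a) :: real) \<longlonglongrightarrow> indicator {snd z<..fst z} (r a)" if a: "a < n" for a
  proof -
   have ne: "fst z \<noteq> r a" "snd z \<noteq> r a" using elim a by auto
   have "\<forall>\<^sub>F q in sequentially. (snd z < \<rho> q a \<longleftrightarrow> snd z < r a) \<and> (\<rho> q a \<le> fst z \<longleftrightarrow> r a \<le> fst z)"
   proof (rule eventually_conj)
    show "\<forall>\<^sub>F q in sequentially. snd z < \<rho> q a \<longleftrightarrow> snd z < r a"
    proof (cases "snd z < r a")
     case True
     then show ?thesis using order_tendstoD(1)[OF lim[OF a] True] by simp
    next
     case False
     then have "r a < snd z" using ne by simp
     from order_tendstoD(2)[OF lim[OF a] this] show ?thesis by eventually_elim (use False in simp)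
    qed
    show "\<forall>\<^sub>F q in sequentially. \<rho> q a \<le> fst z \<longleftrightarrow> r a \<le> fst z"
    proof (cases "r a \<le> fst z")
     case True
     then have "r a < fst z" using ne by simp
     from order_tendstoD(2)[OF lim[OF a] this] show ?thesis by eventually_elim (use True in simp)
    next
     case False
     then have "fst z < r a" by simp
     from order_tendstoD(1)[OF lim[OF a] this] show ?thesis by eventually_elim (use False in simp)
    qed
   qed
   then have "\<forall>\<^sub>F q in sequentially. indicator {snd z<..fst z} (r a) = (indicator {snd z<..fst z} (\<rho> q a) :: real)"
    by eventually_elim (simp add: indicator_def)
   then show ?thesis by (rule Lim_transform_eventually[OF tendsto_const])
  qed
  then show ?case unfolding simplex_integrand_def divide_inverse
   by (intro tendsto_mult tendsto_const tendsto_prod) simp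
 qed
 show "AE z in unit_square. norm (simplex_integrand n p eps (\<rho> q) z) \<le> 1 / eps powr p" for q
  using simplex_integrand_bounded[OF eps p] by simp
qed (rule simplex_integrand_measurable_section)+

lemma gauss_moment_permute:
 assumes "\<pi> permutes {..<n}"
 shows "gauss_moment d k n (i \<circ> \<pi>) = gauss_moment d k n i"
proof -
 have "(\<Prod>a<n. \<xi> ((i \<circ> \<pi>) a)) = (\<Prod>a<n. \<xi> (i a))" for \<xi> :: "nat \<Rightarrow> real"
  using prod.permute[OF assms, of "\<lambda>a. \<xi> (i a)"] by (simp add: o_def)
 then show ?thesis unfolding gauss_moment_def by simp
qed

text \<open>The integrand jumps in \<open>r\<close> only where a coordinate of \<open>r\<close> equals \<open>s\<close> or \<open>t\<close>, which for fixed \<open>r\<close> is a null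
  set of pairs; dominated convergence applies since \<open>\<epsilon> > 0\<close>.\<close>

lemma continuous_kernel_chaos_kernel:
 assumes eps: "0 < eps"
 shows "continuous_kernel d (2 * m - mi_abs d k) (chaos_kernel d k m eps)"
proof -
 define n where "n = 2 * m - mi_abs d k"
 define p where "p = real m + real d / 2"
 have p: "0 \<le> p" by (simp add: p_def)
 have f: "chaos_kernel d k m eps i \<rho> = chaos_coeff d k m i * simplex_kernel n p eps \<rho>" for i \<rho>
  using chaos_kernel_eq[OF eps] by (simp add: n_def p_def)
 show ?thesis
  unfolding continuous_kernel_def n_def[symmetric]
 proof (intro conjI ballI allI impI)
  show "symmetric_kernel d n (chaos_kernel d k m eps)"
   unfolding symmetric_kernel_def
  proof (intro allI impI ballI)
   fix \<pi> i and r :: "nat \<Rightarrow> real" assume \<pi>: "\<pi> permutes {..<n}"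
   have "(\<Prod>a<n. indicator {s<..t} ((r \<circ> \<pi>) a)) = (\<Prod>a<n. indicator {s<..t} (r a) :: real)" for s t
    using prod.permute[OF \<pi>, of "\<lambda>a. indicator {s<..t} (r a) :: real"] by (simp add: o_def)
   then have "simplex_kernel n p eps (r \<circ> \<pi>) = simplex_kernel n p eps r"
    unfolding simplex_kernel_def simplex_integrand_def by simp
   moreover have "chaos_coeff d k m (i \<circ> \<pi>) = chaos_coeff d k m i"
    unfolding chaos_coeff_def Let_def n_def[symmetric] gauss_moment_permute[OF \<pi>] ..
   ultimately show "chaos_kernel d k m eps (i \<circ> \<pi>) (r \<circ> \<pi>) = chaos_kernel d k m eps i r" unfolding f by simp
  qed
  show "chaos_kernel d k m eps i \<in> borel_measurable (unit_cube n)" for i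
  proof -
   interpret prob_space unit_square by (rule prob_space_unit_square)
   have "(\<lambda>\<rho>. \<integral>q. simplex_integrand n p eps \<rho> q \<partial>unit_square) \<in> borel_measurable (unit_cube n)"
    by (rule borel_measurable_lebesgue_integral[OF simplex_integrand_measurable])
   then show ?thesis unfolding f[abs_def] simplex_kernel_def by (intro borel_measurable_times borel_measurable_const)
  qed
  show "\<exists>C. \<forall>i\<in>index_tuples n d. \<forall>r\<in>space (unit_cube n). \<bar>chaos_kernel d k m eps i r\<bar> \<le> C"
  proof (intro exI ballI)
   fix i r assume i: "i \<in> index_tuples n d"
   have "\<bar>chaos_coeff d k m i\<bar> \<le> (\<Sum>i\<in>index_tuples n d. \<bar>chaos_coeff d k m i\<bar>)"
    by (rule member_le_sum[OF i]) (simp_all add: finite_PiE)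
   then show "\<bar>chaos_kernel d k m eps i r\<bar> \<le> (\<Sum>i\<in>index_tuples n d. \<bar>chaos_coeff d k m i\<bar>) * (1 / eps powr p)"
    unfolding f abs_mult by (intro mult_mono simplex_kernel_bounded[OF eps p] sum_nonneg) auto
  qed
  show "(\<lambda>q. chaos_kernel d k m eps i (\<rho> q)) \<longlonglongrightarrow> chaos_kernel d k m eps i r" if "\<forall>a<n. (\<lambda>q. \<rho> q a) \<longlonglongrightarrow> r a" for i r \<rho>
   unfolding f using that by (intro tendsto_mult tendsto_const simplex_kernel_tendsto[OF eps p]) simp
 qed
qed

section \<open>The chaotic components of the regularised local time\<close>

context brownian_motion
begin

lemma BM_jointly_measurable:
 assumes j: "j < d"
 shows "(\<lambda>z. B j (snd z) (fst z)) \<in> borel_measurable (M \<Otimes>\<^sub>M unit_interval)"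
proof -
 let ?P = "M \<Otimes>\<^sub>M unit_interval"
 have id: "(\<lambda>x. x) \<in> borel_measurable unit_interval"
  by (rule measurable_restrict_space1) simp
 have s [measurable]: "(\<lambda>z. snd z) \<in> borel_measurable ?P" by (rule measurable_compose[OF measurable_snd id])
 define u where "u q x = real_of_int \<lceil>real (Suc q) * x\<rceil> / real (Suc q)" for q and x :: real
 show ?thesis
 proof (rule borel_measurable_LIMSEQ_real)
  fix q :: nat
  have 1: "(\<lambda>z. B j (max 0 (real_of_int c / real (Suc q))) (fst z)) \<in> borel_measurable ?P" for c :: int
   by (rule measurable_compose[OF measurable_fst BM_measurable[OF j]]) simp
  have 2: "(\<lambda>z. \<lceil>real (Suc q) * snd z\<rceil>) \<in> measurable ?P (count_space UNIV)" by measurable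
  show "(\<lambda>z. B j (max 0 (real_of_int \<lceil>real (Suc q) * snd z\<rceil> / real (Suc q))) (fst z)) \<in> borel_measurable ?P"
   by (rule measurable_compose_countable[OF 1 2])
 next
  fix z assume "z \<in> space ?P"
  then have z: "fst z \<in> space M" "0 \<le> snd z" by (auto simp: space_pair_measure)
  have lim: "(\<lambda>q. max 0 (u q (snd z))) \<longlonglongrightarrow> max 0 (snd z)"
  proof (rule tendsto_max[OF tendsto_const])
   show "(\<lambda>q. u q (snd z)) \<longlonglongrightarrow> snd z"
   proof (rule LIM_zero_cancel, rule Lim_null_comparison)
    have "norm (u q (snd z) - snd z) \<le> inverse (real (Suc q))" for q
    proof -
     have c: "real (Suc q) * snd z \<le> real_of_int \<lceil>real (Suc q) * snd z\<rceil>" "real_of_int \<lceil>real (Suc q) * snd z\<rceil> \<le> real (Suc q) * snd z + 1"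
      by linarith+
     have "u q (snd z) - snd z = (real_of_int \<lceil>real (Suc q) * snd z\<rceil> - real (Suc q) * snd z) / real (Suc q)"
      unfolding u_def by (simp add: diff_divide_distrib)
     also have "\<bar>\<dots>\<bar> \<le> 1 / real (Suc q)"
      unfolding abs_divide abs_of_nat using c by (intro divide_right_mono abs_leI) linarith+
     finally show ?thesis by (simp add: inverse_eq_divide)
    qed
    then show "\<forall>\<^sub>F q in sequentially. norm (u q (snd z) - snd z) \<le> inverse (real (Suc q))" by simp
    show "(\<lambda>q. inverse (real (Suc q))) \<longlonglongrightarrow> 0" by (rule LIMSEQ_inverse_real_of_nat)
   qed
  qed
  have "continuous_on {0..} (\<lambda>t. B j t (fst z))" by (rule BM_continuous[OF j z(1)])
  from continuous_on_tendsto_compose[OF this lim]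
  show "(\<lambda>q. B j (max 0 (real_of_int \<lceil>real (Suc q) * snd z\<rceil> / real (Suc q))) (fst z)) \<longlonglongrightarrow> B j (snd z) (fst z)"
   using z(2) by (simp add: u_def)
 qed
qed

definition alpha_integrand :: "(nat \<Rightarrow> nat) \<Rightarrow> real \<Rightarrow> 'w \<times> (real \<times> real) \<Rightarrow> real" where
 "alpha_integrand k eps z = of_bool (snd (snd z) \<le> fst (snd z)) *
   mi_deriv d k (heat_kernel d eps) (\<lambda>j. B j (fst (snd z)) (fst z) - B j (snd (snd z)) (fst z))"

lemma alpha_integrand_measurable:
 assumes eps: "0 < eps"
 shows "alpha_integrand k eps \<in> borel_measurable (M \<Otimes>\<^sub>M unit_square)"
proof -
 let ?I = "unit_interval"
 have [measurable]: "(\<lambda>z. fst (snd z)) \<in> borel_measurable (M \<Otimes>\<^sub>M unit_square)"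
  "(\<lambda>z. snd (snd z)) \<in> borel_measurable (M \<Otimes>\<^sub>M unit_square)"
  by (rule measurable_compose[OF measurable_snd unit_square_measurable(1)], rule measurable_compose[OF measurable_snd unit_square_measurable(2)])
 have "(\<lambda>z. gauss_deriv (k j) eps (B j (fst (snd z)) (fst z) - B j (snd (snd z)) (fst z))) \<in> borel_measurable (M \<Otimes>\<^sub>M unit_square)" if j: "j < d" for j
 proof -
  have 1: "(\<lambda>z. (fst z, fst (snd z))) \<in> measurable (M \<Otimes>\<^sub>M unit_square) (M \<Otimes>\<^sub>M ?I)"
   "(\<lambda>z. (fst z, snd (snd z))) \<in> measurable (M \<Otimes>\<^sub>M unit_square) (M \<Otimes>\<^sub>M ?I)" by measurable
  have [measurable]: "(\<lambda>z. B j (fst (snd z)) (fst z)) \<in> borel_measurable (M \<Otimes>\<^sub>M unit_square)"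
   "(\<lambda>z. B j (snd (snd z)) (fst z)) \<in> borel_measurable (M \<Otimes>\<^sub>M unit_square)"
   using measurable_compose[OF 1(1) BM_jointly_measurable[OF j]] measurable_compose[OF 1(2) BM_jointly_measurable[OF j]]
   unfolding fst_conv snd_conv .
  note [measurable] = gauss_deriv_measurable[OF eps]
  show ?thesis by measurable
 qed
 then have [measurable]: "(\<lambda>z. \<Prod>j<d. gauss_deriv (k j) eps (B j (fst (snd z)) (fst z) - B j (snd (snd z)) (fst z))) \<in> borel_measurable (M \<Otimes>\<^sub>M unit_square)"
  by (intro borel_measurable_prod) simp
 show ?thesis unfolding alpha_integrand_def[abs_def] mi_deriv_heat_kernel[OF eps] by measurable
qed

lemma alpha_integrand_bounded:
 assumes eps: "0 < eps"
 shows "\<exists>C. \<forall>z. \<bar>alpha_integrand k eps z\<bar> \<le> C"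
proof -
 have "\<forall>j. \<exists>C. \<forall>x. \<bar>gauss_deriv (k j) eps x\<bar> \<le> C" using gauss_deriv_bounded[OF eps] by blast
 then obtain C where C: "\<forall>j. \<forall>x. \<bar>gauss_deriv (k j) eps x\<bar> \<le> C j" by (elim choice[THEN exE])
 have "\<bar>alpha_integrand k eps z\<bar> \<le> (\<Prod>j<d. C j)" for z
 proof -
  have "\<bar>\<Prod>j<d. gauss_deriv (k j) eps (B j (fst (snd z)) (fst z) - B j (snd (snd z)) (fst z))\<bar> \<le> (\<Prod>j<d. C j)"
   unfolding abs_prod using C by (intro prod_mono) auto
  moreover have "0 \<le> (\<Prod>j<d. C j)" using order_trans[OF abs_ge_zero] C by (intro prod_nonneg) blast
  ultimately show ?thesis unfolding alpha_integrand_def mi_deriv_heat_kernel[OF eps] by simp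
 qed
 then show ?thesis by blast
qed

lemma alpha_integrand_section_integrable:
 assumes eps: "0 < eps" and w: "w \<in> space M"
 shows "integrable unit_square (\<lambda>q. alpha_integrand k eps (w, q))"
proof -
 interpret Q: prob_space unit_square by (rule prob_space_unit_square)
 obtain C where C: "\<forall>z. \<bar>alpha_integrand k eps z\<bar> \<le> C" using alpha_integrand_bounded[OF eps] ..
 show ?thesis
 proof (rule Q.integrable_const_bound[of _ C])
  show "AE q in unit_square. norm (alpha_integrand k eps (w, q)) \<le> C"
   unfolding real_norm_def by (intro AE_I2 spec[OF C])
  show "(\<lambda>q. alpha_integrand k eps (w, q)) \<in> borel_measurable unit_square"
   by (rule measurable_compose[OF measurable_Pair1'[OF w] alpha_integrand_measurable[OF eps]])
 qed
qed

lemma alpha_eq: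
 assumes eps: "0 < eps" and w: "w \<in> space M"
 shows "alpha d B k eps w = (\<integral>q. alpha_integrand k eps (w, q) \<partial>unit_square)"
 unfolding alpha_def alpha_integrand_def fst_conv snd_conv
 by (rule simplex_integral_eq) (use alpha_integrand_section_integrable[OF assms, of k] in \<open>simp add: alpha_integrand_def\<close>)

lemma alpha_measurable:
 assumes eps: "0 < eps"
 shows "alpha d B k eps \<in> borel_measurable M"
proof -
 interpret Q: prob_space unit_square by (rule prob_space_unit_square)
 have "(\<lambda>w. \<integral>q. alpha_integrand k eps (w, q) \<partial>unit_square) \<in> borel_measurable M"
  by (rule Q.borel_measurable_lebesgue_integral) (simp add: alpha_integrand_measurable[OF eps])
 then show ?thesis using alpha_eq[OF eps] by (simp cong: measurable_cong)
qed

lemma alpha_bounded: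
 assumes eps: "0 < eps"
 shows "\<exists>C. \<forall>w\<in>space M. \<bar>alpha d B k eps w\<bar> \<le> C"
proof -
 interpret Q: prob_space unit_square by (rule prob_space_unit_square)
 obtain C where C: "\<forall>z. \<bar>alpha_integrand k eps z\<bar> \<le> C" using alpha_integrand_bounded[OF eps] ..
 have "\<bar>alpha d B k eps w\<bar> \<le> C" if w: "w \<in> space M" for w
 proof -
  have "\<bar>alpha d B k eps w\<bar> \<le> (\<integral>q. \<bar>alpha_integrand k eps (w, q)\<bar> \<partial>unit_square)"
   unfolding alpha_eq[OF eps w] by (rule integral_abs_bound)
  also have "\<dots> \<le> (\<integral>q. C \<partial>unit_square)"
   by (rule integral_mono[OF integrable_abs[OF alpha_integrand_section_integrable[OF eps w]] Q.integrable_const]) (rule spec[OF C])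
  also have "\<dots> = C" by (simp only: lebesgue_integral_const Q.prob_space scaleR_one)
  finally show ?thesis .
 qed
 then show ?thesis by blast
qed

text \<open>Fubini's theorem moves the integral over the two times inside, where it produces the chaos kernel.\<close>

lemma alpha_ip_elementary:
 assumes d: "0 < d" and eps: "0 < eps" and Y: "elementary_integral d B n g Y" and n: "0 < n" and m: "2 * m = mi_abs d k + n"
 shows "expectation (\<lambda>w. alpha d B k eps w * Y w) = fact n * kernel_ip d n (chaos_kernel d k m eps) g"
proof -
 interpret Q: prob_space unit_square by (rule prob_space_unit_square)
 interpret MQ: pair_sigma_finite M unit_square by (rule pair_sigma_finite_prob) unfold_locales
 have nm: "2 * m - mi_abs d k = n" using m by simp
 define p where "p = real m + real d / 2"
 have p: "0 \<le> p" by (simp add: p_def)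
 note Ym [measurable] = elementary_integral_sq(1)[OF Y]
 have Yi: "integrable M Y" by (rule expectation_abs_le_sqrt(1)[OF Ym elementary_integral_sq(2)[OF Y]])
 obtain C where C: "\<forall>z. \<bar>alpha_integrand k eps z\<bar> \<le> C" using alpha_integrand_bounded[OF eps] ..
 note [measurable] = alpha_integrand_measurable[OF eps, of k]
 have int: "integrable (M \<Otimes>\<^sub>M unit_square) (\<lambda>z. alpha_integrand k eps z * Y (fst z))"
 proof (rule integrable_pair_dominated[OF prob_space_axioms prob_space_unit_square Yi])
  show "(\<lambda>z. alpha_integrand k eps z * Y (fst z)) \<in> borel_measurable (M \<Otimes>\<^sub>M unit_square)" by measurable
  show "\<bar>alpha_integrand k eps z * Y (fst z)\<bar> \<le> C * \<bar>Y (fst z)\<bar>" for z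
   unfolding abs_mult by (intro mult_right_mono spec[OF C] abs_ge_zero)
 qed
 have "expectation (\<lambda>w. alpha d B k eps w * Y w) = expectation (\<lambda>w. \<integral>q. alpha_integrand k eps (w, q) * Y w \<partial>unit_square)"
  by (rule Bochner_Integration.integral_cong[OF refl]) (simp add: alpha_eq[OF eps])
 also have "\<dots> = (\<integral>q. expectation (\<lambda>w. alpha_integrand k eps (w, q) * Y w) \<partial>unit_square)"
  by (rule MQ.Fubini_integral[symmetric]) (use int in \<open>simp add: case_prod_beta'\<close>)
 also have "\<dots> = (\<integral>q. (\<Sum>i\<in>index_tuples n d. fact n * chaos_coeff d k m i * (\<integral>\<rho>. g i \<rho> * simplex_integrand n p eps \<rho> q \<partial>unit_cube n)) \<partial>unit_square)"
 proof (rule Bochner_Integration.integral_cong[OF refl])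
  fix q assume q: "q \<in> space unit_square"
  obtain s r where sr: "q = (s, r)" by (cases q)
  show "expectation (\<lambda>w. alpha_integrand k eps (w, q) * Y w) =
    (\<Sum>i\<in>index_tuples n d. fact n * chaos_coeff d k m i * (\<integral>\<rho>. g i \<rho> * simplex_integrand n p eps \<rho> q \<partial>unit_cube n))"
  proof (cases "r \<le> s")
   case True
   have b: "0 \<le> r" "s \<le> 1" using q by (auto simp: sr space_pair_measure)
   have "expectation (\<lambda>w. alpha_integrand k eps (w, q) * Y w) =
     expectation (\<lambda>w. mi_deriv d k (heat_kernel d eps) (\<lambda>j. B j s w - B j r w) * Y w)"
    using True by (simp add: alpha_integrand_def sr)
   also have "\<dots> = (\<Sum>i\<in>index_tuples n d. (-1) ^ m * (2 * pi) powr (- (real d / 2)) * gauss_moment d k n i * (s - r + eps) powr (- p) *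
     (\<integral>\<rho>. g i \<rho> * (\<Prod>a<n. indicator {r<..s} (\<rho> a)) \<partial>unit_cube n))"
    unfolding p_def by (rule gauss_deriv_elementary_expectation[OF d eps b(1) True b(2) Y m])
   also have "\<dots> = (\<Sum>i\<in>index_tuples n d. fact n * chaos_coeff d k m i * (\<integral>\<rho>. g i \<rho> * simplex_integrand n p eps \<rho> q \<partial>unit_cube n))"
   proof (rule sum.cong[OF refl])
    fix i
    have 1: "(\<integral>\<rho>. g i \<rho> * simplex_integrand n p eps \<rho> q \<partial>unit_cube n) =
      (s - r + eps) powr (- p) * (\<integral>\<rho>. g i \<rho> * (\<Prod>a<n. indicator {r<..s} (\<rho> a)) \<partial>unit_cube n)"
     unfolding simplex_integrand_def sr fst_conv snd_conv powr_minus_divide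
     using True by (subst integral_mult_right_zero[symmetric]) (simp add: mult_ac)
    have 2: "fact n * chaos_coeff d k m i = (-1) ^ m * (2 * pi) powr (- (real d / 2)) * gauss_moment d k n i"
     unfolding chaos_coeff_def Let_def nm powr_minus_divide by simp
    show "(-1) ^ m * (2 * pi) powr (- (real d / 2)) * gauss_moment d k n i * (s - r + eps) powr (- p) *
     (\<integral>\<rho>. g i \<rho> * (\<Prod>a<n. indicator {r<..s} (\<rho> a)) \<partial>unit_cube n) =
     fact n * chaos_coeff d k m i * (\<integral>\<rho>. g i \<rho> * simplex_integrand n p eps \<rho> q \<partial>unit_cube n)"
     unfolding 1 2 by (simp only: mult.assoc)
   qed
   finally show ?thesis .
  next
   case False
   then show ?thesis by (simp add: alpha_integrand_def simplex_integrand_def sr)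
  qed
 qed
 also have "\<dots> = (\<Sum>i\<in>index_tuples n d. fact n * chaos_coeff d k m i * (\<integral>\<rho>. g i \<rho> * simplex_kernel n p eps \<rho> \<partial>unit_cube n))"
 proof -
  interpret CQ: pair_sigma_finite "unit_cube n" unit_square by (rule pair_sigma_finite_prob[OF prob_space_unit_cube prob_space_unit_square])
  have gi: "integrable (unit_cube n) (g i)" for i
  proof -
   obtain N t c where "is_partition N t" "g = step_kernel n N t c" using Y unfolding elementary_integral_iff by blast
   then show ?thesis using step_kernel_integral(1) by simp
  qed
  have J: "integrable (unit_cube n \<Otimes>\<^sub>M unit_square) (\<lambda>z. g i (fst z) * simplex_integrand n p eps (fst z) (snd z))" for i
  proof (rule integrable_pair_dominated[OF prob_space_unit_cube prob_space_unit_square gi])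
   have [measurable]: "g i \<in> borel_measurable (unit_cube n)" using gi by simp
   have [measurable]: "(\<lambda>z. simplex_integrand n p eps (fst z) (snd z)) \<in> borel_measurable (unit_cube n \<Otimes>\<^sub>M unit_square)"
    using simplex_integrand_measurable[of n p eps] by (simp add: case_prod_beta')
   show "(\<lambda>z. g i (fst z) * simplex_integrand n p eps (fst z) (snd z)) \<in> borel_measurable (unit_cube n \<Otimes>\<^sub>M unit_square)" by measurable
   show "\<bar>g i (fst z) * simplex_integrand n p eps (fst z) (snd z)\<bar> \<le> 1 / eps powr p * \<bar>g i (fst z)\<bar>" for z
    unfolding abs_mult using mult_left_mono[OF simplex_integrand_bounded[OF eps p], of "\<bar>g i (fst z)\<bar>"] by (simp add: mult.commute)
  qed
  have int_q: "integrable unit_square (\<lambda>q. \<integral>\<rho>. g i \<rho> * simplex_integrand n p eps \<rho> q \<partial>unit_cube n)" for i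
   by (rule CQ.integrable_snd) (use J[of i] in \<open>simp add: case_prod_beta'\<close>)
  have fub: "(\<integral>q. (\<integral>\<rho>. g i \<rho> * simplex_integrand n p eps \<rho> q \<partial>unit_cube n) \<partial>unit_square) = (\<integral>\<rho>. g i \<rho> * simplex_kernel n p eps \<rho> \<partial>unit_cube n)" for i
  proof -
   have "(\<integral>q. (\<integral>\<rho>. g i \<rho> * simplex_integrand n p eps \<rho> q \<partial>unit_cube n) \<partial>unit_square) =
     (\<integral>\<rho>. (\<integral>q. g i \<rho> * simplex_integrand n p eps \<rho> q \<partial>unit_square) \<partial>unit_cube n)"
    by (rule CQ.Fubini_integral) (use J[of i] in \<open>simp add: case_prod_beta'\<close>)
   then show ?thesis unfolding simplex_kernel_def by simp
  qed
  show ?thesis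
   by (subst Bochner_Integration.integral_sum) (simp_all add: int_q fub)
 qed
 also have "\<dots> = fact n * kernel_ip d n (chaos_kernel d k m eps) g"
  unfolding kernel_ip_def chaos_kernel_eq[OF eps] nm p_def[symmetric]
  by (simp add: sum_distrib_left mult.assoc mult.commute[of "g _ _"])
 finally show ?thesis .
qed

text \<open>The regularised local time and the multiple integral have the same correlation with every elementary
  integral of the same order, and these integrals have mean zero. Elements of the chaos are their limits in
  mean square.\<close>

lemma chaos_term_chaotic_component:
 assumes d: "0 < d" and eps: "0 < eps" and m: "mi_abs d k < 2 * m"
 shows "chaotic_component M d B (2 * m - mi_abs d k) (\<lambda>w. alpha d B k eps w - expectation (alpha d B k eps)) (chaos_term M d B k m eps)"
proof -
 define n where "n = 2 * m - mi_abs d k"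
 have n: "0 < n" and nm: "2 * m = mi_abs d k + n" using m by (auto simp: n_def)
 define f where "f = chaos_kernel d k m eps"
 define X where "X = chaos_term M d B k m eps"
 have f: "continuous_kernel d n f" unfolding f_def n_def by (rule continuous_kernel_chaos_kernel[OF eps])
 have X: "is_multiple_integral M d B n f X"
  unfolding X_def chaos_term_def n_def[symmetric] f_def[symmetric] by (rule continuous_kernel_multiple_integral[OF f])
 note L2f = continuous_kernel_L2[OF f]
 have Xm [measurable]: "X \<in> borel_measurable M" and Xi: "integrable M (\<lambda>w. (X w)^2)"
  by (rule is_multiple_integralE[OF X L2f], assumption)+
 define F where "F = (\<lambda>w. alpha d B k eps w - expectation (alpha d B k eps))"
 note am [measurable] = alpha_measurable[OF eps, of k]
 have Fm [measurable]: "F \<in> borel_measurable M" unfolding F_def by measurable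
 obtain C where C: "\<forall>w\<in>space M. \<bar>alpha d B k eps w\<bar> \<le> C" using alpha_bounded[OF eps] ..
 have ai: "integrable M (\<lambda>w. (alpha d B k eps w)^2)"
 proof (rule integrable_const_bound[of _ "C^2"])
  show "AE w in M. norm ((alpha d B k eps w)^2) \<le> C^2"
  proof (rule AE_I2)
   fix w assume "w \<in> space M"
   then have "\<bar>alpha d B k eps w\<bar> \<le> C" using C by simp
   from power_mono[OF this, of 2] show "norm ((alpha d B k eps w)^2) \<le> C^2" by simp
  qed
 qed measurable
 have Fi: "integrable M (\<lambda>w. (F w)^2)"
  unfolding F_def by (rule integrable_sq_add(2)[OF am _ ai]) simp_all
 have Di: "integrable M (\<lambda>w. (F w - X w)^2)" by (rule integrable_sq_add(2)[OF Fm Xm Fi Xi])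
 have orth: "expectation (\<lambda>w. Z w * (F w - X w)) = 0" if Z: "elementary_integral d B n g Z" for g Z
 proof -
  note Zm [measurable] = elementary_integral_sq(1)[OF Z] and Zi = elementary_integral_sq(2)[OF Z]
  have 1: "integrable M (\<lambda>w. alpha d B k eps w * Z w)" by (rule integrable_mult_of_sq[OF am Zm ai Zi])
  have 2: "integrable M (\<lambda>w. X w * Z w)" by (rule integrable_mult_of_sq[OF Xm Zm Xi Zi])
  have 3: "integrable M Z" by (rule expectation_abs_le_sqrt(1)[OF Zm Zi])
  have "expectation (\<lambda>w. Z w * (F w - X w)) =
    expectation (\<lambda>w. alpha d B k eps w * Z w - expectation (alpha d B k eps) * Z w - X w * Z w)"
   by (rule Bochner_Integration.integral_cong[OF refl]) (simp add: F_def algebra_simps)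
  also have "\<dots> = expectation (\<lambda>w. alpha d B k eps w * Z w) - expectation (alpha d B k eps) * expectation Z - expectation (\<lambda>w. X w * Z w)"
   using 1 2 3 by simp
  also have "\<dots> = 0"
   unfolding alpha_ip_elementary[OF d eps Z n nm] elementary_integral_expectation_0[OF Z n]
    multiple_integral_ip_elementary[OF X L2f continuous_kernel_sym_approximable[OF f] Z] f_def by simp
  finally show ?thesis .
 qed
 have "chaotic_component M d B n F X"
  unfolding chaotic_component_def
 proof (intro conjI ballI)
  show "F \<in> borel_measurable M" "integrable M (\<lambda>w. (F w)^2)" by fact+
  show "X \<in> wiener_chaos M d B n"
   unfolding wiener_chaos_def using X continuous_kernel_sym_L2[OF f] by blast
  fix Y assume "Y \<in> wiener_chaos M d B n"
  then obtain h where h: "sym_L2_kernel d n h" "is_multiple_integral M d B n h Y" unfolding wiener_chaos_def by blast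
  note L2h = sym_L2_kernel_imp_L2_kernel[OF h(1)]
  have Ym: "Y \<in> borel_measurable M" and Yi: "integrable M (\<lambda>w. (Y w)^2)"
   by (rule is_multiple_integralE[OF h(2) L2h], assumption)+
  obtain g Z where Z: "\<And>q. elementary_integral d B n (g q) (Z q)" "(\<lambda>q. kernel_diff_sq d n (g q) h) \<longlonglongrightarrow> 0"
   "(\<lambda>q. expectation (\<lambda>w. (Z q w - Y w)^2)) \<longlonglongrightarrow> 0"
   by (rule is_multiple_integralE[OF h(2) L2h]) blast
  have "(\<lambda>q. expectation (\<lambda>w. Z q w * (F w - X w))) \<longlonglongrightarrow> expectation (\<lambda>w. Y w * (F w - X w))"
   by (rule integral_mult_tendsto[OF elementary_integral_sq(1)[OF Z(1)] Ym _ elementary_integral_sq(2)[OF Z(1)] Yi Di Z(3)]) measurable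
  then have "(\<lambda>q. 0) \<longlonglongrightarrow> expectation (\<lambda>w. Y w * (F w - X w))" by (simp only: orth[OF Z(1)])
  then have "expectation (\<lambda>w. Y w * (F w - X w)) = 0" by (rule LIMSEQ_unique[OF _ tendsto_const])
  then show "expectation (\<lambda>w. (F w - X w) * Y w) = 0" by (simp only: mult.commute)
 qed
 then show ?thesis unfolding n_def F_def X_def .
qed

end

(* The projections of other products occur below as well. *)
declare unit_square_measurable [measurable del]

section \<open>The joint law of the extreme coordinates\<close>

definition lowest :: "nat \<Rightarrow> (nat \<Rightarrow> real) \<Rightarrow> real" where "lowest n r = Min (r ` {..<n})"

definition highest :: "nat \<Rightarrow> (nat \<Rightarrow> real) \<Rightarrow> real" where "highest n r = Max (r ` {..<n})"

lemma nn_integral_unit_interval: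
 fixes f :: "real \<Rightarrow> ennreal"
 shows "(\<integral>\<^sup>+ x. f x \<partial>unit_interval) = (\<integral>\<^sup>+ x. f x * indicator {0..1} x \<partial>lborel)"
 by (rule nn_integral_restrict_space) simp

lemma borel_measurable_unit_interval:
 "f \<in> borel_measurable borel \<Longrightarrow> f \<in> borel_measurable unit_interval"
 by (rule measurable_restrict_space1) simp

text \<open>Almost every point of the cube has exactly one smallest and one largest coordinate. There are
  \<open>n (n - 1)\<close> possible positions for the pair, and the remaining coordinates lie in between.\<close>

lemma extreme_coordinates_decomposition:
 fixes H :: "real \<Rightarrow> real \<Rightarrow> ennreal"
 assumes n: "2 \<le> n" and dist: "\<And>a b. a < n \<Longrightarrow> b < n \<Longrightarrow> a \<noteq> b \<Longrightarrow> r a \<noteq> r b"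
 shows "H (lowest n r) (highest n r) =
  (\<Sum>i<n. \<Sum>j\<in>{..<n} - {i}. H (r i) (r j) * of_bool (r i \<le> r j) * (\<Prod>k\<in>{..<n} - {i, j}. indicator {r i..r j} (r k)))"
proof -
 have fin: "finite (r ` {..<n})" "r ` {..<n} \<noteq> {}" using n by (auto simp: lessThan_empty_iff)
 obtain i where i: "i < n" "r i = lowest n r" using Min_in[OF fin] unfolding lowest_def by auto
 obtain j where j: "j < n" "r j = highest n r" using Max_in[OF fin] unfolding highest_def by auto
 have lo: "r i \<le> r k" if "k < n" for k unfolding i(2) lowest_def using fin that by (intro Min_le) auto
 have hi: "r k \<le> r j" if "k < n" for k unfolding j(2) highest_def using fin that by (intro Max_ge) auto
 have ij: "i \<noteq> j"
 proof
  assume "i = j"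
  then have "r k = r i" if "k < n" for k using lo[OF that] hi[OF that] by simp
  then have "r 0 = r 1" using n by simp
  then show False using dist[of 0 1] n by simp
 qed
 let ?T = "\<lambda>i' j'. H (r i') (r j') * of_bool (r i' \<le> r j') * (\<Prod>k\<in>{..<n} - {i', j'}. indicator {r i'..r j'} (r k)) :: ennreal"
 have zero: "?T i' j' = 0" if "i' < n" "j' < n" "i' \<noteq> j'" "i' \<noteq> i \<or> j' \<noteq> j" for i' j'
 proof (cases "r i' \<le> r j'")
  case True
  have "\<exists>k\<in>{..<n} - {i', j'}. indicator {r i'..r j'} (r k) = (0 :: ennreal)"
  proof (cases "i' = i")
   case True
   then have jj: "j' \<noteq> j" using that by simp
   have "r j' < r j" using hi[OF that(2)] dist[OF that(2) j(1) jj] by simp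
   then show ?thesis using jj j(1) ij True by (intro bexI[of _ j]) auto
  next
   case False
   have lt: "r i < r i'" using lo[OF that(1)] dist[OF i(1) that(1)] False by fastforce
   then have "i \<noteq> j'" using True by auto
   then show ?thesis using lt i(1) False by (intro bexI[of _ i]) auto
  qed
  then have "(\<Prod>k\<in>{..<n} - {i', j'}. indicator {r i'..r j'} (r k) :: ennreal) = 0" by (intro prod_zero) auto
  then show ?thesis by simp
 qed simp
 have "(\<Sum>i'<n. \<Sum>j'\<in>{..<n} - {i'}. ?T i' j') = (\<Sum>i'\<in>{i}. \<Sum>j'\<in>{..<n} - {i'}. ?T i' j')"
 proof (rule sum.mono_neutral_right)
  show "\<forall>i'\<in>{..<n} - {i}. (\<Sum>j'\<in>{..<n} - {i'}. ?T i' j') = 0"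
   by (intro ballI sum.neutral zero) auto
 qed (use i(1) in auto)
 also have "\<dots> = (\<Sum>j'\<in>{..<n} - {i}. ?T i j')" by simp
 also have "\<dots> = (\<Sum>j'\<in>{j}. ?T i j')"
 proof (rule sum.mono_neutral_right)
  show "\<forall>j'\<in>{..<n} - {i} - {j}. ?T i j' = 0"
   by (intro ballI zero) (use i(1) in auto)
 qed (use j(1) ij in auto)
 also have "\<dots> = H (lowest n r) (highest n r)"
  using lo[OF j(1)] lo hi i j by simp
 finally show ?thesis by simp
qed

text \<open>The \<open>n - 2\<close> coordinates in between are integrated out and leave a power of the gap.\<close>

lemma nn_integral_lowest_highest:
 fixes H :: "real \<Rightarrow> real \<Rightarrow> ennreal"
 assumes n: "2 \<le> n" and H [measurable]: "(\<lambda>(x, y). H x y) \<in> borel_measurable (borel \<Otimes>\<^sub>M borel)"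
 shows "(\<integral>\<^sup>+ r. H (lowest n r) (highest n r) \<partial>unit_cube n) =
  of_nat (n * (n - 1)) * (\<integral>\<^sup>+ x. (\<integral>\<^sup>+ y. H x y * ennreal ((y - x) ^ (n - 2)) * indicator {x..1} y \<partial>lborel) * indicator {0..1} x \<partial>lborel)"
proof -
 let ?h = "\<lambda>x y. H x y * ennreal ((y - x) ^ (n - 2)) * indicator {x..1} y"
 let ?R = "\<integral>\<^sup>+ x. (\<integral>\<^sup>+ y. ?h x y \<partial>lborel) * indicator {0..1} x \<partial>lborel"
 interpret P: product_sigma_finite "\<lambda>_::nat. unit_interval" by (rule product_sigma_finite_unit)
 let ?I = "unit_interval"
 let ?T = "\<lambda>i j r. H (r i) (r j) * of_bool (r i \<le> r j) * (\<Prod>k\<in>{..<n} - {i, j}. indicator {r i..r j} (r k)) :: ennreal"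
 have Tm: "?T i j \<in> borel_measurable (unit_cube n)" if ij: "i < n" "j < n" for i j
 proof -
  have c: "(\<lambda>r. r a) \<in> borel_measurable (unit_cube n)" if "a < n" for a
   using unit_cube_coordinate_measurable that by auto
  have "(\<lambda>r. \<Prod>k\<in>{..<n} - {i, j}. indicator {r i..r j} (r k) :: ennreal) \<in> borel_measurable (unit_cube n)"
  proof (rule borel_measurable_prod_ennreal)
   fix k assume "k \<in> {..<n} - {i, j}"
   then have k: "k < n" by simp
   have eq: "(\<lambda>r. indicator {r i..r j} (r k) :: ennreal) = (\<lambda>r. if r i \<le> r k \<and> r k \<le> r j then 1 else 0)"
    by (auto simp: indicator_def)
   show "(\<lambda>r. indicator {r i..r j} (r k) :: ennreal) \<in> borel_measurable (unit_cube n)"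
    unfolding eq by (intro measurable_If measurable_const sets.sets_Collect_conj borel_measurable_le c k ij) auto
  qed
  note [measurable] = this
  have [measurable]: "(\<lambda>r. of_bool (r i \<le> r j) :: ennreal) \<in> borel_measurable (unit_cube n)"
   unfolding of_bool_def by (intro measurable_If measurable_const borel_measurable_le c ij) auto
  have "(\<lambda>r. H (r i) (r j)) \<in> borel_measurable (unit_cube n)"
   using measurable_compose[OF measurable_Pair[OF c[OF ij(1)] c[OF ij(2)]] H] by simp
  note [measurable] = this
  show ?thesis by measurable
 qed
 have T: "(\<integral>\<^sup>+ r. ?T i j r \<partial>unit_cube n) =
   ?R"
  if ij: "i < n" "j < n" "i \<noteq> j" for i j
 proof -
  define K where "K = {..<n} - {i, j}"
  have K: "finite K" "i \<notin> insert j K" "j \<notin> K" "{..<n} = insert i (insert j K)" "card K = n - 2"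
   using ij by (auto simp: K_def card_Diff_subset)
  have T1: "?T i j \<in> borel_measurable (Pi\<^sub>M (insert i (insert j K)) (\<lambda>_. ?I))" using Tm[OF ij(1,2)] K(4) by simp
  have "(\<integral>\<^sup>+ r. ?T i j r \<partial>unit_cube n) = (\<integral>\<^sup>+ x. (\<integral>\<^sup>+ r. ?T i j (r(i := x)) \<partial>Pi\<^sub>M (insert j K) (\<lambda>_. ?I)) \<partial>?I)"
   unfolding K(4) by (rule P.product_nn_integral_insert_rev) (use K T1 in auto)
  also have "\<dots> = (\<integral>\<^sup>+ x. (\<integral>\<^sup>+ y. ?h x y \<partial>lborel) \<partial>?I)"
  proof (rule nn_integral_cong)
   fix x assume x: "x \<in> space ?I"
   have m: "(\<lambda>r. ?T i j (r(i := x))) \<in> borel_measurable (Pi\<^sub>M (insert j K) (\<lambda>_. ?I))"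
   proof (rule measurable_compose[OF _ T1])
    show "(\<lambda>r. r(i := x)) \<in> measurable (Pi\<^sub>M (insert j K) (\<lambda>_. ?I)) (Pi\<^sub>M (insert i (insert j K)) (\<lambda>_. ?I))"
     by (rule measurable_fun_upd[where J = "insert j K"]) (use x in auto)
   qed
   have "(\<integral>\<^sup>+ r. ?T i j (r(i := x)) \<partial>Pi\<^sub>M (insert j K) (\<lambda>_. ?I)) =
     (\<integral>\<^sup>+ y. (\<integral>\<^sup>+ r. ?T i j ((r(j := y))(i := x)) \<partial>Pi\<^sub>M K (\<lambda>_. ?I)) \<partial>?I)"
    by (rule P.product_nn_integral_insert_rev) (use K m in auto)
   also have "\<dots> = (\<integral>\<^sup>+ y. ?h x y \<partial>?I)"
   proof (rule nn_integral_cong)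
    fix y assume y: "y \<in> space ?I"
    have eq: "?T i j ((r(j := y))(i := x)) = H x y * of_bool (x \<le> y) * (\<Prod>k\<in>K. indicator {x..y} (r k))" for r
    proof -
     have "(\<Prod>k\<in>{..<n} - {i, j}. indicator {x..y} (((r(j := y))(i := x)) k) :: ennreal) = (\<Prod>k\<in>K. indicator {x..y} (r k))"
      unfolding K_def by (rule prod.cong) auto
     then show ?thesis using ij(3) by simp
    qed
    have xy: "{x..y} \<subseteq> {0..1}" using x y by auto
    have "(\<integral>\<^sup>+ r. ?T i j ((r(j := y))(i := x)) \<partial>Pi\<^sub>M K (\<lambda>_. ?I)) =
      H x y * of_bool (x \<le> y) * (\<integral>\<^sup>+ r. (\<Prod>k\<in>K. indicator {x..y} (r k)) \<partial>Pi\<^sub>M K (\<lambda>_. ?I))"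
     unfolding eq
    proof (rule nn_integral_cmult, rule borel_measurable_prod_ennreal)
     fix k assume k: "k \<in> K"
     show "(\<lambda>r. indicator {x..y} (r k) :: ennreal) \<in> borel_measurable (Pi\<^sub>M K (\<lambda>_. ?I))"
      by (rule measurable_compose[OF measurable_component_singleton[OF k] borel_measurable_unit_interval]) simp
    qed
    also have "(\<integral>\<^sup>+ r. (\<Prod>k\<in>K. indicator {x..y} (r k)) \<partial>Pi\<^sub>M K (\<lambda>_. ?I)) = (\<Prod>k\<in>K. \<integral>\<^sup>+ z. indicator {x..y} z \<partial>?I)"
     by (rule P.product_nn_integral_prod[OF K(1)]) (rule borel_measurable_unit_interval, simp)
    also have "(\<integral>\<^sup>+ z. indicator {x..y} z \<partial>?I) = emeasure lborel {x..y}"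
    proof -
     have "(\<integral>\<^sup>+ z. indicator {x..y} z \<partial>?I) = (\<integral>\<^sup>+ z. indicator {x..y} z \<partial>lborel)"
      unfolding nn_integral_unit_interval using xy by (intro nn_integral_cong) (auto simp: indicator_def)
     then show ?thesis by simp
    qed
    also have "H x y * of_bool (x \<le> y) * (\<Prod>k\<in>K. emeasure lborel {x..y}) = ?h x y"
    proof (cases "x \<le> y")
     case True
     then have "(\<Prod>k\<in>K. emeasure lborel {x..y}) = ennreal ((y - x) ^ (n - 2))" by (simp add: K(5) ennreal_power)
     then show ?thesis using True y by (simp add: indicator_def)
    qed (simp add: indicator_def)
    finally show "(\<integral>\<^sup>+ r. ?T i j ((r(j := y))(i := x)) \<partial>Pi\<^sub>M K (\<lambda>_. ?I)) = ?h x y" .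
   qed
   also have "\<dots> = (\<integral>\<^sup>+ y. ?h x y \<partial>lborel)"
    unfolding nn_integral_unit_interval using x by (intro nn_integral_cong) (auto simp: indicator_def)
   finally show "(\<integral>\<^sup>+ r. ?T i j (r(i := x)) \<partial>Pi\<^sub>M (insert j K) (\<lambda>_. ?I)) = (\<integral>\<^sup>+ y. ?h x y \<partial>lborel)" .
  qed
  finally show ?thesis unfolding nn_integral_unit_interval .
 qed
 have "(\<integral>\<^sup>+ r. H (lowest n r) (highest n r) \<partial>unit_cube n) = (\<integral>\<^sup>+ r. (\<Sum>i<n. \<Sum>j\<in>{..<n} - {i}. ?T i j r) \<partial>unit_cube n)"
 proof (rule nn_integral_cong_AE, use AE_unit_cube_distinct in eventually_elim)
  case (elim r)
  show ?case by (rule extreme_coordinates_decomposition[OF n]) (use elim in blast)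
 qed
 also have "\<dots> = (\<Sum>i<n. \<Sum>j\<in>{..<n} - {i}. \<integral>\<^sup>+ r. ?T i j r \<partial>unit_cube n)"
 proof -
  have "(\<integral>\<^sup>+ r. (\<Sum>i<n. \<Sum>j\<in>{..<n} - {i}. ?T i j r) \<partial>unit_cube n) = (\<Sum>i<n. \<integral>\<^sup>+ r. (\<Sum>j\<in>{..<n} - {i}. ?T i j r) \<partial>unit_cube n)"
   by (rule nn_integral_sum, rule borel_measurable_sum, rule Tm) auto
  also have "\<dots> = (\<Sum>i<n. \<Sum>j\<in>{..<n} - {i}. \<integral>\<^sup>+ r. ?T i j r \<partial>unit_cube n)"
   by (rule sum.cong[OF refl], rule nn_integral_sum, rule Tm) auto
  finally show ?thesis .
 qed
 also have "\<dots> = (\<Sum>i<n. \<Sum>j\<in>{..<n} - {i}. ?R)"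
  by (intro sum.cong refl T) auto
 also have "\<dots> = of_nat (n * (n - 1)) * ?R"
  using n by (simp add: mult.assoc)
 finally show ?thesis .
qed

section \<open>Mass concentrating on the diagonal\<close>

text \<open>The substitution \<open>y = x + z\<close> separates the gap \<open>z\<close> from the position \<open>x\<close>; the bounds differ because the
  gap is also limited by \<open>1 - x\<close>.\<close>

lemma nn_integral_shift:
 fixes f :: "real \<Rightarrow> ennreal"
 assumes "f \<in> borel_measurable borel"
 shows "(\<integral>\<^sup>+ y. f (y - x) \<partial>lborel) = (\<integral>\<^sup>+ z. f z \<partial>lborel)"
 using nn_integral_real_affine[OF assms, of 1 "- x"] by simp

lemma simplex_strip_le:
 fixes w :: "real \<Rightarrow> ennreal"
 assumes [measurable]: "w \<in> borel_measurable borel" "A \<in> sets borel"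
 shows "(\<integral>\<^sup>+ x. (\<integral>\<^sup>+ y. w (y - x) * indicator {x..1} y \<partial>lborel) * indicator (A \<inter> {0..1}) x \<partial>lborel) \<le>
  (\<integral>\<^sup>+ z. w z * indicator {0..1} z \<partial>lborel) * emeasure lborel (A \<inter> {0..1})"
proof -
 have "(\<integral>\<^sup>+ x. (\<integral>\<^sup>+ y. w (y - x) * indicator {x..1} y \<partial>lborel) * indicator (A \<inter> {0..1}) x \<partial>lborel) \<le>
   (\<integral>\<^sup>+ x. (\<integral>\<^sup>+ z. w z * indicator {0..1} z \<partial>lborel) * indicator (A \<inter> {0..1}) x \<partial>lborel)"
 proof (rule nn_integral_mono)
  fix x :: real
  show "(\<integral>\<^sup>+ y. w (y - x) * indicator {x..1} y \<partial>lborel) * indicator (A \<inter> {0..1}) x \<le>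
    (\<integral>\<^sup>+ z. w z * indicator {0..1} z \<partial>lborel) * indicator (A \<inter> {0..1}) x"
  proof (cases "x \<in> {0..1}")
   case True
   have "(\<integral>\<^sup>+ y. w (y - x) * indicator {x..1} y \<partial>lborel) \<le> (\<integral>\<^sup>+ y. w (y - x) * indicator {0..1} (y - x) \<partial>lborel)"
    using True by (intro nn_integral_mono) (auto simp: indicator_def)
   also have "\<dots> = (\<integral>\<^sup>+ z. w z * indicator {0..1} z \<partial>lborel)"
    by (rule nn_integral_shift) measurable
   finally show ?thesis by (rule mult_right_mono) simp
  qed simp
 qed
 also have "\<dots> = (\<integral>\<^sup>+ z. w z * indicator {0..1} z \<partial>lborel) * emeasure lborel (A \<inter> {0..1})"
  by (subst nn_integral_cmult_indicator) auto
 finally show ?thesis .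
qed

lemma simplex_strip_ge:
 fixes w :: "real \<Rightarrow> ennreal"
 assumes [measurable]: "w \<in> borel_measurable borel" and ab: "0 \<le> a" "a \<le> b" "b + \<delta> \<le> 1" "0 \<le> \<delta>"
 shows "(\<integral>\<^sup>+ z. w z * indicator {0..\<delta>} z \<partial>lborel) * ennreal (b - a) \<le>
  (\<integral>\<^sup>+ x. (\<integral>\<^sup>+ y. w (y - x) * indicator {0..\<delta>} (y - x) * indicator {x..1} y \<partial>lborel) * (indicator {a..b} x * indicator {0..1} x) \<partial>lborel)"
proof -
 have "(\<integral>\<^sup>+ z. w z * indicator {0..\<delta>} z \<partial>lborel) * ennreal (b - a) =
   (\<integral>\<^sup>+ x. (\<integral>\<^sup>+ z. w z * indicator {0..\<delta>} z \<partial>lborel) * indicator {a..b} x \<partial>lborel)"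
  using ab by (subst nn_integral_cmult_indicator) auto
 also have "\<dots> \<le> (\<integral>\<^sup>+ x. (\<integral>\<^sup>+ y. w (y - x) * indicator {0..\<delta>} (y - x) * indicator {x..1} y \<partial>lborel) * (indicator {a..b} x * indicator {0..1} x) \<partial>lborel)"
 proof (rule nn_integral_mono)
  fix x :: real
  show "(\<integral>\<^sup>+ z. w z * indicator {0..\<delta>} z \<partial>lborel) * indicator {a..b} x \<le>
    (\<integral>\<^sup>+ y. w (y - x) * indicator {0..\<delta>} (y - x) * indicator {x..1} y \<partial>lborel) * (indicator {a..b} x * indicator {0..1} x)"
  proof (cases "x \<in> {a..b}")
   case True
   have "(\<integral>\<^sup>+ z. w z * indicator {0..\<delta>} z \<partial>lborel) = (\<integral>\<^sup>+ y. w (y - x) * indicator {0..\<delta>} (y - x) \<partial>lborel)"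
    by (rule nn_integral_shift[symmetric]) measurable
   also have "\<dots> = (\<integral>\<^sup>+ y. w (y - x) * indicator {0..\<delta>} (y - x) * indicator {x..1} y \<partial>lborel)"
    using True ab by (intro nn_integral_cong) (auto simp: indicator_def)
   finally show ?thesis using True ab by simp
  qed simp
 qed
 finally show ?thesis .
qed

section \<open>The simplex kernel in closed form\<close>

text \<open>This covers the power for \<open>p > 2\<close> and the logarithm for \<open>p = 2\<close> at once.\<close>

definition second_antiderivative :: "real \<Rightarrow> (real \<Rightarrow> real) \<Rightarrow> bool" where
 "second_antiderivative p g \<longleftrightarrow> 1 < p \<and> g \<in> borel_measurable borel \<and>
  (\<forall>x>0. (g has_real_derivative - (x powr (1 - p) / (p - 1))) (at x))"

text \<open>Up to the sign, the mixed difference of \<open>g (t - s + \<epsilon>)\<close> over the corners of \<open>s \<in> {0, a}\<close>, \<open>t \<in> {b, 1}\<close>.\<close>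

definition corner_difference :: "(real \<Rightarrow> real) \<Rightarrow> real \<Rightarrow> real \<Rightarrow> real \<Rightarrow> real" where
 "corner_difference g eps a b = g (b - a + eps) - g (1 - a + eps) - g (b + eps) + g (1 + eps)"

lemma second_antiderivative_powr:
 assumes "2 < p"
 shows "second_antiderivative p (\<lambda>x. x powr (2 - p) / ((p - 1) * (p - 2)))"
 unfolding second_antiderivative_def
proof (intro conjI allI impI)
 fix x :: real assume "0 < x"
 show "((\<lambda>x. x powr (2 - p) / ((p - 1) * (p - 2))) has_real_derivative - (x powr (1 - p) / (p - 1))) (at x)"
 proof -
  define X where "X = x powr (1 - p)"
  have "((\<lambda>x. x powr (2 - p) / ((p - 1) * (p - 2))) has_real_derivative (2 - p) * x powr (2 - p - 1) / ((p - 1) * (p - 2))) (at x)"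
   by (intro DERIV_cdivide has_real_derivative_powr \<open>0 < x\<close>)
  moreover have "(2 - p) * X / ((p - 1) * (p - 2)) = - (X / (p - 1))"
   using assms by (simp add: divide_simps) (simp add: algebra_simps)
  moreover have "x powr (2 - p - 1) = X" by (simp add: X_def)
  ultimately show ?thesis by (simp add: X_def)
 qed
qed (use assms in auto)

lemma second_antiderivative_ln: "second_antiderivative 2 (\<lambda>x. - ln x)"
 unfolding second_antiderivative_def
 by (auto intro!: derivative_eq_intros simp: powr_minus divide_inverse)

lemma second_antiderivative_antimono:
 assumes "second_antiderivative p g" "0 < x" "x \<le> y"
 shows "g y \<le> g x"
proof (rule DERIV_nonpos_imp_nonincreasing[OF assms(3)])
 fix z assume "x \<le> z" "z \<le> y"
 then have "0 < z" using assms by simp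
 then show "\<exists>D. DERIV g z :> D \<and> D \<le> 0" using assms(1) unfolding second_antiderivative_def
  by (intro exI[of _ "- (z powr (1 - p) / (p - 1))"]) auto
qed

lemma second_antiderivative_isCont:
 assumes "second_antiderivative p g" "0 < x"
 shows "isCont g x"
 using assms unfolding second_antiderivative_def by (intro DERIV_isCont) auto

lemma corner_difference_nonneg:
 assumes g: "second_antiderivative p g" and eps: "0 < eps" and ab: "0 \<le> a" "a \<le> b" "b \<le> 1"
 shows "0 \<le> corner_difference g eps a b"
proof -
 have "g (1 - a + eps) - g (1 + eps) \<le> g (b - a + eps) - g (b + eps)"
 proof (rule DERIV_nonpos_imp_nonincreasing[OF ab(3)])
  fix t assume t: "b \<le> t" "t \<le> 1"
  have p: "1 < p" using g by (simp add: second_antiderivative_def)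
  have 1: "((\<lambda>t. g (t - a + eps)) has_real_derivative - ((t - a + eps) powr (1 - p) / (p - 1)) * 1) (at t)"
   using g t ab eps unfolding second_antiderivative_def
   by (intro DERIV_chain2[of g]) (auto intro!: derivative_eq_intros)
  have 2: "((\<lambda>t. g (t + eps)) has_real_derivative - ((t + eps) powr (1 - p) / (p - 1)) * 1) (at t)"
   using g t ab eps unfolding second_antiderivative_def
   by (intro DERIV_chain2[of g]) (auto intro!: derivative_eq_intros)
  have "(t + eps) powr (1 - p) \<le> (t - a + eps) powr (1 - p)"
   using t ab eps p by (intro powr_mono2') auto
  then show "\<exists>D. DERIV (\<lambda>t. g (t - a + eps) - g (t + eps)) t :> D \<and> D \<le> 0"
   using DERIV_diff[OF 1 2] p by (intro exI conjI) (auto simp: divide_right_mono)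
 qed
 then show ?thesis by (simp add: corner_difference_def)
qed

lemma corner_difference_le:
 assumes g: "second_antiderivative p g" and eps: "0 < eps" and ab: "0 \<le> a" "a \<le> b" "b \<le> 1"
 shows "corner_difference g eps a b \<le> g (b - a + eps) - g (1 + eps)"
proof -
 have "g (1 + eps) \<le> g (1 - a + eps)" "g (1 + eps) \<le> g (b + eps)"
  using ab eps by (auto intro!: second_antiderivative_antimono[OF g])
 then show ?thesis by (simp add: corner_difference_def)
qed

lemma lowest_highest_bounds:
 assumes "0 < n" "r \<in> space (unit_cube n)"
 shows "0 \<le> lowest n r" "lowest n r \<le> highest n r" "highest n r \<le> 1"
proof -
 have fin: "finite (r ` {..<n})" "r ` {..<n} \<noteq> {}" using assms(1) by (auto simp: lessThan_empty_iff)
 have "r a \<in> {0..1}" if "a < n" for a using assms(2) that by (auto simp: space_PiM PiE_def Pi_def)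
 then show "0 \<le> lowest n r" "highest n r \<le> 1"
  using fin by (auto simp: lowest_def highest_def)
 show "lowest n r \<le> highest n r"
  using fin assms(1) by (auto simp: lowest_def highest_def intro: order_trans[OF Min_le Max_ge])
qed

text \<open>All coordinates lie in \<open>(s, t]\<close> iff \<open>s\<close> is below the smallest and \<open>t\<close> is not below the largest, so that the
  domain of integration is a rectangle, on which the integrand has the mixed antiderivative \<open>- g (t - s + \<epsilon>)\<close>.\<close>

lemma simplex_kernel_eq:
 assumes g: "second_antiderivative p g" and eps: "0 < eps" and n: "0 < n" and r: "r \<in> space (unit_cube n)"
 shows "simplex_kernel n p eps r = corner_difference g eps (lowest n r) (highest n r)"
proof -
 define a b where "a = lowest n r" and "b = highest n r"
 have ab: "0 \<le> a" "a \<le> b" "b \<le> 1" unfolding a_def b_def using lowest_highest_bounds[OF n r] by auto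
 have p: "1 < p" using g by (simp add: second_antiderivative_def)
 have fin: "finite (r ` {..<n})" "r ` {..<n} \<noteq> {}" using n by (auto simp: lessThan_empty_iff)
 have lo: "s < a \<longleftrightarrow> (\<forall>c\<in>{..<n}. s < r c)" for s unfolding a_def lowest_def using fin by auto
 have hi: "b \<le> t \<longleftrightarrow> (\<forall>c\<in>{..<n}. r c \<le> t)" for t unfolding b_def highest_def using fin by auto
 have prod: "(\<Prod>c<n. indicator {s<..t} (r c) :: real) = of_bool (s < a \<and> b \<le> t)" for s t
  unfolding prod_indicator_eq_of_bool lo hi by (rule arg_cong[of _ _ of_bool]) auto
 define h where "h x = x powr (1 - p) / (p - 1)" for x
 have hd: "(h has_real_derivative - (x powr - p)) (at x)" if "0 < x" for x
 proof -
  have "(h has_real_derivative (1 - p) * x powr (1 - p - 1) / (p - 1)) (at x)"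
   unfolding h_def by (intro DERIV_cdivide has_real_derivative_powr that)
  moreover have "(1 - p) * Y / (p - 1) = - Y" for Y :: real using p by (simp add: divide_simps) (simp add: algebra_simps)
  moreover have "x powr (1 - p - 1) = x powr - p" by simp
  ultimately show ?thesis by simp
 qed
 have hc: "isCont h x" if "0 < x" for x using hd[OF that] by (rule DERIV_isCont)
 have gd: "(g has_real_derivative - h x) (at x)" if "0 < x" for x
  using g that by (simp add: second_antiderivative_def h_def)
 have inner: "(LINT s:{0..t}|lborel. (\<Prod>c<n. indicator {s<..t} (r c)) / (t - s + eps) powr p) =
   of_bool (b \<le> t) * (h (t - a + eps) - h (t + eps))" if t: "t \<le> 1" for t
 proof (cases "b \<le> t")
  case True
  have "(LINT s:{0..t}|lborel. (\<Prod>c<n. indicator {s<..t} (r c)) / (t - s + eps) powr p) =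
    (\<integral>s. (t - s + eps) powr - p * indicator {0..a} s \<partial>lborel)"
   unfolding set_lebesgue_integral_def prod
  proof (rule integral_cong_AE)
   show "AE s in lborel. indicator {0..t} s *\<^sub>R (of_bool (s < a \<and> b \<le> t) / (t - s + eps) powr p) = (t - s + eps) powr - p * indicator {0..a} s"
    using AE_lborel_singleton[of a]
    by eventually_elim (use True ab in \<open>auto simp: indicator_def powr_minus divide_inverse\<close>)
  qed measurable
  also have "\<dots> = h (t - a + eps) - h (t - 0 + eps)"
  proof (rule integral_FTC_Icc_real[OF ab(1)])
   fix s assume s: "0 \<le> s" "s \<le> a"
   then have pos: "0 < t - s + eps" using True ab eps by simp
   show "((\<lambda>s. h (t - s + eps)) has_real_derivative (t - s + eps) powr - p) (at s)"
   proof -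
    have "((\<lambda>s. t - s + eps) has_real_derivative - 1) (at s)" by (auto intro!: derivative_eq_intros)
    from DERIV_chain2[where f = h and g = "\<lambda>s. t - s + eps" and x = s, OF hd[OF pos] this] show ?thesis by simp
   qed
   show "isCont (\<lambda>s. (t - s + eps) powr - p) s" using pos by (intro continuous_intros) auto
  qed
  finally show ?thesis using True by simp
 next
  case False
  then show ?thesis unfolding prod by simp
 qed
 have "simplex_kernel n p eps r =
   (LINT t:{0..1}|lborel. LINT s:{0..t}|lborel. (\<Prod>c<n. indicator {s<..t} (r c)) / (t - s + eps) powr p)"
  unfolding simplex_kernel_def simplex_integrand_def
  by (rule simplex_integral_eq[symmetric])
    (use simplex_integrand_integrable[OF eps, of p n r] p in \<open>simp add: simplex_integrand_def[abs_def]\<close>)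
 also have "\<dots> = (LINT t:{0..1}|lborel. of_bool (b \<le> t) * (h (t - a + eps) - h (t + eps)))"
  by (rule set_lebesgue_integral_cong) (auto simp: inner)
 also have "\<dots> = (\<integral>t. (h (t - a + eps) - h (t + eps)) * indicator {b..1} t \<partial>lborel)"
  unfolding set_lebesgue_integral_def
  by (rule Bochner_Integration.integral_cong[OF refl]) (use ab in \<open>auto simp: indicator_def\<close>)
 also have "\<dots> = (g (1 + eps) - g (1 - a + eps)) - (g (b + eps) - g (b - a + eps))"
 proof (rule integral_FTC_Icc_real[OF ab(3)])
  fix t assume t: "b \<le> t" "t \<le> 1"
  then have pos: "0 < t - a + eps" "0 < t + eps" using ab eps by auto
  show "((\<lambda>t. g (t + eps) - g (t - a + eps)) has_real_derivative (h (t - a + eps) - h (t + eps))) (at t)"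
  proof -
   have 1: "((\<lambda>t. g (t + eps)) has_real_derivative - h (t + eps) * 1) (at t)"
    by (rule DERIV_chain2[where f = g and g = "\<lambda>t. t + eps", OF gd[OF pos(2)]]) (auto intro!: derivative_eq_intros)
   have 2: "((\<lambda>t. g (t - a + eps)) has_real_derivative - h (t - a + eps) * 1) (at t)"
    by (rule DERIV_chain2[where f = g and g = "\<lambda>t. t - a + eps", OF gd[OF pos(1)]]) (auto intro!: derivative_eq_intros)
   show ?thesis using DERIV_diff[OF 1 2] by simp
  qed
  show "isCont (\<lambda>t. h (t - a + eps) - h (t + eps)) t"
  proof (rule continuous_diff)
   show "isCont (\<lambda>t. h (t - a + eps)) t" by (rule isCont_o2[where f = "\<lambda>t. t - a + eps" and g = h, OF _ hc[OF pos(1)]]) (intro continuous_intros)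
   show "isCont (\<lambda>t. h (t + eps)) t" by (rule isCont_o2[where f = "\<lambda>t. t + eps" and g = h, OF _ hc[OF pos(2)]]) (intro continuous_intros)
  qed
 qed
 also have "\<dots> = corner_difference g eps a b" by (simp add: corner_difference_def)
 finally show ?thesis by (simp add: a_def b_def)
qed

section \<open>Concentration near the diagonal\<close>

definition simplex_mass :: "nat \<Rightarrow> real \<Rightarrow> real \<Rightarrow> ((nat \<Rightarrow> real) \<Rightarrow> bool) \<Rightarrow> real" where
 "simplex_mass n p eps E = (\<integral>r. (simplex_kernel n p eps r)^2 * of_bool (E r) \<partial>unit_cube n)"

lemma simplex_kernel_measurable:
 assumes "0 < eps" "0 \<le> p"
 shows "simplex_kernel n p eps \<in> borel_measurable (unit_cube n)"
proof -
 interpret Q: prob_space unit_square by (rule prob_space_unit_square)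
 have "(\<lambda>\<rho>. \<integral>q. simplex_integrand n p eps \<rho> q \<partial>unit_square) \<in> borel_measurable (unit_cube n)"
  by (rule Q.borel_measurable_lebesgue_integral) (rule simplex_integrand_measurable)
 then show ?thesis by (simp add: simplex_kernel_def[abs_def])
qed

lemma simplex_mass_integrable:
 assumes "0 < eps" "0 \<le> p" and E: "Measurable.pred (unit_cube n) E"
 shows "integrable (unit_cube n) (\<lambda>r. (simplex_kernel n p eps r)^2 * of_bool (E r))"
proof -
 interpret prob_space "unit_cube n" by (rule prob_space_unit_cube)
 note [measurable] = simplex_kernel_measurable[OF assms(1,2), of n] E
 show ?thesis
 proof (rule integrable_const_bound[of _ "(1 / eps powr p)^2"])
  show "AE r in unit_cube n. norm ((simplex_kernel n p eps r)^2 * of_bool (E r)) \<le> (1 / eps powr p)^2"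
  proof (rule AE_I2)
   fix r
   have "\<bar>simplex_kernel n p eps r\<bar>\<^sup>2 \<le> (1 / eps powr p)^2"
    by (rule power_mono[OF simplex_kernel_bounded[OF assms(1,2)]]) simp
   then show "norm ((simplex_kernel n p eps r)^2 * of_bool (E r)) \<le> (1 / eps powr p)^2" by (cases "E r") auto
  qed
  show "(\<lambda>r. (simplex_kernel n p eps r)^2 * of_bool (E r)) \<in> borel_measurable (unit_cube n)"
   unfolding of_bool_def by measurable
 qed
qed

lemma simplex_mass_nn_integral:
 assumes "0 < eps" "0 \<le> p" and E: "Measurable.pred (unit_cube n) E"
 shows "ennreal (simplex_mass n p eps E) = (\<integral>\<^sup>+ r. ennreal ((simplex_kernel n p eps r)^2 * of_bool (E r)) \<partial>unit_cube n)"
 unfolding simplex_mass_def by (rule nn_integral_eq_integral[symmetric, OF simplex_mass_integrable[OF assms]]) simp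

lemma simplex_mass_nonneg: "0 \<le> simplex_mass n p eps E"
 unfolding simplex_mass_def by (rule integral_nonneg_AE) simp

text \<open>The total squared mass per unit length of the diagonal, up to the factor \<open>n (n - 1)\<close>.\<close>

definition diagonal_mass :: "nat \<Rightarrow> (real \<Rightarrow> real) \<Rightarrow> real \<Rightarrow> real" where
 "diagonal_mass n g eps = (\<integral>z. z ^ (n - 2) * (g (z + eps))^2 * indicator {0..1} z \<partial>lborel)"

lemma diagonal_mass_nn_integral:
 assumes g: "second_antiderivative p g" and eps: "0 < eps"
 shows "(\<integral>\<^sup>+ z. ennreal (z ^ (n - 2) * (g (z + eps))^2) * indicator {0..1} z \<partial>lborel) = ennreal (diagonal_mass n g eps)"
proof -
 have "integrable lborel (\<lambda>z. z ^ (n - 2) * (g (z + eps))^2 * indicator {0..1} z)"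
 proof (rule borel_integrable_atLeastAtMost)
  fix z :: real assume "0 \<le> z" "z \<le> 1"
  then have "isCont (\<lambda>z. g (z + eps)) z"
   using eps by (intro isCont_o2[OF _ second_antiderivative_isCont[OF g]]) auto
  then show "isCont (\<lambda>z. z ^ (n - 2) * (g (z + eps))^2) z" by (intro continuous_intros)
 qed
 then have "(\<integral>\<^sup>+ z. ennreal (z ^ (n - 2) * (g (z + eps))^2 * indicator {0..1} z) \<partial>lborel) = ennreal (diagonal_mass n g eps)"
  unfolding diagonal_mass_def by (rule nn_integral_eq_integral) (auto simp: indicator_def)
 moreover have "ennreal (x * indicator {0..1} z) = ennreal x * indicator {0..1} z" for x z :: real by (simp add: indicator_def)
 ultimately show ?thesis by simp
qed

lemma diagonal_mass_nonneg: "0 \<le> diagonal_mass n g eps"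
 unfolding diagonal_mass_def by (rule integral_nonneg_AE) (auto simp: indicator_def)

lemma diagonal_tail_le:
 assumes g: "second_antiderivative p g" and pos: "\<And>x. 0 < x \<Longrightarrow> 0 \<le> g x" and eps: "0 < eps" and \<delta>: "0 < \<delta>"
 shows "(\<integral>\<^sup>+ z. ennreal (z ^ (n - 2) * (g (z + eps))^2) * indicator {\<delta>..1} z \<partial>lborel) \<le> ennreal ((g \<delta>)^2)"
proof -
 have "(\<integral>\<^sup>+ z. ennreal (z ^ (n - 2) * (g (z + eps))^2) * indicator {\<delta>..1} z \<partial>lborel) \<le>
   (\<integral>\<^sup>+ z. ennreal ((g \<delta>)^2) * indicator {0..1::real} z \<partial>lborel)"
 proof (rule nn_integral_mono)
  fix z :: real
  show "ennreal (z ^ (n - 2) * (g (z + eps))^2) * indicator {\<delta>..1} z \<le> ennreal ((g \<delta>)^2) * indicator {0..1} z"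
  proof (cases "z \<in> {\<delta>..1}")
   case True
   then have "g (z + eps) \<le> g \<delta>" "0 \<le> g (z + eps)" using eps \<delta> by (auto intro!: second_antiderivative_antimono[OF g] pos)
   then have "(g (z + eps))^2 \<le> (g \<delta>)^2" by (rule power_mono)
   moreover have "z ^ (n - 2) \<le> 1" "0 \<le> z ^ (n - 2)" using True \<delta> by (auto intro: power_le_one)
   ultimately have "z ^ (n - 2) * (g (z + eps))^2 \<le> 1 * (g \<delta>)^2" by (intro mult_mono) auto
   then show ?thesis using True \<delta> by (simp add: ennreal_leI)
  qed simp
 qed
 then show ?thesis by (simp add: nn_integral_cmult_indicator)
qed

text \<open>The smallest and the largest of \<open>n\<close> coordinates have joint density \<open>n (n - 1) (y - x)\<^sup>n\<^sup>-\<^sup>2\<close>.\<close>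

lemma simplex_mass_lowest_highest:
 assumes g: "second_antiderivative p g" and eps: "0 < eps" and n: "2 \<le> n"
  and P: "Measurable.pred (borel \<Otimes>\<^sub>M borel) (\<lambda>(x, y). P x y)"
  and EP: "\<And>r. r \<in> space (unit_cube n) \<Longrightarrow> E r = P (lowest n r) (highest n r)"
  and E: "Measurable.pred (unit_cube n) E"
 shows "ennreal (simplex_mass n p eps E) = ennreal (real (n * (n - 1))) *
  (\<integral>\<^sup>+ x. (\<integral>\<^sup>+ y. ennreal ((corner_difference g eps x y)^2 * of_bool (P x y)) * ennreal ((y - x) ^ (n - 2)) * indicator {x..1} y \<partial>lborel)
   * indicator {0..1} x \<partial>lborel)"
proof -
 have p: "0 \<le> p" and [measurable]: "g \<in> borel_measurable borel" using g by (auto simp: second_antiderivative_def)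
 have "ennreal (simplex_mass n p eps E) =
   (\<integral>\<^sup>+ r. ennreal ((corner_difference g eps (lowest n r) (highest n r))^2 * of_bool (P (lowest n r) (highest n r))) \<partial>unit_cube n)"
  unfolding simplex_mass_nn_integral[OF eps p E]
  by (rule nn_integral_cong) (use n in \<open>simp add: simplex_kernel_eq[OF g eps] EP\<close>)
 also have "\<dots> = ennreal (real (n * (n - 1))) *
  (\<integral>\<^sup>+ x. (\<integral>\<^sup>+ y. ennreal ((corner_difference g eps x y)^2 * of_bool (P x y)) * ennreal ((y - x) ^ (n - 2)) * indicator {x..1} y \<partial>lborel)
   * indicator {0..1} x \<partial>lborel)"
  unfolding ennreal_of_nat_eq_real_of_nat[symmetric]
 proof (rule nn_integral_lowest_highest[OF n])
  note [measurable] = P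
  show "(\<lambda>(x, y). ennreal ((corner_difference g eps x y)^2 * of_bool (P x y))) \<in> borel_measurable (borel \<Otimes>\<^sub>M borel)"
   unfolding corner_difference_def of_bool_def case_prod_beta using P unfolding case_prod_beta by measurable
 qed
 finally show ?thesis .
qed

lemma simplex_strip_measurable:
 fixes w :: "real \<Rightarrow> ennreal"
 assumes [measurable]: "w \<in> borel_measurable borel"
 shows "(\<lambda>x. \<integral>\<^sup>+ y. w (y - x) * indicator {x..1} y \<partial>lborel) \<in> borel_measurable borel"
proof -
 have eq: "(indicator {fst z..1} (snd z) :: ennreal) = (if fst z \<le> snd z \<and> snd z \<le> 1 then 1 else 0)" for z :: "real \<times> real"
  by (simp add: indicator_def)
 have "(\<lambda>(x, y). w (y - x) * indicator {x..1} y) \<in> borel_measurable (borel \<Otimes>\<^sub>M lborel)"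
  unfolding case_prod_beta eq by measurable
 then show ?thesis by (rule lborel.borel_measurable_nn_integral)
qed

text \<open>Since \<open>g\<close> is nonnegative and decreasing, \<open>corner_difference\<close> is at most its first term. Points with
  extreme coordinates farther apart than \<open>\<delta>\<close> carry a mass that is bounded uniformly in \<open>\<epsilon>\<close>; the others
  are controlled through the position \<open>x\<close> of the smallest coordinate.\<close>

lemma simplex_mass_le:
 assumes g: "second_antiderivative p g" and pos: "\<And>x. 0 < x \<Longrightarrow> 0 \<le> g x" and eps: "0 < eps" and n: "2 \<le> n"
  and P: "Measurable.pred (borel \<Otimes>\<^sub>M borel) (\<lambda>(x, y). P x y)"
  and EP: "\<And>r. r \<in> space (unit_cube n) \<Longrightarrow> E r = P (lowest n r) (highest n r)"
  and E: "Measurable.pred (unit_cube n) E"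
  and A: "A \<in> sets borel" "emeasure lborel (A \<inter> {0..1}) \<le> ennreal \<mu>" "0 \<le> \<mu>" and \<delta>: "0 < \<delta>"
  and cover: "\<And>x y. 0 \<le> x \<Longrightarrow> x \<le> y \<Longrightarrow> y \<le> 1 \<Longrightarrow> P x y \<Longrightarrow> x \<in> A \<or> \<delta> \<le> y - x"
 shows "simplex_mass n p eps E \<le> real (n * (n - 1)) * (diagonal_mass n g eps * \<mu> + (g \<delta>)^2)"
proof -
 let ?c = "\<lambda>x y. ennreal ((corner_difference g eps x y)^2 * of_bool (P x y)) * ennreal ((y - x) ^ (n - 2)) * indicator {x..1} y"
 have [measurable]: "g \<in> borel_measurable borel" using g by (auto simp: second_antiderivative_def)
 note [measurable] = A(1)
 define w where "w z = ennreal (z ^ (n - 2) * (g (z + eps))^2)" for z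
 have [measurable]: "w \<in> borel_measurable borel" unfolding w_def[abs_def] by measurable
 let ?S = "\<integral>\<^sup>+ x. (\<integral>\<^sup>+ y. ?c x y \<partial>lborel)
   * indicator {0..1} x \<partial>lborel"
 let ?W1 = "\<lambda>x. (\<integral>\<^sup>+ y. w (y - x) * indicator {x..1} y \<partial>lborel) * indicator (A \<inter> {0..1}) x"
 let ?W2 = "\<lambda>x. (\<integral>\<^sup>+ y. (w (y - x) * indicator {\<delta>..1} (y - x)) * indicator {x..1} y \<partial>lborel) * indicator (UNIV \<inter> {0..1}) x"
 have "?S \<le> (\<integral>\<^sup>+ x. ?W1 x + ?W2 x \<partial>lborel)"
 proof (rule nn_integral_mono)
  fix x :: real
  show "(\<integral>\<^sup>+ y. ?c x y \<partial>lborel) * indicator {0..1} x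
    \<le> ?W1 x + ?W2 x"
  proof (cases "x \<in> {0..1}")
   case True
   have "(\<integral>\<^sup>+ y. ?c x y \<partial>lborel) \<le>
     (\<integral>\<^sup>+ y. w (y - x) * indicator {x..1} y * indicator A x + w (y - x) * indicator {\<delta>..1} (y - x) * indicator {x..1} y \<partial>lborel)"
   proof (rule nn_integral_mono)
    fix y :: real
    show "?c x y \<le>
     w (y - x) * indicator {x..1} y * indicator A x + w (y - x) * indicator {\<delta>..1} (y - x) * indicator {x..1} y"
    proof (cases "P x y \<and> x \<le> y \<and> y \<le> 1")
     case xy: True
     have "0 \<le> g (1 + eps)" using eps by (intro pos) simp
     then have "corner_difference g eps x y \<le> g (y - x + eps)" "0 \<le> corner_difference g eps x y"
      using corner_difference_le[OF g eps, of x y] corner_difference_nonneg[OF g eps, of x y] True xy by auto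
     then have "(corner_difference g eps x y)^2 \<le> (g (y - x + eps))^2" by (rule power_mono)
     then have "(corner_difference g eps x y)^2 * (y - x) ^ (n - 2) \<le> (y - x) ^ (n - 2) * (g (y - x + eps))^2"
      using xy by (subst mult.commute, intro mult_left_mono) auto
     then have le: "ennreal ((corner_difference g eps x y)^2) * ennreal ((y - x) ^ (n - 2)) \<le> w (y - x)"
      using xy unfolding w_def by (simp add: ennreal_mult[symmetric] ennreal_leI)
     have "x \<in> A \<or> \<delta> \<le> y - x" using cover[of x y] True xy by auto
     then show ?thesis
     proof
      assume "x \<in> A"
      then show ?thesis using le xy by (simp add: add_increasing2)
     next
      assume "\<delta> \<le> y - x"
      then show ?thesis using le xy True by (simp add: add_increasing)
     qed
    qed (auto simp: indicator_def)
   qed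
   also have "\<dots> = ?W1 x + ?W2 x"
    using True by (simp add: nn_integral_add nn_integral_multc indicator_inter_arith)
   finally show ?thesis using True by simp
  qed simp
 qed
 also have "\<dots> = (\<integral>\<^sup>+ x. ?W1 x \<partial>lborel) + (\<integral>\<^sup>+ x. ?W2 x \<partial>lborel)"
 proof (rule nn_integral_add)
  show "?W1 \<in> borel_measurable lborel"
   using simplex_strip_measurable[of w] A(1) by simp
  have "(\<lambda>z. w z * indicator {\<delta>..1} z) \<in> borel_measurable borel" by measurable
  from simplex_strip_measurable[OF this] show "?W2 \<in> borel_measurable lborel" by simp
 qed
 also have "\<dots> \<le> ennreal (diagonal_mass n g eps) * ennreal \<mu> + ennreal ((g \<delta>)^2) * 1"
 proof (rule add_mono)
  have "(\<integral>\<^sup>+ x. ?W1 x \<partial>lborel) \<le> (\<integral>\<^sup>+ z. w z * indicator {0..1} z \<partial>lborel) * emeasure lborel (A \<inter> {0..1})"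
   by (rule simplex_strip_le) measurable
  also have "\<dots> \<le> ennreal (diagonal_mass n g eps) * ennreal \<mu>"
   unfolding w_def diagonal_mass_nn_integral[OF g eps] by (rule mult_left_mono[OF A(2)]) simp
  finally show "(\<integral>\<^sup>+ x. ?W1 x \<partial>lborel) \<le> ennreal (diagonal_mass n g eps) * ennreal \<mu>" .
  have "(\<integral>\<^sup>+ x. ?W2 x \<partial>lborel) \<le> (\<integral>\<^sup>+ z. (w z * indicator {\<delta>..1} z) * indicator {0..1} z \<partial>lborel) * emeasure lborel (UNIV \<inter> {0..1::real})"
   by (rule simplex_strip_le) measurable
  also have "\<dots> \<le> (\<integral>\<^sup>+ z. w z * indicator {\<delta>..1} z \<partial>lborel) * 1"
   by (rule mult_mono) (auto intro!: nn_integral_mono simp: indicator_def)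
  also have "\<dots> \<le> ennreal ((g \<delta>)^2) * 1"
   unfolding w_def by (rule mult_right_mono[OF diagonal_tail_le[OF g pos eps \<delta>]]) auto
  finally show "(\<integral>\<^sup>+ x. ?W2 x \<partial>lborel) \<le> ennreal ((g \<delta>)^2) * 1" .
 qed
 also have "\<dots> = ennreal (diagonal_mass n g eps * \<mu> + (g \<delta>)^2)"
  using A(3) diagonal_mass_nonneg[of n g eps] by (simp add: ennreal_mult)
 finally have S: "?S \<le> ennreal (diagonal_mass n g eps * \<mu> + (g \<delta>)^2)" .
 have "ennreal (simplex_mass n p eps E) = ennreal (real (n * (n - 1))) * ?S"
  by (rule simplex_mass_lowest_highest[OF g eps n P EP E])
 also have "\<dots> \<le> ennreal (real (n * (n - 1))) * ennreal (diagonal_mass n g eps * \<mu> + (g \<delta>)^2)"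
  by (rule mult_left_mono[OF S]) simp
 also have "\<dots> = ennreal (real (n * (n - 1)) * (diagonal_mass n g eps * \<mu> + (g \<delta>)^2))"
  by (rule ennreal_mult'[symmetric]) simp
 finally show ?thesis
  using A(3) diagonal_mass_nonneg[of n g eps] by (subst (asm) ennreal_le_iff) (auto intro!: mult_nonneg_nonneg add_nonneg_nonneg)
qed

text \<open>Near the diagonal but away from the endpoints of the interval, all but the first term of
  \<^term>\<open>corner_difference\<close> stay bounded.\<close>

lemma corner_difference_sq_ge:
 assumes g: "second_antiderivative p g" and pos: "\<And>x. 0 < x \<Longrightarrow> 0 \<le> g x" and eps: "0 < eps"
  and \<delta>: "0 < \<delta>" "\<delta> \<le> x" "x \<le> 1 - 2 * \<delta>" "x \<le> y" "y - x \<le> \<delta>" and \<eta>: "0 < \<eta>"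
 shows "(1 - \<eta>) * (g (y - x + eps))^2 \<le> (corner_difference g eps x y)^2 + (2 * g \<delta>)^2 / \<eta>"
proof -
 let ?G = "g (y - x + eps)" and ?c = "corner_difference g eps x y" and ?C = "2 * g \<delta>"
 have "g (1 - x + eps) \<le> g \<delta>" "g (y + eps) \<le> g \<delta>" using \<delta> eps by (auto intro!: second_antiderivative_antimono[OF g])
 moreover have "0 \<le> g (1 + eps)" "0 \<le> ?G" using eps \<delta> by (auto intro!: pos)
 ultimately have c: "?G - ?C \<le> ?c" "0 \<le> ?G" by (auto simp: corner_difference_def)
 have "?G\<^sup>2 - 2 * ?G * ?C \<le> ?c\<^sup>2"
 proof (cases "?C \<le> ?G")
  case True
  then have "(?G - ?C)^2 \<le> ?c\<^sup>2" using c by (intro power_mono) auto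
  moreover have "?G\<^sup>2 - 2 * ?G * ?C \<le> (?G - ?C)^2" by (simp add: power2_diff)
  ultimately show ?thesis by simp
 next
  case False
  then have "?G * ?G \<le> ?G * (2 * ?C)" using c by (intro mult_left_mono) auto
  then have "?G\<^sup>2 - 2 * ?G * ?C \<le> 0" by (simp add: power2_eq_square)
  then show ?thesis using zero_le_power2[of ?c] by linarith
 qed
 moreover have "2 * ?G * ?C \<le> \<eta> * ?G\<^sup>2 + ?C\<^sup>2 / \<eta>"
 proof -
  have "0 \<le> (\<eta> * ?G - ?C)^2 / \<eta>" using \<eta> by simp
  also have "\<dots> = \<eta> * ?G\<^sup>2 - 2 * ?G * ?C + ?C\<^sup>2 / \<eta>"
   using \<eta> by (simp add: power2_diff field_simps power2_eq_square)
  finally show ?thesis by simp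
 qed
 ultimately show ?thesis by (simp add: algebra_simps)
qed

text \<open>Only points whose smallest coordinate is in \<open>[\<delta>, 1 - 2 \<delta>]\<close> and whose gap is at most \<open>\<delta>\<close> are counted. Both
  corrections are bounded uniformly in \<open>\<epsilon>\<close>, hence disappear after normalisation.\<close>

lemma simplex_mass_ge:
 assumes g: "second_antiderivative p g" and pos: "\<And>x. 0 < x \<Longrightarrow> 0 \<le> g x" and eps: "0 < eps" and n: "2 \<le> n"
  and \<delta>: "0 < \<delta>" "\<delta> \<le> 1 / 3" and \<eta>: "0 < \<eta>" "\<eta> \<le> 1"
 shows "real (n * (n - 1)) * ((1 - 3 * \<delta>) * ((1 - \<eta>) * diagonal_mass n g eps - (g \<delta>)^2)) \<le>
  simplex_mass n p eps (\<lambda>_. True) + real (n * (n - 1)) * ((2 * g \<delta>)^2 / \<eta>)"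
proof -
 have [measurable]: "g \<in> borel_measurable borel" using g by (auto simp: second_antiderivative_def)
 define w where "w z = ennreal ((1 - \<eta>) * (z ^ (n - 2) * (g (z + eps))^2))" for z
 have [measurable]: "w \<in> borel_measurable borel" unfolding w_def[abs_def] by measurable
 let ?v = "\<lambda>x y. w (y - x) * indicator {0..\<delta>} (y - x) * indicator {x..1} y"
 define W where "W = (\<integral>\<^sup>+ z. w z * indicator {0..\<delta>} z \<partial>lborel)"
 define K where "K = (2 * g \<delta>)^2 / \<eta>"
 have K: "0 \<le> K" using \<eta> by (simp add: K_def)
 let ?c = "\<lambda>x y. ennreal ((corner_difference g eps x y)^2 * of_bool True) * ennreal ((y - x) ^ (n - 2)) * indicator {x..1} y"
 let ?S = "\<integral>\<^sup>+ x. (\<integral>\<^sup>+ y. ?c x y \<partial>lborel) * indicator {0..1} x \<partial>lborel"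
 have cm [measurable]: "(\<lambda>(x, y). ?c x y) \<in> borel_measurable (borel \<Otimes>\<^sub>M borel)"
 proof -
  have eq: "(indicator {fst z..1} (snd z) :: ennreal) = (if fst z \<le> snd z \<and> snd z \<le> 1 then 1 else 0)" for z :: "real \<times> real"
   by (simp add: indicator_def)
  show ?thesis unfolding case_prod_beta corner_difference_def eq by measurable
 qed
 have "W * ennreal (1 - 2 * \<delta> - \<delta>) \<le>
   (\<integral>\<^sup>+ x. (\<integral>\<^sup>+ y. ?v x y \<partial>lborel) * (indicator {\<delta>..1 - 2 * \<delta>} x * indicator {0..1} x) \<partial>lborel)"
  unfolding W_def by (rule simplex_strip_ge) (use \<delta> in auto)
 also have "\<dots> \<le> (\<integral>\<^sup>+ x. (\<integral>\<^sup>+ y. ?c x y \<partial>lborel) * indicator {0..1} x + ennreal K * indicator {0..1} x \<partial>lborel)"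
 proof (rule nn_integral_mono)
  fix x :: real
  show "(\<integral>\<^sup>+ y. ?v x y \<partial>lborel) * (indicator {\<delta>..1 - 2 * \<delta>} x * indicator {0..1} x)
    \<le> (\<integral>\<^sup>+ y. ?c x y \<partial>lborel) * indicator {0..1} x + ennreal K * indicator {0..1} x"
  proof (cases "x \<in> {\<delta>..1 - 2 * \<delta>}")
   case x: True
   have "(\<integral>\<^sup>+ y. ?v x y \<partial>lborel) \<le> (\<integral>\<^sup>+ y. ?c x y + ennreal K * indicator {0..1} y \<partial>lborel)"
   proof (rule nn_integral_mono)
    fix y :: real
    show "?v x y \<le> ?c x y + ennreal K * indicator {0..1} y"
    proof (cases "x \<le> y \<and> y \<le> 1 \<and> y - x \<le> \<delta>")
     case True
     have z: "0 \<le> (y - x) ^ (n - 2)" "(y - x) ^ (n - 2) \<le> 1" using True x \<delta> by (auto intro: power_le_one)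
     have "(y - x) ^ (n - 2) * ((1 - \<eta>) * (g (y - x + eps))^2) \<le> (y - x) ^ (n - 2) * ((corner_difference g eps x y)^2 + K)"
      unfolding K_def by (rule mult_left_mono[OF corner_difference_sq_ge[OF g pos eps]]) (use True x \<delta> \<eta> z in auto)
     also have "\<dots> \<le> (y - x) ^ (n - 2) * (corner_difference g eps x y)^2 + K"
      using mult_right_mono[OF z(2) K] by (simp add: algebra_simps)
     finally have "w (y - x) \<le> ennreal ((corner_difference g eps x y)^2 * (y - x) ^ (n - 2) + K)"
      unfolding w_def by (intro ennreal_leI) (simp add: ac_simps)
     also have "\<dots> = ennreal ((corner_difference g eps x y)^2) * ennreal ((y - x) ^ (n - 2)) + ennreal K"
      using z K by (simp add: ennreal_mult)
     finally show ?thesis using True x \<delta> by (simp add: indicator_def)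
    qed (auto simp: indicator_def)
   qed
   also have "\<dots> = (\<integral>\<^sup>+ y. ?c x y \<partial>lborel) + ennreal K"
    using cm by (subst nn_integral_add) (auto simp: nn_integral_cmult_indicator)
   finally show ?thesis using x \<delta> by (simp add: indicator_def)
  qed simp
 qed
 also have "\<dots> = ?S + ennreal K"
 proof (subst nn_integral_add)
  have "(\<lambda>x. \<integral>\<^sup>+ y. ?c x y \<partial>lborel) \<in> borel_measurable borel"
   using lborel.borel_measurable_nn_integral[of ?c borel] cm by simp
  then show "(\<lambda>x. (\<integral>\<^sup>+ y. ?c x y \<partial>lborel) * indicator {0..1} x) \<in> borel_measurable lborel" by simp
 qed (simp_all add: nn_integral_cmult_indicator)
 finally have WS: "W * ennreal (1 - 3 * \<delta>) \<le> ?S + ennreal K" by (simp add: algebra_simps)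
 have "ennreal ((1 - \<eta>) * diagonal_mass n g eps) = (\<integral>\<^sup>+ z. w z * indicator {0..1} z \<partial>lborel)"
 proof -
  have "(\<integral>\<^sup>+ z. w z * indicator {0..1} z \<partial>lborel) = (\<integral>\<^sup>+ z. ennreal (1 - \<eta>) * (ennreal (z ^ (n - 2) * (g (z + eps))^2) * indicator {0..1} z) \<partial>lborel)"
   by (rule nn_integral_cong) (use \<eta> in \<open>simp add: w_def indicator_def ennreal_mult\<close>)
  also have "\<dots> = ennreal (1 - \<eta>) * ennreal (diagonal_mass n g eps)"
   by (subst nn_integral_cmult) (use diagonal_mass_nn_integral[OF g eps] in auto)
  finally show ?thesis using \<eta> diagonal_mass_nonneg[of n g eps] by (simp add: ennreal_mult)
 qed
 also have "\<dots> \<le> (\<integral>\<^sup>+ z. w z * indicator {0..\<delta>} z + ennreal (z ^ (n - 2) * (g (z + eps))^2) * indicator {\<delta>..1} z \<partial>lborel)"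
 proof (rule nn_integral_mono)
  fix z :: real
  have "w z \<le> ennreal (z ^ (n - 2) * (g (z + eps))^2)" if "0 \<le> z"
   unfolding w_def using \<eta> that by (intro ennreal_leI mult_left_le_one_le) auto
  then show "w z * indicator {0..1} z \<le> w z * indicator {0..\<delta>} z + ennreal (z ^ (n - 2) * (g (z + eps))^2) * indicator {\<delta>..1} z"
   using \<delta> by (auto simp: indicator_def)
 qed
 also have "\<dots> = W + (\<integral>\<^sup>+ z. ennreal (z ^ (n - 2) * (g (z + eps))^2) * indicator {\<delta>..1} z \<partial>lborel)"
  unfolding W_def by (rule nn_integral_add) measurable
 also have "\<dots> \<le> W + ennreal ((g \<delta>)^2)" by (rule add_left_mono[OF diagonal_tail_le[OF g pos eps \<delta>(1)]])
 finally have DW: "ennreal ((1 - \<eta>) * diagonal_mass n g eps) \<le> W + ennreal ((g \<delta>)^2)" .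
 have "W \<le> (\<integral>\<^sup>+ z. ennreal (z ^ (n - 2) * (g (z + eps))^2) * indicator {0..1} z \<partial>lborel)"
  unfolding W_def
 proof (rule nn_integral_mono)
  fix z :: real
  have "w z \<le> ennreal (z ^ (n - 2) * (g (z + eps))^2)" if "0 \<le> z"
   unfolding w_def using \<eta> that by (intro ennreal_leI mult_left_le_one_le) auto
  then show "w z * indicator {0..\<delta>} z \<le> ennreal (z ^ (n - 2) * (g (z + eps))^2) * indicator {0..1} z"
   using \<delta> by (auto simp: indicator_def)
 qed
 then have "W \<noteq> \<infinity>" unfolding diagonal_mass_nn_integral[OF g eps] by (auto simp: top_unique)
 then obtain W' where W': "W = ennreal W'" "0 \<le> W'" by (cases W) auto
 have "(1 - \<eta>) * diagonal_mass n g eps - (g \<delta>)^2 \<le> W'"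
  using DW W'(2) unfolding W'(1) by (simp add: ennreal_plus[symmetric] del: ennreal_plus)
 then have "(1 - 3 * \<delta>) * ((1 - \<eta>) * diagonal_mass n g eps - (g \<delta>)^2) \<le> W' * (1 - 3 * \<delta>)"
  using \<delta> by (subst mult.commute, intro mult_right_mono) auto
 then have "real (n * (n - 1)) * ((1 - 3 * \<delta>) * ((1 - \<eta>) * diagonal_mass n g eps - (g \<delta>)^2)) \<le> real (n * (n - 1)) * (W' * (1 - 3 * \<delta>))"
  by (rule mult_left_mono) simp
 also have "\<dots> \<le> simplex_mass n p eps (\<lambda>_. True) + real (n * (n - 1)) * K"
 proof -
  define N where "N = real (n * (n - 1))"
  have N: "0 \<le> N" by (simp add: N_def)
  have total: "ennreal (simplex_mass n p eps (\<lambda>_. True)) = ennreal N * ?S"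
   unfolding N_def by (subst simplex_mass_lowest_highest[OF g eps n, of "\<lambda>_ _. True"]) simp_all
  have "ennreal (N * (W' * (1 - 3 * \<delta>))) = ennreal N * (W * ennreal (1 - 3 * \<delta>))"
   unfolding W'(1) using W'(2) \<delta> N by (simp only: ennreal_mult mult_nonneg_nonneg diff_ge_0_iff_ge)
  also have "\<dots> \<le> ennreal N * (?S + ennreal K)" by (rule mult_left_mono[OF WS]) simp
  also have "\<dots> = ennreal (simplex_mass n p eps (\<lambda>_. True)) + ennreal (N * K)"
   unfolding total distrib_left using K N by (simp only: ennreal_mult)
  also have "\<dots> = ennreal (simplex_mass n p eps (\<lambda>_. True) + N * K)"
   using K N simplex_mass_nonneg by (intro ennreal_plus[symmetric]) auto
  finally have "N * (W' * (1 - 3 * \<delta>)) \<le> simplex_mass n p eps (\<lambda>_. True) + N * K"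
   using K N simplex_mass_nonneg by (subst (asm) ennreal_le_iff) (auto intro!: add_nonneg_nonneg mult_nonneg_nonneg)
  then show ?thesis by (simp only: N_def)
 qed
 finally show ?thesis by (simp add: K_def)
qed

section \<open>Limits of the masses\<close>

text \<open>The hypotheses of \<open>multiple_integral_clt\<close> for simplex kernels at the parameters \<open>e q\<close>, where \<open>c q\<close> is the square
  of the normalising factor. Multiplying by a constant depending on the index tuple does not affect them.\<close>

definition concentrates :: "nat \<Rightarrow> real \<Rightarrow> (nat \<Rightarrow> real) \<Rightarrow> (nat \<Rightarrow> real) \<Rightarrow> real \<Rightarrow> bool" where
 "concentrates n p e c L \<longleftrightarrow>
  (\<lambda>q. c q * simplex_mass n p (e q) (\<lambda>_. True)) \<longlonglongrightarrow> L \<and>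
  (\<forall>J>0. (\<lambda>q. c q * simplex_mass n p (e q) (off_blocks n J)) \<longlonglongrightarrow> 0) \<and>
  (\<exists>C\<ge>0. \<forall>J>0. \<forall>\<^sub>F q in sequentially. \<forall>j<J. c q * simplex_mass n p (e q) (in_block n J j) \<le> C / real J)"

lemma in_block_lowest_highest:
 assumes "0 < n"
 shows "in_block n J j r \<longleftrightarrow> real j / real J < lowest n r \<and> highest n r \<le> real (Suc j) / real J"
proof -
 have fin: "finite (r ` {..<n})" "r ` {..<n} \<noteq> {}" using assms by (auto simp: lessThan_empty_iff)
 show ?thesis unfolding in_block_def lowest_def highest_def using fin by (auto simp: Ball_def)
qed

lemma block_containing:
 assumes "0 < x" "x \<le> 1" "0 < (J::nat)"
 shows "\<exists>j<J. real j / real J < x \<and> x \<le> real (Suc j) / real J"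
 using grid_cell[OF assms(3,1,2)] by (auto simp: grid_def)

text \<open>A point outside all blocks either has two coordinates at distance at least \<open>\<delta>\<close>, or its smallest coordinate is
  within \<open>\<delta>\<close> of an endpoint of a block.\<close>

lemma concentrates_diagonal:
 assumes g: "second_antiderivative p g" and pos: "\<And>x. 0 < x \<Longrightarrow> 0 \<le> g x" and n: "2 \<le> n"
  and e: "\<And>q. 0 < e q" and c0: "\<And>q. 0 \<le> c q" and c: "c \<longlonglongrightarrow> 0"
  and D: "(\<lambda>q. c q * diagonal_mass n g (e q)) \<longlonglongrightarrow> \<sigma>"
 shows "concentrates n p e c (real (n * (n - 1)) * \<sigma>)"
proof -
 let ?D = "\<lambda>q. c q * diagonal_mass n g (e q)" and ?m = "\<lambda>q E. c q * simplex_mass n p (e q) E"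
 define N where "N = real (n * (n - 1))"
 have N: "0 < N" using n by (simp add: N_def)
 have n0: "0 < n" using n by simp
 have \<sigma>: "0 \<le> \<sigma>"
  by (rule tendsto_lowerbound[OF D]) (auto intro!: always_eventually mult_nonneg_nonneg c0 diagonal_mass_nonneg)
 have le: "?m q E \<le> N * (?D q * \<mu> + c q * (g \<delta>)^2)"
  if "Measurable.pred (borel \<Otimes>\<^sub>M borel) (\<lambda>(x, y). P x y)"
   "\<And>r. r \<in> space (unit_cube n) \<Longrightarrow> E r = P (lowest n r) (highest n r)" "Measurable.pred (unit_cube n) E"
   "A \<in> sets borel" "emeasure lborel (A \<inter> {0..1}) \<le> ennreal \<mu>" "0 \<le> \<mu>" "0 < \<delta>"
   "\<And>x y. 0 \<le> x \<Longrightarrow> x \<le> y \<Longrightarrow> y \<le> 1 \<Longrightarrow> P x y \<Longrightarrow> x \<in> A \<or> \<delta> \<le> y - x"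
  for P E A \<mu> \<delta> q
  using mult_left_mono[OF simplex_mass_le[OF g pos e n that] c0[of q]] by (simp add: N_def algebra_simps)
 have total_le: "?m q (\<lambda>_. True) \<le> N * (?D q * 1 + c q * (g 1)^2)" for q
  by (rule le[of "\<lambda>_ _. True" _ UNIV]) auto
 have total: "(\<lambda>q. ?m q (\<lambda>_. True)) \<longlonglongrightarrow> N * \<sigma>"
 proof (rule order_tendstoI)
  fix b assume b: "N * \<sigma> < b"
  have "(\<lambda>q. N * (?D q * 1 + c q * (g 1)^2)) \<longlonglongrightarrow> N * (\<sigma> * 1 + 0 * (g 1)^2)"
   by (intro tendsto_intros D c)
  then have "(\<lambda>q. N * (?D q * 1 + c q * (g 1)^2)) \<longlonglongrightarrow> N * \<sigma>" by simp
  from order_tendstoD(2)[OF this b] show "\<forall>\<^sub>F q in sequentially. ?m q (\<lambda>_. True) < b"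
   by eventually_elim (rule le_less_trans[OF total_le])
 next
  fix b assume b: "b < N * \<sigma>"
  (* simplex_mass_ge with \<delta> = \<theta> / 3 and \<eta> = \<theta> loses two factors 1 - \<theta> in the limit. *)
  have "((\<lambda>\<theta>. N * ((1 - 3 * (\<theta> / 3)) * ((1 - \<theta>) * \<sigma>))) \<longlongrightarrow> N * ((1 - 3 * (0 / 3)) * ((1 - 0) * \<sigma>))) (at_right 0)"
   by (intro tendsto_intros) auto
  then have "((\<lambda>\<theta>. N * ((1 - 3 * (\<theta> / 3)) * ((1 - \<theta>) * \<sigma>))) \<longlongrightarrow> N * \<sigma>) (at_right 0)" by simp
  from order_tendstoD(1)[OF this b]
  have "\<forall>\<^sub>F \<theta> in at_right 0. b < N * ((1 - 3 * (\<theta> / 3)) * ((1 - \<theta>) * \<sigma>)) \<and> 0 < \<theta> \<and> \<theta> < 1"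
   using eventually_at_right_real[OF zero_less_one[where 'a = real]] by eventually_elim auto
  then obtain \<theta> where \<theta>: "b < N * ((1 - 3 * (\<theta> / 3)) * ((1 - \<theta>) * \<sigma>))" "0 < \<theta>" "\<theta> < 1"
   using eventually_happens'[OF trivial_limit_at_right_real] by blast
  define \<delta> K where "\<delta> = \<theta> / 3" and "K = (2 * g \<delta>)^2 / \<theta>"
  have ge: "N * ((1 - 3 * \<delta>) * ((1 - \<theta>) * (?D q) - c q * (g \<delta>)^2)) - N * (c q * K) \<le>
    ?m q (\<lambda>_. True)" for q
  proof -
   have "N * ((1 - 3 * \<delta>) * ((1 - \<theta>) * diagonal_mass n g (e q) - (g \<delta>)^2)) \<le> simplex_mass n p (e q) (\<lambda>_. True) + N * K"
    unfolding N_def K_def by (rule simplex_mass_ge[OF g pos e n]) (use \<theta> in \<open>auto simp: \<delta>_def\<close>)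
   from mult_left_mono[OF this c0[of q]] show ?thesis by (simp add: algebra_simps)
  qed
  have "(\<lambda>q. N * ((1 - 3 * \<delta>) * ((1 - \<theta>) * (?D q) - c q * (g \<delta>)^2)) - N * (c q * K)) \<longlonglongrightarrow>
    N * ((1 - 3 * \<delta>) * ((1 - \<theta>) * \<sigma> - 0 * (g \<delta>)^2)) - N * (0 * K)"
   by (intro tendsto_intros D c)
  then have "(\<lambda>q. N * ((1 - 3 * \<delta>) * ((1 - \<theta>) * (?D q) - c q * (g \<delta>)^2)) - N * (c q * K)) \<longlonglongrightarrow>
    N * ((1 - 3 * (\<theta> / 3)) * ((1 - \<theta>) * \<sigma>))" by (simp add: \<delta>_def)
  from order_tendstoD(1)[OF this \<theta>(1)]
  show "\<forall>\<^sub>F q in sequentially. b < ?m q (\<lambda>_. True)"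
   by eventually_elim (rule less_le_trans[OF _ ge])
 qed
 have off: "(\<lambda>q. ?m q (off_blocks n J)) \<longlonglongrightarrow> 0" if J: "0 < J" for J
 proof (rule order_tendstoI)
  fix b :: real assume "b < 0"
  then show "\<forall>\<^sub>F q in sequentially. b < ?m q (off_blocks n J)"
   by (intro always_eventually allI) (auto intro: less_le_trans mult_nonneg_nonneg c0 simplex_mass_nonneg)
 next
  fix b :: real assume b: "0 < b"
  have pos': "0 < N * \<sigma> * (real J + 1) + 1" using N \<sigma> by (intro add_nonneg_pos mult_nonneg_nonneg) auto
  (* In the limit the strips before the J + 1 endpoints carry at most N * \<sigma> * (J + 1) * \<delta> < b. *)
  define \<delta> where "\<delta> = b / (N * \<sigma> * (real J + 1) + 1)"
  have \<delta>: "0 < \<delta>" using b pos' by (simp add: \<delta>_def)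
  have \<delta>b: "N * \<sigma> * (real J + 1) * \<delta> < b"
  proof -
   have "N * \<sigma> * (real J + 1) * \<delta> < (N * \<sigma> * (real J + 1) + 1) * \<delta>" using \<delta> by (simp add: algebra_simps)
   also have "\<dots> = b" using pos' by (simp add: \<delta>_def)
   finally show ?thesis .
  qed
  define A where "A = (\<Union>j\<le>J. {real j / real J - \<delta>..real j / real J})"
  have A: "A \<in> sets borel" unfolding A_def by auto
  have "emeasure lborel (A \<inter> {0..1}) \<le> emeasure lborel A" using A by (intro emeasure_mono) auto
  also have "\<dots> \<le> (\<Sum>j\<le>J. emeasure lborel {real j / real J - \<delta>..real j / real J})"
   unfolding A_def by (rule emeasure_subadditive_finite) auto
  also have "\<dots> = ennreal ((real J + 1) * \<delta>)"
   using \<delta> by (simp add: ennreal_of_nat_eq_real_of_nat ennreal_mult[symmetric] add.commute flip: of_nat_Suc)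
  finally have \<mu>: "emeasure lborel (A \<inter> {0..1}) \<le> ennreal ((real J + 1) * \<delta>)" .
  have "?m q (off_blocks n J) \<le>
    N * (?D q * ((real J + 1) * \<delta>) + c q * (g \<delta>)^2)" for q
  proof (rule le[of "\<lambda>x y. \<forall>j<J. \<not> (real j / real J < x \<and> y \<le> real (Suc j) / real J)", OF _ _ _ A \<mu>])
   have "Measurable.pred (borel \<Otimes>\<^sub>M borel) (\<lambda>z. \<forall>j\<in>{..<J}. \<not> (real j / real J < fst z \<and> snd z \<le> real (Suc j) / real J))"
   proof (rule pred_intros_finite(3))
    show "Measurable.pred (borel \<Otimes>\<^sub>M borel) (\<lambda>z. \<not> (real j / real J < fst z \<and> snd z \<le> real (Suc j) / real J))" for j
     by measurable
   qed simp
   then show "Measurable.pred (borel \<Otimes>\<^sub>M borel) (\<lambda>(x, y). \<forall>j<J. \<not> (real j / real J < x \<and> y \<le> real (Suc j) / real J))"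
    by (simp only: Ball_def lessThan_iff case_prod_beta')
   fix x y :: real assume xy: "0 \<le> x" "x \<le> y" "y \<le> 1" and P: "\<forall>j<J. \<not> (real j / real J < x \<and> y \<le> real (Suc j) / real J)"
   show "x \<in> A \<or> \<delta> \<le> y - x"
   proof (cases "x = 0")
    case True
    then show ?thesis using \<delta> by (auto simp: A_def intro!: bexI[of _ 0])
   next
    case False
    then obtain j where j: "j < J" "real j / real J < x" "x \<le> real (Suc j) / real J"
     using block_containing[of x J] xy J by auto
    have "real (Suc j) / real J < y" using P[rule_format, OF j(1)] j(2) by linarith
    then have "x \<in> {real (Suc j) / real J - \<delta>..real (Suc j) / real J} \<or> \<delta> \<le> y - x" using j(3) by auto
    moreover have "{real (Suc j) / real J - \<delta>..real (Suc j) / real J} \<subseteq> A" unfolding A_def by (rule UN_upper) (use j in simp)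
    ultimately show ?thesis by blast
   qed
  next
   show "(\<forall>j<J. \<not> in_block n J j r) = (\<forall>j<J. \<not> (real j / real J < lowest n r \<and> highest n r \<le> real (Suc j) / real J))" for r
    by (simp only: in_block_lowest_highest[OF n0])
   show "Measurable.pred (unit_cube n) (off_blocks n J)" by (rule pred_off_block)
   show "0 \<le> (real J + 1) * \<delta>" "0 < \<delta>" using \<delta> by auto
  qed
  moreover
  have "(\<lambda>q. N * (?D q * ((real J + 1) * \<delta>) + c q * (g \<delta>)^2)) \<longlonglongrightarrow> N * (\<sigma> * ((real J + 1) * \<delta>) + 0 * (g \<delta>)^2)"
   by (intro tendsto_intros D c)
  then have "(\<lambda>q. N * (?D q * ((real J + 1) * \<delta>) + c q * (g \<delta>)^2)) \<longlonglongrightarrow> N * \<sigma> * (real J + 1) * \<delta>"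
   by (simp add: ac_simps)
  from order_tendstoD(2)[OF this \<delta>b]
  have "\<forall>\<^sub>F q in sequentially. N * (?D q * ((real J + 1) * \<delta>) + c q * (g \<delta>)^2) < b" .
  ultimately show "\<forall>\<^sub>F q in sequentially. ?m q (off_blocks n J) < b"
   by (intro eventually_mono[OF _ le_less_trans]) auto
 qed
 have block: "\<forall>\<^sub>F q in sequentially. \<forall>j<J. ?m q (in_block n J j) \<le> (N * \<sigma> + 1) / real J" if J: "0 < J" for J
 proof -
  have bl: "?m q (in_block n J j) \<le> N * (?D q * (1 / real J) + c q * (g 1)^2)" if j: "j < J" for q j
  proof (rule le[of "\<lambda>x y. real j / real J < x \<and> y \<le> real (Suc j) / real J" _ "{real j / real J..real (Suc j) / real J}"])
   have "Measurable.pred (borel \<Otimes>\<^sub>M borel) (\<lambda>z. real j / real J < fst z \<and> snd z \<le> real (Suc j) / real J)" by measurable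
   then show "Measurable.pred (borel \<Otimes>\<^sub>M borel) (\<lambda>(x, y). real j / real J < x \<and> y \<le> real (Suc j) / real J)"
    by (simp only: case_prod_beta')
   have "emeasure lborel ({real j / real J..real (Suc j) / real J} \<inter> {0..1}) \<le> emeasure lborel {real j / real J..real (Suc j) / real J}"
    by (intro emeasure_mono) auto
   also have "\<dots> = ennreal (1 / real J)" using J by (simp add: divide_right_mono diff_divide_distrib[symmetric])
   finally show "emeasure lborel ({real j / real J..real (Suc j) / real J} \<inter> {0..1}) \<le> ennreal (1 / real J)" .
   show "in_block n J j r = (real j / real J < lowest n r \<and> highest n r \<le> real (Suc j) / real J)" for r
    by (rule in_block_lowest_highest[OF n0])
   show "Measurable.pred (unit_cube n) (in_block n J j)" by (rule pred_in_block)
  qed auto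
  have "(\<lambda>q. N * (?D q + c q * (g 1)^2 * real J)) \<longlonglongrightarrow> N * (\<sigma> + 0 * (g 1)^2 * real J)"
   by (intro tendsto_intros D c)
  then have "(\<lambda>q. N * (?D q + c q * (g 1)^2 * real J)) \<longlonglongrightarrow> N * \<sigma>" by simp
  from order_tendstoD(2)[OF this, of "N * \<sigma> + 1"]
  have "\<forall>\<^sub>F q in sequentially. N * (?D q + c q * (g 1)^2 * real J) < N * \<sigma> + 1" by simp
  then show ?thesis
  proof eventually_elim
   case (elim q)
   have "N * (?D q * (1 / real J) + c q * (g 1)^2) = N * (?D q + c q * (g 1)^2 * real J) / real J"
    using J by (simp add: field_simps)
   also have "\<dots> \<le> (N * \<sigma> + 1) / real J" using elim by (intro divide_right_mono) auto
   finally show ?case using bl by (auto intro: order_trans)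
  qed
 qed
 have C0: "0 \<le> N * \<sigma> + 1" using N \<sigma> by (intro add_nonneg_nonneg mult_nonneg_nonneg) auto
 show ?thesis unfolding concentrates_def N_def[symmetric]
  by (intro conjI allI impI total off exI[of _ "N * \<sigma> + 1"] C0 block)
qed

section \<open>The integral on the diagonal\<close>

lemma diagonal_mass_powr:
 assumes "0 < eps" "2 * p - 4 = real R"
 shows "diagonal_mass n (\<lambda>x. x powr (2 - p) / ((p - 1) * (p - 2))) eps =
  (\<integral>z. z ^ (n - 2) / (z + eps) ^ R * indicator {0..1} z \<partial>lborel) / ((p - 1) * (p - 2))^2"
proof -
 have eq: "z ^ (n - 2) * ((z + eps) powr (2 - p) / ((p - 1) * (p - 2)))^2 * indicator {0..1} z =
   z ^ (n - 2) / (z + eps) ^ R * indicator {0..1} z / ((p - 1) * (p - 2))^2" for z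
 proof (cases "z \<in> {0..1}")
  case True
  then have z: "0 < z + eps" using assms(1) by simp
  have "((z + eps) powr (2 - p))^2 = (z + eps) powr (- real R)"
   unfolding assms(2)[symmetric] power2_eq_square powr_add[symmetric] by (rule arg_cong[of _ _ "\<lambda>x. _ powr x"]) simp
  also have "\<dots> = 1 / (z + eps) ^ R" using z by (simp add: powr_minus powr_realpow divide_inverse)
  finally show ?thesis by (simp add: power_divide)
 qed simp
 show ?thesis unfolding diagonal_mass_def eq by (rule integral_divide_zero)
qed

text \<open>Bernoulli's inequality for the power of \<open>z / (z + \<epsilon>) = 1 - \<epsilon> / (z + \<epsilon>)\<close> compares the integrand with
  \<open>1 / (z + \<epsilon>)\<close>.\<close>

lemma diagonal_integral_critical:
 assumes n: "2 \<le> n" and eps: "0 < eps"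
 shows "(\<integral>z. z ^ (n - 2) / (z + eps) ^ (n - 1) * indicator {0..1} z \<partial>lborel) \<le> ln (1 + eps) - ln eps"
  and "ln (1 + eps) - ln eps - real (n - 2) \<le> (\<integral>z. z ^ (n - 2) / (z + eps) ^ (n - 1) * indicator {0..1} z \<partial>lborel)"
proof -
 let ?I = "\<integral>z. z ^ (n - 2) / (z + eps) ^ (n - 1) * indicator {0..1} z \<partial>lborel"
 have pos: "0 < z + eps" if "0 \<le> z" for z using that eps by simp
 have ne: "z + eps \<noteq> 0" if "0 \<le> z" for z using pos[OF that] by simp
 have int: "integrable lborel (\<lambda>z. f z * indicator {0..1} z)" if "\<And>z. 0 \<le> z \<Longrightarrow> z \<le> 1 \<Longrightarrow> isCont f z" for f :: "real \<Rightarrow> real"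
  using that by (rule borel_integrable_atLeastAtMost)
 have i0: "integrable lborel (\<lambda>z. z ^ (n - 2) / (z + eps) ^ (n - 1) * indicator {0..1} z)"
  by (intro int continuous_intros) (auto simp: ne)
 have f: "z ^ (n - 2) / (z + eps) ^ (n - 1) = (1 + - (eps / (z + eps))) ^ (n - 2) / (z + eps)" if "0 \<le> z" for z
 proof -
  have "1 + - (eps / (z + eps)) = z / (z + eps)" using pos[OF that] by (simp add: field_simps)
  moreover have "n - 1 = Suc (n - 2)" using n by simp
  ultimately show ?thesis by (simp add: power_divide)
 qed
 have "?I \<le> (\<integral>z. 1 / (z + eps) * indicator {0..1} z \<partial>lborel)"
 proof (rule integral_mono[OF i0])
  show "integrable lborel (\<lambda>z. 1 / (z + eps) * indicator {0..1} z)"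
   by (intro int continuous_intros) (auto simp: ne)
  fix z :: real
  have "(1 + - (eps / (z + eps))) ^ (n - 2) / (z + eps) \<le> 1 / (z + eps)" if z: "0 \<le> z"
  proof (rule divide_right_mono)
   show "(1 + - (eps / (z + eps))) ^ (n - 2) \<le> 1" using pos[OF z] eps z by (intro power_le_one) (auto simp: field_simps)
  qed (use pos[OF z] in simp)
  then show "z ^ (n - 2) / (z + eps) ^ (n - 1) * indicator {0..1} z \<le> 1 / (z + eps) * indicator {0..1} z"
   using f[of z] by (simp add: indicator_def)
 qed
 also have "\<dots> = ln (1 + eps) - ln (0 + eps)"
 proof (rule integral_FTC_Icc_real)
  fix z :: real assume "0 \<le> z" "z \<le> 1"
  note z = pos[OF this(1)]
  show "((\<lambda>z. ln (z + eps)) has_real_derivative 1 / (z + eps)) (at z)"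
   using z by (auto intro!: derivative_eq_intros)
  show "isCont (\<lambda>z. 1 / (z + eps)) z" using z by (intro continuous_intros) auto
 qed simp
 finally show "?I \<le> ln (1 + eps) - ln eps" by simp
 have "ln (1 + eps) - ln eps - real (n - 2) \<le> (ln (1 + eps) + real (n - 2) * eps / (1 + eps)) - (ln (0 + eps) + real (n - 2) * eps / (0 + eps))"
  using eps by simp
 also have "\<dots> = (\<integral>z. (1 / (z + eps) - real (n - 2) * eps / (z + eps)^2) * indicator {0..1} z \<partial>lborel)"
 proof (rule integral_FTC_Icc_real[symmetric])
  fix z :: real assume "0 \<le> z" "z \<le> 1"
  note z = pos[OF this(1)]
  show "((\<lambda>z. ln (z + eps) + real (n - 2) * eps / (z + eps)) has_real_derivative 1 / (z + eps) - real (n - 2) * eps / (z + eps)^2) (at z)"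
   using z by (auto intro!: derivative_eq_intros simp: power2_eq_square)
  show "isCont (\<lambda>z. 1 / (z + eps) - real (n - 2) * eps / (z + eps)^2) z" using z by (intro continuous_intros) auto
 qed simp
 also have "\<dots> \<le> ?I"
 proof (rule integral_mono[OF _ i0])
  show "integrable lborel (\<lambda>z. (1 / (z + eps) - real (n - 2) * eps / (z + eps)^2) * indicator {0..1} z)"
   by (intro int continuous_intros) (auto simp: ne)
  fix z :: real
  have "1 / (z + eps) - real (n - 2) * eps / (z + eps)^2 \<le> (1 + - (eps / (z + eps))) ^ (n - 2) / (z + eps)" if z: "0 \<le> z"
  proof -
   have "1 / (z + eps) - real (n - 2) * eps / (z + eps)^2 = (1 + real (n - 2) * - (eps / (z + eps))) / (z + eps)"
    using ne[OF z] by (simp add: diff_divide_distrib power2_eq_square)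
   also have "\<dots> \<le> (1 + - (eps / (z + eps))) ^ (n - 2) / (z + eps)"
    using pos[OF z] z eps by (intro divide_right_mono Bernoulli_inequality) (auto simp: field_simps)
   finally show ?thesis .
  qed
  then show "(1 / (z + eps) - real (n - 2) * eps / (z + eps)^2) * indicator {0..1} z \<le> z ^ (n - 2) / (z + eps) ^ (n - 1) * indicator {0..1} z"
   using f[of z] by (simp add: indicator_def)
 qed
 finally show "ln (1 + eps) - ln eps - real (n - 2) \<le> ?I" .
qed

lemma integral_beta_nat:
 "((\<lambda>u::real. u ^ a * (1 - u) ^ b) has_integral fact a * fact b / fact (a + b + 1)) {0..1}"
proof -
 have "((\<lambda>t. t powr (real (Suc a) - 1) * (1 - t) powr (real (Suc b) - 1)) has_integral Beta (real (Suc a)) (real (Suc b))) {0..1}"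
  by (rule has_integral_Beta_real) auto
 then have "((\<lambda>t. t powr (real (Suc a) - 1) * (1 - t) powr (real (Suc b) - 1)) has_integral Beta (real (Suc a)) (real (Suc b))) {0<..<1}"
  by (simp add: has_integral_Icc_iff_Ioo)
 moreover have "Beta (real (Suc a)) (real (Suc b)) = fact a * fact b / fact (a + b + 1)"
  using Gamma_fact[of a, where 'a = real] Gamma_fact[of b, where 'a = real] Gamma_fact[of "a + b + 1", where 'a = real]
  unfolding Beta_def by (simp add: add_ac)
 ultimately have "((\<lambda>t. t powr (real (Suc a) - 1) * (1 - t) powr (real (Suc b) - 1)) has_integral fact a * fact b / fact (a + b + 1)) {0<..<1}" by simp
 then have "((\<lambda>u::real. u ^ a * (1 - u) ^ b) has_integral fact a * fact b / fact (a + b + 1)) {0<..<1}"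
  by (rule has_integral_eq[rotated]) (simp add: powr_realpow)
 then show ?thesis by (simp add: has_integral_Icc_iff_Ioo)
qed

text \<open>The substitution \<open>u = z / (z + \<epsilon>)\<close> gives the Beta integrand on \<open>[0, 1 / (1 + \<epsilon>)]\<close> and extracts the power
  of \<open>\<epsilon>\<close>.\<close>

lemma diagonal_integral_supercritical:
 fixes e :: "nat \<Rightarrow> real"
 assumes e: "\<And>q::nat. 0 < e q" "e \<longlonglongrightarrow> 0"
 shows "(\<lambda>q. e q ^ (b + 1) * (\<integral>z. z ^ a / (z + e q) ^ (a + b + 2) * indicator {0..1} z \<partial>lborel)) \<longlonglongrightarrow> fact a * fact b / fact (a + b + 1)"
proof -
 let ?f = "\<lambda>u::real. u ^ a * (1 - u) ^ b"
 have "continuous_on {-1..2} ?f" by (intro continuous_intros)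
 then obtain F where F: "\<And>u. u \<in> {-1..2} \<Longrightarrow> (F has_vector_derivative ?f u) (at u within {-1..2})"
  by (rule antiderivative_continuous) blast
 have F': "(F has_real_derivative ?f u) (at u)" if "-1 < u" "u < 2" for u
 proof -
  have "(F has_real_derivative ?f u) (at u within {-1..2})"
   using F[of u] that by (simp add: has_real_derivative_iff_has_vector_derivative)
  then show ?thesis using that at_within_Icc_at[of "-1" u 2] by simp
 qed
 have val: "eps ^ (b + 1) * (\<integral>z. z ^ a / (z + eps) ^ (a + b + 2) * indicator {0..1} z \<partial>lborel) = F (1 / (1 + eps)) - F 0"
  if eps: "0 < eps" for eps
 proof -
  have "(\<integral>z. eps ^ (b + 1) * (z ^ a / (z + eps) ^ (a + b + 2)) * indicator {0..1} z \<partial>lborel) = F (1 / (1 + eps)) - F (0 / (0 + eps))"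
  proof (rule integral_FTC_Icc_real)
   fix z :: real assume z: "0 \<le> z" "z \<le> 1"
   then have pos: "0 < z + eps" using eps by simp
   have u: "-1 < z / (z + eps)" "z / (z + eps) < 2"
    using z eps pos by (auto simp: divide_less_eq intro: less_le_trans[of _ 0])
   have "((\<lambda>z. z / (z + eps)) has_real_derivative eps / (z + eps)^2) (at z)"
    using pos by (auto intro!: derivative_eq_intros simp: power2_eq_square)
   from DERIV_chain2[where f = F and g = "\<lambda>z. z / (z + eps)", OF F'[OF u] this]
   have "((\<lambda>z. F (z / (z + eps))) has_real_derivative ?f (z / (z + eps)) * (eps / (z + eps)^2)) (at z)" .
   moreover have "?f (z / (z + eps)) * (eps / (z + eps)^2) = eps ^ (b + 1) * (z ^ a / (z + eps) ^ (a + b + 2))"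
   proof -
    have "1 - z / (z + eps) = eps / (z + eps)" using pos by (simp add: field_simps)
    then show ?thesis using pos by (simp add: power_divide power_add power2_eq_square ac_simps)
   qed
   ultimately show "((\<lambda>z. F (z / (z + eps))) has_real_derivative eps ^ (b + 1) * (z ^ a / (z + eps) ^ (a + b + 2))) (at z)" by simp
   show "isCont (\<lambda>z. eps ^ (b + 1) * (z ^ a / (z + eps) ^ (a + b + 2))) z" using pos by (intro continuous_intros) auto
  qed simp
  moreover have "(\<integral>z. eps ^ (b + 1) * (z ^ a / (z + eps) ^ (a + b + 2)) * indicator {0..1} z \<partial>lborel) =
    eps ^ (b + 1) * (\<integral>z. z ^ a / (z + eps) ^ (a + b + 2) * indicator {0..1} z \<partial>lborel)"
   unfolding mult.assoc by (rule integral_mult_right_zero)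
  ultimately show ?thesis by simp
 qed
 have F1: "F 1 - F 0 = fact a * fact b / fact (a + b + 1)"
 proof -
  have "(?f has_integral F 1 - F 0) {0..1}"
  proof (rule fundamental_theorem_of_calculus)
   fix u :: real assume "u \<in> {0..1}"
   then show "(F has_vector_derivative ?f u) (at u within {0..1})"
    unfolding has_real_derivative_iff_has_vector_derivative[symmetric]
    by (intro has_field_derivative_at_within[OF F']) auto
  qed simp
  then show ?thesis by (rule has_integral_unique[OF _ integral_beta_nat])
 qed
 have "(\<lambda>q. 1 / (1 + e q)) \<longlonglongrightarrow> 1 / (1 + 0)"
  by (intro tendsto_divide tendsto_add tendsto_const e) simp
 then have "(\<lambda>q. 1 / (1 + e q)) \<longlonglongrightarrow> 1" by simp
 moreover have "isCont F 1" using F'[of 1] by (intro DERIV_isCont) auto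
 ultimately have "(\<lambda>q. F (1 / (1 + e q)) - F 0) \<longlonglongrightarrow> F 1 - F 0"
  by (intro tendsto_diff tendsto_const isCont_tendsto_compose[of 1 F])
 then show ?thesis unfolding F1[symmetric] val[OF e(1)] .
qed

lemma tendsto_of_at_right:
 assumes "filterlim e (at_right (0::real)) sequentially"
 shows "e \<longlonglongrightarrow> 0"
 using assms by (simp add: filterlim_at)

lemma inverse_ln_tendsto_0:
 assumes "filterlim e (at_right (0::real)) sequentially" "\<And>q. 0 < e q"
 shows "(\<lambda>q. 1 / ln (1 / e q)) \<longlonglongrightarrow> 0"
proof -
 have "filterlim (\<lambda>q. ln (e q)) at_bot sequentially" by (rule filterlim_compose[OF ln_at_0 assms(1)])
 then have "filterlim (\<lambda>q. - ln (e q)) at_top sequentially" by (simp add: filterlim_uminus_at_top)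
 then have "(\<lambda>q. inverse (- ln (e q))) \<longlonglongrightarrow> 0" by (rule tendsto_inverse_0_at_top)
 moreover have "inverse (- ln (e q)) = 1 / ln (1 / e q)" for q
  using assms(2)[of q] by (simp add: ln_div inverse_eq_divide)
 ultimately show ?thesis by simp
qed

lemma concentrates_critical:
 assumes n: "2 \<le> n" and p: "2 * p - 4 = real (n - 1)"
  and e: "filterlim e (at_right 0) sequentially" "\<And>q. 0 < e q" "\<And>q. e q < 1"
 shows "concentrates n p e (\<lambda>q. 1 / ln (1 / e q)) (real (n * (n - 1)) * (1 / ((p - 1) * (p - 2))^2))"
proof -
 have "2 * p - 4 \<ge> 1" unfolding p using n by simp
 then have p2: "2 < p" by simp
 have l: "0 < ln (1 / e q)" for q using e(2)[of q] e(3)[of q] by simp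
 define I where "I q = (\<integral>z. z ^ (n - 2) / (z + e q) ^ (n - 1) * indicator {0..1} z \<partial>lborel)" for q
 have c: "(\<lambda>q. 1 / ln (1 / e q)) \<longlonglongrightarrow> 0" by (rule inverse_ln_tendsto_0[OF e(1,2)])
 have "(\<lambda>q. 1 / ln (1 / e q) * I q) \<longlonglongrightarrow> 1"
 proof (rule tendsto_sandwich)
  have lnl: "(\<lambda>q. ln (1 + e q)) \<longlonglongrightarrow> ln (1 + 0)" by (intro tendsto_intros tendsto_of_at_right e) simp
  have "(\<lambda>q. 1 + (ln (1 + e q) - real (n - 2)) * (1 / ln (1 / e q))) \<longlonglongrightarrow> 1 + (ln (1 + 0) - real (n - 2)) * 0"
   by (intro tendsto_add tendsto_mult tendsto_diff tendsto_const c lnl)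
  then show "(\<lambda>q. 1 + (ln (1 + e q) - real (n - 2)) * (1 / ln (1 / e q))) \<longlonglongrightarrow> 1" by simp
  have "(\<lambda>q. 1 + ln (1 + e q) * (1 / ln (1 / e q))) \<longlonglongrightarrow> 1 + ln (1 + 0) * 0"
   by (intro tendsto_add tendsto_mult tendsto_const c lnl)
  then show "(\<lambda>q. 1 + ln (1 + e q) * (1 / ln (1 / e q))) \<longlonglongrightarrow> 1" by simp
  have expand: "1 + x * (1 / ln (1 / e q)) = 1 / ln (1 / e q) * (x - ln (e q))" for x q
   using l[of q] e(2)[of q] by (simp add: ln_div field_simps)
  show "\<forall>\<^sub>F q in sequentially. 1 + (ln (1 + e q) - real (n - 2)) * (1 / ln (1 / e q)) \<le> 1 / ln (1 / e q) * I q"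
  proof (intro always_eventually allI)
   fix q
   have "1 / ln (1 / e q) * (ln (1 + e q) - real (n - 2) - ln (e q)) \<le> 1 / ln (1 / e q) * I q"
    using diagonal_integral_critical(2)[OF n e(2), of q] l[of q] by (intro mult_left_mono) (auto simp: I_def)
   then show "1 + (ln (1 + e q) - real (n - 2)) * (1 / ln (1 / e q)) \<le> 1 / ln (1 / e q) * I q" by (simp only: expand)
  qed
  show "\<forall>\<^sub>F q in sequentially. 1 / ln (1 / e q) * I q \<le> 1 + ln (1 + e q) * (1 / ln (1 / e q))"
  proof (intro always_eventually allI)
   fix q
   have "1 / ln (1 / e q) * I q \<le> 1 / ln (1 / e q) * (ln (1 + e q) - ln (e q))"
    using diagonal_integral_critical(1)[OF n e(2), of q] l[of q] by (intro mult_left_mono) (auto simp: I_def)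
   then show "1 / ln (1 / e q) * I q \<le> 1 + ln (1 + e q) * (1 / ln (1 / e q))" by (simp only: expand)
  qed
 qed
 then have D: "(\<lambda>q. 1 / ln (1 / e q) * I q / ((p - 1) * (p - 2))^2) \<longlonglongrightarrow> 1 / ((p - 1) * (p - 2))^2"
  using p2 by (intro tendsto_divide tendsto_const) auto
 show ?thesis
 proof (rule concentrates_diagonal[OF second_antiderivative_powr[OF p2] _ n e(2) _ c])
  show "(\<lambda>q. 1 / ln (1 / e q) * diagonal_mass n (\<lambda>x. x powr (2 - p) / ((p - 1) * (p - 2))) (e q)) \<longlonglongrightarrow> 1 / ((p - 1) * (p - 2))^2"
   using D by (simp add: diagonal_mass_powr[OF e(2) p] I_def)
 qed (use p2 l in \<open>auto intro: less_imp_le\<close>)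
qed

lemma concentrates_supercritical:
 assumes n: "2 \<le> n" and D: "4 \<le> D" and p: "2 * p - 4 = real (n + D - 4)"
  and e: "filterlim e (at_right 0) sequentially" "\<And>q. 0 < e q"
 shows "concentrates n p e (\<lambda>q. e q ^ (D - 3))
  (real (n * (n - 1)) * (fact (n - 2) * fact (D - 4) / fact (n + D - 5) / ((p - 1) * (p - 2))^2))"
proof -
 have "2 * p - 4 \<ge> 2" unfolding p using n D by simp
 then have p2: "2 < p" by simp
 define a b where "a = n - 2" and "b = D - 4"
 have ab: "n - 2 = a" "D - 4 = b" "n + D - 4 = a + b + 2" "D - 3 = b + 1" "n + D - 5 = a + b + 1"
  using n D by (auto simp: a_def b_def)
 note e0 = tendsto_of_at_right[OF e(1)]
 have c: "(\<lambda>q. e q ^ (b + 1)) \<longlonglongrightarrow> 0" using tendsto_power[OF e0, of "b + 1"] by simp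
 have "(\<lambda>q. e q ^ (b + 1) * (\<integral>z. z ^ a / (z + e q) ^ (a + b + 2) * indicator {0..1} z \<partial>lborel) / ((p - 1) * (p - 2))^2)
   \<longlonglongrightarrow> fact a * fact b / fact (a + b + 1) / ((p - 1) * (p - 2))^2"
  using p2 by (intro tendsto_divide tendsto_const diagonal_integral_supercritical e(2) e0) auto
 then have lim: "(\<lambda>q. e q ^ (b + 1) * diagonal_mass n (\<lambda>x. x powr (2 - p) / ((p - 1) * (p - 2))) (e q))
   \<longlonglongrightarrow> fact a * fact b / fact (a + b + 1) / ((p - 1) * (p - 2))^2"
  by (simp only: diagonal_mass_powr[OF e(2) p[unfolded ab(3)]] ab(1) times_divide_eq_right)
 show ?thesis unfolding ab
  by (rule concentrates_diagonal[OF second_antiderivative_powr[OF p2] _ n e(2) _ c lim])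
    (use p2 e(2) in \<open>auto intro: less_imp_le\<close>)
qed

text \<open>For \<open>n = 1\<close> the two extreme coordinates coincide, and the kernel is asymptotically constant.\<close>

lemma concentrates_single:
 assumes g: "second_antiderivative p g" and e: "filterlim e (at_right 0) sequentially" "\<And>q. 0 < e q"
  and \<kappa>: "\<kappa> \<longlonglongrightarrow> 0" "\<And>q. 0 \<le> \<kappa> q" and \<kappa>g: "(\<lambda>q. \<kappa> q * g (e q)) \<longlonglongrightarrow> s"
 shows "concentrates 1 p e (\<lambda>q. (\<kappa> q)^2) (s^2)"
proof -
 interpret prob_space "unit_cube 1" by (rule prob_space_unit_cube)
 interpret P: product_sigma_finite "\<lambda>_::nat. unit_interval" by (rule product_sigma_finite_unit)
 have p: "0 \<le> p" using g by (simp add: second_antiderivative_def)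
 note e0 = tendsto_of_at_right[OF e(1)]
 have lh: "lowest 1 r = r 0" "highest 1 r = r 0" for r by (simp_all add: lowest_def highest_def lessThan_Suc)
 have r01: "0 \<le> r 0" "r 0 \<le> 1" if "r \<in> space (unit_cube 1)" for r
  using lowest_highest_bounds[OF zero_less_one that] unfolding lh by auto
 have K: "simplex_kernel 1 p (e q) r = corner_difference g (e q) (r 0) (r 0)" if "r \<in> space (unit_cube 1)" for q r
  using simplex_kernel_eq[OF g e(2) zero_less_one that] unfolding lh .
 have gl: "(\<lambda>q. g (x + e q)) \<longlonglongrightarrow> g x" if "0 < x" for x
 proof (rule isCont_tendsto_compose[OF second_antiderivative_isCont[OF g that]])
  show "(\<lambda>q. x + e q) \<longlonglongrightarrow> x" using tendsto_add[OF tendsto_const e0, of x] by simp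
 qed
 have "(\<lambda>q. \<kappa> q * g (e q) - \<kappa> q * g (1 + e q)) \<longlonglongrightarrow> s - 0 * g 1"
  by (intro tendsto_diff tendsto_mult \<kappa>g \<kappa> gl) simp
 then have "Bseq (\<lambda>q. \<kappa> q * g (e q) - \<kappa> q * g (1 + e q))" by (intro convergent_imp_Bseq) (auto simp: convergent_def)
 then obtain C where C: "0 < C" "\<And>q. \<bar>\<kappa> q * g (e q) - \<kappa> q * g (1 + e q)\<bar> \<le> C" by (auto simp: Bseq_def)
 have bound: "(\<kappa> q)^2 * (simplex_kernel 1 p (e q) r)^2 \<le> C^2" if r: "r \<in> space (unit_cube 1)" for q r
 proof -
  have "corner_difference g (e q) (r 0) (r 0) \<le> g (e q) - g (1 + e q)" "0 \<le> corner_difference g (e q) (r 0) (r 0)"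
   using corner_difference_le[OF g e(2), of "r 0" "r 0" q] corner_difference_nonneg[OF g e(2), of "r 0" "r 0" q] r01[OF r] by auto
  then have "\<kappa> q * corner_difference g (e q) (r 0) (r 0) \<le> \<kappa> q * (g (e q) - g (1 + e q))" "0 \<le> \<kappa> q * corner_difference g (e q) (r 0) (r 0)"
   using \<kappa>(2)[of q] by (auto intro: mult_left_mono)
  moreover have "\<kappa> q * (g (e q) - g (1 + e q)) \<le> C" using C(2)[of q] by (simp add: right_diff_distrib)
  ultimately have "(\<kappa> q * corner_difference g (e q) (r 0) (r 0))^2 \<le> C^2" by (intro power_mono) auto
  then show ?thesis unfolding K[OF r] by (simp add: power_mult_distrib)
 qed
 note Km [measurable] = simplex_kernel_measurable[OF e(2) p, of 1]
 have total: "(\<lambda>q. (\<kappa> q)^2 * simplex_mass 1 p (e q) (\<lambda>_. True)) \<longlonglongrightarrow> s\<^sup>2"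
 proof -
  have "(\<lambda>q. \<integral>r. (\<kappa> q)^2 * (simplex_kernel 1 p (e q) r)^2 \<partial>unit_cube 1) \<longlonglongrightarrow> (\<integral>r. s\<^sup>2 \<partial>unit_cube 1)"
  proof (rule integral_dominated_convergence[where w = "\<lambda>_. C\<^sup>2"])
   have "AE r in unit_cube 1. r 0 \<noteq> 1"
   proof (rule AE_PiM_component[where P = "\<lambda>x. x \<noteq> 1"])
    show "AE x in unit_interval. x \<noteq> 1"
     using AE_lborel_singleton[of "1::real"] by (subst AE_restrict_space_iff) auto
   qed (use prob_space_unit_interval in auto)
   then show "AE r in unit_cube 1. (\<lambda>q. (\<kappa> q)^2 * (simplex_kernel 1 p (e q) r)^2) \<longlonglongrightarrow> s\<^sup>2"
    using AE_unit_cube_positive[of 1] AE_space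
   proof eventually_elim
    case (elim r)
    then have x: "0 < r 0" "0 < 1 - r 0" using r01[of r] by auto
    have "(\<lambda>q. \<kappa> q * g (e q) - \<kappa> q * g (1 - r 0 + e q) - \<kappa> q * g (r 0 + e q) + \<kappa> q * g (1 + e q)) \<longlonglongrightarrow>
      s - 0 * g (1 - r 0) - 0 * g (r 0) + 0 * g 1"
     by (intro tendsto_diff tendsto_add tendsto_mult \<kappa>g \<kappa> gl x) simp
    then have "(\<lambda>q. \<kappa> q * simplex_kernel 1 p (e q) r) \<longlonglongrightarrow> s"
     unfolding K[OF elim(3)] by (simp add: corner_difference_def algebra_simps)
    from tendsto_power[OF this, of 2] show ?case by (simp add: power_mult_distrib)
   qed
   show "AE r in unit_cube 1. norm ((\<kappa> q)^2 * (simplex_kernel 1 p (e q) r)^2) \<le> C^2" for q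
    by (rule AE_I2) (use bound in simp)
   show "(\<lambda>r. (\<kappa> q)^2 * (simplex_kernel 1 p (e q) r)^2) \<in> borel_measurable (unit_cube 1)" for q
    by (intro borel_measurable_times borel_measurable_power Km) simp
   show "integrable (unit_cube 1) (\<lambda>_. C\<^sup>2)" by (rule integrable_const)
  qed simp
  then show ?thesis unfolding simplex_mass_def by (simp add: prob_space[unfolded One_nat_def])
 qed
 have block: "(\<kappa> q)^2 * simplex_mass 1 p (e q) (in_block 1 J j) \<le> C^2 / real J" if j: "j < J" for q J j
 proof -
  let ?A = "{real j / real J<..real (Suc j) / real J}"
  have ib: "in_block 1 J j r \<longleftrightarrow> r 0 \<in> ?A" for r by (simp add: in_block_def)
  have meas: "(\<lambda>x. indicator ?A x :: real) \<in> borel_measurable unit_interval"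
   by (rule borel_measurable_unit_interval) simp
  have A1: "real (Suc j) / real J \<le> 1" "real j / real J \<le> real (Suc j) / real J" using j by (auto simp: divide_right_mono)
  have "0 \<le> real j / real J" by simp
  then have "?A \<subseteq> {0..1}" using A1(1) by (intro subsetI) (simp only: greaterThanAtMost_iff atLeastAtMost_iff, linarith)
  then have int: "(\<integral>r. indicator ?A (r 0) \<partial>unit_cube 1) = 1 / real J"
  proof -
   have s: "{..<1::nat} = {0}" by auto
   have "(\<integral>r. indicator ?A (r 0) \<partial>unit_cube 1) = (\<integral>x. (indicator ?A x :: real) \<partial>unit_interval)"
    unfolding s by (rule P.product_integral_singleton[OF meas])
   also have "\<dots> = (\<integral>x. indicator ?A x \<partial>lborel)"
   proof -
    have eq: "indicator {0..1} x *\<^sub>R (indicator ?A x :: real) = indicator ?A x" for x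
     using \<open>?A \<subseteq> {0..1}\<close> by (cases "x \<in> ?A") auto
    have "(\<integral>x. (indicator ?A x :: real) \<partial>unit_interval) = (\<integral>x. indicator {0..1} x *\<^sub>R (indicator ?A x :: real) \<partial>lborel)"
     by (rule integral_restrict_space) simp
    then show ?thesis unfolding eq .
   qed
   also have "\<dots> = 1 / real J" using A1 j by (simp add: diff_divide_distrib[symmetric])
   finally show ?thesis .
  qed
  have i1: "integrable (unit_cube 1) (\<lambda>r. C\<^sup>2 * indicator ?A (r 0))"
  proof (rule integrable_const_bound[of _ "C^2"])
   show "(\<lambda>r. C\<^sup>2 * indicator ?A (r 0)) \<in> borel_measurable (unit_cube 1)"
    by (intro borel_measurable_times measurable_const
      measurable_compose[OF unit_cube_coordinate_measurable[OF zero_less_one] borel_measurable_indicator]) auto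
  qed (auto simp: indicator_def)
  have "(\<kappa> q)^2 * simplex_mass 1 p (e q) (in_block 1 J j) = (\<integral>r. (\<kappa> q)^2 * ((simplex_kernel 1 p (e q) r)^2 * of_bool (in_block 1 J j r)) \<partial>unit_cube 1)"
   unfolding simplex_mass_def by simp
  also have "\<dots> \<le> (\<integral>r. C\<^sup>2 * indicator ?A (r 0) \<partial>unit_cube 1)"
  proof (rule integral_mono[OF _ i1])
   show "integrable (unit_cube 1) (\<lambda>r. (\<kappa> q)^2 * ((simplex_kernel 1 p (e q) r)^2 * of_bool (in_block 1 J j r)))"
    by (intro integrable_mult_right simplex_mass_integrable[OF e(2) p] pred_in_block)
   fix r assume r: "r \<in> space (unit_cube 1)"
   show "(\<kappa> q)^2 * ((simplex_kernel 1 p (e q) r)^2 * of_bool (in_block 1 J j r)) \<le> C^2 * indicator ?A (r 0)"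
    unfolding ib using bound[OF r, of q] by (cases "r 0 \<in> ?A") auto
  qed
  also have "\<dots> = C^2 / real J" using int by simp
  finally show ?thesis .
 qed
 have off: "simplex_mass 1 p (e q) (off_blocks 1 J) = 0" if J: "0 < J" for q J
 proof -
  have "AE r in unit_cube 1. (simplex_kernel 1 p (e q) r)^2 * of_bool (\<forall>j<J. \<not> in_block 1 J j r) = 0"
   using AE_unit_cube_positive[of 1] AE_space
  proof eventually_elim
   case (elim r)
   then obtain j where "j < J" "real j / real J < r 0" "r 0 \<le> real (Suc j) / real J"
    using block_containing[of "r 0" J] r01[of r] J by auto
   then have "in_block 1 J j r" by (simp add: in_block_def)
   then show ?case using \<open>j < J\<close> by auto
  qed
  then show ?thesis unfolding simplex_mass_def by (rule integral_eq_zero_AE)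
 qed
 have off_lim: "(\<lambda>q. (\<kappa> q)^2 * simplex_mass 1 p (e q) (off_blocks 1 J)) \<longlonglongrightarrow> 0" if "0 < J" for J
  unfolding off[OF that] by simp
 show ?thesis unfolding concentrates_def
  by (intro conjI allI impI total off_lim exI[of _ "C^2"] always_eventually block zero_le_power2)
qed

section \<open>Counting index tuples by their multiplicities\<close>

definition compositions :: "nat \<Rightarrow> nat \<Rightarrow> (nat \<Rightarrow> nat) set" where
 "compositions n d = {\<nu> \<in> {..<d} \<rightarrow>\<^sub>E {..n}. (\<Sum>j<d. \<nu> j) = n}"

lemma finite_compositions: "finite (compositions n d)"
 unfolding compositions_def by (rule finite_subset[of _ "{..<d} \<rightarrow>\<^sub>E {..n}"]) (auto intro: finite_PiE)

lemma compositionsI: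
 assumes "\<nu> \<in> extensional {..<d}" "(\<Sum>j<d. \<nu> j) = n"
 shows "\<nu> \<in> compositions n d"
proof -
 have "\<nu> j \<le> n" if "j < d" for j
  unfolding assms(2)[symmetric] using that by (intro member_le_sum) auto
 then show ?thesis using assms by (auto simp: compositions_def PiE_def)
qed

definition multiplicities :: "nat \<Rightarrow> nat \<Rightarrow> (nat \<Rightarrow> nat) \<Rightarrow> nat \<Rightarrow> nat" where
 "multiplicities d n i = restrict (multiplicity_of n i) {..<d}"

lemma multiplicities_Suc:
 assumes "j < d"
 shows "multiplicities d (Suc n) (i(n := j)) = (multiplicities d n i)(j := Suc (multiplicities d n i j))"
proof
 fix l
 have "{a. a < Suc n \<and> (i(n := j)) a = l} = (if l = j then insert n {a. a < n \<and> i a = l} else {a. a < n \<and> i a = l})"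
  by (auto simp: less_Suc_eq)
 then have "multiplicity_of (Suc n) (i(n := j)) l = (if l = j then Suc (multiplicity_of n i l) else multiplicity_of n i l)"
  unfolding multiplicity_of_def by simp
 then show "multiplicities d (Suc n) (i(n := j)) l = ((multiplicities d n i)(j := Suc (multiplicities d n i j))) l"
  using assms by (cases "l = j") (simp_all add: multiplicities_def restrict_def)
qed

lemma sum_index_tuples_Suc:
 "(\<Sum>i\<in>index_tuples (Suc n) d. f i) = (\<Sum>j<d. \<Sum>i\<in>index_tuples n d. f (i(n := j)))"
proof -
 have "(\<Sum>i\<in>index_tuples (Suc n) d. f i) = (\<Sum>(j, i)\<in>{..<d} \<times> index_tuples n d. f (i(n := j)))"
  unfolding lessThan_Suc PiE_insert_eq
  by (subst sum.reindex) (use inj_combinator[of n "{..<n}" "\<lambda>_. {..<d}"] in \<open>auto simp: case_prod_beta\<close>)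
 then show ?thesis by (simp add: sum.cartesian_product)
qed

lemma sum_compositions_Suc:
 assumes j: "j < d"
 shows "(\<Sum>\<nu>\<in>compositions (Suc n) d. real (\<nu> j) * f \<nu>) = (\<Sum>\<nu>\<in>compositions n d. real (Suc (\<nu> j)) * f (\<nu>(j := Suc (\<nu> j))))"
proof -
 have "(\<Sum>\<nu>\<in>compositions (Suc n) d. real (\<nu> j) * f \<nu>) = (\<Sum>\<nu>\<in>{\<nu> \<in> compositions (Suc n) d. 0 < \<nu> j}. real (\<nu> j) * f \<nu>)"
  by (rule sum.mono_neutral_right[OF finite_compositions]) auto
 also have "\<dots> = (\<Sum>\<nu>\<in>compositions n d. real (Suc (\<nu> j)) * f (\<nu>(j := Suc (\<nu> j))))"
 proof (rule sum.reindex_bij_witness[where i = "\<lambda>\<nu>. \<nu>(j := Suc (\<nu> j))" and j = "\<lambda>\<nu>. \<nu>(j := \<nu> j - 1)"])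
  fix \<nu> assume \<nu>: "\<nu> \<in> {\<nu> \<in> compositions (Suc n) d. 0 < \<nu> j}"
  have "Suc (\<Sum>l<d. (\<nu>(j := \<nu> j - 1)) l) = (\<Sum>l<d. \<nu> l)"
   using \<nu> j by (simp add: sum.remove[of "{..<d}" j])
  then show "\<nu>(j := \<nu> j - 1) \<in> compositions n d"
   using \<nu> j by (intro compositionsI) (auto simp: compositions_def PiE_def extensional_def)
 next
  fix \<nu> assume \<nu>: "\<nu> \<in> compositions n d"
  have "(\<Sum>l<d. (\<nu>(j := Suc (\<nu> j))) l) = Suc (\<Sum>l<d. \<nu> l)"
   using j by (simp add: sum.remove[of "{..<d}" j])
  then have "\<nu>(j := Suc (\<nu> j)) \<in> compositions (Suc n) d"
   using \<nu> j by (intro compositionsI) (auto simp: compositions_def PiE_def extensional_def)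
  then show "\<nu>(j := Suc (\<nu> j)) \<in> {\<nu> \<in> compositions (Suc n) d. 0 < \<nu> j}" by simp
 qed auto
 finally show ?thesis .
qed

text \<open>There are \<open>n! / \<Prod>\<nu>\<^sub>j!\<close> index tuples with multiplicities \<open>\<nu>\<close>: appending an index \<open>j\<close> raises \<open>\<nu>\<^sub>j\<close> by one, and
  \<open>\<Sum>\<nu>\<^sub>j = n + 1\<close> distributes the factor \<open>n + 1\<close> over the possible last indices.\<close>

lemma sum_by_multiplicities:
 fixes \<Phi> :: "(nat \<Rightarrow> nat) \<Rightarrow> real"
 shows "(\<Sum>i\<in>index_tuples n d. \<Phi> (multiplicities d n i)) = (\<Sum>\<nu>\<in>compositions n d. fact n / (\<Prod>j<d. fact (\<nu> j)) * \<Phi> \<nu>)"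
proof (induction n arbitrary: \<Phi>)
 case 0
 have "compositions 0 d = {\<lambda>j\<in>{..<d}. 0}"
  by (auto simp: compositions_def PiE_def extensional_def restrict_def fun_eq_iff)
 then show ?case by (simp add: multiplicities_def multiplicity_of_def[abs_def])
next
 case (Suc n)
 have upd: "(\<Prod>l<d. fact ((\<nu>(j := Suc (\<nu> j))) l) :: real) = real (Suc (\<nu> j)) * (\<Prod>l<d. fact (\<nu> l))" if "j < d" for \<nu> j
  using that by (simp add: prod.remove[of "{..<d}" j] algebra_simps)
 have "(\<Sum>i\<in>index_tuples (Suc n) d. \<Phi> (multiplicities d (Suc n) i)) =
   (\<Sum>j<d. \<Sum>\<nu>\<in>compositions n d. fact n / (\<Prod>l<d. fact (\<nu> l)) * \<Phi> (\<nu>(j := Suc (\<nu> j))))"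
  unfolding sum_index_tuples_Suc by (rule sum.cong[OF refl]) (simp add: multiplicities_Suc Suc.IH[of "\<lambda>\<nu>. \<Phi> (\<nu>(_ := Suc (\<nu> _)))"])
 also have "\<dots> = (\<Sum>j<d. \<Sum>\<nu>\<in>compositions n d. real (Suc (\<nu> j)) * (fact n / (\<Prod>l<d. fact ((\<nu>(j := Suc (\<nu> j))) l)) * \<Phi> (\<nu>(j := Suc (\<nu> j)))))"
  by (intro sum.cong refl) (simp only: upd lessThan_iff, simp add: divide_simps)
 also have "\<dots> = (\<Sum>j<d. \<Sum>\<nu>\<in>compositions (Suc n) d. real (\<nu> j) * (fact n / (\<Prod>l<d. fact (\<nu> l)) * \<Phi> \<nu>))"
  by (intro sum.cong refl sum_compositions_Suc[symmetric]) simp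
 also have "\<dots> = (\<Sum>\<nu>\<in>compositions (Suc n) d. \<Sum>j<d. real (\<nu> j) * (fact n / (\<Prod>l<d. fact (\<nu> l)) * \<Phi> \<nu>))"
  by (rule sum.swap)
 also have "\<dots> = (\<Sum>\<nu>\<in>compositions (Suc n) d. fact (Suc n) / (\<Prod>l<d. fact (\<nu> l)) * \<Phi> \<nu>)"
 proof (rule sum.cong[OF refl])
  fix \<nu> assume "\<nu> \<in> compositions (Suc n) d"
  then have "(\<Sum>j<d. real (\<nu> j)) = real (Suc n)" by (simp only: compositions_def mem_Collect_eq of_nat_sum[symmetric])
  then show "(\<Sum>j<d. real (\<nu> j) * (fact n / (\<Prod>l<d. fact (\<nu> l)) * \<Phi> \<nu>)) = fact (Suc n) / (\<Prod>l<d. fact (\<nu> l)) * \<Phi> \<nu>"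
   unfolding sum_distrib_right[symmetric] by simp
 qed
 finally show ?case .
qed

text \<open>Odd moments vanish, so that only multiplicities \<open>\<nu>\<^sub>j = 2 \<mu>\<^sub>j - k\<^sub>j\<close> contribute, and for these the moments are
  \<open>(2 \<mu>\<^sub>j)! / (2 ^ \<mu>\<^sub>j * \<mu>\<^sub>j!)\<close>.\<close>

lemma beta_eq:
 assumes K: "mi_abs d k \<le> 2 * m"
 defines "n \<equiv> 2 * m - mi_abs d k"
 shows "fact n * (\<Sum>i\<in>index_tuples n d. (chaos_coeff d k m i)^2) = beta d k m"
proof -
 define W where "W \<nu> = (\<Prod>j<d. (normal_moment (k j + \<nu> j))^2)" for \<nu>
 have cc: "(chaos_coeff d k m i)^2 = W (multiplicities d n i) / ((2 * pi) ^ d * (fact n)^2)" if "i \<in> index_tuples n d" for i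
 proof -
  have "((2 * pi) powr (real d / 2))^2 = (2 * pi) ^ d"
   by (simp add: power2_eq_square powr_add[symmetric] powr_realpow)
  moreover have "(gauss_moment d k n i)^2 = W (multiplicities d n i)"
   unfolding gauss_moment_eq[OF that] W_def multiplicities_def by (simp add: prod_power_distrib)
  ultimately show ?thesis
   by (simp add: chaos_coeff_def n_def[symmetric] power_divide power_mult_distrib power_mult[symmetric])
 qed
 have "(\<Sum>i\<in>index_tuples n d. (chaos_coeff d k m i)^2) = (\<Sum>i\<in>index_tuples n d. W (multiplicities d n i)) / ((2 * pi) ^ d * (fact n)^2)"
  unfolding sum_divide_distrib by (rule sum.cong[OF refl cc])
 then have "fact n * (\<Sum>i\<in>index_tuples n d. (chaos_coeff d k m i)^2) = (\<Sum>i\<in>index_tuples n d. W (multiplicities d n i)) / ((2 * pi) ^ d * fact n)"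
  by (simp add: power2_eq_square)
 also have "\<dots> = (\<Sum>\<nu>\<in>compositions n d. W \<nu> / ((2 * pi) ^ d * (\<Prod>j<d. fact (\<nu> j))))"
  unfolding sum_by_multiplicities sum_divide_distrib by (rule sum.cong[OF refl]) simp
 also have "\<dots> = (\<Sum>\<nu>\<in>{\<nu> \<in> compositions n d. \<forall>j<d. even (k j + \<nu> j)}. W \<nu> / ((2 * pi) ^ d * (\<Prod>j<d. fact (\<nu> j))))"
 proof (rule sum.mono_neutral_right[OF finite_compositions])
  show "\<forall>\<nu>\<in>compositions n d - {\<nu> \<in> compositions n d. \<forall>j<d. even (k j + \<nu> j)}. W \<nu> / ((2 * pi) ^ d * (\<Prod>j<d. fact (\<nu> j))) = 0"
  proof
   fix \<nu> assume "\<nu> \<in> compositions n d - {\<nu> \<in> compositions n d. \<forall>j<d. even (k j + \<nu> j)}"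
   then obtain j where j: "j < d" "odd (k j + \<nu> j)" by auto
   have "W \<nu> = 0" unfolding W_def
    by (rule prod_zero[OF finite_lessThan]) (use j in \<open>auto intro!: bexI[of _ j] simp: normal_moment_def\<close>)
   then show "W \<nu> / ((2 * pi) ^ d * (\<Prod>j<d. fact (\<nu> j))) = 0" by simp
  qed
 qed auto
 also have "\<dots> = beta d k m"
  unfolding beta_def
 proof (rule sum.reindex_bij_witness[where i = "\<lambda>\<mu>. \<lambda>j\<in>{..<d}. 2 * \<mu> j - k j" and j = "\<lambda>\<nu>. \<lambda>j\<in>{..<d}. (k j + \<nu> j) div 2"])
  fix \<nu> assume "\<nu> \<in> {\<nu> \<in> compositions n d. \<forall>j<d. even (k j + \<nu> j)}"
  then have \<nu>: "\<nu> \<in> {..<d} \<rightarrow>\<^sub>E {..n}" "(\<Sum>j<d. \<nu> j) = n" and ev: "\<And>j. j < d \<Longrightarrow> even (k j + \<nu> j)"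
   by (auto simp: compositions_def)
  define \<mu> where "\<mu> = (\<lambda>j\<in>{..<d}. (k j + \<nu> j) div 2)"
  have \<mu>2: "2 * \<mu> j = k j + \<nu> j" if "j < d" for j using ev[OF that] that by (simp add: \<mu>_def)
  have "2 * (\<Sum>j<d. \<mu> j) = (\<Sum>j<d. k j + \<nu> j)" unfolding sum_distrib_left by (rule sum.cong) (use \<mu>2 in auto)
  then have s: "(\<Sum>j<d. \<mu> j) = m" using \<nu>(2) K by (simp add: sum.distrib n_def mi_abs_def)
  have le: "\<mu> j \<le> m" if "j < d" for j unfolding s[symmetric] using that by (intro member_le_sum) auto
  have "\<mu> \<in> {..<d} \<rightarrow>\<^sub>E {..m}" using le by (auto simp: \<mu>_def)
  moreover have "real (\<mu> j) \<ge> real (k j) / 2" if "j < d" for j using \<mu>2[OF that] by linarith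
  ultimately show "(\<lambda>j\<in>{..<d}. (k j + \<nu> j) div 2) \<in> {\<mu>. \<mu> \<in> {..<d} \<rightarrow>\<^sub>E {..m} \<and> (\<Sum>j<d. \<mu> j) = m \<and> (\<forall>j<d. real (\<mu> j) \<ge> real (k j) / 2)}"
   using s unfolding \<mu>_def[symmetric] by blast
  have \<nu>\<mu>: "2 * \<mu> j - k j = \<nu> j" if "j < d" for j using \<mu>2[OF that] by simp
  have "(\<lambda>j\<in>{..<d}. 2 * \<mu> j - k j) = \<nu>"
  proof
   fix j show "(\<lambda>j\<in>{..<d}. 2 * \<mu> j - k j) j = \<nu> j"
    using \<nu>\<mu>[of j] PiE_arb[OF \<nu>(1), of j] by (cases "j < d") auto
  qed
  then show "(\<lambda>j\<in>{..<d}. 2 * (\<lambda>j\<in>{..<d}. (k j + \<nu> j) div 2) j - k j) = \<nu>" unfolding \<mu>_def .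
  have nm: "(normal_moment (k j + \<nu> j))^2 = (fact (2 * \<mu> j))^2 / (2 ^ (2 * \<mu> j) * (fact (\<mu> j))^2)" if "j < d" for j
   unfolding \<mu>2[OF that, symmetric]
   by (simp add: normal_moment_def power_divide power_mult_distrib power_mult[symmetric] mult.commute)
  have "(\<Prod>j<d. (2::real) ^ (2 * \<mu> j)) = 2 ^ (2 * m)"
   by (simp add: power_sum[symmetric] sum_distrib_left[symmetric] s)
  then have "W \<nu> = (\<Prod>j<d. fact (2 * \<mu> j))^2 / (2 ^ (2 * m) * (\<Prod>j<d. (fact (\<mu> j))^2))"
   unfolding W_def by (simp add: nm prod_dividef prod.distrib prod_power_distrib)
  moreover have "(\<Prod>j<d. fact (\<nu> j) :: real) = (\<Prod>j<d. fact (2 * \<mu> j - k j))"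
   by (rule prod.cong) (use \<nu>\<mu> in auto)
  ultimately show "(\<Prod>j<d. fact (2 * (\<lambda>j\<in>{..<d}. (k j + \<nu> j) div 2) j))^2 /
    ((2 * pi) ^ d * 2 ^ (2 * m) * (\<Prod>j<d. fact (2 * (\<lambda>j\<in>{..<d}. (k j + \<nu> j) div 2) j - k j)) *
     (\<Prod>j<d. (fact ((\<lambda>j\<in>{..<d}. (k j + \<nu> j) div 2) j))^2)) = W \<nu> / ((2 * pi) ^ d * (\<Prod>j<d. fact (\<nu> j)))"
   unfolding \<mu>_def[symmetric] by (simp add: ac_simps)
 next
  fix \<mu> assume "\<mu> \<in> {\<mu>. \<mu> \<in> {..<d} \<rightarrow>\<^sub>E {..m} \<and> (\<Sum>j<d. \<mu> j) = m \<and> (\<forall>j<d. real (\<mu> j) \<ge> real (k j) / 2)}"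
  then have \<mu>: "\<mu> \<in> {..<d} \<rightarrow>\<^sub>E {..m}" "(\<Sum>j<d. \<mu> j) = m" and ge: "\<And>j. j < d \<Longrightarrow> real (\<mu> j) \<ge> real (k j) / 2" by auto
  have ge: "k j \<le> 2 * \<mu> j" if "j < d" for j using ge[OF that] by linarith
  define \<nu> where "\<nu> = (\<lambda>j\<in>{..<d}. 2 * \<mu> j - k j)"
  have \<nu>2: "k j + \<nu> j = 2 * \<mu> j" if "j < d" for j using ge[OF that] that by (simp add: \<nu>_def)
  have "(\<Sum>j<d. k j + \<nu> j) = (\<Sum>j<d. 2 * \<mu> j)" by (rule sum.cong) (use \<nu>2 in auto)
  then have "(\<Sum>j<d. k j) + (\<Sum>j<d. \<nu> j) = 2 * m" using \<mu>(2) by (simp add: sum.distrib sum_distrib_left[symmetric])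
  then have "(\<Sum>j<d. \<nu> j) = n" by (simp add: n_def mi_abs_def)
  then have "\<nu> \<in> compositions n d" by (intro compositionsI) (auto simp: \<nu>_def)
  moreover have ev: "even (k j + \<nu> j)" if "j < d" for j unfolding \<nu>2[OF that] by simp
  ultimately show "(\<lambda>j\<in>{..<d}. 2 * \<mu> j - k j) \<in> {\<nu> \<in> compositions n d. \<forall>j<d. even (k j + \<nu> j)}"
   unfolding \<nu>_def[symmetric] using ev by blast
  show "(\<lambda>j\<in>{..<d}. (k j + (\<lambda>j\<in>{..<d}. 2 * \<mu> j - k j) j) div 2) = \<mu>"
   unfolding \<nu>_def[symmetric]
  proof
   fix j show "(\<lambda>j\<in>{..<d}. (k j + \<nu> j) div 2) j = \<mu> j"
    using \<nu>2[of j] PiE_arb[OF \<mu>(1), of j] by (cases "j < d") auto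
  qed
 qed
 finally show ?thesis .
qed

section \<open>Scaling of multiple integrals\<close>

lemma elementary_integral_cmult:
 assumes "elementary_integral d B n g Y"
 shows "elementary_integral d B n (\<lambda>i r. c * g i r) (\<lambda>w. c * Y w)"
proof -
 obtain N t b where "is_partition N t" "offdiagonal d n N b" "g = step_kernel n N t b" "Y = step_form d B n N t b"
  using assms unfolding elementary_integral_iff by blast
 then show ?thesis unfolding elementary_integral_iff
  by (intro exI[of _ N] exI[of _ t] exI[of _ "\<lambda>i l. c * b i l"])
    (auto simp: offdiagonal_def step_kernel_def[abs_def] step_form_def[abs_def] sum_distrib_left mult.assoc fun_eq_iff)
qed

lemma kernel_dist_sq_cmult:
 assumes "L2_kernel d n f" "L2_kernel d n g"
 shows "kernel_dist_sq d n (\<lambda>i r. c * f i r) (\<lambda>i r. c * g i r) = ennreal (c^2) * kernel_dist_sq d n f g"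
 unfolding kernel_dist_sq_def sum_distrib_left
proof (rule sum.cong[OF refl])
 fix i assume i: "i \<in> index_tuples n d"
 have [measurable]: "f i \<in> borel_measurable (unit_cube n)" "g i \<in> borel_measurable (unit_cube n)"
  using assms i by (auto simp: L2_kernel_def)
 have eq: "ennreal ((c * f i r - c * g i r)^2) = ennreal (c^2) * ennreal ((f i r - g i r)^2)" for r
  unfolding right_diff_distrib[symmetric] power_mult_distrib by (rule ennreal_mult) auto
 show "(\<integral>\<^sup>+ r. ennreal ((c * f i r - c * g i r)^2) \<partial>unit_cube n) = ennreal (c^2) * (\<integral>\<^sup>+ r. ennreal ((f i r - g i r)^2) \<partial>unit_cube n)"
  unfolding eq by (rule nn_integral_cmult) measurable
qed

lemma (in brownian_motion) is_multiple_integral_cmult: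
 assumes X: "is_multiple_integral M d B n f X" and f: "L2_kernel d n f"
 shows "is_multiple_integral M d B n (\<lambda>i r. c * f i r) (\<lambda>w. c * X w)"
proof -
 obtain g Y where el: "\<And>q. elementary_integral d B n (g q) (Y q)"
  and g: "(\<lambda>q. kernel_dist_sq d n (g q) f) \<longlonglongrightarrow> 0"
  and Y: "(\<lambda>q. \<integral>\<^sup>+ w. ennreal ((Y q w - X w)^2) \<partial>M) \<longlonglongrightarrow> 0" and Xm [measurable]: "X \<in> borel_measurable M"
  using X unfolding is_multiple_integral_def by blast
 have Ym [measurable]: "Y q \<in> borel_measurable M" for q
 proof -
  obtain N t b where "is_partition N t" "offdiagonal d n N b" "Y q = step_form d B n N t b"
   using el[of q] unfolding elementary_integral_iff by blast
  then show ?thesis using step_form_measurable[of N t n b] by simp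
 qed
 have eq: "ennreal ((c * Y q w - c * X w)^2) = ennreal (c^2) * ennreal ((Y q w - X w)^2)" for q w
  unfolding right_diff_distrib[symmetric] power_mult_distrib by (rule ennreal_mult) auto
 have "(\<lambda>q. kernel_dist_sq d n (\<lambda>i r. c * g q i r) (\<lambda>i r. c * f i r)) \<longlonglongrightarrow> ennreal (c^2) * 0"
  unfolding kernel_dist_sq_cmult[OF elementary_integral_L2_kernel[OF el] f]
  by (intro tendsto_mult_ennreal tendsto_const g) simp
 moreover have "(\<lambda>q. \<integral>\<^sup>+ w. ennreal ((c * Y q w - c * X w)^2) \<partial>M) \<longlonglongrightarrow> ennreal (c^2) * 0"
 proof -
  have "(\<lambda>q. ennreal (c^2) * (\<integral>\<^sup>+ w. ennreal ((Y q w - X w)^2) \<partial>M)) \<longlonglongrightarrow> ennreal (c^2) * 0"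
   by (intro tendsto_mult_ennreal tendsto_const Y) simp
  moreover have "(\<integral>\<^sup>+ w. ennreal ((c * Y q w - c * X w)^2) \<partial>M) = ennreal (c^2) * (\<integral>\<^sup>+ w. ennreal ((Y q w - X w)^2) \<partial>M)" for q
   unfolding eq by (rule nn_integral_cmult) measurable
  ultimately show ?thesis by simp
 qed
 ultimately show ?thesis unfolding is_multiple_integral_def
  by (intro conjI exI[of _ "\<lambda>q i r. c * g q i r"] exI[of _ "\<lambda>q w. c * Y q w"] allI elementary_integral_cmult[OF el]) simp_all
qed

lemma continuous_kernel_cmult:
 assumes f: "continuous_kernel d n f"
 shows "continuous_kernel d n (\<lambda>i r. c * f i r)"
 unfolding continuous_kernel_def
proof (intro conjI ballI allI impI)
 show "symmetric_kernel d n (\<lambda>i r. c * f i r)" using f by (simp add: continuous_kernel_def symmetric_kernel_def)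
 show "(\<lambda>r. c * f i r) \<in> borel_measurable (unit_cube n)" if "i \<in> index_tuples n d" for i
  using continuous_kernel_measurable[OF f that] by simp
 obtain C where C: "\<forall>i\<in>index_tuples n d. \<forall>r\<in>space (unit_cube n). \<bar>f i r\<bar> \<le> C"
  using f unfolding continuous_kernel_def by blast
 show "\<exists>C. \<forall>i\<in>index_tuples n d. \<forall>r\<in>space (unit_cube n). \<bar>c * f i r\<bar> \<le> C"
  by (intro exI[of _ "\<bar>c\<bar> * C"] ballI) (simp add: abs_mult mult_left_mono C)
 fix i r \<rho> assume "i \<in> index_tuples n d" "r \<in> space (unit_cube n)" "\<forall>q. \<rho> q \<in> space (unit_cube n)" "\<forall>a<n. (\<lambda>q. \<rho> q a) \<longlonglongrightarrow> r a"
 then show "(\<lambda>q. c * f i (\<rho> q)) \<longlonglongrightarrow> c * f i r"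
  by (intro tendsto_mult tendsto_const continuous_kernel_tendsto[OF f]) auto
qed

lemma kernel_mass_scaled_chaos_kernel:
 assumes eps: "0 < eps" and K: "mi_abs d k \<le> 2 * m"
 shows "kernel_mass d (2 * m - mi_abs d k) (\<lambda>i r. c * chaos_kernel d k m eps i r) E =
  beta d k m * (c^2 * simplex_mass (2 * m - mi_abs d k) (real m + real d / 2) eps E)"
proof -
 let ?n = "2 * m - mi_abs d k" and ?p = "real m + real d / 2"
 have "(\<integral>r. (c * chaos_kernel d k m eps i r)^2 * of_bool (E r) \<partial>unit_cube ?n) = (chaos_coeff d k m i)^2 * (c^2 * simplex_mass ?n ?p eps E)" for i
 proof -
  have "(c * chaos_kernel d k m eps i r)^2 * of_bool (E r) = ((chaos_coeff d k m i)^2 * c^2) * ((simplex_kernel ?n ?p eps r)^2 * of_bool (E r))" for r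
   unfolding chaos_kernel_eq[OF eps] by (simp add: power_mult_distrib)
  note eq = this
  show ?thesis unfolding simplex_mass_def eq by simp
 qed
 then show ?thesis
  unfolding kernel_mass_def beta_eq[OF K, symmetric] by (simp add: sum_distrib_right[symmetric])
qed

section \<open>The central limit theorem for the chaotic components\<close>

lemma weak_conv_m_eventually_cong:
 assumes "\<forall>\<^sub>F q in sequentially. \<mu> q = \<nu> q" "weak_conv_m \<mu> \<tau>"
 shows "weak_conv_m \<nu> \<tau>"
 unfolding weak_conv_m_def weak_conv_def
proof (intro allI impI)
 fix x assume "isCont (cdf \<tau>) x"
 then have "(\<lambda>q. cdf (\<mu> q) x) \<longlonglongrightarrow> cdf \<tau> x" using assms(2) by (simp add: weak_conv_m_def weak_conv_def)
 moreover have "\<forall>\<^sub>F q in sequentially. cdf (\<mu> q) x = cdf (\<nu> q) x" using assms(1) by eventually_elim simp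
 ultimately show "(\<lambda>q. cdf (\<nu> q) x) \<longlonglongrightarrow> cdf \<tau> x" by (rule Lim_transform_eventually)
qed

lemma beta_nonneg: "0 \<le> beta d k m"
 unfolding beta_def by (intro sum_nonneg divide_nonneg_nonneg mult_nonneg_nonneg prod_nonneg) auto

text \<open>A sequence that tends to \<open>0\<close> from the right may start with values outside \<open>(0, 1)\<close>, where the
  logarithmic factors need not be positive; finitely many terms do not affect weak convergence.\<close>

lemma (in brownian_motion) chaos_term_tends_in_law:
 assumes K: "mi_abs d k < 2 * m"
  and conc: "\<And>e. filterlim e (at_right 0) sequentially \<Longrightarrow> (\<And>q. 0 < e q) \<Longrightarrow> (\<And>q. e q < 1) \<Longrightarrow>
   concentrates (2 * m - mi_abs d k) (real m + real d / 2) e (\<lambda>q. (\<kappa> (e q))^2) L"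
 shows "tends_in_law M (\<lambda>eps w. \<kappa> eps * chaos_term M d B k m eps w) (centered_normal (beta d k m * L))"
 unfolding tends_in_law_def
proof (intro allI impI)
 fix e0 :: "nat \<Rightarrow> real" assume e0: "filterlim e0 (at_right 0) sequentially"
 define e where "e q = (if 0 < e0 q \<and> e0 q < 1 then e0 q else 1 / 2)" for q
 let ?X = "\<lambda>eps w. \<kappa> eps * chaos_term M d B k m eps w"
 let ?n = "2 * m - mi_abs d k"
 have "\<forall>\<^sub>F q in sequentially. e0 q \<in> {0<..<1}"
  by (rule eventually_compose_filterlim[OF eventually_at_right_real[OF zero_less_one] e0])
 then have ev: "\<forall>\<^sub>F q in sequentially. e q = e0 q" by eventually_elim (simp add: e_def)
 have e: "filterlim e (at_right 0) sequentially" "\<And>q. 0 < e q" "\<And>q. e q < 1"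
  using e0 unfolding filterlim_cong[OF refl refl ev] by (auto simp: e_def)
 note c = conc[OF e, unfolded concentrates_def]
 obtain C where C: "0 \<le> C" "\<And>J. 0 < J \<Longrightarrow> \<forall>\<^sub>F q in sequentially. \<forall>j<J. (\<kappa> (e q))^2 * simplex_mass ?n (real m + real d / 2) (e q) (in_block ?n J j) \<le> C / real J"
  using c by blast
 note mass = kernel_mass_scaled_chaos_kernel[OF e(2) less_imp_le[OF K]]
 have "weak_conv_m (\<lambda>q. distr M borel (?X (e q))) (centered_normal (beta d k m * L))"
 proof (rule multiple_integral_clt[where f = "\<lambda>q i r. \<kappa> (e q) * chaos_kernel d k m (e q) i r" and n = ?n and C = "beta d k m * C"])
  show "continuous_kernel d ?n (\<lambda>i r. \<kappa> (e q) * chaos_kernel d k m (e q) i r)" for q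
   by (intro continuous_kernel_cmult continuous_kernel_chaos_kernel e)
  show "is_multiple_integral M d B ?n (\<lambda>i r. \<kappa> (e q) * chaos_kernel d k m (e q) i r) (?X (e q))" for q
   unfolding chaos_term_def
   by (intro is_multiple_integral_cmult continuous_kernel_L2 continuous_kernel_multiple_integral continuous_kernel_chaos_kernel e)
  show "0 < ?n" using K by simp
  show "(\<lambda>q. kernel_mass d ?n (\<lambda>i r. \<kappa> (e q) * chaos_kernel d k m (e q) i r) (\<lambda>_. True)) \<longlonglongrightarrow> beta d k m * L"
   unfolding mass using c by (intro tendsto_mult tendsto_const) blast
  show "(\<lambda>q. kernel_mass d ?n (\<lambda>i r. \<kappa> (e q) * chaos_kernel d k m (e q) i r) (off_blocks ?n J)) \<longlonglongrightarrow> 0" if "0 < J" for J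
   unfolding mass by (rule tendsto_mult_right_zero) (use c that in blast)
  show "0 \<le> beta d k m * C" using C(1) beta_nonneg by simp
  show "\<forall>\<^sub>F q in sequentially. \<forall>j<J. kernel_mass d ?n (\<lambda>i r. \<kappa> (e q) * chaos_kernel d k m (e q) i r) (in_block ?n J j) \<le> beta d k m * C / real J" if "0 < J" for J
   using C(2)[OF that]
  proof eventually_elim
   case (elim q)
   show ?case
   proof (intro allI impI)
    fix j assume "j < J"
    then show "kernel_mass d ?n (\<lambda>i r. \<kappa> (e q) * chaos_kernel d k m (e q) i r) (in_block ?n J j) \<le> beta d k m * C / real J"
     unfolding mass times_divide_eq_right[symmetric] using elim beta_nonneg by (intro mult_left_mono) auto
   qed
  qed
 qed
 then show "weak_conv_m (\<lambda>q. distr M borel (?X (e0 q))) (centered_normal (beta d k m * L))"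
  by (rule weak_conv_m_eventually_cong[rotated]) (use ev in \<open>eventually_elim, simp\<close>)
qed

section \<open>The limiting variances\<close>

text \<open>The orders \<open>n = 1\<close> and \<open>n \<ge> 2\<close> arise from different limits but lead to one formula.\<close>

lemma concentrates_powr:
 assumes n: "1 \<le> n" and D: "4 \<le> D" and p: "2 * p - 4 = real (n + D - 4)"
  and e: "filterlim e (at_right 0) sequentially" "\<And>q. 0 < e q"
 shows "concentrates n p e (\<lambda>q. (e q powr ((real D - 3) / 2))^2)
  (fact n * fact (D - 4) / fact (n + D - 5) / ((p - 1) * (p - 2))^2)"
proof (cases "n = 1")
 case True
 have p2: "p - 2 = (real D - 3) / 2" using p D True by (simp add: of_nat_diff)
 then have p3: "2 < p" using D by simp
 have \<kappa>0: "(\<lambda>q. e q powr ((real D - 3) / 2)) \<longlonglongrightarrow> 0"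
  using D by (intro tendsto_zero_powrI[OF tendsto_of_at_right[OF e(1)] tendsto_const]) (auto intro!: always_eventually less_imp_le[OF e(2)])
 have "(\<lambda>q. e q powr ((real D - 3) / 2) * (e q powr (2 - p) / ((p - 1) * (p - 2)))) \<longlonglongrightarrow> 1 / ((p - 1) * (p - 2))"
 proof -
  have eq: "e q powr ((real D - 3) / 2) * (e q powr (2 - p) / ((p - 1) * (p - 2))) = 1 / ((p - 1) * (p - 2))" for q
   using e(2)[of q] unfolding p2[symmetric] times_divide_eq_right powr_add[symmetric] by simp
  show ?thesis unfolding eq by (rule tendsto_const)
 qed
 from concentrates_single[OF second_antiderivative_powr[OF p3] e \<kappa>0 _ this]
 show ?thesis using True D by (simp add: power_divide)
next
 case False
 then have n2: "2 \<le> n" using n by simp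
 have sq: "(e q powr ((real D - 3) / 2))^2 = e q ^ (D - 3)" for q
 proof -
  have "(e q powr ((real D - 3) / 2))^2 = e q powr real (D - 3)"
   unfolding power2_eq_square powr_add[symmetric] using D by (simp add: of_nat_diff)
  then show ?thesis using e(2)[of q] by (simp add: powr_realpow)
 qed
 have eq: "real (n * (n - 1)) * (fact (n - 2) * fact (D - 4) / fact (n + D - 5) / ((p - 1) * (p - 2))^2) =
   fact n * fact (D - 4) / fact (n + D - 5) / ((p - 1) * (p - 2))^2"
 proof -
  obtain j where j: "n = Suc (Suc j)" using n2 by (metis add_2_eq_Suc le_Suc_ex)
  then have "real (n * (n - 1)) * fact (n - 2) = fact n" by (simp add: algebra_simps)
  then show ?thesis unfolding times_divide_eq_right mult.assoc[symmetric] by simp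
 qed
 show ?thesis using concentrates_supercritical[OF n2 D p e] unfolding sq eq .
qed

text \<open>The two fractions in \<open>phi\<close> add up to \<open>(2 p - 3) / ((p - 1) (p - 2))\<close>, and the numerator cancels against the
  Gamma function in the denominator.\<close>

lemma phi_eq:
 assumes K: "K < 2 * m" and D: "4 \<le> d + K"
 defines "n \<equiv> 2 * m - K" and "p \<equiv> real m + real d / 2"
 shows "phi m d K = fact n * fact (d + K - 4) / fact (n + (d + K) - 5) / ((p - 1) * (p - 2))^2"
proof -
 have n1: "1 \<le> n" using K by (simp add: n_def)
 obtain b where b: "n + (d + K) = b + 5" using n1 D by (metis add.commute add_mono le_Suc_ex numeral_plus_one add_num_simps(4) add_One_commute one_plus_numeral)
 have nK: "2 * m = n + K" using K by (simp add: n_def)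
 have rb: "2 * real m + real d = real b + 5"
  using b nK by (metis (no_types) add.assoc add.commute of_nat_add of_nat_mult of_nat_numeral)
 have p: "2 * p = real b + 5" using rb by (simp add: p_def)
 have g1: "Gamma (2 * real m - real K + 1) = fact n"
 proof -
  have "2 * real m = real n + real K" using nK by (metis of_nat_add of_nat_mult of_nat_numeral)
  then show ?thesis using Gamma_fact[of n, where 'a = real] by (simp add: add.commute)
 qed
 have g2: "Gamma (real d + real K - 3) = fact (d + K - 4)"
  using Gamma_fact[of "d + K - 4", where 'a = real] D by (simp add: of_nat_diff)
 have g3: "Gamma (2 * real m + real d - 2) = (2 * p - 3) * (2 * p - 4) * fact b"
 proof -
  have "2 * real m + real d - 2 = 1 + real (Suc (Suc b))" using rb by simp
  then show ?thesis unfolding p using Gamma_fact[of "Suc (Suc b)", where 'a = real] by (simp add: algebra_simps)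
 qed
 have nz: "p - 1 \<noteq> 0" "p - 2 \<noteq> 0" "2 * p - 3 \<noteq> 0" using p by auto
 define X F :: real where "X = fact n * fact (d + K - 4)" and "F = fact b"
 have F: "F \<noteq> 0" by (simp add: F_def)
 have "phi m d K = 2 * fact n * fact (d + K - 4) / ((2 * p - 3) * (2 * p - 4) * F * (p - 1)) * (1 / (p - 1) + 1 / (p - 2))"
  unfolding phi_def g1 g2 g3 F_def by (simp add: p_def)
 also have "1 / (p - 1) + 1 / (p - 2) = (2 * p - 3) / ((p - 1) * (p - 2))"
  using nz by (simp add: divide_simps)
 also have "2 * fact n * fact (d + K - 4) / ((2 * p - 3) * (2 * p - 4) * F * (p - 1)) * ((2 * p - 3) / ((p - 1) * (p - 2))) = X / F / ((p - 1) * (p - 2))^2"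
 proof -
  have "2 * p - 4 = 2 * (p - 2)" by simp
  then show ?thesis unfolding X_def using nz F by (simp only: mult.assoc) (simp add: power2_eq_square)
 qed
 finally show ?thesis unfolding X_def F_def using b by simp
qed

lemma beta_one_dim:
 assumes K: "k 0 \<le> 2 * m"
 shows "beta 1 k m = (fact (2 * m))^2 / (2 * pi * 2 ^ (2 * m) * fact (2 * m - k 0) * (fact m)^2)"
proof -
 have "{\<mu>. \<mu> \<in> {..<1} \<rightarrow>\<^sub>E {..m} \<and> (\<Sum>j<1. \<mu> j) = m \<and> (\<forall>j<1. real (\<mu> j) \<ge> real (k j) / 2)} = {\<lambda>j\<in>{..<1::nat}. m}" (is "?A = _")
 proof (intro equalityI subsetI)
  fix \<mu> assume "\<mu> \<in> ?A"
  then have \<mu>: "\<mu> \<in> {..<1} \<rightarrow>\<^sub>E {..m}" "\<mu> 0 = m" by auto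
  then have "\<mu> j = (\<lambda>j\<in>{..<1::nat}. m) j" for j using PiE_arb[OF \<mu>(1), of j] by (cases "j = 0") auto
  then show "\<mu> \<in> {\<lambda>j\<in>{..<1::nat}. m}" by auto
 next
  have "real (k 0) \<le> 2 * real m" using K by (metis of_nat_le_iff of_nat_mult of_nat_numeral)
  then show "\<mu> \<in> ?A" if "\<mu> \<in> {\<lambda>j\<in>{..<1::nat}. m}" for \<mu> using that by auto
 qed
 then show ?thesis unfolding beta_def by simp
qed

text \<open>In one dimension \<open>beta\<close> has a single summand, and the separate formula is its product with \<open>phi\<close>.\<close>

lemma sigma_hat_sq_eq:
 assumes K: "mi_abs d k < 2 * m" and d: "1 \<le> d"  and D: "4 \<le> d + mi_abs d k"
 shows "sigma_hat_sq d k m = beta d k m * phi m d (mi_abs d k)"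
proof (cases "d = 1")
 case True
 have K0: "mi_abs d k = k 0" using True by (simp add: mi_abs_def)
 obtain j where j: "m = Suc j" using K by (cases m) auto
 have j1: "1 \<le> j" using K D True K0 j by simp
 have m2: "2 * m = Suc (Suc (2 * j))" using j by simp
 define n where "n = 2 * m - k 0"
 define S where "S = 1 / (real m - 1 / 2) + 1 / (real m - 3 / 2)"
 define a b where "a = (fact (2 * j) :: real)" and "b = (fact j :: real)"
 have ab: "a \<noteq> 0" "b \<noteq> 0" by (simp_all add: a_def b_def)
 have g1: "Gamma (2 * real m - real (k 0) + 1) = fact n"
  using Gamma_fact[of n, where 'a = real] K K0 by (simp add: n_def of_nat_diff add.commute)
 have g2: "Gamma (real d + real (k 0) - 3) = fact (k 0 - 3)"
  using Gamma_fact[of "k 0 - 3", where 'a = real] D True K0 by (simp add: of_nat_diff)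
 have g3: "Gamma (2 * real m + real d - 2) = a"
  using Gamma_fact[of "2 * j", where 'a = real] True j by (simp add: a_def add.commute)
 have f: "(fact (2 * m) :: real) = (2 * real j + 2) * (2 * real j + 1) * a" "(fact (2 * m - 1) :: real) = (2 * real j + 1) * a"
  "(fact m :: real) = (real j + 1) * b" "fact (m - 1) = b"
  unfolding m2 j a_def b_def by (simp_all add: algebra_simps)
 have pw: "2 powi (2 * int m - 3) = (2::real) ^ (2 * m) / 8"
  by (simp add: power_int_diff power_int_mult power_mult)
 have phi: "phi m 1 (k 0) = 2 * fact n * fact (k 0 - 3) / (a * (real j + 1 / 2)) * S"
  using g1 g2 g3 True j unfolding phi_def by (simp add: S_def)
 define E where "E = (2::real) ^ (2 * m)"
 have E: "E \<noteq> 0" by (simp add: E_def)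
 have "beta 1 k m = ((2 * real j + 2) * (2 * real j + 1) * a)^2 / (2 * pi * E * fact n * ((real j + 1) * b)^2)"
  using beta_one_dim[of k m] K K0 unfolding f n_def E_def by simp
 also have "\<dots> * (2 * fact n * fact (k 0 - 3) / (a * (real j + 1 / 2)) * S) = (2 * real j + 1) * a * fact (k 0 - 3) / (E / 8 * pi * b^2) * S"
 proof -
  have nz: "real j + 1 \<noteq> 0" "2 * real j + 1 \<noteq> 0" "(fact n :: real) \<noteq> 0" by auto
  have h: "real j + 1 / 2 = (2 * real j + 1) / 2" "2 * real j + 2 = 2 * (real j + 1)" by simp_all
  define u v :: real where "u = real j + 1" and "v = 2 * real j + 1"
  have uv: "u \<noteq> 0" "v \<noteq> 0" using nz by (auto simp: u_def v_def)
  show ?thesis unfolding h u_def[symmetric] v_def[symmetric] using uv ab E nz(3)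
   by (simp add: power2_eq_square field_simps)
 qed
 finally have *: "beta 1 k m * (2 * fact n * fact (k 0 - 3) / (a * (real j + 1 / 2)) * S) = (2 * real j + 1) * a * fact (k 0 - 3) / (E / 8 * pi * b^2) * S" .
 have "sigma_hat_sq d k m = (2 * real j + 1) * a * fact (k 0 - 3) / (E / 8 * pi * b^2) * S"
  unfolding sigma_hat_sq_def if_P[OF True] K0 f pw E_def S_def ..
 then show ?thesis unfolding True K0[unfolded True] phi * .
qed (simp add: sigma_hat_sq_def)

lemma beta_planar: 
 assumes "k 0 = 1" "k 1 = 0"
 shows "beta 2 k 1 = 1 / (4 * pi^2)"
proof -
 have two: "{..<2::nat} = {0, 1}" by auto
 define \<mu>0 where "\<mu>0 = (\<lambda>j\<in>{..<2::nat}. if j = 0 then 1 else 0 :: nat)"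
 have "{\<mu>. \<mu> \<in> {..<2} \<rightarrow>\<^sub>E {..1} \<and> (\<Sum>j<2. \<mu> j) = 1 \<and> (\<forall>j<2. real (\<mu> j) \<ge> real (k j) / 2)} = {\<mu>0}" (is "?A = _")
 proof (intro equalityI subsetI)
  fix \<mu> assume "\<mu> \<in> ?A"
  then have \<mu>: "\<mu> \<in> {..<2} \<rightarrow>\<^sub>E {..1}" "\<mu> 0 + \<mu> 1 = 1" "real (\<mu> 0) \<ge> real (k 0) / 2" by (auto simp: two)
  then have "\<mu> 0 = 1" "\<mu> 1 = 0" using assms by auto
  then have "\<mu> j = \<mu>0 j" for j using PiE_arb[OF \<mu>(1), of j] by (cases "j = 0"; cases "j = 1") (auto simp: \<mu>0_def)
  then show "\<mu> \<in> {\<mu>0}" by auto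
 next
  fix \<mu> assume "\<mu> \<in> {\<mu>0}"
  then show "\<mu> \<in> ?A" using assms by (auto simp: \<mu>0_def two less_2_cases_iff)
 qed
 then show ?thesis unfolding beta_def using assms by (simp add: \<mu>0_def two power2_eq_square)
qed

lemma variance_one_dim:
 assumes m: "2 \<le> m" and k: "k 0 = 2"
 defines "n \<equiv> 2 * m - 2" and "p \<equiv> real m + 1 / 2"
 shows "beta 1 k m * (real (n * (n - 1)) * (1 / ((p - 1) * (p - 2))^2)) = fact (2 * m - 4) / (pi * 2 powi (2 * int m - 7) * (fact (m - 2))^2)"
proof -
 obtain j where j: "m = Suc (Suc j)" using m by (metis add_2_eq_Suc le_Suc_ex)
 define a b where "a = (fact (2 * j) :: real)" and "b = (fact j :: real)"
 define u v w x :: real where "u = real j + 1" and "v = real j + 2" and "w = 2 * real j + 1" and "x = 2 * real j + 3"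
 have nz: "a \<noteq> 0" "b \<noteq> 0" "u \<noteq> 0" "v \<noteq> 0" "w \<noteq> 0" "x \<noteq> 0" by (simp_all add: a_def b_def u_def v_def w_def x_def)
 have f: "(fact (2 * m) :: real) = (2 * v) * x * (2 * u) * w * a" "(fact (2 * m - 2) :: real) = (2 * u) * w * a"
  "(fact m :: real) = v * u * b" "fact (m - 2) = b" "fact (2 * m - 4) = a"
  unfolding j a_def b_def u_def v_def w_def x_def by (simp_all add: algebra_simps)
 have pw: "2 powi (2 * int m - 7) = (2::real) ^ (2 * m) / 128"
  by (simp add: power_int_diff power_int_mult power_mult)
 define E where "E = (2::real) ^ (2 * m)"
 have E: "E \<noteq> 0" by (simp add: E_def)
 have pp: "p - 1 = x / 2" "p - 2 = w / 2" "real (n * (n - 1)) = 2 * u * w"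
  unfolding p_def n_def j u_def w_def x_def by (simp_all add: algebra_simps)
 have "beta 1 k m = ((2 * v) * x * (2 * u) * w * a)^2 / (2 * pi * E * ((2 * u) * w * a) * (v * u * b)^2)"
  using beta_one_dim[of k m] m k unfolding f(1,3) E_def f(2)[symmetric] by simp
 then show ?thesis unfolding pp pw f E_def[symmetric]
  using nz E by (simp add: power2_eq_square field_simps)
qed

lemma variance_planar:
 assumes m: "2 \<le> m"
 defines "n \<equiv> 2 * m - 1" and "p \<equiv> real m + 1"
 shows "b * (real (n * (n - 1)) * (1 / ((p - 1) * (p - 2))^2)) = 2 * b * (2 * real m - 1) / ((real m)^2 * (real m - 1))"
proof -
 define u v w where "u = real m" and "v = real m - 1" and "w = 2 * real m - 1"
 have nz: "u \<noteq> 0" "v \<noteq> 0" using m by (auto simp: u_def v_def)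
 have eq: "real (n * (n - 1)) = w * (2 * v)" "p - 1 = u" "p - 2 = v"
  using m by (simp_all add: n_def p_def u_def v_def w_def of_nat_diff)
 show ?thesis unfolding eq unfolding w_def[symmetric] unfolding v_def[symmetric] unfolding u_def[symmetric]
  using nz by (simp add: power2_eq_square field_simps)
qed

theorem theorem1p3:
  fixes M :: "'w measure" and d :: nat and B :: "nat \<Rightarrow> real \<Rightarrow> 'w \<Rightarrow> real" and k :: "nat \<Rightarrow> nat"
  assumes "d \<ge> 1" and "brownian_motion M d B"
  shows
    "(\<forall>m. real m > real (mi_abs d k) / 2 \<longrightarrow> (\<forall>\<epsilon>>0.
        chaotic_component M d B (2 * m - mi_abs d k)
          (\<lambda>\<omega>. alpha d B k \<epsilon> \<omega> - prob_space.expectation M (alpha d B k \<epsilon>))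
          (chaos_term M d B k m \<epsilon>)))
     \<and>
     (d = 1 \<and> mi_abs d k = 2 \<longrightarrow>
       (\<forall>m\<ge>2. tends_in_law M (\<lambda>\<epsilon> \<omega>. ln (1 / \<epsilon>) powr (- 1 / 2) * chaos_term M d B k m \<epsilon> \<omega>)
          (centered_normal (fact (2 * m - 4) / (pi * 2 powi (2 * int m - 7) * (fact (m - 2))\<^sup>2)))))
     \<and>
     (d = 2 \<and> k 0 = 1 \<and> k 1 = 0 \<longrightarrow>
       tends_in_law M (\<lambda>\<epsilon> \<omega>. ln (1 / \<epsilon>) powi (- 1) * chaos_term M d B k 1 \<epsilon> \<omega>)
          (centered_normal (1 / (4 * pi\<^sup>2))) \<and>
       (\<forall>m\<ge>2. tends_in_law M (\<lambda>\<epsilon> \<omega>. ln (1 / \<epsilon>) powr (- 1 / 2) * chaos_term M d B k m \<epsilon> \<omega>)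
          (centered_normal (2 * beta d k m * (2 * real m - 1) / ((real m)\<^sup>2 * (real m - 1))))))
     \<and>
     (mi_abs d k \<ge> 1 \<and> d + mi_abs d k \<ge> 4 \<longrightarrow>
       (\<forall>m. real m > real (mi_abs d k) / 2 \<longrightarrow>
          tends_in_law M
            (\<lambda>\<epsilon> \<omega>. \<epsilon> powr ((real d + real (mi_abs d k) - 3) / 2) * chaos_term M d B k m \<epsilon> \<omega>)
            (centered_normal (sigma_hat_sq d k m))))"
proof -
  interpret brownian_motion M d B by (rule assms(2))
  have d0: "0 < d" using assms(1) by simp
  have half: "mi_abs d k < 2 * m" if "real m > real (mi_abs d k) / 2" for m
    using that by linarith
  have log_scale: "(\<lambda>q. (ln (1 / e q) powr (- 1 / 2))\<^sup>2) = (\<lambda>q. 1 / ln (1 / e q))" if "\<And>q. 0 < e q" "\<And>q. e q < 1" for e :: "nat \<Rightarrow> real"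
  proof
    fix q
    have "0 < ln (1 / e q)" using that[of q] by simp
    then show "(ln (1 / e q) powr (- 1 / 2))\<^sup>2 = 1 / ln (1 / e q)"
      unfolding power2_eq_square powr_add[symmetric] by (simp add: powr_minus_divide)
  qed
  have critical: "tends_in_law M (\<lambda>\<epsilon> \<omega>. ln (1 / \<epsilon>) powr (- 1 / 2) * chaos_term M d B k m \<epsilon> \<omega>)
      (centered_normal (beta d k m * (real ((2 * m - mi_abs d k) * (2 * m - mi_abs d k - 1)) *
        (1 / ((real m + real d / 2 - 1) * (real m + real d / 2 - 2))\<^sup>2))))"
    if m: "2 \<le> m" and D: "d + mi_abs d k = 3" for m
  proof (rule chaos_term_tends_in_law)
    have K: "mi_abs d k \<le> 2" using D d0 by simp
    then show "mi_abs d k < 2 * m" using m by simp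
    have n: "2 \<le> 2 * m - mi_abs d k" using m K by simp
    have "real d + real (mi_abs d k) = 3" using D by (metis of_nat_add of_nat_numeral)
    then have p: "2 * (real m + real d / 2) - 4 = real (2 * m - mi_abs d k - 1)"
      using m K by (simp add: of_nat_diff)
    fix e :: "nat \<Rightarrow> real" assume e: "filterlim e (at_right 0) sequentially" "\<And>q. 0 < e q" "\<And>q. e q < 1"
    show "concentrates (2 * m - mi_abs d k) (real m + real d / 2) e (\<lambda>q. (ln (1 / e q) powr (- 1 / 2))\<^sup>2)
        (real ((2 * m - mi_abs d k) * (2 * m - mi_abs d k - 1)) * (1 / ((real m + real d / 2 - 1) * (real m + real d / 2 - 2))\<^sup>2))"
      unfolding log_scale[OF e(2,3)] by (rule concentrates_critical[OF n p e])
  qed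
  show ?thesis
  proof (intro conjI allI impI)
    show "chaotic_component M d B (2 * m - mi_abs d k) (\<lambda>\<omega>. alpha d B k \<epsilon> \<omega> - expectation (alpha d B k \<epsilon>)) (chaos_term M d B k m \<epsilon>)"
      if "real m > real (mi_abs d k) / 2" "0 < \<epsilon>" for m \<epsilon>
      by (rule chaos_term_chaotic_component[OF d0 that(2) half[OF that(1)]])
  next
    fix m :: nat assume dk: "d = 1 \<and> mi_abs d k = 2" and m: "2 \<le> m"
    then have k0: "k 0 = 2" by (auto simp: mi_abs_def lessThan_Suc)
    have d1: "d = 1" and K2: "mi_abs d k = 2" using dk by auto
    have real1: "real (1::nat) / 2 = 1 / 2" by simp
    have D3: "d + mi_abs d k = 3" unfolding K2 using d1 by simp
    show "tends_in_law M (\<lambda>\<epsilon> \<omega>. ln (1 / \<epsilon>) powr (- 1 / 2) * chaos_term M d B k m \<epsilon> \<omega>)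
          (centered_normal (fact (2 * m - 4) / (pi * 2 powi (2 * int m - 7) * (fact (m - 2))\<^sup>2)))"
      using critical[OF m D3] variance_one_dim[of m k, OF m k0] unfolding K2 unfolding d1 real1 by simp
  next
    assume dk: "d = 2 \<and> k 0 = 1 \<and> k 1 = 0"
    then have K: "mi_abs d k = 1" by (simp add: mi_abs_def numeral_2_eq_2)
    have "tends_in_law M (\<lambda>\<epsilon> \<omega>. ln (1 / \<epsilon>) powi (- 1) * chaos_term M d B k 1 \<epsilon> \<omega>) (centered_normal (beta d k 1 * 1\<^sup>2))"
    proof (rule chaos_term_tends_in_law)
      show "mi_abs d k < 2 * 1" using K by simp
      fix e :: "nat \<Rightarrow> real" assume e: "filterlim e (at_right 0) sequentially" "\<And>q. 0 < e q" "\<And>q. e q < 1"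
      have l: "0 < ln (1 / e q)" for q using e(2,3)[of q] by simp
      have eq: "ln (1 / e q) powi - 1 = 1 / ln (1 / e q)" for q by (simp add: power_int_minus inverse_eq_divide)
      have "(\<lambda>q. 1 / ln (1 / e q) * - ln (e q)) \<longlonglongrightarrow> 1"
      proof -
        have "1 / ln (1 / e q) * - ln (e q) = 1" for q using l[of q] e(2)[of q] by (simp add: ln_div)
        then show ?thesis by simp
      qed
      from concentrates_single[OF second_antiderivative_ln e(1,2) inverse_ln_tendsto_0[OF e(1,2)] _ this] l
      have "concentrates 1 2 e (\<lambda>q. (1 / ln (1 / e q))\<^sup>2) (1\<^sup>2)" by (auto intro: less_imp_le)
      then show "concentrates (2 * 1 - mi_abs d k) (real 1 + real d / 2) e (\<lambda>q. (ln (1 / e q) powi - 1)\<^sup>2) (1\<^sup>2)"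
        unfolding eq using dk K by simp
    qed
    then show "tends_in_law M (\<lambda>\<epsilon> \<omega>. ln (1 / \<epsilon>) powi (- 1) * chaos_term M d B k 1 \<epsilon> \<omega>) (centered_normal (1 / (4 * pi\<^sup>2)))"
      using beta_planar[of k] dk by simp
    fix m :: nat assume m: "2 \<le> m"
    from critical[OF m] variance_planar[OF m, of "beta d k m"] dk K
    show "tends_in_law M (\<lambda>\<epsilon> \<omega>. ln (1 / \<epsilon>) powr (- 1 / 2) * chaos_term M d B k m \<epsilon> \<omega>)
          (centered_normal (2 * beta d k m * (2 * real m - 1) / ((real m)\<^sup>2 * (real m - 1))))" by simp
  next
    fix m :: nat assume D: "1 \<le> mi_abs d k \<and> 4 \<le> d + mi_abs d k" and "real m > real (mi_abs d k) / 2"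
    note K = half[OF this(2)]
    let ?n = "2 * m - mi_abs d k" and ?p = "real m + real d / 2"
    have n: "1 \<le> ?n" using K by simp
    have p: "2 * ?p - 4 = real (?n + (d + mi_abs d k) - 4)"
    proof -
      have "?n + (d + mi_abs d k) - 4 = 2 * m + d - 4" using K by simp
      moreover have "4 \<le> 2 * m + d" using K D by simp
      ultimately show ?thesis by (simp add: of_nat_diff)
    qed
    have "tends_in_law M (\<lambda>\<epsilon> \<omega>. \<epsilon> powr ((real (d + mi_abs d k) - 3) / 2) * chaos_term M d B k m \<epsilon> \<omega>)
        (centered_normal (beta d k m * (fact ?n * fact (d + mi_abs d k - 4) / fact (?n + (d + mi_abs d k) - 5) / ((?p - 1) * (?p - 2))\<^sup>2)))"
      by (rule chaos_term_tends_in_law[OF K concentrates_powr[OF n _ p]]) (use D in auto)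
    then show "tends_in_law M (\<lambda>\<epsilon> \<omega>. \<epsilon> powr ((real d + real (mi_abs d k) - 3) / 2) * chaos_term M d B k m \<epsilon> \<omega>)
        (centered_normal (sigma_hat_sq d k m))"
      using sigma_hat_sq_eq[OF K assms(1)] phi_eq[OF K] D by simp
  qed
qed

end
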